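(* Let $p\ge1$, $\mathfrak g=\mathfrak{gl}(p\Theta)$, and let $\mathfrak k_0$, $h$, $\mathfrak t_0$, $\mathfrak p=\mathfrak m\oplus\mathfrak n$, $\mathfrak k=\mathfrak k_0+C_{\mathfrak g}(\mathfrak k_0)$ be as in the context, with $\mathfrak m\simeq\mathfrak{gl}(\Theta)^p$. Let $\lambda_{n_0^1},\dots,\lambda_{n_0^p}$ be $p$ dominant integral weights, $\lambda_{n_0^j}$ being a dominant integral weight of $\mathfrak{gl}(\theta_1\cdots\theta_{n_0^j-1})$, and assume that the ordering of the weights is compatible with $\mathfrak n$, i.e. that the value on $h$ of any root $\varepsilon_i-\varepsilon_j$, $i<j$, of $\mathfrak g_1=\mathfrak{gl}(p)$ has non-negative real part. Define $E$ as $\tilde V(\lambda_{n_0^1})\boxtimes\cdots\boxtimes\tilde V(\lambda_{n_0^p})$ with trivial action of $\mathfrak n$. Then $M(\mathfrak p,E)=\mathrm{ind}^{\mathfrak g}_{\mathfrak p}E$ is an $(\mathfrak m,\mathfrak k\cap\mathfrak m)$-module of finite type.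
   Context: Everything is over $\mathbb C$; $\mathrm{ind}^{\mathfrak g}_{\mathfrak p}E=U(\mathfrak g)\otimes_{U(\mathfrak p)}E$; $C_{\mathfrak g}(\cdot)$ is the centralizer in $\mathfrak g$; $W^p$ is the direct sum of $p$ copies of $W$. A subalgebra is reductive in a Lie algebra if the latter is a semisimple module over it. Let $\theta_1,\theta_2,\dots$ be integers $>1$ and $\Theta$ the formal product $\theta_1\theta_2\cdots$. $\mathfrak{gl}(p\Theta)=\bigcup_n\mathfrak g_n$ with $\mathfrak g_n=\mathfrak{gl}(p\theta_1\cdots\theta_{n-1})$ (so $\mathfrak g_1=\mathfrak{gl}(p)$), where $\mathfrak g_n\subset\mathfrak g_{n+1}$ is embedded by repeating a matrix $\theta_n$ times along the main diagonal; $\mathfrak{gl}(\Theta)$ is the case $p=1$. $\mathfrak k_0\subset\mathfrak g_1=\mathfrak{gl}(p)$ is any subalgebra reductive in $\mathfrak g_1$ which contains a $\mathfrak g_1$-regular (semisimple) element $h$ and such that the natural $\mathfrak{gl}(p)$-module $\mathbb C^p$ is simple as a $\mathfrak k_0$-module. Put $\mathfrak t_0=C_{\mathfrak k_0}(h)$ and $\mathfrak p=\bigoplus_{\mathrm{Re}\,\sigma\ge0}\mathfrak g_h^\sigma$, where $\mathfrak g^\sigma_h$ is the $\sigma$-eigenspace of $\mathrm{ad}\,h$. One fixes a decomposition $\mathfrak p=\mathfrak m\oplus\mathfrak n$ (semidirect sum with ideal $\mathfrak n$), where $\mathfrak n=\bigcup_n\mathfrak n_n$ with $\mathfrak n_n$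 the nilradical of $\mathfrak p\cap\mathfrak g_n$, and $\mathfrak m=\bigcup_n\mathfrak m_n$ with $\mathfrak p\cap\mathfrak g_n=\mathfrak m_n\oplus\mathfrak n_n$, $\mathfrak m_n$ reductive in $\mathfrak g_n$, $\mathfrak m_{n+1}\cap\mathfrak g_n=\mathfrak m_n$. One has $\mathfrak m\cap\mathfrak g_n\simeq\mathfrak{gl}(\theta_1\cdots\theta_{n-1})^p$ and $\mathfrak m=C_{\mathfrak g}(\mathfrak t_0)\simeq\mathfrak{gl}(\Theta)^p$; $E$ is an $\mathfrak m$-module via this identification. The modules $\tilde V$: let $V_n$ be the natural $\mathfrak{gl}(\theta_1\cdots\theta_{n-1})$-module. Fix $n_0>1$ and a dominant integral weight $\lambda_{n_0}=(\lambda^1,\dots,\lambda^{\theta_1\cdots\theta_{n_0-1}})$, $\lambda^i\ge\lambda^{i+1}$, of $\mathfrak{gl}(\theta_1\cdots\theta_{n_0-1})$. Let $n'$ be the largest index for which $\lambda^{n'}$ is non-negative ($n'=0$ if $\lambda^1<0$). Let $\lambda_{n_0+1}$ be the weight of $\mathfrak{gl}(\theta_1\cdots\theta_{n_0})$ obtained from $\lambda_{n_0}$ by inserting $\theta_1\cdots\theta_{n_0-1}(\theta_{n_0}-1)$ zeros between $\lambda^{n'}$ and $\lambda^{n'+1}$; iterating defines $\lambda_n$ for $n\ge n_0$. Let $V(\lambda_n)$ be the simple finite-dimensional $\mathfrak{gl}(\theta_1\cdots\theta_{n-1})$-module with highest weight $\lambda_n$. The natural injection $V_n^{\theta_n}\to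 V_{n+1}$ induces, via the tensor algebras of $V_n\oplus V_n^*$ and $V_{n+1}\oplus V_{n+1}^*$, a natural injection of $\mathfrak{gl}(\theta_1\cdots\theta_{n-1})^{\theta_n}$-modules $V(\lambda_n)^{\theta_n}\to V(\lambda_{n+1})$, and hence a diagonal injection of $\mathfrak{gl}(\theta_1\cdots\theta_{n-1})$-modules $V(\lambda_n)\to V(\lambda_{n+1})$. The simple $\mathfrak{gl}(\Theta)$-module $\tilde V(\lambda_{n_0})$ is the direct limit $\varinjlim_{n\ge n_0}V(\lambda_n)$ along these diagonal injections. For a Lie algebra $\mathfrak l=\bigcup_n\mathfrak l_n$ (union of nested finite-dimensional Lie algebras), an $\mathfrak l$-module is integrable if every vector generates a finite-dimensional $\mathfrak l_n$-submodule for each $n$. For a subalgebra $\mathfrak l\subset\mathfrak m$, an $(\mathfrak m,\mathfrak l)$-module is an $\mathfrak m$-module which is integrable over $\mathfrak l$. It is of finite type if (i) every finitely generated $\mathfrak l$-submodule $M'$ has finite length over $\mathfrak l$, and (ii) for each fixed simple integrable $\mathfrak l$-module $L$, the multiplicity of $L$ as a subquotient of $M'$ is bounded when $M'$ runs over all finitely generated $\mathfrak l$-submodules. *)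

theory Defs
  imports
    Complex_Main
    "HOL-Library.Function_Algebras"
    "HOL-Library.Extended_Nat"
    "HOL-Algebra.Module"
    "HOL-Algebra.QuotRing"
    "HOL-Algebra.Algebraic_Closure_Type"
begin

section \<open>Complex vector spaces of functions\<close>

abbreviation fscale :: "complex \<Rightarrow> ('i \<Rightarrow> complex) \<Rightarrow> 'i \<Rightarrow> complex"
  where "fscale c f \<equiv> (\<lambda>i. c * f i)"

global_interpretation cfun: vector_space "fscale :: complex \<Rightarrow> ('i \<Rightarrow> complex) \<Rightarrow> 'i \<Rightarrow> complex"
  by unfold_locales (auto simp: fun_eq_iff algebra_simps)

definition direct_sum_decomp :: "'a::comm_monoid_add set \<Rightarrow> 'a set \<Rightarrow> 'a set \<Rightarrow> bool" where
  "direct_sum_decomp P A B \<longleftrightarrow> A \<inter> B = {0} \<and> P = {a + b | a b. a \<in> A \<and> b \<in> B}"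


section \<open>The matrix Lie algebras\<close>

text \<open>
  An element of the direct limit is realised as an infinite matrix: \<open>dsum N A\<close> repeats the
  \<open>N \<times> N\<close> matrix \<open>A\<close> (the entries of \<open>A\<close> outside \<open>{..<N} \<times> {..<N}\<close> are not used) infinitely often
  along the main diagonal.  Repeating \<open>A\<close> first \<open>t\<close> times to an \<open>Nt \<times> Nt\<close> matrix gives the same infinite
  matrix (lemma \<open>dsum_repeat\<close>), so \<open>gl_blk N\<close> is a copy of \<open>gl(N)\<close>, the inclusion
  \<open>gl_blk N \<subseteq> gl_blk (N * t)\<close> is the embedding that repeats a matrix \<open>t\<close> times, and the direct limit is
  a union.
\<close>

type_synonym cmat = "nat \<times> nat \<Rightarrow> complex"

definition dsum :: "nat \<Rightarrow> cmat \<Rightarrow> cmat" where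
  "dsum N A = (\<lambda>(i, j). if i div N = j div N then A (i mod N, j mod N) else 0)"

definition gl_blk :: "nat \<Rightarrow> cmat set" where
  "gl_blk N = range (dsum N)"

lemma dsum_repeat:
  assumes "N > 0" "t > 0"
  shows "dsum (N * t) (dsum N A) = dsum N A"
proof -
  have "a mod (N * t) div N = a div N mod t" "a div (N * t) = a div N div t" for a :: nat
    using assms by (simp_all add: mod_mult2_eq div_mult2_eq)
  moreover have "c mod t = d mod t \<and> c div t = d div t \<longleftrightarrow> c = d" for c d :: nat
    by (metis div_mult_mod_eq)
  moreover have "i mod (N * t) mod N = i mod N" for i :: nat
    by (simp add: mod_mult2_eq)
  ultimately show ?thesis
    unfolding dsum_def by (auto simp: fun_eq_iff)
qed

lemma gl_blk_mono:
  assumes "N > 0" "t > 0"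
  shows "gl_blk N \<subseteq> gl_blk (N * t)"
  using dsum_repeat[OF assms] unfolding gl_blk_def by (metis image_subsetI rangeI)

text \<open>Matrix product; meant for row-finite \<open>A\<close>, which every element of \<open>gl_blk N\<close> is.\<close>

definition mmul :: "cmat \<Rightarrow> cmat \<Rightarrow> cmat" where
  "mmul A B = (\<lambda>(i, k). \<Sum>j | A (i, j) \<noteq> 0. A (i, j) * B (j, k))"

definition lbr :: "cmat \<Rightarrow> cmat \<Rightarrow> cmat" where
  "lbr A B = mmul A B - mmul B A"

definition nil_matrix :: "cmat \<Rightarrow> bool" where
  "nil_matrix A \<longleftrightarrow> (\<exists>k. (mmul A ^^ k) A = 0)"

text \<open>\<open>Nsize \<theta> n = \<theta>\<^sub>1 \<cdots> \<theta>\<^sub>n\<^sub>-\<^sub>1\<close>; the levels are \<open>n = 1, 2, \<dots>\<close>.\<close>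

definition Nsize :: "(nat \<Rightarrow> nat) \<Rightarrow> nat \<Rightarrow> nat" where
  "Nsize \<theta> n = (\<Prod>i = 1..<n. \<theta> i)"

definition gl_level :: "nat \<Rightarrow> (nat \<Rightarrow> nat) \<Rightarrow> nat \<Rightarrow> cmat set" where
  "gl_level q \<theta> n = gl_blk (q * Nsize \<theta> n)"

definition gl_lim :: "nat \<Rightarrow> (nat \<Rightarrow> nat) \<Rightarrow> cmat set" where
  "gl_lim q \<theta> = (\<Union>n\<in>{1..}. gl_level q \<theta> n)"

definition lie_subalgebra :: "cmat set \<Rightarrow> cmat set \<Rightarrow> bool" where
  "lie_subalgebra K L \<longleftrightarrow> K \<subseteq> L \<and> cfun.subspace K \<and> (\<forall>x\<in>K. \<forall>y\<in>K. lbr x y \<in> K)"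

definition lie_ideal :: "cmat set \<Rightarrow> cmat set \<Rightarrow> bool" where
  "lie_ideal I L \<longleftrightarrow> I \<subseteq> L \<and> cfun.subspace I \<and> (\<forall>x\<in>L. \<forall>y\<in>I. lbr x y \<in> I)"

definition centralizer :: "cmat set \<Rightarrow> cmat set \<Rightarrow> cmat set" where
  "centralizer L S = {x \<in> L. \<forall>s\<in>S. lbr x s = 0}"

primrec lower_central :: "cmat set \<Rightarrow> nat \<Rightarrow> cmat set" where
  "lower_central H 0 = H"
| "lower_central H (Suc k) = cfun.span {lbr x y | x y. x \<in> H \<and> y \<in> lower_central H k}"

definition cartan_subalgebra :: "cmat set \<Rightarrow> cmat set \<Rightarrow> bool" where
  "cartan_subalgebra H L \<longleftrightarrow> lie_subalgebra H L \<and> (\<exists>k. lower_central H k = {0})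
     \<and> {x \<in> L. \<forall>y\<in>H. lbr x y \<in> H} = H"

definition ad_eigenspace :: "cmat set \<Rightarrow> cmat \<Rightarrow> complex \<Rightarrow> cmat set" where
  "ad_eigenspace L h \<sigma> = {x \<in> L. lbr h x = fscale \<sigma> x}"

definition regular_semisimple :: "cmat set \<Rightarrow> cmat \<Rightarrow> bool" where
  "regular_semisimple L h \<longleftrightarrow> h \<in> L \<and> cfun.span (\<Union>\<sigma>. ad_eigenspace L h \<sigma>) = L
     \<and> cartan_subalgebra (centralizer L {h}) L"

definition parabolic :: "cmat set \<Rightarrow> cmat \<Rightarrow> cmat set" where
  "parabolic L h = cfun.span (\<Union>\<sigma>\<in>{\<sigma>. Re \<sigma> \<ge> 0}. ad_eigenspace L h \<sigma>)"

text \<open>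
  The largest ideal consisting of nilpotent matrices.  For a parabolic subalgebra of \<open>gl(N)\<close> this is the
  nilradical in the sense in which it is complemented by a Levi subalgebra; the largest nilpotent ideal
  would also contain the scalar matrices.
\<close>

definition nilradical :: "cmat set \<Rightarrow> cmat set" where
  "nilradical P = cfun.span (\<Union>{I. lie_ideal I P \<and> (\<forall>x\<in>I. nil_matrix x)})"


section \<open>Modules over Lie algebras\<close>

record ('x, 'v) lmod = "(complex, 'v) module" +
  lact :: "'x \<Rightarrow> 'v \<Rightarrow> 'v"

abbreviation CC :: "complex ring" where
  "CC \<equiv> ring_of_type_algebra"

text \<open>A subspace \<open>W\<close> of a space of functions, with an action; \<open>mult\<close> and \<open>one\<close> are not used.\<close>

definition fmod :: "('i \<Rightarrow> complex) set \<Rightarrow> ('x \<Rightarrow> ('i \<Rightarrow> complex) \<Rightarrow> 'i \<Rightarrow> complex)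
    \<Rightarrow> ('x, 'i \<Rightarrow> complex) lmod" where
  "fmod W \<rho> = \<lparr>carrier = W, monoid.mult = undefined, one = undefined, zero = 0, add = (+),
     module.smult = fscale, lact = \<rho>\<rparr>"

definition lie_module :: "cmat set \<Rightarrow> (cmat, 'v) lmod \<Rightarrow> bool" where
  "lie_module L V \<longleftrightarrow> module CC V \<and>
     (\<forall>x\<in>L. \<forall>v\<in>carrier V. lact V x v \<in> carrier V) \<and>
     (\<forall>x\<in>L. \<forall>v\<in>carrier V. \<forall>w\<in>carrier V. lact V x (v \<oplus>\<^bsub>V\<^esub> w) = lact V x v \<oplus>\<^bsub>V\<^esub> lact V x w) \<and>
     (\<forall>x\<in>L. \<forall>c. \<forall>v\<in>carrier V. lact V x (c \<odot>\<^bsub>V\<^esub> v) = c \<odot>\<^bsub>V\<^esub> lact V x v) \<and>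
     (\<forall>x\<in>L. \<forall>y\<in>L. \<forall>v\<in>carrier V. lact V (x + y) v = lact V x v \<oplus>\<^bsub>V\<^esub> lact V y v) \<and>
     (\<forall>x\<in>L. \<forall>c. \<forall>v\<in>carrier V. lact V (fscale c x) v = c \<odot>\<^bsub>V\<^esub> lact V x v) \<and>
     (\<forall>x\<in>L. \<forall>y\<in>L. \<forall>v\<in>carrier V.
        lact V (lbr x y) v = lact V x (lact V y v) \<ominus>\<^bsub>V\<^esub> lact V y (lact V x v))"

definition submod :: "'x set \<Rightarrow> ('x, 'v) lmod \<Rightarrow> 'v set \<Rightarrow> bool" where
  "submod L V W \<longleftrightarrow> submodule W CC V \<and> (\<forall>x\<in>L. \<forall>w\<in>W. lact V x w \<in> W)"

definition restr :: "('x, 'v) lmod \<Rightarrow> 'v set \<Rightarrow> ('x, 'v) lmod" where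
  "restr V W = V\<lparr>carrier := W\<rparr>"

text \<open>The \<open>L\<close>-submodule generated by \<open>S\<close>; for \<open>L = {}\<close> it is the linear span of \<open>S\<close>.\<close>

definition gen :: "'x set \<Rightarrow> ('x, 'v) lmod \<Rightarrow> 'v set \<Rightarrow> 'v set" where
  "gen L V S = \<Inter>{W. submod L V W \<and> S \<subseteq> W}"

definition fin_dim :: "('x, 'v) lmod \<Rightarrow> 'v set \<Rightarrow> bool" where
  "fin_dim V W \<longleftrightarrow> (\<exists>B. finite B \<and> B \<subseteq> carrier V \<and> W = gen {} V B)"

definition quot_mod :: "('x, 'v) lmod \<Rightarrow> 'v set \<Rightarrow> ('x, 'v set) lmod" where
  "quot_mod V K = \<lparr>carrier = a_rcosets\<^bsub>V\<^esub> K, monoid.mult = undefined, one = undefined, zero = K,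
     add = set_add V,
     module.smult = (\<lambda>c C. \<Union>v\<in>C. K +>\<^bsub>V\<^esub> (c \<odot>\<^bsub>V\<^esub> v)),
     lact = (\<lambda>x C. \<Union>v\<in>C. K +>\<^bsub>V\<^esub> lact V x v)\<rparr>"

definition lmod_iso :: "'x set \<Rightarrow> ('x, 'v) lmod \<Rightarrow> ('x, 'w) lmod \<Rightarrow> bool" where
  "lmod_iso L V V' \<longleftrightarrow> (\<exists>f. bij_betw f (carrier V) (carrier V') \<and>
     (\<forall>v\<in>carrier V. \<forall>w\<in>carrier V. f (v \<oplus>\<^bsub>V\<^esub> w) = f v \<oplus>\<^bsub>V'\<^esub> f w) \<and>
     (\<forall>c. \<forall>v\<in>carrier V. f (c \<odot>\<^bsub>V\<^esub> v) = c \<odot>\<^bsub>V'\<^esub> f v) \<and>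
     (\<forall>x\<in>L. \<forall>v\<in>carrier V. f (lact V x v) = lact V' x (f v)))"

definition simple_mod :: "'x set \<Rightarrow> ('x, 'v) lmod \<Rightarrow> bool" where
  "simple_mod L V \<longleftrightarrow> carrier V \<noteq> {\<zero>\<^bsub>V\<^esub>} \<and>
     (\<forall>W. submod L V W \<longrightarrow> W = {\<zero>\<^bsub>V\<^esub>} \<or> W = carrier V)"

definition semisimple_mod :: "'x set \<Rightarrow> ('x, 'v) lmod \<Rightarrow> bool" where
  "semisimple_mod L V \<longleftrightarrow> (\<forall>W. submod L V W \<longrightarrow>
     (\<exists>W'. submod L V W' \<and> W \<inter> W' = {\<zero>\<^bsub>V\<^esub>} \<and> W <+>\<^bsub>V\<^esub> W' = carrier V))"

definition reductive_in :: "cmat set \<Rightarrow> cmat set \<Rightarrow> bool" where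
  "reductive_in K L \<longleftrightarrow> lie_subalgebra K L \<and> semisimple_mod K (fmod L lbr)"

definition has_finite_length :: "'x set \<Rightarrow> ('x, 'v) lmod \<Rightarrow> bool" where
  "has_finite_length L V \<longleftrightarrow> (\<exists>k W. W 0 = {\<zero>\<^bsub>V\<^esub>} \<and> W k = carrier V \<and>
     (\<forall>i\<le>k. submod L V (W i)) \<and>
     (\<forall>i<k. W i \<subseteq> W (Suc i) \<and> simple_mod L (quot_mod (restr V (W (Suc i))) (W i))))"

text \<open>
  The multiplicity of the simple module \<open>S\<close> as a subquotient of \<open>V\<close>: the largest number of subquotients
  isomorphic to \<open>S\<close> in a finite filtration of \<open>V\<close> by submodules.  For \<open>V\<close> of finite length it is the
  number of factors isomorphic to \<open>S\<close> in any composition series.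
\<close>

definition multiplicity :: "'x set \<Rightarrow> ('x, 'v) lmod \<Rightarrow> ('x, 'w) lmod \<Rightarrow> enat" where
  "multiplicity L V S = Sup {enat (card {i. i < k \<and> lmod_iso L (quot_mod (restr V (W (Suc i))) (W i)) S})
     | k W. (\<forall>i\<le>k. submod L V (W i)) \<and> (\<forall>i<k. W i \<subseteq> W (Suc i))}"

text \<open>In the following two definitions \<open>Lf n\<close> are the finite-dimensional members of the exhaustion of \<open>L\<close>.\<close>

definition integrable_mod :: "(nat \<Rightarrow> cmat set) \<Rightarrow> (cmat, 'v) lmod \<Rightarrow> bool" where
  "integrable_mod Lf V \<longleftrightarrow> (\<forall>n\<ge>1. \<forall>v\<in>carrier V. fin_dim V (gen (Lf n) V {v}))"

text \<open>The type argument is the type that carries the test modules \<open>S\<close>.\<close>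

definition finite_type_mod ::
    "'w itself \<Rightarrow> (nat \<Rightarrow> cmat set) \<Rightarrow> cmat set \<Rightarrow> (cmat, 'v) lmod \<Rightarrow> bool" where
  "finite_type_mod T Lf L V \<longleftrightarrow>
     (\<forall>F. finite F \<and> F \<subseteq> carrier V \<longrightarrow> has_finite_length L (restr V (gen L V F))) \<and>
     (\<forall>S :: (cmat, 'w) lmod. lie_module L S \<and> simple_mod L S \<and> integrable_mod Lf S \<longrightarrow>
        (\<exists>b::nat. \<forall>F. finite F \<and> F \<subseteq> carrier V \<longrightarrow>
           multiplicity L (restr V (gen L V F)) S \<le> enat b))"

text \<open>\<open>G n\<close> are the finite-dimensional members of the exhaustion of the ambient Lie algebra.\<close>

definition pair_module_of_finite_type ::
    "'w itself \<Rightarrow> (nat \<Rightarrow> cmat set) \<Rightarrow> cmat set \<Rightarrow> cmat set \<Rightarrow> (cmat, 'v) lmod \<Rightarrow> bool" where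
  "pair_module_of_finite_type T G M L V \<longleftrightarrow>
     lie_module M V \<and> integrable_mod (\<lambda>n. L \<inter> G n) V \<and> finite_type_mod T (\<lambda>n. L \<inter> G n) L V"


section \<open>Enveloping algebras and induced modules\<close>

text \<open>
  \<open>free_alg L\<close> is the free associative algebra on the set \<open>L\<close>: finitely supported functions on words
  over \<open>L\<close>.  The enveloping algebra is its quotient by the two-sided ideal expressing that the
  generators depend linearly on the elements of \<open>L\<close> and that commutators are brackets.
\<close>

type_synonym free_elem = "cmat list \<Rightarrow> complex"

definition free_alg :: "cmat set \<Rightarrow> free_elem ring" where
  "free_alg L = \<lparr>carrier = {f. finite {w. f w \<noteq> 0} \<and> (\<forall>w. f w \<noteq> 0 \<longrightarrow> set w \<subseteq> L)},
     monoid.mult = (\<lambda>f g w. \<Sum>k\<le>length w. f (take k w) * g (drop k w)),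
     one = (\<lambda>w. of_bool (w = [])), zero = 0, add = (+)\<rparr>"

definition word :: "cmat list \<Rightarrow> free_elem" where
  "word u = (\<lambda>w. of_bool (w = u))"

definition env_rel :: "cmat set \<Rightarrow> free_elem set" where
  "env_rel L = {word [x + y] - word [x] - word [y] | x y. x \<in> L \<and> y \<in> L}
     \<union> {word [fscale c x] - fscale c (word [x]) | c x. x \<in> L}
     \<union> {word [x, y] - word [y, x] - word [lbr x y] | x y. x \<in> L \<and> y \<in> L}"

definition env_ideal :: "cmat set \<Rightarrow> free_elem set" where
  "env_ideal L = genideal (free_alg L) (env_rel L)"

definition env_alg :: "cmat set \<Rightarrow> free_elem set ring" where
  "env_alg L = free_alg L Quot env_ideal L"

definition env_class :: "cmat set \<Rightarrow> free_elem \<Rightarrow> free_elem set" where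
  "env_class L f = env_ideal L +>\<^bsub>free_alg L\<^esub> f"

definition free_act :: "(cmat, 'e) lmod \<Rightarrow> free_elem \<Rightarrow> 'e \<Rightarrow> 'e" where
  "free_act E f e = finsum E (\<lambda>w. f w \<odot>\<^bsub>E\<^esub> foldr (lact E) w e) {w. f w \<noteq> 0}"

definition delta :: "'b \<Rightarrow> 'b \<Rightarrow> complex" where
  "delta b = (\<lambda>b'. of_bool (b' = b))"

text \<open>
  The free vector space on \<open>U(g) \<times> E\<close>, with \<open>x \<in> g\<close> acting by left multiplication on the first
  component of the basis elements.
\<close>

definition free_tensor ::
    "cmat set \<Rightarrow> (cmat, 'e) lmod \<Rightarrow> (cmat, free_elem set \<times> 'e \<Rightarrow> complex) lmod" where
  "free_tensor g E = fmod
     {F. finite {q. F q \<noteq> 0} \<and> {q. F q \<noteq> 0} \<subseteq> carrier (env_alg g) \<times> carrier E}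
     (\<lambda>x F q. \<Sum>q' | F q' \<noteq> 0 \<and> (env_class g (word [x]) \<otimes>\<^bsub>env_alg g\<^esub> fst q', snd q') = q. F q')"

text \<open>
  The relations of the tensor product over \<open>U(P)\<close>.  In the last family \<open>a\<close> runs over \<open>U(P)\<close>, \<open>f\<close> over its
  representatives in the free algebra, \<open>env_class g f\<close> is the image of \<open>a\<close> in \<open>U(g)\<close> and \<open>free_act E f e\<close>
  is the action of \<open>a\<close> on \<open>e\<close>.
\<close>

definition tensor_rel ::
    "cmat set \<Rightarrow> cmat set \<Rightarrow> (cmat, 'e) lmod \<Rightarrow> (free_elem set \<times> 'e \<Rightarrow> complex) set" where
  "tensor_rel g P E =
     {delta (u \<oplus>\<^bsub>env_alg g\<^esub> u', e) - delta (u, e) - delta (u', e) | u u' e.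
        u \<in> carrier (env_alg g) \<and> u' \<in> carrier (env_alg g) \<and> e \<in> carrier E}
   \<union> {delta (u, e \<oplus>\<^bsub>E\<^esub> e') - delta (u, e) - delta (u, e') | u e e'.
        u \<in> carrier (env_alg g) \<and> e \<in> carrier E \<and> e' \<in> carrier E}
   \<union> {delta (env_class g (fscale c (word [])) \<otimes>\<^bsub>env_alg g\<^esub> u, e) - fscale c (delta (u, e)) | c u e.
        u \<in> carrier (env_alg g) \<and> e \<in> carrier E}
   \<union> {delta (u \<otimes>\<^bsub>env_alg g\<^esub> env_class g f, e) - delta (u, free_act E f e) | u a f e.
        u \<in> carrier (env_alg g) \<and> a \<in> carrier (env_alg P) \<and> f \<in> a \<and> e \<in> carrier E}"

definition induced ::
    "cmat set \<Rightarrow> cmat set \<Rightarrow> (cmat, 'e) lmod \<Rightarrow> (cmat, (free_elem set \<times> 'e \<Rightarrow> complex) set) lmod" where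
  "induced g P E = quot_mod (free_tensor g E) (gen {} (free_tensor g E) (tensor_rel g P E))"


section \<open>The modules \<open>V(\<lambda>)\<close> inside the tensor algebra, and their limits\<close>

text \<open>
  The letter \<open>(False, i)\<close> stands for the basis vector \<open>e\<^sub>i\<close> of the natural module, \<open>(True, i)\<close> for the dual basis
  vector; a tensor is its coefficient function on words.  \<open>tens N\<close> is the tensor algebra of
  \<open>V \<oplus> V\<^sup>*\<close>, \<open>V\<close> the natural \<open>gl(N)\<close>-module, on which \<open>gl_blk N\<close> acts through its first diagonal block.
\<close>

type_synonym letter = "bool \<times> nat"
type_synonym tensor = "letter list \<Rightarrow> complex"

definition tens :: "nat \<Rightarrow> tensor set" where
  "tens N = {t. finite {w. t w \<noteq> 0} \<and> (\<forall>w. t w \<noteq> 0 \<longrightarrow> (\<forall>l\<in>set w. snd l < N))}"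

definition tact :: "cmat \<Rightarrow> tensor \<Rightarrow> tensor" where
  "tact A t = (\<lambda>w. \<Sum>k<length w. case w ! k of
       (False, i) \<Rightarrow> (\<Sum>j | A (i, j) \<noteq> 0. A (i, j) * t (w[k := (False, j)]))
     | (True, i) \<Rightarrow> - (\<Sum>j | A (j, i) \<noteq> 0. A (j, i) * t (w[k := (True, j)])))"

text \<open>
  \<open>blk_inj N i\<close> is induced by the injection of \<open>V \<oplus> V\<^sup>*\<close> for \<open>gl(N)\<close> as the \<open>i\<close>-th summand of the one for
  \<open>gl(N * t)\<close>, and \<open>diag_inj\<close> is the resulting diagonal map.  \<open>dext N x\<close> is the infinite block diagonal
  extension of \<open>x\<close>; by \<open>dext_diag_inj\<close> it is compatible with the diagonal maps, so the direct limit along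
  these is the union of the spaces of extended tensors.  (In tensor degree 0, i.e. for the trivial module,
  \<open>diag_inj\<close> is multiplication by \<open>t\<close> and \<open>dext\<close> is the identity; both give the trivial module in the limit.)
\<close>

definition blk_inj :: "nat \<Rightarrow> nat \<Rightarrow> tensor \<Rightarrow> tensor" where
  "blk_inj N i t = (\<lambda>w. if \<forall>l\<in>set w. snd l div N = i
     then t (map (\<lambda>(s, a). (s, a mod N)) w) else 0)"

definition diag_inj :: "nat \<Rightarrow> nat \<Rightarrow> tensor \<Rightarrow> tensor" where
  "diag_inj N t x = (\<Sum>i<t. blk_inj N i x)"

definition dext :: "nat \<Rightarrow> tensor \<Rightarrow> tensor" where
  "dext N t = (\<lambda>w. if \<exists>i. \<forall>l\<in>set w. snd l div N = i
     then t (map (\<lambda>(s, a). (s, a mod N)) w) else 0)"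

primrec weight_seq :: "(nat \<Rightarrow> nat) \<Rightarrow> nat \<Rightarrow> int list \<Rightarrow> nat \<Rightarrow> int list" where
  "weight_seq \<theta> n0 lam 0 = lam"
| "weight_seq \<theta> n0 lam (Suc k) = (let mu = weight_seq \<theta> n0 lam k in
     takeWhile (\<lambda>a. a \<ge> 0) mu
     @ replicate (Nsize \<theta> (n0 + k) * (\<theta> (n0 + k) - 1)) 0
     @ dropWhile (\<lambda>a. a \<ge> 0) mu)"

definition dominant_integral :: "nat \<Rightarrow> int list \<Rightarrow> bool" where
  "dominant_integral N lam \<longleftrightarrow> length lam = N \<and> sorted_wrt (\<ge>) lam"

definition has_highest_weight :: "nat \<Rightarrow> int list \<Rightarrow> (cmat, 'v) lmod \<Rightarrow> bool" where
  "has_highest_weight N lam V \<longleftrightarrow> (\<exists>v\<in>carrier V. v \<noteq> \<zero>\<^bsub>V\<^esub> \<and>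
     (\<forall>i<N. \<forall>j<N. i < j \<longrightarrow> lact V (dsum N (delta (i, j))) v = \<zero>\<^bsub>V\<^esub>) \<and>
     (\<forall>i<N. lact V (dsum N (delta (i, i))) v = complex_of_int (lam ! i) \<odot>\<^bsub>V\<^esub> v))"

text \<open>
  \<open>W n\<close>, \<open>n \<ge> n0\<close>, is a realisation of \<open>V(\<lambda>\<^sub>n)\<close> in the tensor algebra for which the tensor algebra maps
  \<open>blk_inj\<close> restrict to maps \<open>V(\<lambda>\<^sub>n) \<rightarrow> V(\<lambda>\<^sub>n\<^sub>+\<^sub>1)\<close>.
\<close>

definition natural_realisation ::
    "(nat \<Rightarrow> nat) \<Rightarrow> nat \<Rightarrow> int list \<Rightarrow> (nat \<Rightarrow> tensor set) \<Rightarrow> bool" where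
  "natural_realisation \<theta> n0 lam W \<longleftrightarrow> (\<forall>k. let n = n0 + k; N = Nsize \<theta> n; V = fmod (W n) tact in
     submod (gl_blk N) (fmod (tens N) tact) (W n) \<and> fin_dim V (W n) \<and> simple_mod (gl_blk N) V \<and>
     has_highest_weight N (weight_seq \<theta> n0 lam k) V \<and>
     (\<forall>i<\<theta> n. blk_inj N i ` W n \<subseteq> W (Suc n)))"

definition Vtilde :: "(nat \<Rightarrow> nat) \<Rightarrow> nat \<Rightarrow> (nat \<Rightarrow> tensor set) \<Rightarrow> tensor set" where
  "Vtilde \<theta> n0 W = (\<Union>n\<in>{n0..}. dext (Nsize \<theta> n) ` W n)"

lemma dext_diag_inj:
  assumes N: "N > 0" and t: "t > 0" and w: "w \<noteq> []"
  shows "dext (N * t) (diag_inj N t x) w = dext N x w"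
proof -
  let ?r = "\<lambda>M. map (\<lambda>(s, a). (s, a mod M)) (w :: letter list)"
  let ?P = "\<lambda>i. \<forall>l\<in>set w. snd l mod (N * t) div N = i"
  have small: "a mod (N * t) div N < t" for a :: nat
    using N t by (simp add: mod_mult2_eq)
  have rr: "map (\<lambda>(s, a). (s, a mod N)) (?r (N * t)) = ?r N"
    by (auto simp: mod_mult2_eq)
  have sum_app: "(\<Sum>i<s. F i) v = (\<Sum>i<s. F i v)" for s :: nat and F :: "nat \<Rightarrow> tensor" and v
    by (induction s) auto
  have d: "diag_inj N t x (?r (N * t)) = (\<Sum>i<t. if ?P i then x (?r N) else 0)"
  proof -
    have "diag_inj N t x (?r (N * t)) = (\<Sum>i<t. blk_inj N i x (?r (N * t)))"
      unfolding diag_inj_def by (rule sum_app)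
    also have "\<dots> = (\<Sum>i<t. if ?P i then x (?r N) else 0)"
      unfolding blk_inj_def rr by (intro sum.cong refl if_cong) (auto simp: case_prod_beta)
    finally show ?thesis .
  qed
  obtain l0 where l0: "l0 \<in> set w" using w by (cases w) auto
  let ?i0 = "snd l0 mod (N * t) div N"
  have s: "(\<Sum>i<t. if ?P i then x (?r N) else 0) = (if ?P ?i0 then x (?r N) else 0)"
  proof -
    have "(\<Sum>i<t. if ?P i then x (?r N) else 0)
        = (\<Sum>i<t. if i = ?i0 then (if ?P ?i0 then x (?r N) else 0) else 0)"
      using l0 by (intro sum.cong) auto
    also have "\<dots> = (if ?P ?i0 then x (?r N) else 0)"
      using small[of "snd l0"] by simp
    finally show ?thesis .
  qed
  have inj: "a div N = b div N \<longleftrightarrow>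
      a div (N * t) = b div (N * t) \<and> a mod (N * t) div N = b mod (N * t) div N" for a b :: nat
  proof -
    have "a mod (N * t) div N = a div N mod t" "a div (N * t) = a div N div t" for a :: nat
      using N by (simp_all add: mod_mult2_eq div_mult2_eq)
    then show ?thesis by (metis div_mult_mod_eq)
  qed
  have ex: "(\<exists>i. \<forall>l\<in>set w. f l = i) \<longleftrightarrow> (\<forall>l\<in>set w. f l = f l0)" for f :: "letter \<Rightarrow> nat"
    using l0 by auto
  have "(\<exists>i. \<forall>l\<in>set w. snd l div N = i) \<longleftrightarrow> (\<forall>l\<in>set w. snd l div N = snd l0 div N)"
    by (rule ex)
  also have "\<dots> \<longleftrightarrow> (\<forall>l\<in>set w. snd l div (N * t) = snd l0 div (N * t)) \<and> ?P ?i0"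
    using inj[of _ "snd l0"] by blast
  also have "\<dots> \<longleftrightarrow> (\<exists>i. \<forall>l\<in>set w. snd l div (N * t) = i) \<and> ?P ?i0"
    by (simp only: ex)
  finally show ?thesis
    unfolding dext_def d s by auto
qed


section \<open>The inducing module\<close>

text \<open>The natural \<open>gl(p)\<close>-module, on which \<open>gl_blk p\<close> acts through its first diagonal block.\<close>

definition nat_vec :: "nat \<Rightarrow> (nat \<Rightarrow> complex) set" where
  "nat_vec p = {v. \<forall>i\<ge>p. v i = 0}"

definition mvec :: "cmat \<Rightarrow> (nat \<Rightarrow> complex) \<Rightarrow> nat \<Rightarrow> complex" where
  "mvec A v = (\<lambda>i. \<Sum>j | A (i, j) \<noteq> 0. A (i, j) * v j)"

text \<open>\<open>b 0, \<dots>, b (p - 1)\<close> is an eigenbasis of \<open>h\<close>, and the \<open>j\<close>-th coordinate functional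
  \<open>\<epsilon>\<^sub>j\<close> takes the value \<open>\<eta> j\<close> on \<open>h\<close>.\<close>

definition eigenbasis ::
    "nat \<Rightarrow> cmat \<Rightarrow> (nat \<Rightarrow> nat \<Rightarrow> complex) \<Rightarrow> (nat \<Rightarrow> complex) \<Rightarrow> bool" where
  "eigenbasis p h b \<eta> \<longleftrightarrow> inj_on b {..<p} \<and> cfun.independent (b ` {..<p}) \<and>
     cfun.span (b ` {..<p}) = nat_vec p \<and> (\<forall>j<p. mvec h (b j) = fscale (\<eta> j) (b j))"

text \<open>
  The identification of the centralizer of \<open>h\<close> with \<open>gl(\<Theta>)\<^sup>p\<close>.  The matrix position \<open>a * p + k\<close>, \<open>k < p\<close>,
  is the position of \<open>e\<^sub>a \<otimes> e\<^sub>k\<close>.  The component \<open>Y = component p b j A\<close> describes \<open>A\<close> on the \<open>\<eta> j\<close>-eigenspace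
  of \<open>h\<close>: \<open>A (e\<^sub>c \<otimes> b j) = (Y e\<^sub>c) \<otimes> b j\<close>.
\<close>

definition component :: "nat \<Rightarrow> (nat \<Rightarrow> nat \<Rightarrow> complex) \<Rightarrow> nat \<Rightarrow> cmat \<Rightarrow> cmat" where
  "component p b j A = (THE Y. \<forall>a c k. k < p \<longrightarrow>
     (\<Sum>l<p. A (a * p + k, c * p + l) * b j l) = Y (a, c) * b j k)"

text \<open>Outer tensor product: the tensor product of function spaces is realised by functions on \<open>p\<close>-tuples.\<close>

definition pure_box :: "nat \<Rightarrow> (nat \<Rightarrow> tensor) \<Rightarrow> letter list list \<Rightarrow> complex" where
  "pure_box p f = (\<lambda>ws. if length ws = p then \<Prod>j<p. f j (ws ! j) else 0)"

definition box_space :: "nat \<Rightarrow> (nat \<Rightarrow> tensor set) \<Rightarrow> (letter list list \<Rightarrow> complex) set" where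
  "box_space p U = cfun.span {pure_box p f | f. \<forall>j<p. f j \<in> U j}"

definition box_act :: "nat \<Rightarrow> (nat \<Rightarrow> cmat \<Rightarrow> cmat) \<Rightarrow> cmat \<Rightarrow> (letter list list \<Rightarrow> complex)
    \<Rightarrow> letter list list \<Rightarrow> complex" where
  "box_act p \<phi> A F = (\<lambda>ws. if length ws = p
     then \<Sum>j<p. tact (\<phi> j A) (\<lambda>w. F (ws[j := w])) (ws ! j) else 0)"

definition mcomp :: "cmat set \<Rightarrow> cmat set \<Rightarrow> cmat \<Rightarrow> cmat" where
  "mcomp m n x = (THE y. y \<in> m \<and> x - y \<in> n)"

definition inducing_module :: "(nat \<Rightarrow> nat) \<Rightarrow> nat \<Rightarrow> (nat \<Rightarrow> nat \<Rightarrow> complex) \<Rightarrow> cmat set \<Rightarrow> cmat set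
    \<Rightarrow> (nat \<Rightarrow> nat) \<Rightarrow> (nat \<Rightarrow> nat \<Rightarrow> tensor set) \<Rightarrow> (cmat, letter list list \<Rightarrow> complex) lmod" where
  "inducing_module \<theta> p b m n n0 W = fmod (box_space p (\<lambda>j. Vtilde \<theta> (n0 j) (W j)))
     (\<lambda>x. box_act p (component p b) (mcomp m n x))"

text \<open>The decomposition \<open>P = m \<oplus> n\<close> with \<open>m\<close> exhausted by the \<open>mf i\<close>; \<open>G i\<close> exhausts the ambient Lie
  algebra.\<close>

definition levi_decomposition ::
    "(nat \<Rightarrow> cmat set) \<Rightarrow> cmat set \<Rightarrow> (nat \<Rightarrow> cmat set) \<Rightarrow> cmat set \<Rightarrow> cmat set \<Rightarrow> bool" where
  "levi_decomposition G P mf m n \<longleftrightarrow>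
     m = (\<Union>i\<in>{1..}. mf i) \<and> n = (\<Union>i\<in>{1..}. nilradical (P \<inter> G i)) \<and>
     (\<forall>i\<ge>1. direct_sum_decomp (P \<inter> G i) (mf i) (nilradical (P \<inter> G i)) \<and>
        reductive_in (mf i) (G i) \<and> mf (Suc i) \<inter> G i = mf i) \<and>
     lie_subalgebra m P \<and> lie_ideal n P \<and> direct_sum_decomp P m n"

end

theory Submission
  imports Defs
begin

text \<open>
  Filter \<open>M = ind E\<close> by the number of factors taken from the opposite nilradical.  The element \<open>h\<close> is central in
  \<open>k \<inter> m\<close>, is locally finite on \<open>M\<close>, and its eigenvalues on the \<open>d\<close>-th layer have real parts tending to
  \<open>-\<infinity>\<close> with \<open>d\<close>; as \<open>h\<close> acts on a simple module \<open>S\<close> by a scalar, only finitely many layers contribute to the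
  multiplicity of \<open>S\<close>.  So it suffices that the number of proper inclusions in a chain of \<open>k \<inter> m\<close>-submodules of a finite layer is
  bounded.  Now \<open>k \<inter> m\<close> contains the matrices \<open>Y \<otimes> 1\<close>, \<open>Y \<in> gl(\<Theta>)\<close>, and over \<open>gl(N)\<close> (the part of \<open>gl(\<Theta>)\<close> at
  some level) a finite layer is a quotient of a sum of mixed tensor powers of the natural module and its dual whose number and degrees
  do not depend on \<open>N\<close>.  An invariant subspace of such a sum is determined by its orthogonal projection, which
  commutes with \<open>gl(N)\<close>, and the kernel of an equivariant endomorphism is an invariant tensor, hence determined
  by its coefficients at boundedly many small letters.  This bounds the lengths of chains independently of \<open>N\<close>.
\<close>

section \<open>Orthogonal projections in spaces of functions\<close>

text \<open>The obstacle is uniformity: a \<open>k \<inter> m\<close>-submodule of a layer need not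
  live at any finite level, and dimensions grow with the level, so every bound has to hold for all
  \<open>N\<close> at once. Two properties of matrix units provide this. They are real and their
  transposes are matrix units, so orthogonal complements of invariant subspaces are invariant; this
  is complete reducibility by plain linear algebra. And the invariants of a mixed tensor power stay
  bounded as \<open>N\<close> grows, because a single relation trades a letter for a fresh one. A
  chain of submodules is finite, so its proper inclusions are witnessed by finitely many vectors of
  one common level, and the bound applies there. A factor from the opposite nilradical transforms
  under \<open>Y \<otimes> 1\<close> like a vector tensor a covector, so \<open>d\<close> factors
  lengthen the words by a fixed amount; for \<open>E\<close> itself, the tensor degrees in
  \<open>W j l\<close> do not grow with \<open>l\<close>. The modules of the definitions are carried
  by cosets; they are transported to spaces of functions, where spans, bases and projections are at
  hand.\<close>

definition fun_on :: "'i set \<Rightarrow> ('i \<Rightarrow> complex) set" where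
  "fun_on I = {F. \<forall>x. x \<notin> I \<longrightarrow> F x = 0}"

lemma sum_fun_apply: "(\<Sum>x\<in>A. F x) y = (\<Sum>x\<in>A. F x y)"
  by (induction A rule: infinite_finite_induct) auto

lemma subspace_fun_on: "cfun.subspace (fun_on I)"
  unfolding cfun.subspace_def fun_on_def by auto

lemma delta_in_fun_on: "x \<in> I \<Longrightarrow> delta x \<in> fun_on I"
  by (auto simp: fun_on_def delta_def)

lemma fun_on_expand:
  assumes "finite I" "F \<in> fun_on I"
  shows "F = (\<Sum>x\<in>I. fscale (F x) (delta x))"
proof
  fix y
  have "(\<Sum>x\<in>I. F x * of_bool (y = x)) = (\<Sum>x\<in>I. if y = x then F x else 0)"
    by (rule sum.cong) auto
  then show "F y = (\<Sum>x\<in>I. fscale (F x) (delta x)) y"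
    using assms by (auto simp: sum_fun_apply delta_def sum.delta' fun_on_def)
qed

lemma fun_on_subset_span:
  assumes "finite I"
  shows "fun_on I \<subseteq> cfun.span (delta ` I)"
proof
  fix F assume "F \<in> fun_on I"
  then show "F \<in> cfun.span (delta ` I)"
    by (subst fun_on_expand[OF assms], assumption) (intro cfun.span_sum cfun.span_scale cfun.span_base imageI)
qed

lemma finite_basis_in_span:
  assumes "cfun.subspace U" "U \<subseteq> cfun.span S" "finite S"
  obtains B where "finite B" "B \<subseteq> U" "cfun.independent B" "cfun.span B = U"
proof -
  obtain B where B: "B \<subseteq> U" "cfun.independent B" "U \<subseteq> cfun.span B"
    using cfun.basis_exists[of U] by metis
  have "finite B"
    using cfun.independent_span_bound[OF assms(3) B(2)] order_trans[OF B(1) assms(2)] by simp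
  moreover have "cfun.span B = U"
    using B assms(1) by (simp add: cfun.span_minimal subset_antisym)
  ultimately show ?thesis using that B by blast
qed

text \<open>Each proper inclusion contributes a vector of the larger space outside the smaller one.
  The vectors so collected are independent, and an independent set in the span of \<open>S\<close>
  has at most \<open>card S\<close> elements.\<close>

lemma subspace_chain_bound:
  fixes Y :: "nat \<Rightarrow> ('i \<Rightarrow> complex) set"
  assumes sub: "\<And>i. i \<le> k \<Longrightarrow> cfun.subspace (Y i)"
    and mono: "\<And>i. i < k \<Longrightarrow> Y i \<subseteq> Y (Suc i)"
    and fin: "finite S" "Y k \<subseteq> cfun.span S"
  shows "card {i. i < k \<and> Y i \<noteq> Y (Suc i)} \<le> card S"
proof -
  have "\<exists>B\<subseteq>Y j. finite B \<and> cfun.independent B \<and> card B = card {i. i < j \<and> Y i \<noteq> Y (Suc i)}"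
    if "j \<le> k" for j
    using that
  proof (induction j)
    case 0
    show ?case by (rule exI[of _ "{}"]) (auto simp: cfun.independent_empty)
  next
    case (Suc j)
    then obtain B where B: "B \<subseteq> Y j" "finite B" "cfun.independent B"
      "card B = card {i. i < j \<and> Y i \<noteq> Y (Suc i)}" by auto
    show ?case
    proof (cases "Y j = Y (Suc j)")
      case True
      then have "{i. i < Suc j \<and> Y i \<noteq> Y (Suc i)} = {i. i < j \<and> Y i \<noteq> Y (Suc i)}"
        using less_Suc_eq by auto
      then show ?thesis using B True by auto
    next
      case False
      then obtain a where a: "a \<in> Y (Suc j)" "a \<notin> Y j" using mono[of j] Suc.prems by auto
      have nspan: "a \<notin> cfun.span B"
        using a(2) B(1) cfun.span_minimal[OF B(1) sub[of j]] Suc.prems by auto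
      have "{i. i < Suc j \<and> Y i \<noteq> Y (Suc i)} = insert j {i. i < j \<and> Y i \<noteq> Y (Suc i)}"
        using False less_Suc_eq by auto
      then have c: "card {i. i < Suc j \<and> Y i \<noteq> Y (Suc i)} = Suc (card {i. i < j \<and> Y i \<noteq> Y (Suc i)})"
        by simp
      have "a \<notin> B" using nspan cfun.span_base by blast
      then show ?thesis
        using B a nspan mono[of j] Suc.prems c
        by (intro exI[of _ "insert a B"]) (auto simp: cfun.independent_insert)
    qed
  qed
  then obtain B where "B \<subseteq> Y k" "cfun.independent B" "card B = card {i. i < k \<and> Y i \<noteq> Y (Suc i)}"
    by blast
  then show ?thesis
    using cfun.independent_span_bound[of S B] fin by auto
qed

definition herm :: "'i set \<Rightarrow> ('i \<Rightarrow> complex) \<Rightarrow> ('i \<Rightarrow> complex) \<Rightarrow> complex" where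
  "herm I F G = (\<Sum>x\<in>I. F x * cnj (G x))"

lemma herm_add: "herm I (F + F') G = herm I F G + herm I F' G"
  and herm_diff: "herm I (F - F') G = herm I F G - herm I F' G"
  and herm_scale: "herm I (fscale c F) G = c * herm I F G"
  and herm_add_right: "herm I F (G + G') = herm I F G + herm I F G'"
  and herm_scale_right: "herm I F (fscale c G) = cnj c * herm I F G"
  by (simp_all add: herm_def sum.distrib sum_subtractf sum_distrib_left algebra_simps)

lemma herm_self_eq_0:
  assumes "finite I" "F \<in> fun_on I" "herm I F F = 0"
  shows "F = 0"
proof -
  have "herm I F F = of_real (\<Sum>x\<in>I. (cmod (F x))\<^sup>2)"
    unfolding herm_def of_real_sum by (rule sum.cong) (simp_all add: complex_norm_square[symmetric])
  then have "(\<Sum>x\<in>I. (cmod (F x))\<^sup>2) = 0" using assms(3) of_real_eq_0_iff by metis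
  then have "\<forall>x\<in>I. F x = 0" using assms(1) by (simp add: sum_nonneg_eq_0_iff)
  then show ?thesis using assms(2) by (auto simp: fun_on_def fun_eq_iff)
qed

definition orth :: "'i set \<Rightarrow> ('i \<Rightarrow> complex) set \<Rightarrow> ('i \<Rightarrow> complex) set" where
  "orth I U = {F \<in> fun_on I. \<forall>G\<in>U. herm I F G = 0}"

lemma subspace_orth: "cfun.subspace (orth I U)"
  using subspace_fun_on[of I] herm_add[of I] herm_scale[of I]
  unfolding cfun.subspace_def orth_def by (auto simp: herm_def)

lemma orth_span: "orth I (cfun.span B) = orth I B"
proof
  show "orth I (cfun.span B) \<subseteq> orth I B" by (auto simp: orth_def cfun.span_base)
next
  show "orth I B \<subseteq> orth I (cfun.span B)"
  proof
    fix F assume F: "F \<in> orth I B"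
    have "cfun.subspace {G. herm I F G = 0}"
      unfolding cfun.subspace_def by (auto simp: herm_add_right herm_scale_right) (simp add: herm_def)
    moreover have "B \<subseteq> {G. herm I F G = 0}" using F by (auto simp: orth_def)
    ultimately have "cfun.span B \<subseteq> {G. herm I F G = 0}" by (rule cfun.span_minimal[rotated])
    then show "F \<in> orth I (cfun.span B)" using F by (auto simp: orth_def)
  qed
qed

text \<open>Gram--Schmidt: one basis vector at a time.\<close>

lemma orth_decomp:
  assumes I: "finite I" and U: "cfun.subspace U" "U \<subseteq> fun_on I" and F: "F \<in> fun_on I"
  shows "\<exists>x\<in>U. F - x \<in> orth I U"
proof -
  obtain B where B: "finite B" "B \<subseteq> U" "cfun.span B = U"
    using finite_basis_in_span[OF U(1) order_trans[OF U(2) fun_on_subset_span[OF I]]] I by blast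
  have "\<forall>F\<in>fun_on I. \<exists>x\<in>cfun.span B. F - x \<in> orth I (cfun.span B)"
    using B(1) U(2) B(2)
  proof (induction B)
    case empty
    then show ?case
      by (auto simp: orth_def herm_def)
  next
    case (insert b B)
    have fB: "cfun.span B \<subseteq> fun_on I"
      using insert.prems by (intro cfun.span_minimal) (auto simp: subspace_fun_on)
    have fb: "b \<in> fun_on I" using insert.prems by auto
    from insert fb obtain b0 where b0: "b0 \<in> cfun.span B" "b - b0 \<in> orth I (cfun.span B)"
      by (meson insert_subset order_trans)
    let ?b = "b - b0"
    have bs: "?b \<in> cfun.span (insert b B)" "cfun.span B \<subseteq> cfun.span (insert b B)"
      using b0 cfun.span_mono[OF subset_insertI[of B b]]
      by (auto intro!: cfun.span_diff intro: cfun.span_base)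
    show ?case
    proof
      fix F assume "F \<in> fun_on I"
      with insert obtain x where x: "x \<in> cfun.span B" "F - x \<in> orth I (cfun.span B)"
        by (meson insert_subset order_trans)
      \<comment> \<open>If \<open>b\<close> already lies in the span of \<open>B\<close>, the
        residual \<open>?b\<close> is 0 and any coefficient will do; the value 0 avoids the
        division.\<close>
      define c where "c = (if herm I ?b ?b = 0 then 0 else herm I (F - x) ?b / herm I ?b ?b)"
      let ?y = "x + fscale c ?b"
      have F': "F - ?y = (F - x) - fscale c ?b" by (simp add: fun_eq_iff)
      have "F - ?y \<in> orth I (cfun.span B)"
        unfolding F' using cfun.subspace_diff[OF subspace_orth x(2) cfun.subspace_scale[OF subspace_orth b0(2)]] .
      then have o: "herm I (F - ?y) G = 0" if "G \<in> cfun.span B" for G using that by (auto simp: orth_def)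
      have "herm I (F - x) ?b = 0" if "herm I ?b ?b = 0"
      proof -
        have "?b \<in> fun_on I" using b0 by (auto simp: orth_def)
        then have "?b = 0" using herm_self_eq_0[OF I] that by blast
        then show ?thesis by (simp add: herm_def)
      qed
      moreover have "herm I (F - ?y) ?b = herm I (F - x) ?b - c * herm I ?b ?b"
        unfolding F' by (simp only: herm_diff[of I "F - x" "fscale c ?b"] herm_scale)
      ultimately have "herm I (F - ?y) ?b = 0"
        unfolding c_def by (cases "herm I ?b ?b = 0") auto
      moreover have "herm I (F - ?y) b = herm I (F - ?y) ?b + herm I (F - ?y) b0"
        by (simp add: herm_add_right[symmetric])
      ultimately have "F - ?y \<in> orth I (insert b B)"
        using \<open>F - ?y \<in> orth I (cfun.span B)\<close> o[OF b0(1)] by (auto simp: orth_def cfun.span_base)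
      then have "F - ?y \<in> orth I (cfun.span (insert b B))" by (simp add: orth_span)
      moreover have "?y \<in> cfun.span (insert b B)"
        using x(1) bs(2) by (intro cfun.span_add[OF _ cfun.span_scale[OF bs(1)]]) auto
      ultimately show "\<exists>x\<in>cfun.span (insert b B). F - x \<in> orth I (cfun.span (insert b B))" by blast
    qed
  qed
  then show ?thesis using F B(3) by auto
qed

definition proj :: "'i set \<Rightarrow> ('i \<Rightarrow> complex) set \<Rightarrow> ('i \<Rightarrow> complex) \<Rightarrow> 'i \<Rightarrow> complex" where
  "proj I U F = (SOME x. x \<in> U \<and> F - x \<in> orth I U)"

context
  fixes I :: "'i set" and U
  assumes I: "finite I" and U: "cfun.subspace U" "U \<subseteq> fun_on I"
begin

lemma proj: assumes "F \<in> fun_on I" shows "proj I U F \<in> U" "F - proj I U F \<in> orth I U"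
  using someI_ex[of "\<lambda>x. x \<in> U \<and> F - x \<in> orth I U"] orth_decomp[OF I U assms]
  unfolding proj_def by blast+

text \<open>Two candidates differ by a vector of \<open>U\<close> that is orthogonal to
  \<open>U\<close>, hence by 0. Linearity of \<open>proj\<close> and its commuting with the matrix
  units are read off from this by exhibiting the right candidate.\<close>

lemma proj_eqI:
  assumes "F \<in> fun_on I" "x \<in> U" "F - x \<in> orth I U" shows "proj I U F = x"
proof -
  let ?d = "proj I U F - x"
  have "?d \<in> U" using proj[OF assms(1)] assms U by (simp add: cfun.subspace_diff)
  moreover have "?d = (F - x) - (F - proj I U F)" by simp
  then have "?d \<in> orth I U" using proj[OF assms(1)] assms(3) cfun.subspace_diff[OF subspace_orth]
    by metis
  ultimately have "herm I ?d ?d = 0" "?d \<in> fun_on I" by (auto simp: orth_def)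
  then show ?thesis using herm_self_eq_0[OF I] by fastforce
qed

lemma proj_ident: "F \<in> U \<Longrightarrow> proj I U F = F"
  using U subspace_orth[of I U] by (intro proj_eqI) (auto simp: cfun.subspace_0)

lemma proj_add:
  assumes "F \<in> fun_on I" "G \<in> fun_on I"
  shows "proj I U (F + G) = proj I U F + proj I U G"
proof (rule proj_eqI)
  have "F + G - (proj I U F + proj I U G) = (F - proj I U F) + (G - proj I U G)" by simp
  then show "F + G - (proj I U F + proj I U G) \<in> orth I U"
    using proj assms by (metis cfun.subspace_add subspace_orth)
qed (use proj assms U in \<open>auto intro: cfun.subspace_add subspace_fun_on[THEN cfun.subspace_add]\<close>)

lemma proj_scale:
  assumes "F \<in> fun_on I"
  shows "proj I U (fscale c F) = fscale c (proj I U F)"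
proof (rule proj_eqI)
  have "fscale c F - fscale c (proj I U F) = fscale c (F - proj I U F)"
    by (simp add: fun_eq_iff algebra_simps)
  then show "fscale c F - fscale c (proj I U F) \<in> orth I U"
    using proj[OF assms] by (metis cfun.subspace_scale subspace_orth)
qed (use proj assms U in \<open>auto intro: cfun.subspace_scale subspace_fun_on[THEN cfun.subspace_scale]\<close>)

lemma proj_sum:
  assumes "finite J" "\<And>j. j \<in> J \<Longrightarrow> F j \<in> fun_on I"
  shows "proj I U (\<Sum>j\<in>J. fscale (c j) (F j)) = (\<Sum>j\<in>J. fscale (c j) (proj I U (F j)))"
  using assms
proof (induction J)
  case empty
  then show ?case using proj_ident[OF cfun.subspace_0[OF U(1)]] by (simp flip: zero_fun_def)
next
  case (insert a J)
  then have "fscale (c a) (F a) \<in> fun_on I" "(\<Sum>j\<in>J. fscale (c j) (F j)) \<in> fun_on I"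
    by (auto intro!: cfun.subspace_scale[OF subspace_fun_on] cfun.subspace_sum[OF subspace_fun_on])
  then have "proj I U (fscale (c a) (F a) + (\<Sum>j\<in>J. fscale (c j) (F j)))
      = fscale (c a) (proj I U (F a)) + (\<Sum>j\<in>J. fscale (c j) (proj I U (F j)))"
    using insert.IH insert.prems by (subst proj_add) (auto simp: proj_scale)
  then show ?case unfolding sum.insert[OF insert.hyps] .
qed

end

section \<open>Matrix units on words\<close>

definition emat :: "nat \<Rightarrow> nat \<Rightarrow> nat \<Rightarrow> cmat" where
  "emat N r s = dsum N (delta (r, s))"

text \<open>A list of words is a basis tensor of an outer tensor product; the same matrix acts on
  every factor, by the Leibniz rule.\<close>

definition wact :: "cmat \<Rightarrow> (letter list list \<Rightarrow> complex) \<Rightarrow> letter list list \<Rightarrow> complex" where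
  "wact A F ws = (\<Sum>q<length ws. tact A (\<lambda>w. F (ws[q := w])) (ws ! q))"

text \<open>The first component of an index is a passive label that tells several copies of a tensor
  power apart.\<close>

definition ract :: "cmat \<Rightarrow> ('c \<times> letter list list \<Rightarrow> complex) \<Rightarrow> 'c \<times> letter list list \<Rightarrow> complex" where
  "ract A F x = wact A (\<lambda>ws. F (fst x, ws)) (snd x)"

definition small :: "nat \<Rightarrow> letter list list \<Rightarrow> bool" where
  "small N ws \<longleftrightarrow> (\<forall>w\<in>set ws. \<forall>l\<in>set w. snd l < N)"

definition pat :: "letter list list \<Rightarrow> bool list list" where
  "pat ws = map (map fst) ws"

text \<open>Index set of the standard basis of a sum of mixed tensor powers of the natural
  \<open>gl(N)\<close>-module: one summand for each element of \<open>Q\<close>, whose pattern tells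
  the natural module from its dual. \<open>Q\<close> does not mention \<open>N\<close>, which is
  what makes later bounds uniform.\<close>

definition widx :: "nat \<Rightarrow> ('c \<times> bool list list) set \<Rightarrow> ('c \<times> letter list list) set" where
  "widx N Q = {x. (fst x, pat (snd x)) \<in> Q \<and> small N (snd x)}"

definition positions :: "'a list list \<Rightarrow> (nat \<times> nat) set" where
  "positions ws = (SIGMA q:{..<length ws}. {..<length (ws ! q)})"

definition letter_at :: "'a list list \<Rightarrow> nat \<times> nat \<Rightarrow> 'a" where
  "letter_at ws x = ws ! fst x ! snd x"

definition upd :: "'a list list \<Rightarrow> nat \<times> nat \<Rightarrow> 'a \<Rightarrow> 'a list list" where
  "upd ws x l = ws[fst x := (ws ! fst x)[snd x := l]]"

text \<open>The matrix unit \<open>emat N r s\<close> replaces one letter at a time, with these replacements and signs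
  (on coefficient functions, hence from \<open>r\<close> to \<open>s\<close> in \<open>V\<close> and from \<open>s\<close> to \<open>r\<close> in the dual).\<close>

definition swp :: "nat \<Rightarrow> nat \<Rightarrow> letter \<Rightarrow> letter" where
  "swp r s l = (if l = (False, r) then (False, s) else if l = (True, s) then (True, r) else l)"

definition sg :: "nat \<Rightarrow> nat \<Rightarrow> letter \<Rightarrow> complex" where
  "sg r s l = (if l = (False, r) then 1 else if l = (True, s) then -1 else 0)"

lemma emat_apply: "emat N r s (i, j) = of_bool (i div N = j div N \<and> i mod N = r \<and> j mod N = s)"
  by (auto simp: emat_def dsum_def delta_def)

text \<open>The matrix \<open>emat N r s\<close> is repeated along the diagonal, so a letter is
  moved inside its own block. For letters below \<open>N\<close> this is the first block, where a
  row or a column has at most one entry.\<close>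

lemma tact_emat:
  assumes "r < N" "s < N" "\<forall>l\<in>set w. snd l < N"
  shows "tact (emat N r s) t w = (\<Sum>k<length w. sg r s (w ! k) * t (w[k := swp r s (w ! k)]))"
  unfolding tact_def
proof (rule sum.cong[OF refl])
  fix k assume "k \<in> {..<length w}"
  obtain b i where l: "w ! k = (b, i)" by force
  have i: "i < N" using assms(3) l \<open>k \<in> _\<close> nth_mem by fastforce
  have row: "{j. emat N r s (i, j) \<noteq> 0} = (if i = r then {s} else {})"
    using i assms by (auto simp: emat_apply div_eq_0_iff)
  have col: "{j. emat N r s (j, i) \<noteq> 0} = (if i = s then {r} else {})"
    using i assms by (auto simp: emat_apply div_eq_0_iff)
  show "(case w ! k of
         (False, i) \<Rightarrow> \<Sum>j | emat N r s (i, j) \<noteq> 0. emat N r s (i, j) * t (w[k := (False, j)])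
       | (True, i) \<Rightarrow> - (\<Sum>j | emat N r s (j, i) \<noteq> 0. emat N r s (j, i) * t (w[k := (True, j)])))
     = sg r s (w ! k) * t (w[k := swp r s (w ! k)])"
    unfolding l using i assms
    by (cases b; simp only: prod.case bool.case row col) (auto simp: sg_def swp_def emat_apply)
qed

lemma finite_positions [simp]: "finite (positions ws)"
  by (simp add: positions_def)

lemma wact_emat:
  assumes "r < N" "s < N" "small N ws"
  shows "wact (emat N r s) F ws
    = (\<Sum>x\<in>positions ws. sg r s (letter_at ws x) * F (upd ws x (swp r s (letter_at ws x))))"
proof -
  have "wact (emat N r s) F ws = (\<Sum>q<length ws. \<Sum>k<length (ws ! q).
      sg r s (ws ! q ! k) * F (ws[q := (ws ! q)[k := swp r s (ws ! q ! k)]]))"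
    unfolding wact_def using assms
    by (intro sum.cong refl tact_emat) (auto simp: small_def)
  then show ?thesis
    by (simp add: positions_def letter_at_def upd_def sum.Sigma case_prod_beta)
qed

lemma positions_upd [simp]: "positions (upd ws x l) = positions ws"
  by (cases "fst x < length ws") (auto simp: positions_def upd_def nth_list_update split: if_splits)

lemma letter_at_upd:
  "x \<in> positions ws \<Longrightarrow> y \<in> positions ws \<Longrightarrow> letter_at (upd ws x l) y = (if x = y then l else letter_at ws y)"
  by (cases x; cases y) (simp add: positions_def letter_at_def upd_def nth_list_update)

lemma upd_upd [simp]: "x \<in> positions ws \<Longrightarrow> upd (upd ws x l) x l' = upd ws x l'"
  by (auto simp: positions_def upd_def)

lemma upd_letter_at [simp]: "upd ws x (letter_at ws x) = ws"
  by (simp add: letter_at_def upd_def)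

lemma pat_upd:
  assumes "x \<in> positions ws" "fst l = fst (letter_at ws x)"
  shows "pat (upd ws x l) = pat ws"
proof -
  have b: "fst x < length ws" "snd x < length (ws ! fst x)"
    using assms(1) by (auto simp: positions_def)
  have e: "fst l = map fst (ws ! fst x) ! snd x"
    using assms(2) b by (simp add: letter_at_def)
  have "(map fst (ws ! fst x))[snd x := fst l] = map fst (ws ! fst x)"
    unfolding e by (rule list_update_id)
  then show ?thesis
    using list_update_id[of "map (map fst) ws" "fst x"] b by (simp add: pat_def upd_def map_update)
qed

lemma small_iff: "small N ws \<longleftrightarrow> (\<forall>x\<in>positions ws. snd (letter_at ws x) < N)"
proof -
  have "(\<forall>w\<in>set ws. \<forall>l\<in>set w. snd l < N)
      \<longleftrightarrow> (\<forall>q<length ws. \<forall>k<length (ws ! q). snd (ws ! q ! k) < N)"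
    unfolding all_set_conv_all_nth ..
  then show ?thesis unfolding small_def positions_def letter_at_def by auto
qed

lemma small_upd: "small N ws \<Longrightarrow> x \<in> positions ws \<Longrightarrow> snd l < N \<Longrightarrow> small N (upd ws x l)"
  by (auto simp: small_iff letter_at_upd)

lemma positions_pat [simp]: "positions (pat ws) = positions ws"
  by (auto simp: positions_def pat_def)

lemma fst_swp [simp]: "fst (swp r s l) = fst l"
  by (auto simp: swp_def)

lemma snd_swp: "r < N \<Longrightarrow> s < N \<Longrightarrow> snd l < N \<Longrightarrow> snd (swp r s l) < N"
  by (auto simp: swp_def)

text \<open>Where the unit acts at all, the transposed unit undoes the replacement with the same
  sign. This is the combinatorial core of \<open>ract_adjoint\<close>.\<close>

lemma swp_swp: "sg r s l \<noteq> 0 \<Longrightarrow> swp s r (swp r s l) = l \<and> sg s r (swp r s l) = sg r s l"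
  by (auto simp: swp_def sg_def split: if_splits)

lemma widx_upd:
  assumes "(c, ws) \<in> widx N Q" "x \<in> positions ws" "r < N" "s < N"
  shows "(c, upd ws x (swp r s (letter_at ws x))) \<in> widx N Q"
  using assms by (auto simp: widx_def pat_upd small_iff letter_at_upd snd_swp)

lemma finite_widx:
  assumes "finite Q"
  shows "finite (widx N Q)"
proof -
  have "finite {ws. pat ws = pt \<and> small N ws}" for pt
  proof -
    define m where "m = Max (insert 0 (length ` set pt))"
    let ?A = "{w. set w \<subseteq> (UNIV :: bool set) \<times> {..<N} \<and> length w \<le> m}"
    have "finite ?A" by (rule finite_lists_length_le) simp
    then have "finite {ws. set ws \<subseteq> ?A \<and> length ws = length pt}" by (rule finite_lists_length_eq)
    moreover have "{ws. pat ws = pt \<and> small N ws} \<subseteq> {ws. set ws \<subseteq> ?A \<and> length ws = length pt}"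
    proof safe
      fix ws w b i assume ws: "small N ws" "pt = pat ws" "w \<in> set ws"
      have "length w \<in> length ` set (pat ws)" using ws(3) by (force simp: pat_def)
      then show "length w \<le> m" unfolding m_def ws(2) by (intro Max_ge) auto
      assume "(b, i) \<in> set w"
      then show "i < N" using ws unfolding small_def by fastforce
    qed (auto simp: pat_def)
    ultimately show ?thesis by (rule finite_subset[rotated])
  qed
  then have "finite (\<Union>(c, pt)\<in>Q. {c} \<times> {ws. pat ws = pt \<and> small N ws})"
    using assms by auto
  moreover have "widx N Q \<subseteq> (\<Union>(c, pt)\<in>Q. {c} \<times> {ws. pat ws = pt \<and> small N ws})"
    by (auto simp: widx_def)
  ultimately show ?thesis by (rule finite_subset[rotated])
qed

lemma ract_emat:
  assumes "r < N" "s < N" "x \<in> widx N Q"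
  shows "ract (emat N r s) F x = (\<Sum>y\<in>positions (snd x).
      sg r s (letter_at (snd x) y) * F (fst x, upd (snd x) y (swp r s (letter_at (snd x) y))))"
  using assms by (simp add: ract_def wact_emat widx_def)

text \<open>Transposition of matrix units, for the bilinear pairing of coefficient functions:
  replacement is a bijection between the pairs of an index and a position at which the one unit acts
  nontrivially and those at which the other does.\<close>

lemma ract_adjoint:
  fixes F H :: "'c \<times> letter list list \<Rightarrow> complex"
  assumes Q: "finite Q" and rs: "r < N" "s < N"
  shows "(\<Sum>x\<in>widx N Q. ract (emat N r s) F x * H x) = (\<Sum>x\<in>widx N Q. F x * ract (emat N s r) H x)"
proof -
  define P where "P = (SIGMA x:widx N Q. positions (snd x))"
  define f :: "nat \<Rightarrow> nat \<Rightarrow> ('c \<times> letter list list) \<times> nat \<times> nat \<Rightarrow> ('c \<times> letter list list) \<times> nat \<times> nat"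
    where "f r s z = ((fst (fst z), upd (snd (fst z)) (snd z) (swp r s (letter_at (snd (fst z)) (snd z)))), snd z)"
    for r s z
  define a where "a r s z = sg r s (letter_at (snd (fst z)) (snd z))"
    for r s and z :: "('c \<times> letter list list) \<times> nat \<times> nat"
  have finP: "finite P" unfolding P_def using finite_widx[OF Q] finite_positions by blast
  have sumP: "(\<Sum>z\<in>P. g z) = (\<Sum>x\<in>widx N Q. \<Sum>y\<in>positions (snd x). g (x, y))"
    for g :: "('c \<times> letter list list) \<times> nat \<times> nat \<Rightarrow> complex"
    unfolding P_def
    using sum.Sigma[of "widx N Q" "\<lambda>x. positions (snd x)" "\<lambda>x y. g (x, y)"] finite_widx[OF Q, of N] finite_positions
    by auto
  have fP: "f r s z \<in> P" if "z \<in> P" "r < N" "s < N" for z r s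
    using that widx_upd[of "fst (fst z)" "snd (fst z)" N Q "snd z" r s] by (auto simp: P_def f_def)
  have ff: "f s r (f r s z) = z \<and> a s r (f r s z) = a r s z" if "z \<in> P" "a r s z \<noteq> 0" for z r s
    using that swp_swp[of r s "letter_at (snd (fst z)) (snd z)"]
    by (auto simp: P_def f_def a_def letter_at_upd)
  have "(\<Sum>x\<in>widx N Q. ract (emat N r s) F x * H x) = (\<Sum>z\<in>P. a r s z * F (fst (f r s z)) * H (fst z))"
    unfolding sumP using rs
    by (intro sum.cong refl) (simp add: ract_emat sum_distrib_right a_def f_def)
  \<comment> \<open>The two replacements are mutually inverse only where the sign is nonzero, so the
    vanishing terms are dropped before reindexing.\<close>
  also have "\<dots> = (\<Sum>z\<in>{z\<in>P. a r s z \<noteq> 0}. a r s z * F (fst (f r s z)) * H (fst z))"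
    using finP by (intro sum.mono_neutral_right) auto
  also have "\<dots> = (\<Sum>z\<in>{z\<in>P. a s r z \<noteq> 0}. F (fst z) * (a s r z * H (fst (f s r z))))"
    by (rule sum.reindex_bij_witness[where i = "f s r" and j = "f r s"]) (use fP ff rs in auto)
  also have "\<dots> = (\<Sum>z\<in>P. F (fst z) * (a s r z * H (fst (f s r z))))"
    using finP by (intro sum.mono_neutral_left) auto
  also have "\<dots> = (\<Sum>x\<in>widx N Q. F x * ract (emat N s r) H x)"
    unfolding sumP using rs
    by (intro sum.cong refl) (simp add: ract_emat sum_distrib_left a_def f_def)
  finally show ?thesis .
qed

section \<open>Invariant tensors and their coefficients at small letters\<close>

text \<open>An invariant is determined by its coefficients at small letters: the relation for a matrix unit
  trades a large letter of the dual for a small one that does not occur yet.\<close>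

lemma invariant_zero:
  assumes inv: "\<And>r s zs. r < N \<Longrightarrow> s < N \<Longrightarrow> pat zs = pt \<Longrightarrow> small N zs \<Longrightarrow> wact (emat N r s) t zs = 0"
    and zero: "\<And>zs. pat zs = pt \<Longrightarrow> small N zs \<Longrightarrow> small L zs \<Longrightarrow> t zs = 0"
    and L: "card (positions pt) < L"
    and zs: "pat zs = pt" "small N zs"
  shows "t zs = 0"
proof (cases "N \<le> L")
  case True
  then show ?thesis using zero[OF zs] zs(2) by (fastforce simp: small_iff)
next
  case False
  \<comment> \<open>Only large letters of the dual are counted; once there are none, a diagonal
    matrix unit excludes large letters of the natural module.\<close>
  define bad where "bad zs = {x\<in>positions zs. fst (letter_at zs x) \<and> snd (letter_at zs x) \<ge> L}"
    for zs :: "letter list list"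
  have finbad: "finite (bad zs)" for zs unfolding bad_def using finite_positions by simp
  show ?thesis using zs
  proof (induction "card (bad zs)" arbitrary: zs rule: less_induct)
    case less
    let ?l = "letter_at zs"
    have pos: "positions zs = positions pt" using less.prems positions_pat by metis
    show ?case
    proof (cases "bad zs = {}")
      case True
      show ?thesis
      proof (rule ccontr)
        assume nz: "t zs \<noteq> 0"
        have "small L zs"
          unfolding small_iff
        proof
          fix x assume x: "x \<in> positions zs"
          obtain b i where l: "?l x = (b, i)" by force
          show "snd (?l x) < L"
          proof (rule ccontr)
            assume "\<not> snd (?l x) < L"
            then have i: "i \<ge> L" using l by simp
            moreover have "x \<notin> bad zs" using True by simp
            ultimately have nb: "\<not> b" using x l by (simp add: bad_def)
            have iN: "i < N" using less.prems(2) x l by (fastforce simp: small_iff)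
            have no: "?l y \<noteq> (True, i)" if "y \<in> positions zs" for y
            proof
              assume "?l y = (True, i)"
              then have "y \<in> bad zs" using that i by (simp add: bad_def)
              then show False using True by simp
            qed
            \<comment> \<open>No dual letter equals \<open>i\<close>, so the diagonal unit
              multiplies the coefficient by the number of natural letters \<open>i\<close>. This
              number is positive because of \<open>x\<close>, so invariance forces the coefficient
              to vanish.\<close>
            have "0 = wact (emat N i i) t zs" using inv[OF iN iN less.prems] by simp
            also have "\<dots> = (\<Sum>y\<in>positions zs. sg i i (?l y) * t (upd zs y (swp i i (?l y))))"
              by (rule wact_emat[OF iN iN less.prems(2)])
            also have "\<dots> = (\<Sum>y\<in>positions zs. (if ?l y = (False, i) then 1 else 0) * t zs)"
            proof (rule sum.cong[OF refl])
              fix y assume y: "y \<in> positions zs"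
              have "swp i i (?l y) = ?l y" by (simp add: swp_def)
              then show "sg i i (?l y) * t (upd zs y (swp i i (?l y)))
                  = (if ?l y = (False, i) then 1 else 0) * t zs"
                using no[OF y] by (simp add: sg_def)
            qed
            also have "\<dots> = of_nat (card {y\<in>positions zs. ?l y = (False, i)}) * t zs"
              by (simp add: sum_distrib_right[symmetric] finite_positions sum.If_cases Int_def)
            finally have "card {y\<in>positions zs. ?l y = (False, i)} = 0" using nz by simp
            then show False using x l nb by (cases x) auto
          qed
        qed
        then show False using zero less.prems nz by blast
      qed
    next
      case False
      then obtain x where "x \<in> bad zs" by blast
      then obtain v where x: "x \<in> positions zs" "?l x = (True, v)" "v \<ge> L"
        by (cases "?l x") (simp add: bad_def)
      have v: "v < N" using less.prems(2) x by (fastforce simp: small_iff)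
      \<comment> \<open>There are fewer positions than numbers below \<open>L\<close>, so some
        \<open>u\<close> is the index of no letter of \<open>zs\<close>.\<close>
      have "card ((\<lambda>y. snd (?l y)) ` positions zs) < card {..<L}"
        using card_image_le[OF finite_positions[of zs], of "\<lambda>y. snd (?l y)"] L pos by simp
      then have "\<not> {..<L} \<subseteq> (\<lambda>y. snd (?l y)) ` positions zs"
        by (metis card_mono finite_imageI finite_positions leD)
      then obtain u where u: "u < L" "\<And>y. y \<in> positions zs \<Longrightarrow> snd (?l y) \<noteq> u" by auto
      have uN: "u < N" using u(1) False \<open>\<not> N \<le> L\<close> by simp
      \<comment> \<open>The relation of \<open>emat N v u\<close> at this word contains the
        coefficient at \<open>zs\<close> as its term at \<open>x\<close>, since \<open>swp\<close>
        turns the new letter back into \<open>(True, v)\<close>.\<close>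
      define zs' where "zs' = upd zs x (True, u)"
      have pos': "positions zs' = positions zs" by (simp add: zs'_def)
      have l': "letter_at zs' y = (if x = y then (True, u) else ?l y)" if "y \<in> positions zs" for y
        using that x by (simp add: zs'_def letter_at_upd)
      have pat': "pat zs' = pt" and small': "small N zs'"
        using less.prems x uN by (simp_all add: zs'_def pat_upd small_upd)
      have badeq: "bad zs = insert x (bad zs')" "x \<notin> bad zs'"
      proof -
        have "y \<in> bad zs' \<longleftrightarrow> y \<in> bad zs \<and> y \<noteq> x" for y
          using u(1) l'[of y] pos' by (auto simp only: bad_def mem_Collect_eq split: if_splits) simp_all
        moreover have "x \<in> bad zs" using x by (simp add: bad_def)
        ultimately show "bad zs = insert x (bad zs')" "x \<notin> bad zs'" by blast+
      qed
      then have lt: "card (bad zs') < card (bad zs)" using finbad[of zs'] by simp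
      \<comment> \<open>Every other term replaces a natural letter \<open>v\<close> by
        \<open>u\<close>. This leaves the large dual letters of \<open>zs'\<close> alone, and there
        is one fewer of them than in \<open>zs\<close>, so the induction hypothesis applies.\<close>
      have others: "t (upd zs' y (False, u)) = 0"
        if y: "y \<in> positions zs" "letter_at zs' y = (False, v)" for y
      proof -
        have "bad (upd zs' y (False, u)) = bad zs'"
          using y pos' by (auto simp only: bad_def mem_Collect_eq letter_at_upd positions_upd split: if_splits) simp_all
        moreover have "pat (upd zs' y (False, u)) = pt" "small N (upd zs' y (False, u))"
          using y pos' pat' small' uN by (simp_all add: pat_upd small_upd)
        ultimately show ?thesis using less.hyps lt by metis
      qed
      have "0 = wact (emat N v u) t zs'" using inv[OF v uN pat' small'] by simp
      also have "\<dots> = (\<Sum>y\<in>positions zs. sg v u (letter_at zs' y) * t (upd zs' y (swp v u (letter_at zs' y))))"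
        using wact_emat[OF v uN small'] pos' by simp
      also have "\<dots> = (\<Sum>y\<in>positions zs. if y = x then - t zs else 0)"
      proof (rule sum.cong[OF refl])
        fix y assume y: "y \<in> positions zs"
        show "sg v u (letter_at zs' y) * t (upd zs' y (swp v u (letter_at zs' y))) = (if y = x then - t zs else 0)"
        proof (cases "y = x")
          case True
          have "upd zs' x (True, v) = zs" using x upd_letter_at[of zs x] by (simp add: zs'_def)
          then show ?thesis using True y l'[OF y] by (simp add: sg_def swp_def)
        next
          case False
          then have "letter_at zs' y \<noteq> (True, u)" using l'[OF y] u(2)[OF y] by auto
          then show ?thesis using False others[OF y] by (auto simp: sg_def swp_def)
        qed
      qed
      also have "\<dots> = - t zs" using x(1) by (simp add: finite_positions)
      finally show ?thesis by simp
    qed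
  qed
qed

section \<open>Kernels of equivariant endomorphisms\<close>

definition flip_words :: "letter list list \<Rightarrow> letter list list" where
  "flip_words ws = map (map (map_prod Not id)) ws"

lemma sg_flip: "sg r s (map_prod Not id l) = - sg s r l"
  and swp_flip: "swp r s (map_prod Not id l) = map_prod Not id (swp s r l)"
  by (cases l, auto simp: sg_def swp_def)+

lemma positions_flip [simp]: "positions (flip_words ws) = positions ws"
  by (auto simp: positions_def flip_words_def)

lemma small_flip [simp]: "small N (flip_words ws) = small N ws"
  by (auto simp: small_def flip_words_def)

lemma small_append: "small N (xs @ ys) \<longleftrightarrow> small N xs \<and> small N ys"
  by (auto simp: small_def)

lemma flip_flip [simp]: "flip_words (flip_words ws) = ws"
  by (simp add: flip_words_def comp_def map_prod_def case_prod_beta)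

lemma letter_at_flip: "x \<in> positions ws \<Longrightarrow> letter_at (flip_words ws) x = map_prod Not id (letter_at ws x)"
  by (auto simp: positions_def flip_words_def letter_at_def)

lemma flip_upd: "x \<in> positions ws \<Longrightarrow> flip_words (upd ws x l) = upd (flip_words ws) x (map_prod Not id l)"
  by (auto simp: positions_def flip_words_def upd_def map_update)

lemma wact_append:
  "wact A t (xs @ ys) = wact A (\<lambda>us. t (us @ ys)) xs + wact A (\<lambda>us. t (xs @ us)) ys"
proof -
  have "wact A t (xs @ ys) = (\<Sum>q<length xs. tact A (\<lambda>w. t ((xs @ ys)[q := w])) ((xs @ ys) ! q))
    + (\<Sum>q = length xs..<length xs + length ys. tact A (\<lambda>w. t ((xs @ ys)[q := w])) ((xs @ ys) ! q))"
    unfolding wact_def length_append lessThan_atLeast0 by (subst sum.atLeastLessThan_concat) auto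
  also have "(\<Sum>q = length xs..<length xs + length ys. tact A (\<lambda>w. t ((xs @ ys)[q := w])) ((xs @ ys) ! q))
    = (\<Sum>q<length ys. tact A (\<lambda>w. t (xs @ ys[q := w])) (ys ! q))"
    using sum.shift_bounds_nat_ivl[of "\<lambda>q. tact A (\<lambda>w. t ((xs @ ys)[q := w])) ((xs @ ys) ! q)" 0 "length xs" "length ys"]
    by (simp add: add.commute lessThan_atLeast0 nth_append list_update_append)
  finally show ?thesis
    unfolding wact_def by (simp add: nth_append list_update_append)
qed

text \<open>The dual action is minus the transpose. Flipping moves the column index of a kernel to
  the dual side, so that a row followed by a flipped column is an index of one mixed tensor
  power.\<close>

lemma wact_flip:
  assumes "r < N" "s < N" "small N ws"
  shows "wact (emat N r s) (\<lambda>us. t (flip_words us)) (flip_words ws) = - wact (emat N s r) t ws"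
  using assms
  by (simp add: wact_emat sum_negf[symmetric] letter_at_flip sg_flip swp_flip flip_upd[symmetric] cong: sum.cong)

text \<open>\<open>K\<close> is the matrix of an operator commuting with all matrix units.
  Multiplying by a unit from the right acts on the column index through the transposed unit, whence
  the exchange of \<open>r\<close> and \<open>s\<close>.\<close>

definition invariant_kernel ::
  "nat \<Rightarrow> ('c \<times> bool list list) set \<Rightarrow> (('c \<times> letter list list) \<times> ('c \<times> letter list list) \<Rightarrow> complex) \<Rightarrow> bool"
where "invariant_kernel N Q K \<longleftrightarrow> (\<forall>r<N. \<forall>s<N. \<forall>x\<in>widx N Q. \<forall>y\<in>widx N Q.
   ract (emat N r s) (\<lambda>x. K (x, y)) x = ract (emat N s r) (\<lambda>y. K (x, y)) y)"

text \<open>\<open>L\<close> only has to exceed the number of letters in a row pattern and a column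
  pattern from \<open>Q\<close> together, so one \<open>L\<close> serves for all
  \<open>N\<close>.\<close>

lemma kernel_zero:
  assumes Q: "finite Q"
  shows "\<exists>L. \<forall>N K. invariant_kernel N Q K \<longrightarrow>
     (\<forall>x\<in>widx N Q \<inter> widx L Q. \<forall>y\<in>widx N Q \<inter> widx L Q. K (x, y) = 0) \<longrightarrow>
     (\<forall>x\<in>widx N Q. \<forall>y\<in>widx N Q. K (x, y) = 0)"
proof -
  have "finite {card (positions (p @ map (map Not) p')) | c p c' p'. (c, p) \<in> Q \<and> (c', p') \<in> Q}"
    (is "finite ?S")
    by (rule finite_subset[of _ "(\<lambda>(z, z'). card (positions (snd z @ map (map Not) (snd z')))) ` (Q \<times> Q)"])
       (use Q in force)+
  then obtain L where L: "\<forall>n\<in>?S. n < L" using finite_nat_set_iff_bounded by blast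
  show ?thesis
  proof (intro exI[of _ L] allI impI ballI)
    fix N K x y
    assume inv: "invariant_kernel N Q K" and x: "x \<in> widx N Q" and y: "y \<in> widx N Q"
      and zero: "\<forall>x\<in>widx N Q \<inter> widx L Q. \<forall>y\<in>widx N Q \<inter> widx L Q. K (x, y) = 0"
    obtain c xs c' ys where xy: "x = (c, xs)" "y = (c', ys)" by (cases x; cases y)
    \<comment> \<open>The kernel read as a mixed tensor: the first \<open>length xs\<close> words
      are the row index, the flipped remaining words the column index.\<close>
    define t where "t zs = K ((c, take (length xs) zs), (c', flip_words (drop (length xs) zs)))" for zs
    let ?pt = "pat xs @ map (map Not) (pat ys)"
    have split: "\<exists>us vs. zs = us @ flip_words vs \<and> length us = length xs \<and> (c, us) \<in> widx M Q \<and> (c', vs) \<in> widx M Q"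
      if zs: "pat zs = ?pt" "small M zs" for zs M
    proof -
      let ?u = "take (length xs) zs" and ?v = "flip_words (drop (length xs) zs)"
      have len: "length zs = length xs + length ys" using arg_cong[OF zs(1), of length] by (simp add: pat_def)
      have "pat ?u = pat xs" using arg_cong[OF zs(1), of "take (length xs)"] by (simp add: pat_def take_map)
      moreover have "pat (drop (length xs) zs) = map (map Not) (pat ys)"
        using arg_cong[OF zs(1), of "drop (length xs)"] by (simp add: pat_def drop_map)
      then have "map (map Not) (pat (drop (length xs) zs)) = pat ys" by (simp add: comp_def)
      then have "pat ?v = pat ys" by (simp add: pat_def flip_words_def comp_def)
      moreover have "small M ?u" "small M ?v"
        unfolding small_flip using zs(2) by (auto simp: small_def dest: in_set_takeD in_set_dropD)
      ultimately show ?thesis using x y xy len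
        by (intro exI[of _ ?u] exI[of _ ?v]) (auto simp: widx_def)
    qed
    have "t (xs @ flip_words ys) = 0"
    proof (rule invariant_zero[where N = N and L = L and pt = ?pt])
      fix r s zs assume rs: "r < N" "s < N" and "pat zs = ?pt" "small N zs"
      then obtain us vs where uv: "zs = us @ flip_words vs" "length us = length xs" "(c, us) \<in> widx N Q" "(c', vs) \<in> widx N Q"
        using split by blast
      have len: "length (ws[q := w]) = length xs" if "length ws = length xs" for ws :: "letter list list" and q w
        using that by simp
      have "wact (emat N r s) (\<lambda>ws. t (ws @ flip_words vs)) us = ract (emat N r s) (\<lambda>x. K (x, (c', vs))) (c, us)"
        unfolding wact_def ract_def using uv(2) by (simp add: t_def)
      moreover have "wact (emat N r s) (\<lambda>ws. t (us @ ws)) (flip_words vs)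
          = - ract (emat N s r) (\<lambda>y. K ((c, us), y)) (c', vs)"
        using wact_flip[OF rs, of vs "\<lambda>ws. K ((c, us), (c', ws))"] uv
        by (simp add: ract_def t_def widx_def)
      ultimately show "wact (emat N r s) t zs = 0"
        using inv uv rs unfolding wact_append uv(1) invariant_kernel_def by simp
    next
      fix zs assume zs: "pat zs = ?pt" "small N zs" "small L zs"
      obtain us vs where uv: "zs = us @ flip_words vs" "length us = length xs"
        "(c, us) \<in> widx N Q" "(c', vs) \<in> widx N Q"
        using split[OF zs(1,2)] by blast
      moreover have "small L us" "small L vs" using zs(3) by (simp_all add: uv(1) small_append)
      ultimately have "(c, us) \<in> widx N Q \<inter> widx L Q" "(c', vs) \<in> widx N Q \<inter> widx L Q"
        by (simp_all add: widx_def)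
      then show "t zs = 0" using zero uv by (simp add: t_def)
    next
      show "card (positions ?pt) < L" using L x y xy by (fastforce simp: widx_def)
    next
      show "pat (xs @ flip_words ys) = ?pt" by (simp add: pat_def flip_words_def comp_def)
      show "small N (xs @ flip_words ys)" using x y xy by (simp add: small_append widx_def)
    qed
    then show "K (x, y) = 0" by (simp add: t_def xy)
  qed
qed

section \<open>Chains of invariant subspaces\<close>

definition wfun :: "nat \<Rightarrow> ('c \<times> bool list list) set \<Rightarrow> ('c \<times> letter list list \<Rightarrow> complex) set" where
  "wfun N Q = fun_on (widx N Q)"

text \<open>Truncated to words in small letters, since \<open>ract\<close> is only controlled there.\<close>

definition eact :: "nat \<Rightarrow> ('c \<times> bool list list) set \<Rightarrow> nat \<Rightarrow> nat
    \<Rightarrow> ('c \<times> letter list list \<Rightarrow> complex) \<Rightarrow> 'c \<times> letter list list \<Rightarrow> complex" where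
  "eact N Q r s F x = (if x \<in> widx N Q then ract (emat N r s) F x else 0)"

definition einvariant :: "nat \<Rightarrow> ('c \<times> bool list list) set \<Rightarrow> ('c \<times> letter list list \<Rightarrow> complex) set \<Rightarrow> bool" where
  "einvariant N Q U \<longleftrightarrow> cfun.subspace U \<and> U \<subseteq> wfun N Q \<and> (\<forall>r<N. \<forall>s<N. \<forall>F\<in>U. eact N Q r s F \<in> U)"

lemma eact_in_wfun [simp]: "eact N Q r s F \<in> wfun N Q"
  by (simp add: wfun_def fun_on_def eact_def)

lemma eact_diff:
  assumes "r < N" "s < N"
  shows "eact N Q r s (F - G) = eact N Q r s F - eact N Q r s G"
  using assms by (simp add: fun_eq_iff eact_def ract_emat right_diff_distrib sum_subtractf)

text \<open>Matrix units have real entries, so the bilinear adjunction \<open>ract_adjoint\<close>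
  carries over to the Hermitian form.\<close>

lemma eact_herm:
  fixes F G :: "'c \<times> letter list list \<Rightarrow> complex"
  assumes "finite Q" "r < N" "s < N"
  shows "herm (widx N Q) (eact N Q r s F) G = herm (widx N Q) F (eact N Q s r G)"
proof -
  have c: "cnj (ract (emat N s r) G x) = ract (emat N s r) (\<lambda>x. cnj (G x)) x" if "x \<in> widx N Q" for x
  proof -
    have "cnj (sg r s l) = sg r s l" for r s l by (simp add: sg_def)
    then show ?thesis using that assms by (simp add: ract_emat)
  qed
  have "herm (widx N Q) (eact N Q r s F) G = (\<Sum>x\<in>widx N Q. ract (emat N r s) F x * cnj (G x))"
    by (simp add: herm_def eact_def cong: sum.cong)
  also have "\<dots> = (\<Sum>x\<in>widx N Q. F x * ract (emat N s r) (\<lambda>x. cnj (G x)) x)"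
    by (rule ract_adjoint[OF assms])
  also have "\<dots> = herm (widx N Q) F (eact N Q s r G)"
    by (simp add: herm_def eact_def c cong: sum.cong)
  finally show ?thesis .
qed

context
  fixes N :: nat and Q :: "('c \<times> bool list list) set" and U
  assumes Q: "finite Q" and U: "einvariant N Q U"
begin

text \<open>Complete reducibility: the adjoint of a matrix unit is again a matrix unit and so
  preserves \<open>U\<close>.\<close>

lemma eact_orth:
  assumes "r < N" "s < N" "F \<in> orth (widx N Q) U"
  shows "eact N Q r s F \<in> orth (widx N Q) U"
  using assms U eact_herm[OF Q assms(1,2), of F]
  by (auto simp: orth_def einvariant_def wfun_def[symmetric])

lemma proj_eact:
  assumes "r < N" "s < N" "F \<in> wfun N Q"
  shows "proj (widx N Q) U (eact N Q r s F) = eact N Q r s (proj (widx N Q) U F)"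
proof -
  let ?p = "proj (widx N Q) U F"
  note U' = U[unfolded einvariant_def wfun_def] and I = finite_widx[OF Q, of N]
  have p: "?p \<in> U" "F - ?p \<in> orth (widx N Q) U"
    using proj[OF I _ _ assms(3)[unfolded wfun_def]] U' by blast+
  have "eact N Q r s (F - ?p) = eact N Q r s F - eact N Q r s ?p"
    by (rule eact_diff[OF assms(1,2)])
  then have "eact N Q r s F - eact N Q r s ?p \<in> orth (widx N Q) U"
    using eact_orth[OF assms(1,2) p(2)] by simp
  moreover have "eact N Q r s ?p \<in> U" using U p assms by (auto simp: einvariant_def)
  ultimately show ?thesis
    using U' I by (intro proj_eqI) (auto simp: eact_in_wfun[unfolded wfun_def])
qed

lemma proj_expand:
  assumes "F \<in> wfun N Q"
  shows "proj (widx N Q) U F = (\<Sum>x\<in>widx N Q. fscale (F x) (proj (widx N Q) U (delta x)))"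
proof -
  have "proj (widx N Q) U F = proj (widx N Q) U (\<Sum>x\<in>widx N Q. fscale (F x) (delta x))"
    using fun_on_expand[OF finite_widx[OF Q]] assms by (simp add: wfun_def)
  also have "\<dots> = (\<Sum>x\<in>widx N Q. fscale (F x) (proj (widx N Q) U (delta x)))"
    using U finite_widx[OF Q]
    by (intro proj_sum) (auto simp: einvariant_def wfun_def delta_in_fun_on)
  finally show ?thesis .
qed

text \<open>The entry at \<open>(x, y)\<close> is the coefficient at \<open>x\<close> of the
  projection of the basis vector \<open>y\<close>; the claim is that the projection commutes with
  the matrix units, written in entries.\<close>

lemma proj_kernel_invariant:
  "invariant_kernel N Q (\<lambda>(x, y). if x \<in> widx N Q \<and> y \<in> widx N Q then proj (widx N Q) U (delta y) x else 0)"
  (is "invariant_kernel N Q ?K")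
  unfolding invariant_kernel_def
proof (intro allI impI ballI)
  fix r s x y assume rs: "r < N" "s < N" and x: "x \<in> widx N Q" and y: "y \<in> widx N Q"
  let ?p = "\<lambda>y. proj (widx N Q) U (delta y)"
  have dy: "delta y \<in> wfun N Q" using y by (simp add: wfun_def delta_in_fun_on)
  have px: "?p y \<in> fun_on (widx N Q)"
    using proj(1)[OF finite_widx[OF Q]] U dy by (auto simp: einvariant_def wfun_def)
  have "(\<lambda>x. ?K (x, y)) = ?p y"
    using px y by (auto simp: fun_on_def fun_eq_iff)
  then have "ract (emat N r s) (\<lambda>x. ?K (x, y)) x = eact N Q r s (?p y) x"
    using x by (simp add: eact_def)
  also have "\<dots> = proj (widx N Q) U (eact N Q r s (delta y)) x"
    by (simp add: proj_eact rs dy)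
  also have "\<dots> = (\<Sum>z\<in>widx N Q. eact N Q r s (delta y) z * ?p z x)"
    by (subst proj_expand) (simp_all add: sum_fun_apply)
  also have "\<dots> = (\<Sum>z\<in>widx N Q. ract (emat N r s) (delta y) z * ?K (x, z))"
    using x by (intro sum.cong refl) (simp add: eact_def)
  also have "\<dots> = (\<Sum>z\<in>widx N Q. delta y z * ract (emat N s r) (\<lambda>y. ?K (x, y)) z)"
    by (rule ract_adjoint[OF Q rs])
  also have "\<dots> = ract (emat N s r) (\<lambda>y. ?K (x, y)) y"
    using y finite_widx[OF Q] by (simp add: delta_def of_bool_def if_distrib[of "\<lambda>c. c * _"] cong: if_cong)
  finally show "ract (emat N r s) (\<lambda>x. ?K (x, y)) x = ract (emat N s r) (\<lambda>y. ?K (x, y)) y" .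
qed

end

text \<open>Attach to each member \<open>U\<close> of the chain the space of equivariant
  endomorphisms with image in \<open>U\<close>. Restriction of their kernels to small letters is
  injective, so these spaces form a chain inside a space of fixed finite dimension. A proper
  inclusion stays proper, since the projection onto the larger member belongs to the larger space of
  endomorphisms only.\<close>

theorem einvariant_chain_bound:
  assumes Q: "finite (Q :: ('c \<times> bool list list) set)"
  shows "\<exists>c. \<forall>N k Y. (\<forall>i\<le>k. einvariant N Q (Y i)) \<longrightarrow> (\<forall>i<k. Y i \<subseteq> Y (Suc i)) \<longrightarrow>
    card {i. i < k \<and> Y i \<noteq> Y (Suc i)} \<le> c"
proof -
  obtain L where L: "\<And>N K. invariant_kernel N Q K \<Longrightarrow>
     (\<And>x y. x \<in> widx N Q \<inter> widx L Q \<Longrightarrow> y \<in> widx N Q \<inter> widx L Q \<Longrightarrow> K (x, y) = 0) \<Longrightarrow>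
     x \<in> widx N Q \<Longrightarrow> y \<in> widx N Q \<Longrightarrow> K (x, y) = 0" for x y
    using kernel_zero[OF Q] by metis
  let ?S = "widx L Q \<times> widx L Q"
  have finS: "finite ?S" using finite_widx[OF Q] by blast
  show ?thesis
  \<comment> \<open>The bound counts pairs of indices with letters below \<open>L\<close>; neither
    \<open>N\<close> nor the chain enters.\<close>
  proof (intro exI[of _ "card (delta ` ?S)"] allI impI)
    fix N k and Y :: "nat \<Rightarrow> ('c \<times> letter list list \<Rightarrow> complex) set"
    assume inv: "\<forall>i\<le>k. einvariant N Q (Y i)" and mono: "\<forall>i<k. Y i \<subseteq> Y (Suc i)"
    let ?I = "widx N Q"
    note finI = finite_widx[OF Q, of N]
    \<comment> \<open>Kernels of equivariant endomorphisms with image in \<open>U\<close>, extended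
      by 0 so that \<open>K = 0\<close> can be tested at indices.\<close>
    define \<K> where "\<K> U = {K. invariant_kernel N Q K \<and> (\<forall>z. z \<notin> ?I \<times> ?I \<longrightarrow> K z = 0) \<and> (\<forall>y\<in>?I. (\<lambda>x. K (x, y)) \<in> U)}"
      for U
    define res where "res K = (\<lambda>z. if z \<in> ?S then K z else 0)"
      for K :: "('c \<times> letter list list) \<times> ('c \<times> letter list list) \<Rightarrow> complex"
    have res_lin: "res (K + K') = res K + res K'" "res (fscale c K) = fscale c (res K)" for K K' c
      by (auto simp: res_def fun_eq_iff)
    have ract_lin: "ract (emat N r s) (\<lambda>x. F x + F' x) x = ract (emat N r s) F x + ract (emat N r s) F' x"
      "ract (emat N r s) (\<lambda>x. c * F x) x = c * ract (emat N r s) F x"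
      "ract (emat N r s) (\<lambda>x. 0) x = 0"
      if "r < N" "s < N" "x \<in> ?I" for r s x c and F F' :: "'c \<times> letter list list \<Rightarrow> complex"
      using that by (simp_all add: ract_emat sum.distrib sum_distrib_left algebra_simps)
    have inv_sub: "cfun.subspace {K. invariant_kernel N Q K}"
      unfolding cfun.subspace_def invariant_kernel_def by (simp add: ract_lin)
    have K_sub: "cfun.subspace (\<K> U)" if "cfun.subspace U" for U
    proof (rule cfun.subspaceI)
      show "0 \<in> \<K> U"
        using cfun.subspace_0[OF inv_sub] cfun.subspace_0[OF that] by (simp add: \<K>_def zero_fun_def)
    next
      fix K K' assume K: "K \<in> \<K> U" "K' \<in> \<K> U"
      have "(\<lambda>x. (K + K') (x, y)) = (\<lambda>x. K (x, y)) + (\<lambda>x. K' (x, y))" for y by (simp add: plus_fun_def)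
      then show "K + K' \<in> \<K> U"
        using K cfun.subspace_add[OF inv_sub, of K K'] cfun.subspace_add[OF that] unfolding \<K>_def
        by (simp only: mem_Collect_eq) simp
    next
      fix K c assume K: "K \<in> \<K> U"
      then show "fscale c K \<in> \<K> U"
        using cfun.subspace_scale[OF inv_sub, of K c] cfun.subspace_scale[OF that, of _ c] unfolding \<K>_def
        by (simp only: mem_Collect_eq) simp
    qed
    have inj: "K = 0" if "K \<in> \<K> U" "res K = 0" for K U
    proof
      fix z show "K z = 0 z"
      proof (cases "z \<in> ?I \<times> ?I")
        case True
        have z: "K (x, y) = 0" if "x \<in> ?I \<inter> widx L Q" "y \<in> ?I \<inter> widx L Q" for x y
          using that fun_cong[OF \<open>res K = 0\<close>, of "(x, y)"] by (simp add: res_def)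
        have "invariant_kernel N Q K" using that by (simp add: \<K>_def)
        from L[OF this z] have "K (fst z, snd z) = 0" using True by auto
        then show ?thesis by simp
      next
        case False
        then show ?thesis using that unfolding \<K>_def zero_fun_def by blast
      qed
    qed
    let ?Z = "\<lambda>i. res ` \<K> (Y i)"
    have "card {i. i < k \<and> ?Z i \<noteq> ?Z (Suc i)} \<le> card (delta ` ?S)"
    proof (rule subspace_chain_bound)
      fix i assume "i \<le> k"
      then have "cfun.subspace (\<K> (Y i))" using inv K_sub by (auto simp: einvariant_def)
      then show "cfun.subspace (?Z i)"
        unfolding cfun.subspace_def
        by (auto simp flip: res_lin) (auto simp: res_def fun_eq_iff image_iff intro!: bexI[of _ 0])
    next
      fix i assume "i < k"
      then have "\<K> (Y i) \<subseteq> \<K> (Y (Suc i))" using mono unfolding \<K>_def by blast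
      then show "?Z i \<subseteq> ?Z (Suc i)" by (rule image_mono)
    next
      show "?Z k \<subseteq> cfun.span (delta ` ?S)"
        using fun_on_subset_span[OF finS] by (auto simp: res_def fun_on_def)
    qed (use finS in simp)
    \<comment> \<open>If the restricted spaces agreed, injectivity would identify the projection
      onto the larger member with a kernel whose columns lie in the smaller one; but its columns
      span the larger member.\<close>
    moreover have "?Z i \<noteq> ?Z (Suc i)" if i: "i < k" "Y i \<noteq> Y (Suc i)" for i
    proof
      assume eq: "?Z i = ?Z (Suc i)"
      let ?K = "\<lambda>(x, y). if x \<in> ?I \<and> y \<in> ?I then proj ?I (Y (Suc i)) (delta y) x else 0"
      have e: "einvariant N Q (Y (Suc i))" "einvariant N Q (Y i)" using inv i by auto
      have col: "(\<lambda>x. ?K (x, y)) = proj ?I (Y (Suc i)) (delta y)" "(\<lambda>x. ?K (x, y)) \<in> Y (Suc i)"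
        if "y \<in> ?I" for y
      proof -
        have p: "proj ?I (Y (Suc i)) (delta y) \<in> Y (Suc i)"
          using proj(1)[OF finI] e that by (auto simp: einvariant_def wfun_def delta_in_fun_on)
        then have "proj ?I (Y (Suc i)) (delta y) \<in> fun_on ?I" using e by (auto simp: einvariant_def wfun_def)
        then show "(\<lambda>x. ?K (x, y)) = proj ?I (Y (Suc i)) (delta y)"
          using that by (auto simp: fun_on_def fun_eq_iff)
        with p show "(\<lambda>x. ?K (x, y)) \<in> Y (Suc i)" by simp
      qed
      define K where "K = ?K"
      have K: "K \<in> \<K> (Y (Suc i))"
        using proj_kernel_invariant[OF Q e(1)] col(2) unfolding \<K>_def K_def by (simp only: mem_Collect_eq) simp
      then have "res K \<in> ?Z i" unfolding eq by (rule imageI)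
      then obtain K' where K': "res K = res K'" "K' \<in> \<K> (Y i)" by (rule imageE)
      have "K' \<in> \<K> (Y (Suc i))" using K'(2) mono i unfolding \<K>_def by blast
      then have "K - K' \<in> \<K> (Y (Suc i))"
        using K cfun.subspace_diff[OF K_sub] e(1) unfolding einvariant_def by blast
      moreover have "res (K - K') = 0"
      proof
        fix z show "res (K - K') z = 0 z"
          using fun_cong[OF K'(1), of z] by (simp add: res_def split: if_splits)
      qed
      ultimately have "K - K' = 0" by (rule inj)
      then have "K = K'" by simp
      then have colY: "proj ?I (Y (Suc i)) (delta y) \<in> Y i" if "y \<in> ?I" for y
      proof -
        have "(\<lambda>x. K' (x, y)) = proj ?I (Y (Suc i)) (delta y)"
          using col(1)[OF that] unfolding \<open>K = K'\<close>[symmetric] K_def .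
        moreover have "(\<lambda>x. K' (x, y)) \<in> Y i" using K'(2) that unfolding \<K>_def by blast
        ultimately show ?thesis by simp
      qed
      have "Y (Suc i) \<subseteq> Y i"
      proof
        fix F assume F: "F \<in> Y (Suc i)"
        then have Fw: "F \<in> wfun N Q" using e by (auto simp: einvariant_def)
        have "F = proj ?I (Y (Suc i)) F"
          using proj_ident[OF finI] e F by (simp add: einvariant_def wfun_def)
        also have "\<dots> = (\<Sum>x\<in>?I. fscale (F x) (proj ?I (Y (Suc i)) (delta x)))"
          by (rule proj_expand[OF Q e(1) Fw])
        also have "\<dots> \<in> Y i"
          using e(2) colY by (intro cfun.subspace_sum cfun.subspace_scale) (auto simp: einvariant_def)
        finally show "F \<in> Y i" .
      qed
      then show False using mono i by blast
    qed
    then have "{i. i < k \<and> Y i \<noteq> Y (Suc i)} \<subseteq> {i. i < k \<and> ?Z i \<noteq> ?Z (Suc i)}" by blast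
    then have "card {i. i < k \<and> Y i \<noteq> Y (Suc i)} \<le> card {i. i < k \<and> ?Z i \<noteq> ?Z (Suc i)}"
      by (intro card_mono) auto
    ultimately show "card {i. i < k \<and> Y i \<noteq> Y (Suc i)} \<le> card (delta ` ?S)" by linarith
  qed
qed

section \<open>Enveloping algebras\<close>

lemma finite_support_sum:
  "finite {w. f w \<noteq> 0} \<Longrightarrow> finite {w. g w \<noteq> 0} \<Longrightarrow> finite {w. f w + (g w :: complex) \<noteq> 0}"
  by (rule finite_subset[of _ "{w. f w \<noteq> 0} \<union> {w. g w \<noteq> 0}"]) auto

definition conv :: "free_elem \<Rightarrow> free_elem \<Rightarrow> free_elem" where
  "conv f g = (\<lambda>w. \<Sum>k\<le>length w. f (take k w) * g (drop k w))"

text \<open>Both sides sum over the ways to cut \<open>w\<close> into three consecutive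
  pieces.\<close>

lemma conv_assoc: "conv (conv f g) h = conv f (conv g h)"
proof
  fix w :: "cmat list"
  define F where "F i j = f (take i w) * g (take j (drop i w)) * h (drop (i + j) w)" for i j
  let ?n = "length w"
  have "conv (conv f g) h w = (\<Sum>k\<le>?n. \<Sum>i\<le>k. F i (k - i))"
    unfolding conv_def sum_distrib_right F_def
    by (intro sum.cong refl) (auto simp: drop_take min_def intro!: sum.cong)
  also have "\<dots> = (\<Sum>(i, j)\<in>{(i, j). i + j \<le> ?n}. F i j)"
    by (rule sum.triangle_reindex_eq[symmetric])
  also have "{(i, j). i + j \<le> ?n} = (SIGMA i:{..?n}. {..?n - i})" by auto
  also have "(\<Sum>(i, j)\<in>\<dots>. F i j) = (\<Sum>i\<le>?n. \<Sum>j\<le>?n - i. F i j)"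
    by (rule sum.Sigma[symmetric]) auto
  also have "\<dots> = conv f (conv g h) w"
    unfolding conv_def sum_distrib_left F_def
    by (intro sum.cong refl) (auto simp: mult.assoc add.commute intro!: sum.cong)
  finally show "conv (conv f g) h w = conv f (conv g h) w" .
qed

lemma conv_add: "conv (f + f') g = conv f g + conv f' g" "conv g (f + f') = conv g f + conv g f'"
  by (simp_all add: conv_def fun_eq_iff sum.distrib algebra_simps)

lemma conv_word: "conv (word u) (word v) = word (u @ v)"
proof
  fix w
  have "(\<Sum>k\<le>length w. of_bool (take k w = u) * of_bool (drop k w = v) :: complex)
      = (\<Sum>k\<le>length w. if k = length u then of_bool (w = u @ v) else 0)"
  proof (rule sum.cong[OF refl])
    fix k assume "k \<in> {..length w}"
    then have "take k w = u \<and> drop k w = v \<longleftrightarrow> k = length u \<and> w = u @ v"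
      by (metis append_eq_conv_conj append_take_drop_id atMost_iff length_take min.absorb2)
    then show "of_bool (take k w = u) * of_bool (drop k w = v) = (if k = length u then of_bool (w = u @ v) else (0::complex))"
      by auto
  qed
  then show "conv (word u) (word v) w = word (u @ v) w"
    by (auto simp: conv_def word_def)
qed

lemma conv_scale: "conv (fscale c f) g = fscale c (conv f g)" "conv f (fscale c g) = fscale c (conv f g)"
  by (simp_all add: conv_def fun_eq_iff sum_distrib_left mult.left_commute mult.assoc)

lemma conv_one: "conv (word []) f = f" "conv f (word []) = f"
proof -
  have "(\<Sum>k\<le>length w. of_bool (take k w = []) * f (drop k w)) = (\<Sum>k\<le>length w. if k = 0 then f w else 0)" for w
    by (rule sum.cong) (auto simp: take_eq_Nil)
  then show "conv (word []) f = f" by (auto simp: conv_def word_def fun_eq_iff)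
  have "(\<Sum>k\<le>length w. f (take k w) * of_bool (drop k w = [])) = (\<Sum>k\<le>length w. if k = length w then f w else 0)" for w
    by (rule sum.cong) auto
  then show "conv f (word []) = f" by (auto simp: conv_def word_def fun_eq_iff)
qed

lemma free_alg_simps:
  "carrier (free_alg L) = {f. finite {w. f w \<noteq> 0} \<and> (\<forall>w. f w \<noteq> 0 \<longrightarrow> set w \<subseteq> L)}"
  "monoid.mult (free_alg L) = conv" "one (free_alg L) = word []" "zero (free_alg L) = 0" "add (free_alg L) = (+)"
  by (simp_all add: free_alg_def conv_def word_def fun_eq_iff)

lemma conv_closed:
  assumes "f \<in> carrier (free_alg L)" "g \<in> carrier (free_alg L)"
  shows "conv f g \<in> carrier (free_alg L)"
proof -
  have nz: "\<exists>u v. w = u @ v \<and> f u \<noteq> 0 \<and> g v \<noteq> 0" if nz: "conv f g w \<noteq> 0" for w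
  proof -
    have "\<exists>k. f (take k w) * g (drop k w) \<noteq> 0"
      using nz unfolding conv_def by (metis (no_types, lifting) sum.neutral)
    then show ?thesis by (metis append_take_drop_id mult_eq_0_iff)
  qed
  then have "{w. conv f g w \<noteq> 0} \<subseteq> (\<lambda>(u, v). u @ v) ` ({w. f w \<noteq> 0} \<times> {w. g w \<noteq> 0})" by force
  then have "finite {w. conv f g w \<noteq> 0}"
    using assms by (auto simp: free_alg_simps intro: finite_subset)
  moreover have "set w \<subseteq> L" if "conv f g w \<noteq> 0" for w
  proof -
    obtain u v where "w = u @ v" "f u \<noteq> 0" "g v \<noteq> 0" using nz[OF \<open>conv f g w \<noteq> 0\<close>] by blast
    then show ?thesis using assms by (simp add: free_alg_simps)
  qed
  ultimately show ?thesis by (simp add: free_alg_simps)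
qed

lemma free_alg_subspace: "cfun.subspace (carrier (free_alg L))"
proof (rule cfun.subspaceI)
  fix f g assume fg: "f \<in> carrier (free_alg L)" "g \<in> carrier (free_alg L)"
  have "set w \<subseteq> L" if "f w + g w \<noteq> 0" for w
  proof -
    have "f w \<noteq> 0 \<or> g w \<noteq> 0" using that by auto
    then show ?thesis using fg unfolding free_alg_simps by blast
  qed
  then show "f + g \<in> carrier (free_alg L)" using fg by (simp add: free_alg_simps finite_support_sum)
qed (simp_all add: free_alg_simps)

lemma free_alg_ring: "ring (free_alg L)"
proof (rule ringI)
  note sub = free_alg_subspace[of L]
  show "abelian_group (free_alg L)"
  proof (rule abelian_groupI)
    fix f assume f: "f \<in> carrier (free_alg L)"
    then have "- f \<in> carrier (free_alg L)" by (rule cfun.subspace_neg[OF sub])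
    then show "\<exists>g\<in>carrier (free_alg L). g \<oplus>\<^bsub>free_alg L\<^esub> f = \<zero>\<^bsub>free_alg L\<^esub>"
      by (intro bexI[of _ "- f"]) (auto simp: free_alg_simps)
  qed (use cfun.subspace_add[OF sub] cfun.subspace_0[OF sub] in \<open>auto simp: free_alg_simps(4,5) add.assoc add.commute\<close>)
  show "monoid (free_alg L)"
    by (rule monoidI) (use conv_closed in \<open>auto simp: free_alg_simps(2,3) conv_assoc conv_one\<close>, simp add: free_alg_simps word_def)
qed (simp_all add: free_alg_simps conv_add)

lemma word_closed [simp]: "word w \<in> carrier (free_alg L) \<longleftrightarrow> set w \<subseteq> L"
  by (auto simp: free_alg_simps word_def)

text \<open>The relations regrouped as differences \<open>f - g\<close>, the form in which
  \<open>env_class_eq\<close> identifies the classes of \<open>f\<close> and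
  \<open>g\<close>.\<close>

lemma env_relI:
  assumes "x \<in> L" "y \<in> L"
  shows "word [x + y] - (word [x] + word [y]) \<in> env_rel L"
    and "word [fscale c x] - fscale c (word [x]) \<in> env_rel L"
    and "word [x, y] - (word [lbr x y] + word [y, x]) \<in> env_rel L"
proof -
  have "word [x, y] - (word [lbr x y] + word [y, x]) = word [x, y] - word [y, x] - word [lbr x y]"
    by (simp add: algebra_simps)
  then show "word [x, y] - (word [lbr x y] + word [y, x]) \<in> env_rel L"
    using assms unfolding env_rel_def by blast
  show "word [x + y] - (word [x] + word [y]) \<in> env_rel L"
    using assms unfolding env_rel_def diff_diff_add[symmetric] by blast
  show "word [fscale c x] - fscale c (word [x]) \<in> env_rel L"
    using assms unfolding env_rel_def by blast
qed

locale lie_closed =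
  fixes L :: "cmat set"
  assumes subspace: "cfun.subspace L" and lbr_closed: "x \<in> L \<Longrightarrow> y \<in> L \<Longrightarrow> lbr x y \<in> L"
begin

lemma env_rel_closed: "env_rel L \<subseteq> carrier (free_alg L)"
proof -
  note sub = free_alg_subspace[of L]
  show ?thesis
    unfolding env_rel_def
    using cfun.subspace_add[OF subspace] cfun.subspace_scale[OF subspace] lbr_closed
    by (auto intro!: cfun.subspace_diff[OF sub] cfun.subspace_scale[OF sub])
qed

lemma env_ideal: "ideal (env_ideal L) (free_alg L)"
  unfolding env_ideal_def using ring.genideal_ideal[OF free_alg_ring env_rel_closed] .

lemma env_ring: "ring (env_alg L)"
  unfolding env_alg_def by (rule ideal.quotient_is_ring[OF env_ideal])

lemma env_class_hom: "env_class L \<in> ring_hom (free_alg L) (env_alg L)"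
  using ideal.rcos_ring_hom[OF env_ideal] unfolding env_alg_def env_class_def .

lemma env_class_closed: "f \<in> carrier (free_alg L) \<Longrightarrow> env_class L f \<in> carrier (env_alg L)"
  by (rule ring_hom_closed[OF env_class_hom])

lemma env_class_mult:
  "f \<in> carrier (free_alg L) \<Longrightarrow> g \<in> carrier (free_alg L) \<Longrightarrow>
   env_class L (conv f g) = env_class L f \<otimes>\<^bsub>env_alg L\<^esub> env_class L g"
  using ring_hom_mult[OF env_class_hom] by (simp add: free_alg_simps(2))

lemma env_class_add:
  "f \<in> carrier (free_alg L) \<Longrightarrow> g \<in> carrier (free_alg L) \<Longrightarrow>
   env_class L (f + g) = env_class L f \<oplus>\<^bsub>env_alg L\<^esub> env_class L g"
  using ring_hom_add[OF env_class_hom] by (simp add: free_alg_simps(5))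

lemma env_class_one: "env_class L (word []) = \<one>\<^bsub>env_alg L\<^esub>"
  using ring_hom_one[OF env_class_hom] by (simp add: free_alg_simps(3))

lemma env_carrier: "carrier (env_alg L) = env_class L ` carrier (free_alg L)"
  unfolding env_alg_def env_class_def FactRing_def A_RCOSETS_def' by auto

lemma env_class_eq:
  assumes "f \<in> carrier (free_alg L)" "g \<in> carrier (free_alg L)" "f - g \<in> env_rel L"
  shows "env_class L f = env_class L g"
proof -
  have "f - g \<in> env_ideal L"
    unfolding env_ideal_def using ring.genideal_self[OF free_alg_ring env_rel_closed] assms(3) by blast
  then have "(f - g) + g \<in> env_class L g"
    unfolding env_class_def a_r_coset_def' free_alg_simps by blast
  then have "f \<in> env_class L g" by simp
  then have m: "f \<in> env_ideal L +>\<^bsub>free_alg L\<^esub> g" by (simp add: env_class_def)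
  interpret ideal "env_ideal L" "free_alg L" by (rule env_ideal)
  show ?thesis
    unfolding env_class_def by (rule a_repr_independence'[OF m assms(2), symmetric])
qed

lemma env_class_rel:
  assumes "x \<in> L" "y \<in> L"
  shows "env_class L (word [x + y]) = env_class L (word [x]) \<oplus>\<^bsub>env_alg L\<^esub> env_class L (word [y])"
    and "env_class L (word [fscale c x]) = env_class L (fscale c (word [])) \<otimes>\<^bsub>env_alg L\<^esub> env_class L (word [x])"
    and "env_class L (word [lbr x y]) \<oplus>\<^bsub>env_alg L\<^esub> env_class L (word [y]) \<otimes>\<^bsub>env_alg L\<^esub> env_class L (word [x])
      = env_class L (word [x]) \<otimes>\<^bsub>env_alg L\<^esub> env_class L (word [y])"
proof -
  note sub = free_alg_subspace[of L] and cl = cfun.subspace_add[OF subspace] cfun.subspace_scale[OF subspace] lbr_closed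
  have "env_class L (word [x + y]) = env_class L (word [x] + word [y])"
    using assms cl by (intro env_class_eq cfun.subspace_add[OF sub] env_relI) auto
  then show "env_class L (word [x + y]) = env_class L (word [x]) \<oplus>\<^bsub>env_alg L\<^esub> env_class L (word [y])"
    using assms by (simp add: env_class_add)
  have "env_class L (word [fscale c x]) = env_class L (fscale c (word [x]))"
    using assms cl by (intro env_class_eq cfun.subspace_scale[OF sub] env_relI) auto
  also have "fscale c (word [x]) = conv (fscale c (word [])) (word [x])" by (simp add: conv_scale conv_one)
  also have "env_class L \<dots> = env_class L (fscale c (word [])) \<otimes>\<^bsub>env_alg L\<^esub> env_class L (word [x])"
    using assms by (intro env_class_mult cfun.subspace_scale[OF sub]) auto
  finally show "env_class L (word [fscale c x]) = env_class L (fscale c (word [])) \<otimes>\<^bsub>env_alg L\<^esub> env_class L (word [x])" .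
  have "env_class L (word [x, y]) = env_class L (word [lbr x y] + word [y, x])"
    using assms cl by (intro env_class_eq cfun.subspace_add[OF sub] env_relI) auto
  then show "env_class L (word [lbr x y]) \<oplus>\<^bsub>env_alg L\<^esub> env_class L (word [y]) \<otimes>\<^bsub>env_alg L\<^esub> env_class L (word [x])
      = env_class L (word [x]) \<otimes>\<^bsub>env_alg L\<^esub> env_class L (word [y])"
    using assms cl by (simp add: env_class_add env_class_mult[symmetric] conv_word)
qed

text \<open>Scalars enter the tensor relations as left factors, the classes of multiples of the
  empty word. They must be moved past a generator when the generator acts from the left.\<close>

lemma env_scalar_commute:
  assumes "x \<in> L" "u \<in> carrier (env_alg L)"
  shows "env_class L (word [x]) \<otimes>\<^bsub>env_alg L\<^esub> (env_class L (fscale c (word [])) \<otimes>\<^bsub>env_alg L\<^esub> u)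
       = env_class L (fscale c (word [])) \<otimes>\<^bsub>env_alg L\<^esub> (env_class L (word [x]) \<otimes>\<^bsub>env_alg L\<^esub> u)"
proof -
  interpret ring "env_alg L" by (rule env_ring)
  have c: "fscale c (word []) \<in> carrier (free_alg L)"
    by (intro cfun.subspace_scale[OF free_alg_subspace]) simp
  have "env_class L (word [x]) \<otimes>\<^bsub>env_alg L\<^esub> env_class L (fscale c (word []))
      = env_class L (fscale c (word [])) \<otimes>\<^bsub>env_alg L\<^esub> env_class L (word [x])"
    using assms c by (simp add: env_class_mult[symmetric] conv_scale conv_one)
  then show ?thesis
    using assms c env_class_closed by (simp add: m_assoc[symmetric])
qed

end

section \<open>Representations on spaces of functions\<close>

locale lie_rep =
  fixes g :: "cmat set" and M :: "('i \<Rightarrow> complex) set" and act :: "cmat \<Rightarrow> ('i \<Rightarrow> complex) \<Rightarrow> 'i \<Rightarrow> complex"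
  assumes subspace_rep: "cfun.subspace M"
    and act_closed: "\<lbrakk>x \<in> g; v \<in> M\<rbrakk> \<Longrightarrow> act x v \<in> M"
    and act_add: "\<lbrakk>x \<in> g; v \<in> M; w \<in> M\<rbrakk> \<Longrightarrow> act x (v + w) = act x v + act x w"
    and act_scale: "\<lbrakk>x \<in> g; v \<in> M\<rbrakk> \<Longrightarrow> act x (fscale c v) = fscale c (act x v)"
    and act_plus: "\<lbrakk>x \<in> g; y \<in> g; v \<in> M\<rbrakk> \<Longrightarrow> act (x + y) v = act x v + act y v"
    and act_smult: "\<lbrakk>x \<in> g; v \<in> M\<rbrakk> \<Longrightarrow> act (fscale c x) v = fscale c (act x v)"
    and act_lbr: "\<lbrakk>x \<in> g; y \<in> g; v \<in> M\<rbrakk> \<Longrightarrow> act (lbr x y) v = act x (act y v) - act y (act x v)"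

text \<open>\<open>\<iota>\<close> realises the module \<open>V\<close> on a space of functions, where linear algebra is available.\<close>

locale lmod_model = lie_rep g M act
  for g and M :: "('i \<Rightarrow> complex) set" and act +
  fixes V :: "(cmat, 'v) lmod" and \<iota> :: "'v \<Rightarrow> 'i \<Rightarrow> complex"
  assumes bij: "bij_betw \<iota> (carrier V) M"
    and add_closed: "\<lbrakk>v \<in> carrier V; w \<in> carrier V\<rbrakk> \<Longrightarrow> v \<oplus>\<^bsub>V\<^esub> w \<in> carrier V"
    and \<iota>_add: "\<lbrakk>v \<in> carrier V; w \<in> carrier V\<rbrakk> \<Longrightarrow> \<iota> (v \<oplus>\<^bsub>V\<^esub> w) = \<iota> v + \<iota> w"
    and smult_closed: "v \<in> carrier V \<Longrightarrow> c \<odot>\<^bsub>V\<^esub> v \<in> carrier V"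
    and \<iota>_smult: "v \<in> carrier V \<Longrightarrow> \<iota> (c \<odot>\<^bsub>V\<^esub> v) = fscale c (\<iota> v)"
    and zero_closed: "\<zero>\<^bsub>V\<^esub> \<in> carrier V" and \<iota>_zero: "\<iota> \<zero>\<^bsub>V\<^esub> = 0"
    and lact_closed: "\<lbrakk>x \<in> g; v \<in> carrier V\<rbrakk> \<Longrightarrow> lact V x v \<in> carrier V"
    and \<iota>_lact: "\<lbrakk>x \<in> g; v \<in> carrier V\<rbrakk> \<Longrightarrow> \<iota> (lact V x v) = act x (\<iota> v)"
begin

lemma \<iota>_eq_iff: "v \<in> carrier V \<Longrightarrow> w \<in> carrier V \<Longrightarrow> \<iota> v = \<iota> w \<longleftrightarrow> v = w"
  using bij by (auto simp: bij_betw_def inj_on_eq_iff)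

lemma \<iota>_eqI: "v \<in> carrier V \<Longrightarrow> w \<in> carrier V \<Longrightarrow> \<iota> v = \<iota> w \<Longrightarrow> v = w"
  using \<iota>_eq_iff by blast

lemma \<iota>_in: "v \<in> carrier V \<Longrightarrow> \<iota> v \<in> M"
  using bij by (auto simp: bij_betw_def)

lemma abelian_group: "abelian_group V"
proof (rule abelian_groupI)
  fix v assume v: "v \<in> carrier V"
  have "\<iota> ((-1) \<odot>\<^bsub>V\<^esub> v \<oplus>\<^bsub>V\<^esub> v) = 0" using v by (simp add: \<iota>_add \<iota>_smult smult_closed fun_eq_iff)
  then have "(-1) \<odot>\<^bsub>V\<^esub> v \<oplus>\<^bsub>V\<^esub> v = \<zero>\<^bsub>V\<^esub>"
    using v \<iota>_eq_iff[of "(-1) \<odot>\<^bsub>V\<^esub> v \<oplus>\<^bsub>V\<^esub> v" "\<zero>\<^bsub>V\<^esub>"] by (simp add: add_closed smult_closed zero_closed \<iota>_zero)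
  then show "\<exists>w\<in>carrier V. w \<oplus>\<^bsub>V\<^esub> v = \<zero>\<^bsub>V\<^esub>" using v smult_closed by blast
next
  fix v w z assume "v \<in> carrier V" "w \<in> carrier V" "z \<in> carrier V"
  then show "v \<oplus>\<^bsub>V\<^esub> w \<oplus>\<^bsub>V\<^esub> z = v \<oplus>\<^bsub>V\<^esub> (w \<oplus>\<^bsub>V\<^esub> z)"
    by (intro \<iota>_eqI) (simp_all add: add_closed \<iota>_add add.assoc)
next
  fix v w assume "v \<in> carrier V" "w \<in> carrier V"
  then show "v \<oplus>\<^bsub>V\<^esub> w = w \<oplus>\<^bsub>V\<^esub> v"
    by (intro \<iota>_eqI) (simp_all add: add_closed \<iota>_add add.commute)
next
  fix v assume "v \<in> carrier V"
  then show "\<zero>\<^bsub>V\<^esub> \<oplus>\<^bsub>V\<^esub> v = v"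
    by (intro \<iota>_eqI) (simp_all add: add_closed \<iota>_add zero_closed \<iota>_zero)
qed (use add_closed zero_closed in auto)

lemma module: "module CC V"
proof (rule moduleI)
  show "cring CC" by (rule cring_from_type_algebra)
  fix a b :: complex and v w assume vw: "v \<in> carrier V" "w \<in> carrier V"
  note [simp] = vw add_closed smult_closed \<iota>_add \<iota>_smult
  have CC: "a \<oplus>\<^bsub>CC\<^esub> b = a + b" "a \<otimes>\<^bsub>CC\<^esub> b = a * b" "\<one>\<^bsub>CC\<^esub> = 1" by (simp_all add: ring_of_type_algebra_def)
  show "(a \<oplus>\<^bsub>CC\<^esub> b) \<odot>\<^bsub>V\<^esub> v = a \<odot>\<^bsub>V\<^esub> v \<oplus>\<^bsub>V\<^esub> b \<odot>\<^bsub>V\<^esub> v"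
    unfolding CC by (rule \<iota>_eqI) (simp_all, rule ext, simp add: distrib_right)
  show "a \<odot>\<^bsub>V\<^esub> (v \<oplus>\<^bsub>V\<^esub> w) = a \<odot>\<^bsub>V\<^esub> v \<oplus>\<^bsub>V\<^esub> a \<odot>\<^bsub>V\<^esub> w"
    by (rule \<iota>_eqI) (simp_all, rule ext, simp add: distrib_left)
  show "(a \<otimes>\<^bsub>CC\<^esub> b) \<odot>\<^bsub>V\<^esub> v = a \<odot>\<^bsub>V\<^esub> (b \<odot>\<^bsub>V\<^esub> v)"
    unfolding CC by (rule \<iota>_eqI) simp_all
  show "\<one>\<^bsub>CC\<^esub> \<odot>\<^bsub>V\<^esub> v = v"
    unfolding CC by (rule \<iota>_eqI) simp_all
qed (use abelian_group smult_closed in auto)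

lemma \<iota>_minus:
  assumes "v \<in> carrier V" "w \<in> carrier V"
  shows "v \<ominus>\<^bsub>V\<^esub> w \<in> carrier V" "\<iota> (v \<ominus>\<^bsub>V\<^esub> w) = \<iota> v - \<iota> w"
proof -
  interpret abelian_group V by (rule abelian_group)
  show c: "v \<ominus>\<^bsub>V\<^esub> w \<in> carrier V" using assms by simp
  have "\<iota> v = \<iota> ((v \<ominus>\<^bsub>V\<^esub> w) \<oplus>\<^bsub>V\<^esub> w)" using assms by (simp add: a_minus_def a_assoc l_neg)
  also have "\<dots> = \<iota> (v \<ominus>\<^bsub>V\<^esub> w) + \<iota> w" using c assms(2) by (rule \<iota>_add)
  finally show "\<iota> (v \<ominus>\<^bsub>V\<^esub> w) = \<iota> v - \<iota> w" by simp
qed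

lemma lie_module:
  assumes g: "lie_closed g" and m: "m \<subseteq> g"
  shows "lie_module m V"
proof -
  interpret lie_closed g by (rule g)
  have sum: "x + y \<in> g" "fscale c x \<in> g" if "x \<in> g" "y \<in> g" for x y c
    using that subspace by (simp_all add: cfun.subspace_add cfun.subspace_scale)
  have eq: "v = w" if "\<iota> v = \<iota> w" "v \<in> carrier V" "w \<in> carrier V" for v w using that \<iota>_eq_iff by blast
  show ?thesis
    unfolding lie_module_def
  proof (intro conjI ballI allI module)
    fix x v assume x: "x \<in> m" and v: "v \<in> carrier V"
    note x' = subsetD[OF m x]
    show "lact V x v \<in> carrier V" using x' v by (rule lact_closed)
    fix c
    show "lact V x (c \<odot>\<^bsub>V\<^esub> v) = c \<odot>\<^bsub>V\<^esub> lact V x v" "lact V (fscale c x) v = c \<odot>\<^bsub>V\<^esub> lact V x v"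
      using x' v sum by (auto intro!: eq simp: lact_closed smult_closed \<iota>_lact \<iota>_smult act_scale act_smult \<iota>_in)
    fix w assume w: "w \<in> carrier V"
    show "lact V x (v \<oplus>\<^bsub>V\<^esub> w) = lact V x v \<oplus>\<^bsub>V\<^esub> lact V x w"
      using x' v w by (auto intro!: eq simp: lact_closed add_closed \<iota>_lact \<iota>_add act_add \<iota>_in)
  next
    fix x y v assume x: "x \<in> m" and y: "y \<in> m" and v: "v \<in> carrier V"
    note xy = subsetD[OF m x] subsetD[OF m y]
    show "lact V (x + y) v = lact V x v \<oplus>\<^bsub>V\<^esub> lact V y v"
      using xy v sum by (auto intro!: eq simp: lact_closed add_closed \<iota>_lact \<iota>_add act_plus \<iota>_in)
    show "lact V (lbr x y) v = lact V x (lact V y v) \<ominus>\<^bsub>V\<^esub> lact V y (lact V x v)"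
      using xy v by (auto intro!: eq simp: lact_closed lbr_closed \<iota>_minus \<iota>_lact act_lbr \<iota>_in)
  qed
qed

end

lemma fmod_simps [simp]:
  "carrier (fmod U \<rho>) = U" "zero (fmod U \<rho>) = 0" "add (fmod U \<rho>) = (+)" "module.smult (fmod U \<rho>) = fscale"
  "lact (fmod U \<rho>) = \<rho>"
  by (simp_all add: fmod_def)

lemma fmod_module:
  fixes \<rho> :: "cmat \<Rightarrow> ('i \<Rightarrow> complex) \<Rightarrow> 'i \<Rightarrow> complex"
  assumes "cfun.subspace U"
  shows "module CC (fmod U \<rho>)"
proof -
  \<comment> \<open>Over the empty set all conditions on the action are void, and only the vector
    space axioms remain.\<close>
  interpret lmod_model "{}" U undefined "fmod U \<rho>" id
    using assms by unfold_locales (auto simp: cfun.subspace_add cfun.subspace_scale cfun.subspace_0)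
  show ?thesis by (rule module)
qed

lemma submodule_fmod:
  fixes \<rho> :: "cmat \<Rightarrow> ('i \<Rightarrow> complex) \<Rightarrow> 'i \<Rightarrow> complex"
  assumes "cfun.subspace U"
  shows "submodule Z CC (fmod U \<rho>) \<longleftrightarrow> cfun.subspace Z \<and> Z \<subseteq> U"
proof
  interpret module CC "fmod U \<rho>" by (rule fmod_module[OF assms])
  have CC: "carrier CC = UNIV" by (simp add: ring_of_type_algebra_def)
  {
    assume Z: "submodule Z CC (fmod U \<rho>)"
    then obtain z where "z \<in> Z" using submoduleE(2) by blast
    then have "fscale 0 z \<in> Z" using submoduleE(4)[OF Z, of 0 z] CC by simp
    then have "0 \<in> Z" by (simp add: zero_fun_def)
    then show "cfun.subspace Z \<and> Z \<subseteq> U"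
      using submoduleE(1,4,5)[OF Z] CC by (auto intro!: cfun.subspaceI)
  }
  assume Z: "cfun.subspace Z \<and> Z \<subseteq> U"
  show "submodule Z CC (fmod U \<rho>)"
  proof (rule submoduleI)
    fix a assume a: "a \<in> Z"
    have "\<ominus>\<^bsub>fmod U \<rho>\<^esub> a = - a"
      using a Z by (intro minus_equality) (auto simp: cfun.subspace_neg)
    then show "\<ominus>\<^bsub>fmod U \<rho>\<^esub> a \<in> Z" using a Z by (simp add: cfun.subspace_neg)
  qed (use Z in \<open>auto simp: cfun.subspace_0 cfun.subspace_add cfun.subspace_scale\<close>)
qed

lemma gen_fmod_span:
  fixes \<rho> :: "cmat \<Rightarrow> ('i \<Rightarrow> complex) \<Rightarrow> 'i \<Rightarrow> complex"
  assumes U: "cfun.subspace U" and S: "S \<subseteq> U"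
  shows "gen {} (fmod U \<rho>) S = cfun.span S"
proof -
  have "gen {} (fmod U \<rho>) S = \<Inter>{Z. cfun.subspace Z \<and> Z \<subseteq> U \<and> S \<subseteq> Z}"
    by (simp add: gen_def submod_def submodule_fmod[OF U] conj_assoc)
  also have "\<dots> = cfun.span S"
    using cfun.span_minimal[OF S U] cfun.span_minimal[of S] cfun.subspace_span[of S] cfun.span_superset[of S]
    by blast
  finally show ?thesis .
qed

text \<open>A basis of \<open>K\<close> is extended to the whole function space and then sent to 0.
  The image of a subspace containing \<open>K\<close> is a copy of its quotient by \<open>K\<close>
  that again consists of functions.\<close>

lemma linear_with_kernel:
  fixes K :: "('i \<Rightarrow> complex) set"
  assumes "cfun.subspace K"
  obtains pr :: "('i \<Rightarrow> complex) \<Rightarrow> 'i \<Rightarrow> complex"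
  where "\<And>v w. pr (v + w) = pr v + pr w" "\<And>c v. pr (fscale c v) = fscale c (pr v)" "\<And>v. pr v = 0 \<longleftrightarrow> v \<in> K"
proof -
  interpret P: vector_space_pair fscale fscale by unfold_locales
  obtain B where B: "B \<subseteq> K" "cfun.independent B" "K \<subseteq> cfun.span B" using cfun.basis_exists[of K] by metis
  obtain B' where B': "B \<subseteq> B'" "cfun.independent B'" "UNIV \<subseteq> cfun.span B'"
    using cfun.maximal_independent_subset_extend[of B UNIV] B(2) by auto
  define f where "f b = (if b \<in> B then 0 else b)" for b :: "'i \<Rightarrow> complex"
  define pr where "pr = P.construct B' f"
  have lin: "Vector_Spaces.linear fscale fscale pr"
    unfolding pr_def by (rule P.linear_construct[OF B'(2)])
  have prb: "pr b = f b" if "b \<in> B'" for b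
    unfolding pr_def by (rule P.construct_basis[OF B'(2) that])
  have add: "pr (v + w) = pr v + pr w" and scale: "pr (fscale c v) = fscale c (pr v)" for v w c
    by (rule P.linear_add[OF lin], rule P.linear_scale[OF lin])
  have "pr v = 0 \<longleftrightarrow> v \<in> K" for v
  proof
    have sub: "cfun.subspace {v. pr v = 0}"
      using P.linear_0[OF lin] by (auto intro!: cfun.subspaceI simp: add scale fun_eq_iff)
    show "pr v = 0" if "v \<in> K"
    proof -
      have "cfun.span B \<subseteq> {v. pr v = 0}"
        using B B' prb by (intro cfun.span_minimal sub) (auto simp: f_def)
      then show ?thesis using that B by auto
    qed
    assume v: "pr v = 0"
    \<comment> \<open>The map changes vectors only by elements of \<open>K\<close>, so its kernel is
      not larger than \<open>K\<close>.\<close>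
    have "\<exists>x\<in>K. pr v = v - x" for v
    proof -
      have "cfun.subspace {v. \<exists>x\<in>K. pr v = v - x}"
      proof (rule cfun.subspaceI)
        show "0 \<in> {v. \<exists>x\<in>K. pr v = v - x}"
          using P.linear_0[OF lin] cfun.subspace_0[OF assms] by force
      next
        fix v w assume "v \<in> {v. \<exists>x\<in>K. pr v = v - x}" "w \<in> {v. \<exists>x\<in>K. pr v = v - x}"
        then obtain x y where "x \<in> K" "y \<in> K" "pr v = v - x" "pr w = w - y" by blast
        then show "v + w \<in> {v. \<exists>x\<in>K. pr v = v - x}"
          using assms by (auto intro!: bexI[of _ "x + y"] simp: add cfun.subspace_add)
      next
        fix c v assume "v \<in> {v. \<exists>x\<in>K. pr v = v - x}"
        then obtain x where "x \<in> K" "pr v = v - x" by blast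
        then show "fscale c v \<in> {v. \<exists>x\<in>K. pr v = v - x}"
          using assms by (auto intro!: bexI[of _ "fscale c x"] simp: scale cfun.subspace_scale fun_eq_iff right_diff_distrib)
      qed
      moreover have "B' \<subseteq> {v. \<exists>x\<in>K. pr v = v - x}"
      proof
        fix b assume b: "b \<in> B'"
        then have "pr b = b - (if b \<in> B then b else 0)" by (simp add: prb f_def)
        moreover have "(if b \<in> B then b else 0) \<in> K" using B(1) cfun.subspace_0[OF assms] by auto
        ultimately show "b \<in> {v. \<exists>x\<in>K. pr v = v - x}" by blast
      qed
      ultimately have "cfun.span B' \<subseteq> {v. \<exists>x\<in>K. pr v = v - x}" by (rule cfun.span_minimal[rotated])
      then show ?thesis using B'(3) by auto
    qed
    then obtain x where "x \<in> K" "pr v = v - x" by blast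
    then show "v \<in> K" using v by simp
  qed
  then show ?thesis using that add scale by blast
qed

section \<open>Induced modules\<close>

text \<open>Linear extension of a map of basis elements to finitely supported functions. For left
  multiplication by a generator it is the action in \<open>free_tensor\<close>.\<close>

definition push :: "('a \<Rightarrow> 'a) \<Rightarrow> ('a \<Rightarrow> complex) \<Rightarrow> 'a \<Rightarrow> complex" where
  "push \<phi> F = (\<lambda>q. \<Sum>q' | F q' \<noteq> 0 \<and> \<phi> q' = q. F q')"

definition fin_fun :: "'a set \<Rightarrow> ('a \<Rightarrow> complex) set" where
  "fin_fun A = {F. finite {q. F q \<noteq> 0} \<and> {q. F q \<noteq> 0} \<subseteq> A}"

lemma fin_fun_span: "fin_fun A = cfun.span (delta ` A)"
proof
  show "fin_fun A \<subseteq> cfun.span (delta ` A)"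
  proof
    fix F assume F: "F \<in> fin_fun A"
    then have "F = (\<Sum>q | F q \<noteq> 0. fscale (F q) (delta q))"
      by (intro fun_on_expand) (auto simp: fin_fun_def fun_on_def)
    also have "\<dots> \<in> cfun.span (delta ` A)"
      using F by (intro cfun.span_sum cfun.span_scale cfun.span_base) (auto simp: fin_fun_def)
    finally show "F \<in> cfun.span (delta ` A)" .
  qed
  have "cfun.subspace (fin_fun A)"
  proof (rule cfun.subspaceI)
    fix F G assume FG: "F \<in> fin_fun A" "G \<in> fin_fun A"
    have "{q. (F + G) q \<noteq> 0} \<subseteq> {q. F q \<noteq> 0} \<union> {q. G q \<noteq> 0}" by auto
    then show "F + G \<in> fin_fun A"
      using FG finite_subset unfolding fin_fun_def by blast
  qed (auto simp: fin_fun_def)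
  then show "cfun.span (delta ` A) \<subseteq> fin_fun A"
    by (intro cfun.span_minimal) (auto simp: fin_fun_def delta_def)
qed

lemma push_alt:
  assumes "finite S" "{q. F q \<noteq> 0} \<subseteq> S"
  shows "push \<phi> F q = (\<Sum>q'\<in>S. if \<phi> q' = q then F q' else 0)"
proof -
  have "push \<phi> F q = (\<Sum>q' | q' \<in> S \<and> \<phi> q' = q. F q')"
    unfolding push_def using assms by (intro sum.mono_neutral_left) auto
  also have "\<dots> = (\<Sum>q'\<in>S. if \<phi> q' = q then F q' else 0)"
    using assms(1) by (simp add: sum.inter_filter)
  finally show ?thesis .
qed

lemma push_add:
  assumes "F \<in> fin_fun A" "G \<in> fin_fun A"
  shows "push \<phi> (F + G) = push \<phi> F + push \<phi> G"
proof
  fix q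
  let ?S = "{q. F q \<noteq> 0} \<union> {q. G q \<noteq> 0}"
  have S: "finite ?S" "{q. F q \<noteq> 0} \<subseteq> ?S" "{q. G q \<noteq> 0} \<subseteq> ?S" "{q. (F + G) q \<noteq> 0} \<subseteq> ?S"
    using assms by (auto simp: fin_fun_def)
  show "push \<phi> (F + G) q = (push \<phi> F + push \<phi> G) q"
    unfolding plus_fun_apply push_alt[OF S(1,2)] push_alt[OF S(1,3)] push_alt[OF S(1,4)] sum.distrib[symmetric]
    by (rule sum.cong) auto
qed

lemma push_scale:
  assumes "F \<in> fin_fun A"
  shows "push \<phi> (fscale c F) = fscale c (push \<phi> F)"
proof
  fix q
  have S: "finite {q. F q \<noteq> 0}" "{q. F q \<noteq> 0} \<subseteq> {q. F q \<noteq> 0}" "{q. fscale c F q \<noteq> 0} \<subseteq> {q. F q \<noteq> 0}"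
    using assms by (auto simp: fin_fun_def)
  show "push \<phi> (fscale c F) q = fscale c (push \<phi> F) q"
    unfolding push_alt[OF S(1,2)] push_alt[OF S(1,3)] sum_distrib_left
    by (rule sum.cong) auto
qed

lemma push_delta: "push \<phi> (delta a) = delta (\<phi> a)"
proof
  fix q
  have "push \<phi> (delta a) q = (\<Sum>q'\<in>{a}. if \<phi> q' = q then delta a q' else 0)"
    by (rule push_alt) (auto simp: delta_def)
  then show "push \<phi> (delta a) q = delta (\<phi> a) q" by (auto simp: delta_def)
qed

lemma push_closed:
  assumes "F \<in> fin_fun A" "\<phi> ` A \<subseteq> A'"
  shows "push \<phi> F \<in> fin_fun A'"
proof -
  have "cfun.span (delta ` A) \<subseteq> {F \<in> fin_fun A. push \<phi> F \<in> fin_fun A'}"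
  proof (rule cfun.span_minimal)
    show "delta ` A \<subseteq> {F \<in> fin_fun A. push \<phi> F \<in> fin_fun A'}"
      using assms(2) by (auto simp: push_delta fin_fun_span intro!: cfun.span_base)
    have s: "cfun.subspace (fin_fun A)" "cfun.subspace (fin_fun A')" by (auto simp: fin_fun_span)
    show "cfun.subspace {F \<in> fin_fun A. push \<phi> F \<in> fin_fun A'}"
    proof (rule cfun.subspaceI)
      have "push \<phi> 0 = 0" unfolding push_def zero_fun_def by simp
      then show "0 \<in> {F \<in> fin_fun A. push \<phi> F \<in> fin_fun A'}" using s cfun.subspace_0 by auto
    qed (use s in \<open>auto simp: push_add push_scale cfun.subspace_add cfun.subspace_scale\<close>)
  qed
  then show ?thesis using assms(1) by (auto simp: fin_fun_span)
qed

section \<open>The relations of the tensor product and the descent of the action\<close>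

locale induction_data = g: lie_closed g + P: lie_closed P
  for g P :: "cmat set" +
  fixes WE :: "('e \<Rightarrow> complex) set" and \<rho> :: "cmat \<Rightarrow> ('e \<Rightarrow> complex) \<Rightarrow> 'e \<Rightarrow> complex"
  assumes Pg: "P \<subseteq> g" and WE: "cfun.subspace WE"
    and \<rho>_closed: "x \<in> P \<Longrightarrow> e \<in> WE \<Longrightarrow> \<rho> x e \<in> WE"
begin

abbreviation "E \<equiv> fmod WE \<rho>"
abbreviation "U \<equiv> env_alg g"
abbreviation "cl x \<equiv> env_class g (word [x])"
abbreviation "scal c \<equiv> env_class g (fscale c (word []))"
definition "Wc = fin_fun (carrier U \<times> WE)"
definition "K = cfun.span (tensor_rel g P E)"
definition "lmul x = (\<lambda>q. (cl x \<otimes>\<^bsub>U\<^esub> fst q, snd (q :: free_elem set \<times> ('e \<Rightarrow> complex))))"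

interpretation U: ring U by (rule g.env_ring)

lemma E_module: "module CC E"
  by (rule fmod_module[OF WE])

lemma cl_closed: "x \<in> g \<Longrightarrow> cl x \<in> carrier U"
  by (simp add: g.env_class_closed)

lemma scal_free: "fscale c (word []) \<in> carrier (free_alg L)"
  by (intro cfun.subspace_scale[OF free_alg_subspace]) simp

lemma scal_closed: "scal c \<in> carrier U"
  by (intro g.env_class_closed scal_free)

lemma free_act_single: "free_act E (fscale c (word w)) e = fscale c (foldr \<rho> w e)"
  if "foldr \<rho> w e \<in> WE"
proof -
  interpret module CC E by (rule E_module)
  have CC: "carrier CC = UNIV" by (simp add: ring_of_type_algebra_def)
  have s: "fscale c (foldr \<rho> w e) \<in> WE" for c using that WE by (rule cfun.subspace_scale[rotated])
  show ?thesis
  proof (cases "c = 0")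
    case True
    then show ?thesis by (simp add: free_act_def) (simp add: zero_fun_def)
  next
    case False
    then have "{w'. fscale c (word w) w' \<noteq> 0} = {w}" by (auto simp: word_def)
    then show ?thesis unfolding free_act_def using s
      by (simp add: M.finsum_insert word_def)
  qed
qed

lemma foldr_closed: "set w \<subseteq> P \<Longrightarrow> e \<in> WE \<Longrightarrow> foldr \<rho> w e \<in> WE"
  by (induction w) (auto intro: \<rho>_closed)

lemma free_act_closed:
  assumes "f \<in> carrier (free_alg P)" "e \<in> WE"
  shows "free_act E f e \<in> WE"
proof -
  interpret module CC E by (rule E_module)
  have "fscale (f w) (foldr \<rho> w e) \<in> WE" if "f w \<noteq> 0" for w
    using assms that foldr_closed WE by (intro cfun.subspace_scale) (auto simp: free_alg_simps)
  then show ?thesis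
    unfolding free_act_def using M.finsum_closed[of "\<lambda>w. fscale (f w) (foldr \<rho> w e)"] by auto
qed

lemma env_P_rep:
  assumes "a \<in> carrier (env_alg P)" "f \<in> a"
  shows "f \<in> carrier (free_alg P)"
proof -
  interpret I: ideal "env_ideal P" "free_alg P" by (rule P.env_ideal)
  obtain f0 where f0: "f0 \<in> carrier (free_alg P)" "a = env_ideal P +>\<^bsub>free_alg P\<^esub> f0"
    using assms(1) unfolding P.env_carrier env_class_def by blast
  then show ?thesis
    using assms(2) subsetD[OF I.a_r_coset_subset_G[OF I.a_subset f0(1)]] unfolding f0(2) by simp
qed

lemma free_mono: "carrier (free_alg P) \<subseteq> carrier (free_alg g)"
  using Pg by (auto simp: free_alg_simps)

lemma rel_cases:
  assumes "r \<in> tensor_rel g P E"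
  obtains (add_left) u u' e where "u \<in> carrier U" "u' \<in> carrier U" "e \<in> WE"
      "r = delta (u \<oplus>\<^bsub>U\<^esub> u', e) - delta (u, e) - delta (u', e)"
  | (add_right) u e e' where "u \<in> carrier U" "e \<in> WE" "e' \<in> WE"
      "r = delta (u, e + e') - delta (u, e) - delta (u, e')"
  | (scale) c u e where "u \<in> carrier U" "e \<in> WE" "r = delta (scal c \<otimes>\<^bsub>U\<^esub> u, e) - fscale c (delta (u, e))"
  | (tensor) u f e where "u \<in> carrier U" "f \<in> carrier (free_alg P)" "e \<in> WE"
      "\<exists>a\<in>carrier (env_alg P). f \<in> a" "r = delta (u \<otimes>\<^bsub>U\<^esub> env_class g f, e) - delta (u, free_act E f e)"
  using assms unfolding tensor_rel_def fmod_simps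
proof (elim UnE CollectE exE conjE)
  fix u u' e assume "r = delta (u \<oplus>\<^bsub>U\<^esub> u', e) - delta (u, e) - delta (u', e)"
    "u \<in> carrier U" "u' \<in> carrier U" "e \<in> WE"
  then show thesis by (intro add_left)
next
  fix u e e' assume "r = delta (u, e + e') - delta (u, e) - delta (u, e')" "u \<in> carrier U" "e \<in> WE" "e' \<in> WE"
  then show thesis by (intro add_right)
next
  fix c u e assume "r = delta (scal c \<otimes>\<^bsub>U\<^esub> u, e) - fscale c (delta (u, e))" "u \<in> carrier U" "e \<in> WE"
  then show thesis by (intro scale)
next
  fix u a f e assume r: "r = delta (u \<otimes>\<^bsub>U\<^esub> env_class g f, e) - delta (u, free_act E f e)" "u \<in> carrier U"
    and a: "a \<in> carrier (env_alg P)" "f \<in> a" and e: "e \<in> WE"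
  have "\<exists>a\<in>carrier (env_alg P). f \<in> a" using a by blast
  then show thesis by (rule tensor[OF r(2) env_P_rep[OF a] e _ r(1)])
qed

lemma relI:
  shows "u \<in> carrier U \<Longrightarrow> u' \<in> carrier U \<Longrightarrow> e \<in> WE \<Longrightarrow>
      delta (u \<oplus>\<^bsub>U\<^esub> u', e) - delta (u, e) - delta (u', e) \<in> tensor_rel g P E"
    and "u \<in> carrier U \<Longrightarrow> e \<in> WE \<Longrightarrow> e' \<in> WE \<Longrightarrow>
      delta (u, e + e') - delta (u, e) - delta (u, e') \<in> tensor_rel g P E"
    and "u \<in> carrier U \<Longrightarrow> e \<in> WE \<Longrightarrow> delta (scal c \<otimes>\<^bsub>U\<^esub> u, e) - fscale c (delta (u, e)) \<in> tensor_rel g P E"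
    and "u \<in> carrier U \<Longrightarrow> e \<in> WE \<Longrightarrow> \<exists>a\<in>carrier (env_alg P). f \<in> a \<Longrightarrow>
      delta (u \<otimes>\<^bsub>U\<^esub> env_class g f, e) - delta (u, free_act E f e) \<in> tensor_rel g P E"
  unfolding tensor_rel_def fmod_simps by blast+

lemma Wc_subspace: "cfun.subspace Wc"
  by (simp add: Wc_def fin_fun_span)

lemma delta_Wc: "u \<in> carrier U \<Longrightarrow> e \<in> WE \<Longrightarrow> delta (u, e) \<in> Wc"
  unfolding Wc_def fin_fun_span by (rule cfun.span_base) auto

lemma rel_Wc: "tensor_rel g P E \<subseteq> Wc"
proof
  fix r assume "r \<in> tensor_rel g P E"
  then show "r \<in> Wc"
    by (cases rule: rel_cases)
      (auto intro!: cfun.subspace_diff[OF Wc_subspace] cfun.subspace_scale[OF Wc_subspace] delta_Wc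
        cfun.subspace_add[OF WE] scal_closed g.env_class_closed free_act_closed subsetD[OF free_mono])
qed

lemma K_Wc: "K \<subseteq> Wc"
  unfolding K_def using rel_Wc Wc_subspace by (rule cfun.span_minimal)

lemma lmul_image: "x \<in> g \<Longrightarrow> lmul x ` (carrier U \<times> WE) \<subseteq> carrier U \<times> WE"
  by (auto simp: lmul_def cl_closed)

lemma push_Wc: "x \<in> g \<Longrightarrow> F \<in> Wc \<Longrightarrow> push (lmul x) F \<in> Wc"
  unfolding Wc_def by (rule push_closed[OF _ lmul_image])

lemma push_diff_delta:
  assumes "F \<in> Wc" "G \<in> Wc"
  shows "push \<phi> (F - G) = push \<phi> F - push \<phi> G"
proof -
  have d: "F - G \<in> Wc" using assms Wc_subspace by (simp add: cfun.subspace_diff)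
  have "push \<phi> ((F - G) + G) = push \<phi> (F - G) + push \<phi> G"
    using push_add d assms(2) unfolding Wc_def by blast
  then show ?thesis by simp
qed

text \<open>Left multiplication sends each family of relations to itself: it distributes over sums,
  commutes with scalars and is associative with the right factor from \<open>U(P)\<close>. So the
  action descends to the quotient by \<open>K\<close>.\<close>

lemma push_K:
  assumes x: "x \<in> g" and F: "F \<in> K"
  shows "push (lmul x) F \<in> K"
proof -
  have "K \<subseteq> {F \<in> Wc. push (lmul x) F \<in> K}"
    unfolding K_def
  proof (rule cfun.span_minimal)
    show "tensor_rel g P E \<subseteq> {F \<in> Wc. push (lmul x) F \<in> cfun.span (tensor_rel g P E)}"
    proof safe
      fix r assume r: "r \<in> tensor_rel g P E"
      then show "r \<in> Wc" using rel_Wc by blast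
      note c = cl_closed[OF x]
      from r have "push (lmul x) r \<in> tensor_rel g P E"
      proof (cases rule: rel_cases)
        case (add_left u u' e)
        then have "push (lmul x) r
            = delta (cl x \<otimes>\<^bsub>U\<^esub> u \<oplus>\<^bsub>U\<^esub> cl x \<otimes>\<^bsub>U\<^esub> u', e) - delta (cl x \<otimes>\<^bsub>U\<^esub> u, e) - delta (cl x \<otimes>\<^bsub>U\<^esub> u', e)"
          using c by (simp add: push_diff_delta delta_Wc cfun.subspace_diff[OF Wc_subspace] push_delta lmul_def U.r_distr)
        then show ?thesis using add_left c relI(1) by simp
      next
        case (add_right u e e')
        then have "push (lmul x) r = delta (cl x \<otimes>\<^bsub>U\<^esub> u, e + e') - delta (cl x \<otimes>\<^bsub>U\<^esub> u, e) - delta (cl x \<otimes>\<^bsub>U\<^esub> u, e')"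
          using c WE by (simp add: push_diff_delta delta_Wc cfun.subspace_diff[OF Wc_subspace] push_delta lmul_def cfun.subspace_add)
        then show ?thesis using add_right c relI(2) by simp
      next
        case (scale s u e)
        then have "push (lmul x) r = delta (scal s \<otimes>\<^bsub>U\<^esub> (cl x \<otimes>\<^bsub>U\<^esub> u), e) - fscale s (delta (cl x \<otimes>\<^bsub>U\<^esub> u, e))"
          using c scal_closed delta_Wc[of u e]
          by (simp add: push_diff_delta delta_Wc cfun.subspace_scale[OF Wc_subspace] push_delta lmul_def
              g.env_scalar_commute[OF x] push_scale[of _ "carrier U \<times> WE"] Wc_def[symmetric])
        then show ?thesis using scale c relI(3)[of "cl x \<otimes>\<^bsub>U\<^esub> u" e s] by simp
      next
        case (tensor u f e)
        have f: "env_class g f \<in> carrier U" using tensor free_mono g.env_class_closed by blast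
        then have "push (lmul x) r
            = delta ((cl x \<otimes>\<^bsub>U\<^esub> u) \<otimes>\<^bsub>U\<^esub> env_class g f, e) - delta (cl x \<otimes>\<^bsub>U\<^esub> u, free_act E f e)"
          using tensor c by (simp add: push_diff_delta delta_Wc free_act_closed push_delta lmul_def U.m_assoc)
        then show ?thesis using tensor c relI(4) by simp
      qed
      then show "push (lmul x) r \<in> cfun.span (tensor_rel g P E)" by (rule cfun.span_base)
    qed
    show "cfun.subspace {F \<in> Wc. push (lmul x) F \<in> cfun.span (tensor_rel g P E)}"
    proof (rule cfun.subspaceI)
      have "push (lmul x) 0 = 0" unfolding push_def zero_fun_def by simp
      then show "0 \<in> {F \<in> Wc. push (lmul x) F \<in> cfun.span (tensor_rel g P E)}"
        using cfun.subspace_0[OF Wc_subspace] cfun.span_zero by auto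
    qed (use Wc_subspace in \<open>auto simp: Wc_def push_add push_scale intro: cfun.subspace_add cfun.subspace_scale cfun.span_add cfun.span_scale\<close>)
  qed
  then show ?thesis using F by blast
qed

end

context induction_data
begin

interpretation U: ring U by (rule g.env_ring)

lemma induced_simps:
  "carrier (induced g P E) = (\<lambda>F. {k + F | k. k \<in> K}) ` Wc"
  "zero (induced g P E) = K"
  "add (induced g P E) = (\<lambda>A B. {a + b | a b. a \<in> A \<and> b \<in> B})"
  "module.smult (induced g P E) = (\<lambda>c A. \<Union>v\<in>A. {k + fscale c v | k. k \<in> K})"
  "lact (induced g P E) = (\<lambda>x A. \<Union>v\<in>A. {k + push (lmul x) v | k. k \<in> K})"
proof -
  have ft: "free_tensor g E = fmod Wc (\<lambda>x. push (lmul x))"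
    unfolding free_tensor_def Wc_def fin_fun_def push_def lmul_def by simp
  have K: "gen {} (free_tensor g E) (tensor_rel g P E) = K"
    unfolding ft K_def by (rule gen_fmod_span[OF Wc_subspace rel_Wc])
  have rc: "K +>\<^bsub>fmod Wc (\<lambda>x. push (lmul x))\<^esub> F = {k + F | k. k \<in> K}" for F
    unfolding a_r_coset_def' by auto
  show "carrier (induced g P E) = (\<lambda>F. {k + F | k. k \<in> K}) ` Wc"
    unfolding induced_def K unfolding ft quot_mod_def A_RCOSETS_def' by (auto simp: a_r_coset_def')
  show "zero (induced g P E) = K" unfolding induced_def K by (simp add: quot_mod_def)
  show "add (induced g P E) = (\<lambda>A B. {a + b | a b. a \<in> A \<and> b \<in> B})"
    unfolding induced_def K unfolding ft quot_mod_def by (intro ext) (simp add: set_add_def', blast)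
  show "module.smult (induced g P E) = (\<lambda>c A. \<Union>v\<in>A. {k + fscale c v | k. k \<in> K})"
    unfolding induced_def K unfolding ft quot_mod_def rc by simp
  show "lact (induced g P E) = (\<lambda>x A. \<Union>v\<in>A. {k + push (lmul x) v | k. k \<in> K})"
    unfolding induced_def K unfolding ft quot_mod_def rc by simp
qed

text \<open>The image of \<open>Wc\<close> under a linear map with kernel \<open>K\<close> is a copy
  of the induced module made of functions. Here \<open>\<tau> e\<close> is the class of 1 tensor
  \<open>e\<close>; its linearity, its compatibility with \<open>P\<close> and the fact that it
  generates are the interface through which the later sections see the induced module.\<close>

theorem induced_model:
  "\<exists>M act \<tau> \<iota>. lmod_model g (M :: (free_elem set \<times> ('e \<Rightarrow> complex) \<Rightarrow> complex) set) act (induced g P E) \<iota>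
     \<and> (\<forall>e\<in>WE. \<tau> e \<in> M) \<and> (\<forall>e\<in>WE. \<forall>e'\<in>WE. \<tau> (e + e') = \<tau> e + \<tau> e')
     \<and> (\<forall>c. \<forall>e\<in>WE. \<tau> (fscale c e) = fscale c (\<tau> e)) \<and> (\<forall>x\<in>P. \<forall>e\<in>WE. act x (\<tau> e) = \<tau> (\<rho> x e))
     \<and> (\<forall>Z. cfun.subspace Z \<longrightarrow> \<tau> ` WE \<subseteq> Z \<longrightarrow> (\<forall>x\<in>g. \<forall>v\<in>Z \<inter> M. act x v \<in> Z) \<longrightarrow> M \<subseteq> Z)"
proof -
  have Ksub: "cfun.subspace K" by (simp add: K_def)
  obtain pr :: "(free_elem set \<times> ('e \<Rightarrow> complex) \<Rightarrow> complex) \<Rightarrow> free_elem set \<times> ('e \<Rightarrow> complex) \<Rightarrow> complex"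
    where pr_add: "\<And>v w. pr (v + w) = pr v + pr w" and pr_scale: "\<And>c v. pr (fscale c v) = fscale c (pr v)"
      and pr_ker: "\<And>v. pr v = 0 \<longleftrightarrow> v \<in> K"
    by (rule linear_with_kernel[OF Ksub]) (rule that)
  have pr_diff: "pr (v - w) = pr v - pr w" for v w
    using pr_add[of "v - w" w] by (simp add: algebra_simps)
  have pr_eq: "pr v = pr w \<longleftrightarrow> v - w \<in> K" for v w using pr_ker[of "v - w"] by (simp add: pr_diff)
  define M where "M = pr ` Wc"
  \<comment> \<open>Chosen representatives; \<open>act_pr\<close> and \<open>\<iota>q\<close> show
    that the results do not depend on the choice.\<close>
  define rep where "rep v = (SOME F. F \<in> Wc \<and> pr F = v)" for v
  define act where "act x v = pr (push (lmul x) (rep v))" for x v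
  define \<iota> where "\<iota> A = pr (SOME F. F \<in> A)" for A
  define \<tau> where "\<tau> e = pr (delta (\<one>\<^bsub>U\<^esub>, e))" for e
  define q where "q F = {k + F | k. k \<in> K}" for F
  have rep: "rep (pr F) \<in> Wc \<and> pr (rep (pr F)) = pr F" if "F \<in> Wc" for F
    unfolding rep_def using someI[of "\<lambda>G. G \<in> Wc \<and> pr G = pr F" F] that by blast
  have push_add': "push (lmul x) (F + G) = push (lmul x) F + push (lmul x) G"
    and push_scale': "push (lmul x) (fscale c F) = fscale c (push (lmul x) F)" if "F \<in> Wc" "G \<in> Wc" for F G x c
    using that push_add push_scale unfolding Wc_def by blast+
  note Wadd = cfun.subspace_add[OF Wc_subspace] and Wscale = cfun.subspace_scale[OF Wc_subspace]
  have act_pr: "act x (pr F) = pr (push (lmul x) F)" if "x \<in> g" "F \<in> Wc" for x F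
  proof -
    have "rep (pr F) - F \<in> K" using rep[OF that(2)] pr_eq by blast
    then have "push (lmul x) (rep (pr F) - F) \<in> K" using push_K that by blast
    then show ?thesis using rep[OF that(2)] that(2) by (simp add: act_def pr_eq push_diff_delta)
  qed
  have act_M: "act x (pr F) \<in> M" if "x \<in> g" "F \<in> Wc" for x F
    using that push_Wc by (auto simp: act_pr M_def)
  have act_delta: "act x (pr (delta (u, e))) = pr (delta (cl x \<otimes>\<^bsub>U\<^esub> u, e))" if "x \<in> g" "u \<in> carrier U" "e \<in> WE" for x u e
    using that by (simp add: act_pr delta_Wc push_delta lmul_def)
  have prs: "pr (delta (u \<oplus>\<^bsub>U\<^esub> u', e)) = pr (delta (u, e)) + pr (delta (u', e))"
    if "u \<in> carrier U" "u' \<in> carrier U" "e \<in> WE" for u u' e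
    using pr_ker[of "delta (u \<oplus>\<^bsub>U\<^esub> u', e) - delta (u, e) - delta (u', e)"] that relI(1)
    by (simp add: K_def cfun.span_base pr_diff pr_add diff_diff_add)
  have prs2: "pr (delta (u, e + e')) = pr (delta (u, e)) + pr (delta (u, e'))"
    if "u \<in> carrier U" "e' \<in> WE" "e \<in> WE" for u e e'
    using pr_ker[of "delta (u, e + e') - delta (u, e) - delta (u, e')"] that relI(2)
    by (simp add: K_def cfun.span_base pr_diff pr_add diff_diff_add)
  have prs3: "pr (delta (scal c \<otimes>\<^bsub>U\<^esub> u, e)) = fscale c (pr (delta (u, e)))"
    if "u \<in> carrier U" "e \<in> WE" for u e c
    using pr_ker[of "delta (scal c \<otimes>\<^bsub>U\<^esub> u, e) - fscale c (delta (u, e))"] that relI(3)[of u e c]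
    by (simp add: K_def cfun.span_base pr_diff pr_scale)
  have prs4: "pr (delta (u \<otimes>\<^bsub>U\<^esub> env_class g f, e)) = pr (delta (u, free_act E f e))"
    if "u \<in> carrier U" "e \<in> WE" "f \<in> carrier (free_alg P)" for u e f
  proof -
    interpret I: ideal "env_ideal P" "free_alg P" by (rule P.env_ideal)
    have "f \<in> env_class P f" unfolding env_class_def using I.a_rcos_self[OF that(3)] .
    then have "\<exists>a\<in>carrier (env_alg P). f \<in> a" using P.env_class_closed[OF that(3)] by blast
    then show ?thesis
      using pr_ker[of "delta (u \<otimes>\<^bsub>U\<^esub> env_class g f, e) - delta (u, free_act E f e)"] that relI(4)[of u e f]
      by (simp add: K_def cfun.span_base pr_diff)
  qed
  have Wc_induct [consumes 1]: "Q F"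
    if F: "F \<in> Wc"
      and "\<And>u e. u \<in> carrier U \<Longrightarrow> e \<in> WE \<Longrightarrow> Q (delta (u, e))"
      and "\<And>F G. F \<in> Wc \<Longrightarrow> G \<in> Wc \<Longrightarrow> Q F \<Longrightarrow> Q G \<Longrightarrow> Q (F + G)"
      and "\<And>c F. F \<in> Wc \<Longrightarrow> Q F \<Longrightarrow> Q (fscale c F)" and "Q 0" for Q F
  proof -
    have "cfun.subspace {F \<in> Wc. Q F}"
      using that Wadd Wscale cfun.subspace_0[OF Wc_subspace] by (intro cfun.subspaceI) auto
    moreover have "delta ` (carrier U \<times> WE) \<subseteq> {F \<in> Wc. Q F}" using that delta_Wc by auto
    ultimately have "Wc \<subseteq> {F \<in> Wc. Q F}"
      unfolding Wc_def[unfolded fin_fun_span] by (intro cfun.span_minimal) (simp_all add: Wc_def fin_fun_span)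
    then show "Q F" using F by blast
  qed
  have act_add: "act x (v + w) = act x v + act x w" if x: "x \<in> g" and v: "v \<in> M" and w: "w \<in> M" for x v w
  proof -
    obtain F G where "F \<in> Wc" "G \<in> Wc" "v = pr F" "w = pr G" using v w by (auto simp: M_def)
    then show ?thesis using x Wadd by (simp add: pr_add[symmetric] act_pr push_add')
  qed
  have act_scale: "act x (fscale c v) = fscale c (act x v)" if x: "x \<in> g" and v: "v \<in> M" for x v c
  proof -
    obtain F where "F \<in> Wc" "v = pr F" using v by (auto simp: M_def)
    then show ?thesis using x Wscale by (simp add: pr_scale[symmetric] act_pr push_scale')
  qed
  have act_M': "act x v \<in> M" if "x \<in> g" "v \<in> M" for x v
    using that act_M by (auto simp: M_def)
  have zeroW: "0 \<in> Wc" by (rule cfun.subspace_0[OF Wc_subspace])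
  have act0: "act x 0 = 0" if "x \<in> g" for x
    using act_scale[OF that, of 0 0] zeroW pr_ker[of 0] cfun.subspace_0[OF Ksub]
    by (simp add: M_def zero_fun_def[symmetric] image_iff) (metis zero_fun_def)
  have pr0: "pr 0 = 0" using pr_ker cfun.subspace_0[OF Ksub] by blast
  have M_sub: "cfun.subspace M"
    unfolding M_def by (rule cfun.subspaceI) (auto simp: pr_add[symmetric] pr_scale[symmetric] intro: Wadd Wscale, use pr0 zeroW in force)
  \<comment> \<open>Two linear maps agree once they agree on pure tensors; this reduces the module
    axioms to identities in the enveloping algebra.\<close>
  have M_ext: "A v = B v"
    if v: "v \<in> M"
      and A: "\<And>v w. v \<in> M \<Longrightarrow> w \<in> M \<Longrightarrow> A (v + w) = A v + A w" "\<And>c v. v \<in> M \<Longrightarrow> A (fscale c v) = fscale c (A v)"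
      and B: "\<And>v w. v \<in> M \<Longrightarrow> w \<in> M \<Longrightarrow> B (v + w) = B v + B w" "\<And>c v. v \<in> M \<Longrightarrow> B (fscale c v) = fscale c (B v)"
      and AB: "\<And>u e. u \<in> carrier U \<Longrightarrow> e \<in> WE \<Longrightarrow> A (pr (delta (u, e))) = B (pr (delta (u, e)))"
    for v and A B :: "(free_elem set \<times> ('e \<Rightarrow> complex) \<Rightarrow> complex) \<Rightarrow> (free_elem set \<times> ('e \<Rightarrow> complex) \<Rightarrow> complex)"
  proof -
    obtain F where F: "F \<in> Wc" "v = pr F" using v by (auto simp: M_def)
    have "A (pr F) = B (pr F)" using F(1)
    proof (induction F rule: Wc_induct)
      case (2 F G)
      then have "pr F \<in> M" "pr G \<in> M" by (auto simp: M_def)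
      then show ?case by (simp only: pr_add A(1) B(1) 2(3,4))
    next
      case (3 c F)
      then have "pr F \<in> M" by (auto simp: M_def)
      then show ?case by (simp only: pr_scale A(2) B(2) 3(2))
    next
      case 4
      have z: "0 \<in> M" by (rule cfun.subspace_0[OF M_sub])
      have "A 0 = 0" "B 0 = 0" using A(1)[OF z z] B(1)[OF z z] by simp_all
      then show ?case by (simp only: pr0)
    qed (rule AB)
    then show ?thesis by (simp only: F(2))
  qed
  have rep_ax: "lie_rep g M act"
  proof (unfold_locales)
    fix x y v assume x: "x \<in> g" and y: "y \<in> g" and v: "v \<in> M"
    have xy: "x + y \<in> g" using x y g.subspace by (simp add: cfun.subspace_add)
    have l: "lbr x y \<in> g" using x y by (rule g.lbr_closed)
    note cx = cl_closed[OF x] and cy = cl_closed[OF y]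
    note lin = act_add[OF x] act_add[OF y] act_add[OF xy] act_add[OF l]
      act_scale[OF x] act_scale[OF y] act_scale[OF xy] act_scale[OF l] act_M'[OF x] act_M'[OF y]
    show "act (x + y) v = act x v + act y v"
      by (rule M_ext[OF v])
        (simp_all only: lin ac_simps act_delta[OF xy] act_delta[OF x] act_delta[OF y] g.env_class_rel(1)[OF x y]
          U.l_distr cx cy prs U.m_closed, simp_all only: cfun.scale_right_distrib)
    have "act x (act y v) = act (lbr x y) v + act y (act x v)"
    proof (rule M_ext[OF v])
      fix u e assume u: "u \<in> carrier U" and e: "e \<in> WE"
      have "act x (act y (pr (delta (u, e)))) = pr (delta ((cl x \<otimes>\<^bsub>U\<^esub> cl y) \<otimes>\<^bsub>U\<^esub> u, e))"
        using u e x y cx cy by (simp add: act_delta U.m_assoc)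
      also have "cl x \<otimes>\<^bsub>U\<^esub> cl y = cl (lbr x y) \<oplus>\<^bsub>U\<^esub> cl y \<otimes>\<^bsub>U\<^esub> cl x"
        using g.env_class_rel(3)[OF x y] by simp
      also have "pr (delta (\<dots> \<otimes>\<^bsub>U\<^esub> u, e)) = pr (delta (cl (lbr x y) \<otimes>\<^bsub>U\<^esub> u, e)) + pr (delta (cl y \<otimes>\<^bsub>U\<^esub> (cl x \<otimes>\<^bsub>U\<^esub> u), e))"
        using u e cx cy cl_closed[OF l] by (simp only: U.l_distr U.m_closed U.m_assoc prs)
      also have "\<dots> = act (lbr x y) (pr (delta (u, e))) + act y (act x (pr (delta (u, e))))"
        using u e x y cx cy l by (simp only: act_delta U.m_closed)
      finally show "act x (act y (pr (delta (u, e)))) = act (lbr x y) (pr (delta (u, e))) + act y (act x (pr (delta (u, e))))" .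
    qed (simp_all only: lin ac_simps, simp_all only: cfun.scale_right_distrib)
    then show "act (lbr x y) v = act x (act y v) - act y (act x v)" by (simp only: add_diff_cancel_right')
  next
    fix x v c assume x: "x \<in> g" and v: "v \<in> M"
    have cx: "fscale c x \<in> g" using x g.subspace by (simp add: cfun.subspace_scale)
    note lin = act_add[OF x] act_add[OF cx] act_scale[OF x] act_scale[OF cx] act_M'[OF x]
    show "act (fscale c x) v = fscale c (act x v)"
    proof (rule M_ext[OF v])
      fix u e assume u: "u \<in> carrier U" and e: "e \<in> WE"
      have "cl (fscale c x) \<otimes>\<^bsub>U\<^esub> u = scal c \<otimes>\<^bsub>U\<^esub> (cl x \<otimes>\<^bsub>U\<^esub> u)"
        using u cl_closed[OF x] scal_closed by (simp add: g.env_class_rel(2)[OF x x] U.m_assoc)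
      then show "act (fscale c x) (pr (delta (u, e))) = fscale c (act x (pr (delta (u, e))))"
        using u e x cx cl_closed[OF x] by (simp add: act_delta prs3)
    next
      fix v w assume vw: "v \<in> M" "w \<in> M"
      show "fscale c (act x (v + w)) = fscale c (act x v) + fscale c (act x w)"
        unfolding lin(1)[OF vw] by (rule cfun.scale_right_distrib)
    next
      fix d v assume v: "v \<in> M"
      show "fscale c (act x (fscale d v)) = fscale d (fscale c (act x v))"
        unfolding lin(3)[OF v] by (rule cfun.scale_left_commute)
    qed (simp_all only: lin)
  qed (use M_sub act_M' act_add act_scale in auto)
  have qW: "q F \<in> carrier (induced g P E)" if "F \<in> Wc" for F
    using that by (auto simp: induced_simps q_def)
  have carr: "carrier (induced g P E) = q ` Wc" by (simp add: induced_simps q_def image_def)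
  have inq: "F' \<in> q F \<longleftrightarrow> F' - F \<in> K" for F F'
    unfolding q_def by (auto intro!: exI[of _ "F' - F"])
  have \<iota>q: "\<iota> (q F) = pr F" for F
  proof -
    have "F \<in> q F" using cfun.subspace_0[OF Ksub] by (simp add: inq)
    then have "(SOME F'. F' \<in> q F) \<in> q F" by (rule someI[of "\<lambda>F'. F' \<in> q F"])
    then show ?thesis unfolding \<iota>_def inq pr_eq .
  qed
  have q_eq: "q F = q G \<longleftrightarrow> F - G \<in> K" for F G
  proof
    assume "q F = q G"
    then show "F - G \<in> K" using inq[of F F] inq[of F G] cfun.subspace_0[OF Ksub] by simp
  next
    assume "F - G \<in> K"
    then have "H - F \<in> K \<longleftrightarrow> H - G \<in> K" for H
      using cfun.subspace_add[OF Ksub, of "H - F" "F - G"] cfun.subspace_diff[OF Ksub, of "H - G" "F - G"] by auto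
    then show "q F = q G" using inq by blast
  qed
  \<comment> \<open>The operations of the quotient are unions over a coset. If \<open>f\<close>
    respects congruence modulo \<open>K\<close>, all united cosets coincide.\<close>
  have q_img: "(\<Union>v\<in>q F. {k + f v | k. k \<in> K}) = q (f F)" if "\<And>v. v - F \<in> K \<Longrightarrow> f v - f F \<in> K" for f F
  proof -
    have "(\<Union>v\<in>q F. {k + f v | k. k \<in> K}) = (\<Union>v\<in>q F. q (f v))" by (simp add: q_def)
    also have "\<dots> = (\<Union>v\<in>q F. q (f F))"
      using that inq q_eq by (intro SUP_cong refl) blast
    also have "q F \<noteq> {}" using cfun.subspace_0[OF Ksub] inq[of F F] by auto
    then have "(\<Union>v\<in>q F. q (f F)) = q (f F)" by simp
    finally show ?thesis .
  qed
  have q_add: "q F \<oplus>\<^bsub>induced g P E\<^esub> q G = q (F + G)" for F G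
  proof (rule Set.set_eqI)
    fix H
    have "H \<in> q F \<oplus>\<^bsub>induced g P E\<^esub> q G \<longleftrightarrow> (\<exists>a b. H = a + b \<and> a - F \<in> K \<and> b - G \<in> K)"
      by (simp add: induced_simps inq)
    also have "\<dots> \<longleftrightarrow> H - (F + G) \<in> K"
    proof
      assume "\<exists>a b. H = a + b \<and> a - F \<in> K \<and> b - G \<in> K"
      then obtain a b where "H = a + b" "a - F \<in> K" "b - G \<in> K" by blast
      then have "(a - F) + (b - G) \<in> K" using cfun.subspace_add[OF Ksub] by blast
      then show "H - (F + G) \<in> K" using \<open>H = a + b\<close> by (simp add: algebra_simps)
    next
      assume "H - (F + G) \<in> K"
      then show "\<exists>a b. H = a + b \<and> a - F \<in> K \<and> b - G \<in> K"
        by (intro exI[of _ "H - G"] exI[of _ G]) (simp add: cfun.subspace_0[OF Ksub] algebra_simps)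
    qed
    finally show "H \<in> q F \<oplus>\<^bsub>induced g P E\<^esub> q G \<longleftrightarrow> H \<in> q (F + G)" by (simp add: inq)
  qed
  have q_smult: "c \<odot>\<^bsub>induced g P E\<^esub> q F = q (fscale c F)" for c F
  proof -
    have "fscale c v - fscale c F \<in> K" if "v - F \<in> K" for v
      using cfun.subspace_scale[OF Ksub that, of c] by (simp only: cfun.scale_right_diff_distrib)
    then show ?thesis unfolding induced_simps by (rule q_img)
  qed
  have q_lact: "lact (induced g P E) x (q F) = q (push (lmul x) F)" if "x \<in> g" "F \<in> Wc" for x F
  proof -
    have "push (lmul x) v - push (lmul x) F \<in> K" if v: "v - F \<in> K" for v
    proof -
      have "(v - F) + F \<in> Wc" using v K_Wc \<open>F \<in> Wc\<close> Wadd by blast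
      then have "push (lmul x) v - push (lmul x) F = push (lmul x) (v - F)"
        using \<open>F \<in> Wc\<close> by (simp add: push_diff_delta)
      then show ?thesis using push_K[OF \<open>x \<in> g\<close> v] by simp
    qed
    then show ?thesis unfolding induced_simps by (rule q_img)
  qed
  have q_zero: "zero (induced g P E) = q 0" by (simp add: induced_simps q_def)
  interpret lie_rep g M act by (rule rep_ax)
  have model: "lmod_model g M act (induced g P E) \<iota>"
  proof (unfold_locales)
    show "bij_betw \<iota> (carrier (induced g P E)) M"
      unfolding bij_betw_def inj_on_def carr M_def by (auto simp: \<iota>q pr_eq q_eq image_image)
  qed (auto simp: carr \<iota>q q_add q_smult q_zero q_lact pr_add pr_scale pr0 act_pr zeroW intro: Wadd Wscale push_Wc)
  have \<tau>M: "\<tau> e \<in> M" if "e \<in> WE" for e using that by (auto simp: \<tau>_def M_def delta_Wc)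
  have sing: "free_act E (word [x]) e = \<rho> x e" if "x \<in> P" "e \<in> WE" for x e
    using free_act_single[of "[x]" e 1] that \<rho>_closed by simp
  have scal_act: "free_act E (fscale c (word [])) e = fscale c e" if "e \<in> WE" for c e
    using free_act_single[of "[]" e c] that by simp
  \<comment> \<open>The scalar is regarded as an element of \<open>U(P)\<close>, moved across the
    tensor sign, and then commuted with 1.\<close>
  have \<tau>_scale: "\<tau> (fscale c e) = fscale c (\<tau> e)" if e: "e \<in> WE" for c e
  proof -
    have "\<tau> (fscale c e) = pr (delta (\<one>\<^bsub>U\<^esub> \<otimes>\<^bsub>U\<^esub> scal c, e))"
      unfolding \<tau>_def using prs4[OF U.one_closed e, of "fscale c (word [])"] e scal_act scal_free by simp
    also have "\<dots> = pr (delta (scal c \<otimes>\<^bsub>U\<^esub> \<one>\<^bsub>U\<^esub>, e))" using scal_closed by simp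
    also have "\<dots> = fscale c (\<tau> e)" unfolding \<tau>_def by (rule prs3[OF U.one_closed e])
    finally show ?thesis .
  qed
  have \<tau>_P: "act x (\<tau> e) = \<tau> (\<rho> x e)" if x: "x \<in> P" and e: "e \<in> WE" for x e
  proof -
    have xg: "x \<in> g" using x Pg by blast
    have "act x (\<tau> e) = pr (delta (\<one>\<^bsub>U\<^esub> \<otimes>\<^bsub>U\<^esub> cl x, e))"
      unfolding \<tau>_def using xg e cl_closed[OF xg] by (simp add: act_delta)
    also have "\<dots> = \<tau> (\<rho> x e)" unfolding \<tau>_def using prs4[OF U.one_closed e, of "word [x]"] x e by (simp add: sing)
    finally show ?thesis .
  qed
  \<comment> \<open>Applying the letters of a word to \<open>\<tau> e\<close> one by one gives the
    class of the word tensor \<open>e\<close>. Combinations of words, and then of pure tensors,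
    exhaust \<open>M\<close>.\<close>
  have generate: "M \<subseteq> Z" if Z: "cfun.subspace Z" "\<tau> ` WE \<subseteq> Z" "\<forall>x\<in>g. \<forall>v\<in>Z \<inter> M. act x v \<in> Z" for Z
  proof -
    have wordZ: "pr (delta (env_class g (word w), e)) \<in> Z \<inter> M" if "set w \<subseteq> g" "e \<in> WE" for w e
      using that(1)
    proof (induction w)
      case Nil
      then show ?case using Z(2) that(2) \<tau>M by (auto simp: \<tau>_def g.env_class_one)
    next
      case (Cons x w)
      have "pr (delta (env_class g (word (x # w)), e)) = act x (pr (delta (env_class g (word w), e)))"
        using Cons.prems that(2) by (simp add: act_delta g.env_class_closed g.env_class_mult[symmetric] conv_word)
      then show ?case using Cons Z(3) act_M' by auto
    qed
    have polyZ: "pr (delta (env_class g f, e)) \<in> Z" if f: "f \<in> carrier (free_alg g)" and e: "e \<in> WE" for f e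
    proof -
      note fsub = free_alg_subspace[of g]
      have sub: "cfun.subspace {f \<in> carrier (free_alg g). pr (delta (env_class g f, e)) \<in> Z}"
      proof (rule cfun.subspaceI)
        have z: "0 \<in> carrier (free_alg g)" by (rule cfun.subspace_0[OF fsub])
        have s: "pr (delta (env_class g (fscale c f), e)) = fscale c (pr (delta (env_class g f, e)))"
          if "f \<in> carrier (free_alg g)" for c f
        proof -
          have "fscale c f = conv (fscale c (word [])) f" by (simp add: conv_scale conv_one)
          then show ?thesis using that e by (simp add: g.env_class_mult[OF scal_free that] g.env_class_closed prs3)
        qed
        have "pr (delta (env_class g 0, e)) = 0" using s[OF z, of 0] by (simp add: zero_fun_def)
        then show "0 \<in> {f \<in> carrier (free_alg g). pr (delta (env_class g f, e)) \<in> Z}"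
          using z cfun.subspace_0[OF Z(1)] by simp
        fix f f' assume "f \<in> {f \<in> carrier (free_alg g). pr (delta (env_class g f, e)) \<in> Z}"
          "f' \<in> {f \<in> carrier (free_alg g). pr (delta (env_class g f, e)) \<in> Z}"
        then show "f + f' \<in> {f \<in> carrier (free_alg g). pr (delta (env_class g f, e)) \<in> Z}"
          using cfun.subspace_add[OF fsub] cfun.subspace_add[OF Z(1)] e
          by (auto simp: g.env_class_add g.env_class_closed prs)
      next
        fix c f assume "f \<in> {f \<in> carrier (free_alg g). pr (delta (env_class g f, e)) \<in> Z}"
        moreover have "pr (delta (env_class g (fscale c f), e)) = fscale c (pr (delta (env_class g f, e)))"
          if "f \<in> carrier (free_alg g)"
        proof -
          have "fscale c f = conv (fscale c (word [])) f" by (simp add: conv_scale conv_one)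
          then show ?thesis using that e by (simp add: g.env_class_mult[OF scal_free that] g.env_class_closed prs3)
        qed
        ultimately show "fscale c f \<in> {f \<in> carrier (free_alg g). pr (delta (env_class g f, e)) \<in> Z}"
          using cfun.subspace_scale[OF fsub] cfun.subspace_scale[OF Z(1)] by auto
      qed
      have fs: "carrier (free_alg g) = cfun.span (delta ` {w. set w \<subseteq> g})"
        unfolding fin_fun_span[symmetric] by (auto simp: free_alg_simps fin_fun_def)
      have "delta w = word w" for w :: "cmat list" by (simp add: delta_def word_def)
      then have "delta ` {w. set w \<subseteq> g} \<subseteq> {f \<in> carrier (free_alg g). pr (delta (env_class g f, e)) \<in> Z}"
        using wordZ e by auto
      then have "carrier (free_alg g) \<subseteq> {f \<in> carrier (free_alg g). pr (delta (env_class g f, e)) \<in> Z}"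
        using sub unfolding fs by (intro cfun.span_minimal) auto
      then show ?thesis using f by blast
    qed
    have "pr F \<in> Z" if "F \<in> Wc" for F
      using that
    proof (induction F rule: Wc_induct)
      case (1 u e)
      then show ?case using polyZ unfolding g.env_carrier by blast
    next
      case (2 F G)
      then show ?case by (simp only: pr_add cfun.subspace_add[OF Z(1)])
    next
      case (3 c F)
      then show ?case by (simp only: pr_scale cfun.subspace_scale[OF Z(1)])
    next
      case 4
      then show ?case by (simp only: pr0 cfun.subspace_0[OF Z(1)])
    qed
    then show ?thesis by (auto simp: M_def)
  qed
  have \<tau>_add: "\<tau> (e + e') = \<tau> e + \<tau> e'" if "e \<in> WE" "e' \<in> WE" for e e'
    unfolding \<tau>_def using that by (simp add: prs2)
  show ?thesis
    using model \<tau>M \<tau>_scale \<tau>_P \<tau>_add generate by (intro exI[of _ M] exI[of _ act] exI[of _ \<tau>] exI[of _ \<iota>]) blast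
qed

end

section \<open>Lengths and multiplicities\<close>

lemma CC_simps: "carrier CC = UNIV" "add CC = (+)" "monoid.mult CC = (*)" "one CC = 1" "zero CC = 0"
  by (simp_all add: ring_of_type_algebra_def fun_eq_iff)

lemma CC_minus_one: "\<ominus>\<^bsub>CC\<^esub> \<one>\<^bsub>CC\<^esub> = -1"
proof -
  interpret cring CC by (rule cring_from_type_algebra)
  show ?thesis by (rule minus_equality) (simp_all add: CC_simps)
qed

lemma submodule_closed:
  assumes "submodule Y CC V"
  shows "Y \<subseteq> carrier V" "zero V \<in> Y" "\<And>v w. v \<in> Y \<Longrightarrow> w \<in> Y \<Longrightarrow> v \<oplus>\<^bsub>V\<^esub> w \<in> Y" "\<And>c v. v \<in> Y \<Longrightarrow> c \<odot>\<^bsub>V\<^esub> v \<in> Y"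
proof -
  interpret submodule Y CC V by (rule assms)
  show "Y \<subseteq> carrier V" "zero V \<in> Y" "\<And>v w. v \<in> Y \<Longrightarrow> w \<in> Y \<Longrightarrow> v \<oplus>\<^bsub>V\<^esub> w \<in> Y" "\<And>c v. v \<in> Y \<Longrightarrow> c \<odot>\<^bsub>V\<^esub> v \<in> Y"
    using subset one_closed m_closed smult_closed by (auto simp: CC_simps)
qed

lemma submod_iff:
  assumes "module CC V"
  shows "submod L V Y \<longleftrightarrow> Y \<subseteq> carrier V \<and> zero V \<in> Y \<and> (\<forall>v\<in>Y. \<forall>w\<in>Y. v \<oplus>\<^bsub>V\<^esub> w \<in> Y)
    \<and> (\<forall>c. \<forall>v\<in>Y. c \<odot>\<^bsub>V\<^esub> v \<in> Y) \<and> (\<forall>x\<in>L. \<forall>v\<in>Y. lact V x v \<in> Y)" (is "_ \<longleftrightarrow> ?R")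
proof
  assume "submod L V Y"
  then show ?R using submodule_closed[of Y V] unfolding submod_def by blast
next
  assume R: ?R
  interpret module CC V by (rule assms)
  have "submodule Y CC V"
  proof (rule submoduleI)
    fix v assume v: "v \<in> Y"
    then have vc: "v \<in> carrier V" using R by blast
    then have "(\<ominus>\<^bsub>CC\<^esub> \<one>\<^bsub>CC\<^esub>) \<odot>\<^bsub>V\<^esub> v = \<ominus>\<^bsub>V\<^esub> v" by (subst smult_l_minus) (simp_all add: CC_simps(1))
    then show "\<ominus>\<^bsub>V\<^esub> v \<in> Y" using R v by (metis CC_minus_one)
  qed (use R in \<open>auto simp: CC_simps\<close>)
  then show "submod L V Y" using R by (simp add: submod_def)
qed

lemma restr_simps [simp]:
  "carrier (restr V A) = A" "zero (restr V A) = zero V" "add (restr V A) = add V"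
  "module.smult (restr V A) = module.smult V" "lact (restr V A) = lact V" "restr (restr V A) B = restr V B"
  by (simp_all add: restr_def)

definition stable_subspace :: "cmat set \<Rightarrow> (cmat \<Rightarrow> ('i \<Rightarrow> complex) \<Rightarrow> 'i \<Rightarrow> complex) \<Rightarrow> ('i \<Rightarrow> complex) set \<Rightarrow> bool" where
  "stable_subspace L act Y \<longleftrightarrow> cfun.subspace Y \<and> (\<forall>x\<in>L. \<forall>v\<in>Y. act x v \<in> Y)"

text \<open>Chains may stall and only proper inclusions count, so that intersecting a chain with a
  submodule, or taking preimages, again gives a chain.\<close>

definition chain_bounded :: "cmat set \<Rightarrow> (cmat \<Rightarrow> ('i \<Rightarrow> complex) \<Rightarrow> 'i \<Rightarrow> complex) \<Rightarrow> ('i \<Rightarrow> complex) set \<Rightarrow> nat \<Rightarrow> bool" where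
  "chain_bounded L act Z c \<longleftrightarrow> (\<forall>k Y. (\<forall>i\<le>k. stable_subspace L act (Y i) \<and> Y i \<subseteq> Z) \<longrightarrow> (\<forall>i<k. Y i \<subseteq> Y (Suc i)) \<longrightarrow>
     card {i. i < k \<and> Y i \<noteq> Y (Suc i)} \<le> c)"

context lmod_model
begin

lemma submod_model:
  assumes "L \<subseteq> g"
  shows "submod L V Y \<longleftrightarrow> Y \<subseteq> carrier V \<and> stable_subspace L act (\<iota> ` Y)"
proof
  assume "submod L V Y"
  then have Y: "Y \<subseteq> carrier V" "zero V \<in> Y" "\<And>v w. v \<in> Y \<Longrightarrow> w \<in> Y \<Longrightarrow> v \<oplus>\<^bsub>V\<^esub> w \<in> Y"
    "\<And>c v. v \<in> Y \<Longrightarrow> c \<odot>\<^bsub>V\<^esub> v \<in> Y" "\<And>x v. x \<in> L \<Longrightarrow> v \<in> Y \<Longrightarrow> lact V x v \<in> Y"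
    unfolding submod_iff[OF module] by blast+
  have "cfun.subspace (\<iota> ` Y)"
  proof (rule cfun.subspaceI)
    show "0 \<in> \<iota> ` Y" using Y(2) \<iota>_zero by (metis imageI)
    fix v w assume "v \<in> \<iota> ` Y" "w \<in> \<iota> ` Y"
    then obtain v' w' where "v' \<in> Y" "w' \<in> Y" "v = \<iota> v'" "w = \<iota> w'" by blast
    then show "v + w \<in> \<iota> ` Y" using Y(3)[of v' w'] \<iota>_add[of v' w'] subsetD[OF Y(1)] by (auto intro!: image_eqI[of _ _ "v' \<oplus>\<^bsub>V\<^esub> w'"])
  next
    fix c v assume "v \<in> \<iota> ` Y"
    then obtain v' where "v' \<in> Y" "v = \<iota> v'" by blast
    then show "fscale c v \<in> \<iota> ` Y" using Y(4)[of v' c] \<iota>_smult[of v' c] subsetD[OF Y(1)] by (auto intro!: image_eqI[of _ _ "c \<odot>\<^bsub>V\<^esub> v'"])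
  qed
  moreover have "act x v \<in> \<iota> ` Y" if "x \<in> L" "v \<in> \<iota> ` Y" for x v
  proof -
    obtain v' where "v' \<in> Y" "v = \<iota> v'" using \<open>v \<in> \<iota> ` Y\<close> by blast
    then show ?thesis using Y(5)[OF \<open>x \<in> L\<close>, of v'] \<iota>_lact[of x v'] subsetD[OF Y(1)] assms \<open>x \<in> L\<close> by (auto intro!: image_eqI[of _ _ "lact V x v'"])
  qed
  ultimately show "Y \<subseteq> carrier V \<and> stable_subspace L act (\<iota> ` Y)"
    using Y(1) by (simp add: stable_subspace_def)
next
  assume R: "Y \<subseteq> carrier V \<and> stable_subspace L act (\<iota> ` Y)"
  then have Y: "Y \<subseteq> carrier V" and sub: "cfun.subspace (\<iota> ` Y)" and st: "\<And>x v. x \<in> L \<Longrightarrow> v \<in> \<iota> ` Y \<Longrightarrow> act x v \<in> \<iota> ` Y"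
    by (auto simp: stable_subspace_def)
  have mem: "v \<in> Y" if "\<iota> v \<in> \<iota> ` Y" "v \<in> carrier V" for v
    using that Y \<iota>_eq_iff by blast
  show "submod L V Y"
    unfolding submod_iff[OF module]
  proof (intro conjI ballI allI)
    show "zero V \<in> Y" using mem zero_closed \<iota>_zero cfun.subspace_0[OF sub] by metis
    fix v assume v: "v \<in> Y"
    show "c \<odot>\<^bsub>V\<^esub> v \<in> Y" for c
      by (rule mem) (use v Y cfun.subspace_scale[OF sub, of "\<iota> v" c] \<iota>_smult[of v c] smult_closed in auto)
    show "lact V x v \<in> Y" if "x \<in> L" for x
    proof (rule mem)
      have xv: "x \<in> g" "v \<in> carrier V" using that assms v Y by blast+
      show "\<iota> (lact V x v) \<in> \<iota> ` Y" unfolding \<iota>_lact[OF xv] using st[OF that] v by blast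
      show "lact V x v \<in> carrier V" by (rule lact_closed[OF xv])
    qed
    fix w assume w: "w \<in> Y"
    show "v \<oplus>\<^bsub>V\<^esub> w \<in> Y"
    proof (rule mem)
      have vw: "v \<in> carrier V" "w \<in> carrier V" using v w Y by blast+
      show "\<iota> (v \<oplus>\<^bsub>V\<^esub> w) \<in> \<iota> ` Y" unfolding \<iota>_add[OF vw] by (intro cfun.subspace_add[OF sub] imageI v w)
      show "v \<oplus>\<^bsub>V\<^esub> w \<in> carrier V" by (rule add_closed[OF vw])
    qed
  qed (rule Y)
qed

lemma submod_vimage:
  assumes "L \<subseteq> g" "stable_subspace L act Z" "Z \<subseteq> M"
  shows "submod L V {v \<in> carrier V. \<iota> v \<in> Z}" "\<iota> ` {v \<in> carrier V. \<iota> v \<in> Z} = Z"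
proof -
  show "\<iota> ` {v \<in> carrier V. \<iota> v \<in> Z} = Z"
    using bij assms(3) unfolding bij_betw_def by blast
  then show "submod L V {v \<in> carrier V. \<iota> v \<in> Z}"
    unfolding submod_model[OF assms(1)] using assms(2) by auto
qed

lemma submod_carrier: "L \<subseteq> g \<Longrightarrow> submod L V (carrier V)"
  unfolding submod_iff[OF module] using add_closed smult_closed zero_closed lact_closed by auto

lemma submod_gen:
  assumes "L \<subseteq> g" "F \<subseteq> carrier V"
  shows "submod L V (gen L V F)" "F \<subseteq> gen L V F" "gen L V F \<subseteq> carrier V"
proof -
  show c: "gen L V F \<subseteq> carrier V"
    unfolding gen_def using submod_carrier[OF assms(1)] assms(2) by blast
  show "F \<subseteq> gen L V F" unfolding gen_def by blast
  show "submod L V (gen L V F)"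
    using c unfolding submod_iff[OF module] gen_def by blast
qed

lemma gen_least: "submod L V Y \<Longrightarrow> F \<subseteq> Y \<Longrightarrow> gen L V F \<subseteq> Y"
  unfolding gen_def by blast

lemma submod_restr:
  assumes "submod L V X'" "L \<subseteq> g"
  shows "submod L (restr V X') Y \<longleftrightarrow> submod L V Y \<and> Y \<subseteq> X'"
proof -
  have X': "X' \<subseteq> carrier V" "zero V \<in> X'" "\<And>v w. v \<in> X' \<Longrightarrow> w \<in> X' \<Longrightarrow> v \<oplus>\<^bsub>V\<^esub> w \<in> X'"
    "\<And>c v. v \<in> X' \<Longrightarrow> c \<odot>\<^bsub>V\<^esub> v \<in> X'"
    using assms(1) unfolding submod_iff[OF module] by blast+
  have "submodule X' CC V" using assms(1) by (simp add: submod_def)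
  then have "module CC (V\<lparr>carrier := X'\<rparr>)" using submodule.submodule_is_module[OF _ module] by blast
  then have "module CC (restr V X')" by (simp add: restr_def)
  from submod_iff[OF this, of L Y] show ?thesis
    using X'(1) unfolding submod_iff[OF module] restr_simps by blast
qed

end

section \<open>Subquotients and composition series\<close>

locale subquotient = lmod_model g M act V \<iota>
  for g and M :: "('i \<Rightarrow> complex) set" and act and V :: "(cmat, 'v) lmod" and \<iota> +
  fixes L A B
  assumes L: "L \<subseteq> g" and A: "submod L V A" and B: "submod L V B" and BA: "B \<subseteq> A"
begin

abbreviation "Q \<equiv> quot_mod (restr V A) B"

definition coset :: "'v \<Rightarrow> 'v set" where "coset a = {b \<oplus>\<^bsub>V\<^esub> a | b. b \<in> B}"

lemma A_carrier: "A \<subseteq> carrier V" and B_carrier: "B \<subseteq> carrier V"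
  and B_sub: "cfun.subspace (\<iota> ` B)" and A_sub: "cfun.subspace (\<iota> ` A)"
  using A B unfolding submod_model[OF L] stable_subspace_def by auto

lemma in_coset: "a \<in> carrier V \<Longrightarrow> w \<in> coset a \<longleftrightarrow> w \<in> carrier V \<and> \<iota> w - \<iota> a \<in> \<iota> ` B"
proof
  assume a: "a \<in> carrier V" and "w \<in> coset a"
  then obtain b where b: "b \<in> B" "w = b \<oplus>\<^bsub>V\<^esub> a" by (auto simp: coset_def)
  then have "\<iota> w = \<iota> b + \<iota> a" using a B_carrier \<iota>_add by blast
  then show "w \<in> carrier V \<and> \<iota> w - \<iota> a \<in> \<iota> ` B" using a b B_carrier add_closed by auto
next
  assume a: "a \<in> carrier V" and w: "w \<in> carrier V \<and> \<iota> w - \<iota> a \<in> \<iota> ` B"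
  then obtain b where b: "b \<in> B" "\<iota> w - \<iota> a = \<iota> b" by blast
  have "\<iota> w = (\<iota> w - \<iota> a) + \<iota> a" by (simp only: diff_add_cancel)
  also have "\<dots> = \<iota> (b \<oplus>\<^bsub>V\<^esub> a)" using a b B_carrier \<iota>_add[of b a] by (simp only: subsetD)
  finally have "w = b \<oplus>\<^bsub>V\<^esub> a" using a w b B_carrier add_closed \<iota>_eqI by blast
  then show "w \<in> coset a" using b by (auto simp: coset_def)
qed

lemma coset_self: "a \<in> carrier V \<Longrightarrow> a \<in> coset a"
  using cfun.subspace_0[OF B_sub] by (simp add: in_coset)

lemma coset_eq: "a \<in> carrier V \<Longrightarrow> a' \<in> carrier V \<Longrightarrow> coset a = coset a' \<longleftrightarrow> \<iota> a - \<iota> a' \<in> \<iota> ` B"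
proof
  assume a: "a \<in> carrier V" "a' \<in> carrier V"
  show "\<iota> a - \<iota> a' \<in> \<iota> ` B" if "coset a = coset a'"
    using coset_self[OF a(1)] unfolding that in_coset[OF a(2)] by simp
  assume d: "\<iota> a - \<iota> a' \<in> \<iota> ` B"
  have "v - \<iota> a \<in> \<iota> ` B \<longleftrightarrow> v - \<iota> a' \<in> \<iota> ` B" for v
  proof -
    have e: "(\<iota> a - \<iota> a') + (v - \<iota> a) = v - \<iota> a'" "(v - \<iota> a') - (\<iota> a - \<iota> a') = v - \<iota> a"
      by (rule ext, simp)+
    show ?thesis
      using cfun.subspace_add[OF B_sub d, of "v - \<iota> a"] cfun.subspace_diff[OF B_sub _ d, of "v - \<iota> a'"]
      unfolding e by blast
  qed
  then show "coset a = coset a'" by (intro Set.set_eqI) (simp only: in_coset a)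
qed

lemma coset_B: "a \<in> B \<Longrightarrow> coset a = B"
proof -
  assume a: "a \<in> B"
  have "w \<in> carrier V \<and> \<iota> w - \<iota> a \<in> \<iota> ` B \<longleftrightarrow> w \<in> B" for w
  proof
    assume w: "w \<in> carrier V \<and> \<iota> w - \<iota> a \<in> \<iota> ` B"
    then have "(\<iota> w - \<iota> a) + \<iota> a \<in> \<iota> ` B" using a cfun.subspace_add[OF B_sub] by blast
    then have "\<iota> w \<in> \<iota> ` B" by (simp only: diff_add_cancel)
    then show "w \<in> B" using w B_carrier \<iota>_eqI by blast
  next
    assume "w \<in> B"
    then show "w \<in> carrier V \<and> \<iota> w - \<iota> a \<in> \<iota> ` B" using a B_carrier cfun.subspace_diff[OF B_sub] by blast
  qed
  then show "coset a = B" by (intro Set.set_eqI) (simp only: in_coset[OF subsetD[OF B_carrier a]])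
qed

lemma Q_carrier: "carrier Q = coset ` A" and Q_zero: "zero Q = B"
proof -
  have "B +>\<^bsub>restr V A\<^esub> a = coset a" for a by (auto simp: a_r_coset_def' coset_def)
  then show "carrier Q = coset ` A" by (simp add: quot_mod_def A_RCOSETS_def' a_r_coset_def' image_def) (auto simp: a_r_coset_def')
qed (simp add: quot_mod_def)

lemma Q_add:
  assumes a: "a \<in> A" "a' \<in> A"
  shows "coset a \<oplus>\<^bsub>Q\<^esub> coset a' = coset (a \<oplus>\<^bsub>V\<^esub> a')"
proof (rule Set.set_eqI)
  fix w
  have c: "a \<in> carrier V" "a' \<in> carrier V" "a \<oplus>\<^bsub>V\<^esub> a' \<in> carrier V" using a A_carrier add_closed by blast+
  have "w \<in> coset a \<oplus>\<^bsub>Q\<^esub> coset a' \<longleftrightarrow> (\<exists>v\<in>coset a. \<exists>v'\<in>coset a'. w = v \<oplus>\<^bsub>V\<^esub> v')"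
    by (auto simp: quot_mod_def set_add_def')
  also have "\<dots> \<longleftrightarrow> w \<in> coset (a \<oplus>\<^bsub>V\<^esub> a')"
  proof
    assume "\<exists>v\<in>coset a. \<exists>v'\<in>coset a'. w = v \<oplus>\<^bsub>V\<^esub> v'"
    then obtain v v' where "v \<in> coset a" "v' \<in> coset a'" "w = v \<oplus>\<^bsub>V\<^esub> v'" by blast
    then have v: "v \<in> carrier V" "\<iota> v - \<iota> a \<in> \<iota> ` B" "v' \<in> carrier V" "\<iota> v' - \<iota> a' \<in> \<iota> ` B" "w = v \<oplus>\<^bsub>V\<^esub> v'"
      by (simp_all add: in_coset[OF c(1)] in_coset[OF c(2)])
    have "(\<iota> v - \<iota> a) + (\<iota> v' - \<iota> a') \<in> \<iota> ` B" by (rule cfun.subspace_add[OF B_sub v(2,4)])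
    also have "(\<iota> v - \<iota> a) + (\<iota> v' - \<iota> a') = \<iota> w - \<iota> (a \<oplus>\<^bsub>V\<^esub> a')"
      unfolding v(5) \<iota>_add[OF v(1,3)] \<iota>_add[OF c(1,2)] by (simp only: add_diff_add)
    finally show "w \<in> coset (a \<oplus>\<^bsub>V\<^esub> a')" unfolding in_coset[OF c(3)] using add_closed[OF v(1,3)] unfolding v(5) by blast
  next
    assume "w \<in> coset (a \<oplus>\<^bsub>V\<^esub> a')"
    then obtain b where b: "b \<in> B" "w = b \<oplus>\<^bsub>V\<^esub> (a \<oplus>\<^bsub>V\<^esub> a')" by (auto simp: coset_def)
    interpret V: abelian_group V by (rule abelian_group)
    have "w = (b \<oplus>\<^bsub>V\<^esub> a) \<oplus>\<^bsub>V\<^esub> a'" using b B_carrier c by (simp add: V.a_assoc subset_iff)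
    then show "\<exists>v\<in>coset a. \<exists>v'\<in>coset a'. w = v \<oplus>\<^bsub>V\<^esub> v'"
      using b(1) coset_self[OF c(2)] unfolding coset_def by blast
  qed
  finally show "w \<in> coset a \<oplus>\<^bsub>Q\<^esub> coset a' \<longleftrightarrow> w \<in> coset (a \<oplus>\<^bsub>V\<^esub> a')" .
qed

lemma coset_image:
  assumes a: "a \<in> carrier V" and f: "\<And>v. v \<in> carrier V \<Longrightarrow> f v \<in> carrier V"
    and d: "\<And>v. v \<in> carrier V \<Longrightarrow> \<iota> v - \<iota> a \<in> \<iota> ` B \<Longrightarrow> \<iota> (f v) - \<iota> (f a) \<in> \<iota> ` B"
  shows "(\<Union>v\<in>coset a. B +>\<^bsub>restr V A\<^esub> f v) = coset (f a)"
proof -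
  have "B +>\<^bsub>restr V A\<^esub> f v = coset (f a)" if "v \<in> coset a" for v
  proof -
    have v: "v \<in> carrier V" "\<iota> v - \<iota> a \<in> \<iota> ` B" using that unfolding in_coset[OF a] by blast+
    have "B +>\<^bsub>restr V A\<^esub> f v = coset (f v)" by (auto simp: a_r_coset_def' coset_def)
    also have "\<dots> = coset (f a)" using coset_eq[OF f[OF v(1)] f[OF a]] d[OF v] by simp
    finally show ?thesis .
  qed
  moreover have "coset a \<noteq> {}" using coset_self[OF a] by blast
  ultimately show ?thesis by simp
qed

lemma Q_smult: "a \<in> A \<Longrightarrow> c \<odot>\<^bsub>Q\<^esub> coset a = coset (c \<odot>\<^bsub>V\<^esub> a)"
proof -
  assume "a \<in> A"
  then have a: "a \<in> carrier V" using A_carrier by blast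
  have "(\<Union>v\<in>coset a. B +>\<^bsub>restr V A\<^esub> (c \<odot>\<^bsub>V\<^esub> v)) = coset (c \<odot>\<^bsub>V\<^esub> a)"
  proof (rule coset_image[OF a smult_closed])
    fix v assume v: "v \<in> carrier V" "\<iota> v - \<iota> a \<in> \<iota> ` B"
    then show "\<iota> (c \<odot>\<^bsub>V\<^esub> v) - \<iota> (c \<odot>\<^bsub>V\<^esub> a) \<in> \<iota> ` B"
      unfolding \<iota>_smult[OF v(1)] \<iota>_smult[OF a] cfun.scale_right_diff_distrib[symmetric]
      by (intro cfun.subspace_scale[OF B_sub])
  qed
  then show ?thesis by (simp add: quot_mod_def)
qed

lemma act_diff: "x \<in> g \<Longrightarrow> v \<in> M \<Longrightarrow> w \<in> M \<Longrightarrow> act x (v - w) = act x v - act x w"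
proof -
  assume x: "x \<in> g" "v \<in> M" "w \<in> M"
  have "act x ((v - w) + w) = act x (v - w) + act x w"
    by (rule act_add[OF x(1) cfun.subspace_diff[OF subspace_rep x(2,3)] x(3)])
  then show ?thesis by (simp only: diff_add_cancel eq_diff_eq)
qed

lemma Q_lact: "a \<in> A \<Longrightarrow> x \<in> L \<Longrightarrow> lact Q x (coset a) = coset (lact V x a)"
proof -
  assume "a \<in> A" and x: "x \<in> L"
  then have a: "a \<in> carrier V" and xg: "x \<in> g" using A_carrier L by blast+
  have "(\<Union>v\<in>coset a. B +>\<^bsub>restr V A\<^esub> (lact V x v)) = coset (lact V x a)"
  proof (rule coset_image[OF a lact_closed[OF xg]])
    fix v assume v: "v \<in> carrier V" "\<iota> v - \<iota> a \<in> \<iota> ` B"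
    have "act x (\<iota> v - \<iota> a) \<in> \<iota> ` B"
      using B v(2) x unfolding submod_model[OF L] stable_subspace_def by blast
    then show "\<iota> (lact V x v) - \<iota> (lact V x a) \<in> \<iota> ` B"
      unfolding \<iota>_lact[OF xg v(1)] \<iota>_lact[OF xg a] act_diff[OF xg \<iota>_in[OF v(1)] \<iota>_in[OF a]] .
  qed
  then show ?thesis by (simp add: quot_mod_def)
qed

text \<open>The preimage in \<open>A\<close> of a submodule of the quotient is a submodule between
  \<open>B\<close> and \<open>A\<close>, hence one of the two.\<close>

lemma simple_of_maximal:
  assumes "A \<noteq> B" and max: "\<And>Y. submod L V Y \<Longrightarrow> B \<subseteq> Y \<Longrightarrow> Y \<subseteq> A \<Longrightarrow> Y = A \<or> Y = B"
  shows "simple_mod L Q"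
  unfolding simple_mod_def
proof (intro conjI allI impI)
  obtain a where a: "a \<in> A" "a \<notin> B" using assms(1) BA by blast
  then have "coset a \<noteq> B" using coset_self[of a] A_carrier by blast
  then show "carrier Q \<noteq> {zero Q}" using a by (auto simp: Q_carrier Q_zero)
  fix Y assume Y: "submod L Q Y"
  then have sY: "submodule Y CC Q" by (simp add: submod_def)
  let ?A = "{a \<in> A. coset a \<in> Y}"
  have A': "zero V \<in> A" "\<And>v w. v \<in> A \<Longrightarrow> w \<in> A \<Longrightarrow> v \<oplus>\<^bsub>V\<^esub> w \<in> A"
    "\<And>c v. v \<in> A \<Longrightarrow> c \<odot>\<^bsub>V\<^esub> v \<in> A" "\<And>x v. x \<in> L \<Longrightarrow> v \<in> A \<Longrightarrow> lact V x v \<in> A"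
    using A unfolding submod_iff[OF module] by blast+
  have zB: "zero V \<in> B" using B unfolding submod_iff[OF module] by blast
  have "submod L V ?A"
    unfolding submod_iff[OF module]
  proof (intro conjI ballI allI)
    show "zero V \<in> ?A" using A'(1) coset_B[OF zB] submodule_closed(2)[OF sY] by (simp add: Q_zero)
    fix v assume v: "v \<in> ?A"
    show "c \<odot>\<^bsub>V\<^esub> v \<in> ?A" for c using v A'(3) submodule_closed(4)[OF sY, of "coset v" c] by (simp add: Q_smult)
    show "lact V x v \<in> ?A" if "x \<in> L" for x
      using v A'(4)[OF that] Y that unfolding submod_def by (auto simp: Q_lact[symmetric])
    show "v \<oplus>\<^bsub>V\<^esub> w \<in> ?A" if "w \<in> ?A" for w
      using v that A'(2) submodule_closed(3)[OF sY, of "coset v" "coset w"] by (simp add: Q_add)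
  qed (use A_carrier in blast)
  moreover have "B \<subseteq> ?A" using BA coset_B submodule_closed(2)[OF sY] by (auto simp: Q_zero)
  ultimately consider "?A = A" | "?A = B" using max[of ?A] by blast
  then show "Y = {zero Q} \<or> Y = carrier Q"
  proof cases
    case 1
    then show ?thesis using submodule_closed(1)[OF sY] by (auto simp: Q_carrier)
  next
    case 2
    have "y = B" if y: "y \<in> Y" for y
    proof -
      obtain a where a: "a \<in> A" "y = coset a" using y submodule_closed(1)[OF sY] unfolding Q_carrier by blast
      then have "a \<in> B" using y 2 by blast
      then show ?thesis using a coset_B by blast
    qed
    moreover have "zero Q \<in> Y" by (rule submodule_closed(2)[OF sY])
    ultimately have "Y = {zero Q}" unfolding Q_zero by blast
    then show ?thesis ..
  qed
qed

end

context lmod_model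
begin

text \<open>The bound provides a longest strict chain from 0 to \<open>D\<close>. It admits no
  refinement, so its subquotients are simple.\<close>

lemma has_finite_length_of_bound:
  assumes L: "L \<subseteq> g" and D: "submod L V D" and bound: "chain_bounded L act (\<iota> ` D) c"
  shows "has_finite_length L (restr V D)"
proof -
  define chain where "chain k W \<longleftrightarrow> W 0 = {zero V} \<and> W k = D \<and> (\<forall>i\<le>k. submod L V (W i)) \<and> (\<forall>i<k. W i \<subset> W (Suc i))"
    for k and W :: "nat \<Rightarrow> 'v set"
  have below: "W i \<subseteq> W j" if "chain k W" "i \<le> j" "j \<le> k" for k W i j
    using that(2,3)
  proof (induction rule: dec_induct)
    case (step n)
    then have "W i \<subseteq> W n" "W n \<subset> W (Suc n)" using that(1) by (simp_all add: chain_def)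
    then show ?case by blast
  qed simp
  have len: "k \<le> c" if W: "chain k W" for k W
  proof -
    have neq: "\<iota> ` W i \<noteq> \<iota> ` W (Suc i)" if i: "i < k" for i
    proof
      assume e: "\<iota> ` W i = \<iota> ` W (Suc i)"
      have "W i \<subseteq> carrier V" "W (Suc i) \<subseteq> carrier V"
        using W i unfolding chain_def submod_iff[OF module] by (meson Suc_leI less_imp_le)+
      then have "W i = W (Suc i)" using e \<iota>_eqI by blast
      then show False using W i unfolding chain_def by blast
    qed
    have "card {i. i < k \<and> \<iota> ` W i \<noteq> \<iota> ` W (Suc i)} \<le> c"
    proof (rule bound[unfolded chain_bounded_def, rule_format])
      fix i assume i: "i \<le> k"
      have "submod L V (W i)" using W i unfolding chain_def by blast
      moreover have "W i \<subseteq> D" using below[OF W i] W unfolding chain_def by blast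
      ultimately show "stable_subspace L act (\<iota> ` W i) \<and> \<iota> ` W i \<subseteq> \<iota> ` D"
        unfolding submod_model[OF L] by blast
    next
      fix i assume "i < k"
      then show "\<iota> ` W i \<subseteq> \<iota> ` W (Suc i)" using W unfolding chain_def by blast
    qed
    moreover have "{i. i < k \<and> \<iota> ` W i \<noteq> \<iota> ` W (Suc i)} = {..<k}" using neq by auto
    ultimately show ?thesis by simp
  qed
  have "act x 0 = 0" if "x \<in> g" for x
    using act_add[OF that cfun.subspace_0[OF subspace_rep] cfun.subspace_0[OF subspace_rep]] by simp
  then have "stable_subspace L act {0}"
    using L unfolding stable_subspace_def by (auto simp only: cfun.subspace_single_0 singleton_iff subset_iff)
  then have zero_sub: "submod L V {zero V}"
    unfolding submod_model[OF L] using zero_closed \<iota>_zero by simp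
  have zD: "zero V \<in> D" using D unfolding submod_iff[OF module] by blast
  \<comment> \<open>If \<open>D\<close> is zero, the only strict chain has length 0; otherwise 0 and
    \<open>D\<close> form one of length 1.\<close>
  have ex: "\<exists>k W. chain k W"
  proof (cases "D = {zero V}")
    case True
    then show ?thesis using zero_sub by (intro exI[of _ 0] exI[of _ "\<lambda>_. D"]) (auto simp: chain_def)
  next
    case False
    then show ?thesis using zero_sub D zD
      by (intro exI[of _ 1] exI[of _ "\<lambda>i. if i = 0 then {zero V} else D"]) (auto simp: chain_def)
  qed
  define k where "k = Greatest (\<lambda>k. \<exists>W. chain k W)"
  have "\<exists>W. chain k W"
    unfolding k_def by (rule GreatestI_ex_nat[OF ex, of c]) (use len in blast)
  then obtain W where W: "chain k W" by blast
  have kmax: "k' \<le> k" if "chain k' W'" for k' W'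
    unfolding k_def by (rule Greatest_le_nat[of _ _ c]) (use that len in blast)+
  show ?thesis
    unfolding has_finite_length_def
  proof (intro exI[of _ k] exI[of _ W] conjI allI impI)
    show "W 0 = {zero (restr V D)}" "W k = carrier (restr V D)" using W by (simp_all add: chain_def)
    show "submod L (restr V D) (W i)" if "i \<le> k" for i
      unfolding submod_restr[OF D L] using W below[OF W that] that by (auto simp: chain_def)
    fix i assume i: "i < k"
    show "W i \<subseteq> W (Suc i)" using W i by (auto simp: chain_def)
    interpret s: subquotient g M act V \<iota> L "W (Suc i)" "W i"
      by unfold_locales (use L W i in \<open>auto simp: chain_def\<close>)
    have "simple_mod L s.Q"
    proof (rule s.simple_of_maximal)
      show "W (Suc i) \<noteq> W i" using W i by (auto simp: chain_def)
      fix Y assume Y: "submod L V Y" "W i \<subseteq> Y" "Y \<subseteq> W (Suc i)"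
      show "Y = W (Suc i) \<or> Y = W i"
      proof (rule ccontr)
        assume neq: "\<not> (Y = W (Suc i) \<or> Y = W i)"
        \<comment> \<open>Inserting \<open>Y\<close> after index \<open>i\<close> gives a strict
          chain of length \<open>Suc k\<close>, against the maximality of \<open>k\<close>.\<close>
        define W' where "W' j = (if j \<le> i then W j else if j = Suc i then Y else W (j - 1))" for j
        have "chain (Suc k) W'"
          unfolding chain_def
        proof (intro conjI allI impI)
          show "W' 0 = {zero V}" "W' (Suc k) = D" using W i by (auto simp: W'_def chain_def)
          show "submod L V (W' j)" if "j \<le> Suc k" for j
            using that W Y i by (auto simp: W'_def chain_def)
          fix j assume j: "j < Suc k"
          consider "j < i" | "j = i" | "j = Suc i" | "j > Suc i" by linarith
          then show "W' j \<subset> W' (Suc j)"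
          proof cases
            case 4
            then obtain j' where j': "j = Suc j'" by (cases j) auto
            then have "W j' \<subset> W (Suc j')" using W j by (simp add: chain_def)
            then show ?thesis using 4 j' by (simp add: W'_def)
          qed (use W Y neq i in \<open>auto simp: W'_def chain_def\<close>)
        qed
        then show False using kmax by fastforce
      qed
    qed
    then show "simple_mod L (quot_mod (restr (restr V D) (W (Suc i))) (W i))" by simp
  qed
qed

end

text \<open>The product of the operators \<open>h - \<mu>\<close> over a list. A vector killed by it
  is a sum of generalised eigenvectors of \<open>h\<close> with eigenvalues in the list, so lists
  stand for the spectrum without any choice of eigenvectors.\<close>

definition shift_prod :: "(cmat \<Rightarrow> ('i \<Rightarrow> complex) \<Rightarrow> 'i \<Rightarrow> complex) \<Rightarrow> cmat \<Rightarrow> complex list \<Rightarrow> ('i \<Rightarrow> complex) \<Rightarrow> 'i \<Rightarrow> complex" where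
  "shift_prod act h \<mu>s v = foldr (\<lambda>\<mu> v. act h v - fscale \<mu> v) \<mu>s v"

lemma shift_prod_simps:
  "shift_prod act h [] v = v"
  "shift_prod act h (\<mu> # \<mu>s) v = act h (shift_prod act h \<mu>s v) - fscale \<mu> (shift_prod act h \<mu>s v)"
  by (simp_all add: shift_prod_def)

lemma shift_prod_append: "shift_prod act h (\<mu>s @ \<nu>s) v = shift_prod act h \<mu>s (shift_prod act h \<nu>s v)"
  by (simp add: shift_prod_def)

lemma shift_prod_closed:
  assumes "cfun.subspace Z" "\<And>v. v \<in> Z \<Longrightarrow> act h v \<in> Z" "v \<in> Z"
  shows "shift_prod act h \<mu>s v \<in> Z"
proof (induction \<mu>s)
  case (Cons \<mu> \<mu>s)
  show ?case unfolding shift_prod_simps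
    by (intro cfun.subspace_diff cfun.subspace_scale assms Cons)
qed (simp add: shift_prod_simps assms)

context subquotient
begin

lemma iota_mem: "v \<in> carrier V \<Longrightarrow> \<iota> v \<in> \<iota> ` B \<longleftrightarrow> v \<in> B" "v \<in> carrier V \<Longrightarrow> \<iota> v \<in> \<iota> ` A \<longleftrightarrow> v \<in> A"
  using A_carrier B_carrier \<iota>_eqI by blast+

text \<open>The first partial product that falls into \<open>B\<close> yields an eigenvector of the quotient.\<close>

lemma eigenvector_exists:
  assumes h: "h \<in> L" and v: "v \<in> \<iota> ` A" "v \<notin> \<iota> ` B" "shift_prod act h \<mu>s v \<in> \<iota> ` B"
  shows "\<exists>w\<in>\<iota> ` A. w \<notin> \<iota> ` B \<and> (\<exists>\<mu>. act h w - fscale \<mu> w \<in> \<iota> ` B)"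
  using v(3)
proof (induction \<mu>s)
  case Nil
  then show ?case using v(2) by (simp add: shift_prod_simps)
next
  case (Cons \<mu> \<mu>s)
  have "act h v \<in> \<iota> ` A" if "v \<in> \<iota> ` A" for v
    using A h that unfolding submod_model[OF L] stable_subspace_def by blast
  then have "shift_prod act h \<mu>s v \<in> \<iota> ` A" using A_sub v(1) by (intro shift_prod_closed) auto
  then show ?case using Cons unfolding shift_prod_simps by blast
qed

text \<open>A simple module is nonzero, whereas the quotient of \<open>A\<close> by itself is
  zero.\<close>

lemma iso_proper:
  assumes S: "lie_module L S" "simple_mod L S" and iso: "lmod_iso L Q S"
  shows "A \<noteq> B"
proof
  assume e: "A = B"
  obtain f where f: "bij_betw f (carrier Q) (carrier S)" using iso unfolding lmod_iso_def by blast
  have "B \<noteq> {}" using B unfolding submod_iff[OF module] by blast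
  then have "coset ` A = {B}" using coset_B e by auto
  then have "f ` {B} = carrier S" using f by (simp add: bij_betw_def Q_carrier)
  then obtain t where t: "carrier S = {t}" by blast
  interpret S: module CC S using S(1) by (simp add: lie_module_def)
  have "zero S \<in> carrier S" by simp
  then have "carrier S = {zero S}" using t by (metis singletonD)
  then show False using S(2) by (simp add: simple_mod_def)
qed

lemma iso_eigenvector:
  assumes h: "h \<in> L" and S: "lie_module L S" and iso: "lmod_iso L Q S"
    and w: "w \<in> \<iota> ` A" "w \<notin> \<iota> ` B" "act h w - fscale \<mu> w \<in> \<iota> ` B"
  shows "\<exists>s\<in>carrier S. s \<noteq> zero S \<and> lact S h s = \<mu> \<odot>\<^bsub>S\<^esub> s"
proof -
  obtain f where f: "bij_betw f (carrier Q) (carrier S)"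
    "\<And>v w. v \<in> carrier Q \<Longrightarrow> w \<in> carrier Q \<Longrightarrow> f (v \<oplus>\<^bsub>Q\<^esub> w) = f v \<oplus>\<^bsub>S\<^esub> f w"
    "\<And>c v. v \<in> carrier Q \<Longrightarrow> f (c \<odot>\<^bsub>Q\<^esub> v) = c \<odot>\<^bsub>S\<^esub> f v"
    "\<And>x v. x \<in> L \<Longrightarrow> v \<in> carrier Q \<Longrightarrow> f (lact Q x v) = lact S x (f v)"
    using iso unfolding lmod_iso_def by blast
  interpret S: module CC S using S by (simp add: lie_module_def)
  have zB: "zero V \<in> B" "zero V \<in> A" using B A unfolding submod_iff[OF module] by blast+
  have BQ: "B \<in> carrier Q" unfolding Q_carrier using coset_B[OF zB(1)] zB(2) by (metis imageI)
  have "B \<oplus>\<^bsub>Q\<^esub> B = B"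
    using Q_add[OF zB(2) zB(2)] coset_B[OF zB(1)] coset_B submodule_closed(3)[of B V] B zB(1)
    by (simp add: submod_def)
  then have "f B \<oplus>\<^bsub>S\<^esub> f B = f B" using f(2)[OF BQ BQ] by simp
  moreover have fB: "f B \<in> carrier S" using f(1) BQ by (auto simp: bij_betw_def)
  ultimately have fz: "f B = zero S" by (metis S.add.r_cancel_one)
  obtain a where a: "a \<in> A" "w = \<iota> a" using w(1) by blast
  have ac: "a \<in> carrier V" using a A_carrier by blast
  have hg: "h \<in> g" using h L by blast
  have haA: "lact V h a \<in> A" "\<mu> \<odot>\<^bsub>V\<^esub> a \<in> A" using A a(1) h unfolding submod_iff[OF module] by blast+
  have "coset (lact V h a) = coset (\<mu> \<odot>\<^bsub>V\<^esub> a)"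
    unfolding coset_eq[OF lact_closed[OF hg ac] smult_closed[OF ac]] \<iota>_lact[OF hg ac] \<iota>_smult[OF ac]
    using w(3) a(2) by simp
  then have "lact Q h (coset a) = \<mu> \<odot>\<^bsub>Q\<^esub> coset a" using a h by (simp only: Q_lact Q_smult)
  moreover have aQ: "coset a \<in> carrier Q" using a by (auto simp: Q_carrier)
  ultimately have "lact S h (f (coset a)) = \<mu> \<odot>\<^bsub>S\<^esub> f (coset a)" using f(3,4) h by metis
  moreover have "coset a \<noteq> B"
    using coset_self[OF ac] w(2) a(2) by blast
  then have "f (coset a) \<noteq> zero S" using f(1) aQ BQ fz unfolding bij_betw_def inj_on_def by metis
  moreover have "f (coset a) \<in> carrier S" using f(1) aQ by (auto simp: bij_betw_def)
  ultimately show ?thesis by blast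
qed

lemma iso_scalar:
  assumes h: "h \<in> L" and iso: "lmod_iso L Q S" and scal: "\<And>s. s \<in> carrier S \<Longrightarrow> lact S h s = \<chi> \<odot>\<^bsub>S\<^esub> s"
    and v: "v \<in> \<iota> ` A"
  shows "act h v - fscale \<chi> v \<in> \<iota> ` B"
proof -
  obtain f where f: "bij_betw f (carrier Q) (carrier S)"
    "\<And>c v. v \<in> carrier Q \<Longrightarrow> f (c \<odot>\<^bsub>Q\<^esub> v) = c \<odot>\<^bsub>S\<^esub> f v"
    "\<And>x v. x \<in> L \<Longrightarrow> v \<in> carrier Q \<Longrightarrow> f (lact Q x v) = lact S x (f v)"
    using iso unfolding lmod_iso_def by blast
  obtain a where a: "a \<in> A" "v = \<iota> a" using v by blast
  have ac: "a \<in> carrier V" using a A_carrier by blast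
  have hg: "h \<in> g" using h L by blast
  have haA: "lact V h a \<in> A" "\<chi> \<odot>\<^bsub>V\<^esub> a \<in> A" using A a(1) h unfolding submod_iff[OF module] by blast+
  have aQ: "coset a \<in> carrier Q" "coset (lact V h a) \<in> carrier Q" "coset (\<chi> \<odot>\<^bsub>V\<^esub> a) \<in> carrier Q"
    using a haA by (auto simp: Q_carrier)
  have "f (coset a) \<in> carrier S" using f(1) aQ by (auto simp: bij_betw_def)
  then have "f (coset (lact V h a)) = f (coset (\<chi> \<odot>\<^bsub>V\<^esub> a))"
    using f(2,3) aQ(1) h scal a(1) by (metis Q_lact Q_smult)
  then have "coset (lact V h a) = coset (\<chi> \<odot>\<^bsub>V\<^esub> a)" using f(1) aQ unfolding bij_betw_def inj_on_def by blast
  then show ?thesis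
    unfolding coset_eq[OF lact_closed[OF hg ac] smult_closed[OF ac]] \<iota>_lact[OF hg ac] \<iota>_smult[OF ac] a(2) .
qed

text \<open>On the quotient \<open>h\<close> is the scalar \<open>\<chi>\<close>, so the product
  acts as the product of the numbers \<open>\<chi> - \<mu>\<close>, which is nonzero.\<close>

lemma shift_prod_mod:
  assumes h: "h \<in> L" and scal: "\<And>v. v \<in> \<iota> ` A \<Longrightarrow> act h v - fscale \<chi> v \<in> \<iota> ` B"
    and v: "v \<in> \<iota> ` A" "v \<notin> \<iota> ` B" and \<mu>s: "\<chi> \<notin> set \<mu>s"
  shows "shift_prod act h \<mu>s v \<in> \<iota> ` A \<and> shift_prod act h \<mu>s v \<notin> \<iota> ` B"
  using \<mu>s
proof (induction \<mu>s)
  case (Cons \<mu> \<mu>s)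
  let ?u = "shift_prod act h \<mu>s v"
  have u: "?u \<in> \<iota> ` A" "?u \<notin> \<iota> ` B" using Cons by auto
  have "act h ?u \<in> \<iota> ` A" using A h u(1) unfolding submod_model[OF L] stable_subspace_def by blast
  then have inA: "act h ?u - fscale \<mu> ?u \<in> \<iota> ` A" by (intro cfun.subspace_diff[OF A_sub] cfun.subspace_scale[OF A_sub] u(1))
  have "act h ?u - fscale \<mu> ?u \<notin> \<iota> ` B"
  proof
    assume "act h ?u - fscale \<mu> ?u \<in> \<iota> ` B"
    then have "(act h ?u - fscale \<mu> ?u) - (act h ?u - fscale \<chi> ?u) \<in> \<iota> ` B"
      using scal[OF u(1)] by (rule cfun.subspace_diff[OF B_sub])
    also have "(act h ?u - fscale \<mu> ?u) - (act h ?u - fscale \<chi> ?u) = fscale (\<chi> - \<mu>) ?u"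
      by (rule ext) (simp add: algebra_simps)
    finally have "fscale (inverse (\<chi> - \<mu>)) (fscale (\<chi> - \<mu>) ?u) \<in> \<iota> ` B" by (rule cfun.subspace_scale[OF B_sub])
    moreover have "fscale (inverse (\<chi> - \<mu>)) (fscale (\<chi> - \<mu>) ?u) = ?u"
      using Cons.prems by (intro ext) (simp add: field_simps)
    ultimately show False using u(2) by (simp only:)
  qed
  then show ?case using inA unfolding shift_prod_simps by blast
qed (use v in \<open>simp add: shift_prod_simps\<close>)

end

text \<open>Schur's lemma in arbitrary dimension, the eigenvector being given: the eigenspace of a
  central element is a nonzero submodule.\<close>

lemma central_scalar:
  assumes S: "lie_module L S" and simple: "simple_mod L S" and h: "h \<in> L"
    and central: "\<And>x. x \<in> L \<Longrightarrow> lbr x h = 0"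
    and s: "s \<in> carrier S" "s \<noteq> zero S" "lact S h s = \<mu> \<odot>\<^bsub>S\<^esub> s"
  shows "\<forall>s\<in>carrier S. lact S h s = \<mu> \<odot>\<^bsub>S\<^esub> s"
proof -
  have mS: "module CC S" and Sc: "\<And>x v. x \<in> L \<Longrightarrow> v \<in> carrier S \<Longrightarrow> lact S x v \<in> carrier S"
    and Sadd: "\<And>x v w. x \<in> L \<Longrightarrow> v \<in> carrier S \<Longrightarrow> w \<in> carrier S \<Longrightarrow> lact S x (v \<oplus>\<^bsub>S\<^esub> w) = lact S x v \<oplus>\<^bsub>S\<^esub> lact S x w"
    and Sscale: "\<And>x c v. x \<in> L \<Longrightarrow> v \<in> carrier S \<Longrightarrow> lact S x (c \<odot>\<^bsub>S\<^esub> v) = c \<odot>\<^bsub>S\<^esub> lact S x v"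
    and Sxs: "\<And>x c v. x \<in> L \<Longrightarrow> v \<in> carrier S \<Longrightarrow> lact S (fscale c x) v = c \<odot>\<^bsub>S\<^esub> lact S x v"
    and Sbr: "\<And>x y v. x \<in> L \<Longrightarrow> y \<in> L \<Longrightarrow> v \<in> carrier S \<Longrightarrow>
        lact S (lbr x y) v = lact S x (lact S y v) \<ominus>\<^bsub>S\<^esub> lact S y (lact S x v)"
    using S unfolding lie_module_def by blast+
  interpret S: module CC S by (rule mS)
  have zero: "(0::complex) \<odot>\<^bsub>S\<^esub> v = zero S" if "v \<in> carrier S" for v
    using S.smult_l_null[OF that] by (simp add: CC_simps)
  have c: "c \<odot>\<^bsub>S\<^esub> v \<in> carrier S" if "v \<in> carrier S" for c v using that S.smult_closed by (simp add: CC_simps)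
  let ?E = "{s \<in> carrier S. lact S h s = \<mu> \<odot>\<^bsub>S\<^esub> s}"
  have "submod L S ?E"
    unfolding submod_iff[OF mS]
  proof (intro conjI ballI allI)
    have "lact S h (zero S) = zero S" using Sscale[OF h, of "zero S" 0] zero Sc h by (metis S.M.zero_closed)
    moreover have "\<mu> \<odot>\<^bsub>S\<^esub> zero S = zero S" using S.smult_r_null[of \<mu>] by (simp add: CC_simps)
    ultimately show "zero S \<in> ?E" by simp
    fix v assume v: "v \<in> ?E"
    show "v \<oplus>\<^bsub>S\<^esub> w \<in> ?E" if "w \<in> ?E" for w
      using v that Sadd[OF h] S.smult_r_distr[of \<mu> v w] by (auto simp: CC_simps)
    show "d \<odot>\<^bsub>S\<^esub> v \<in> ?E" for d
      using v c Sscale[OF h, of v d] S.smult_assoc1[of d \<mu> v] S.smult_assoc1[of \<mu> d v]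
      by (simp add: CC_simps mult.commute)
    show "lact S x v \<in> ?E" if x: "x \<in> L" for x
    proof -
      have vc: "v \<in> carrier S" and vh: "lact S h v = \<mu> \<odot>\<^bsub>S\<^esub> v" using v by auto
      \<comment> \<open>The vanishing bracket is written as a scalar multiple because
        \<open>lie_module\<close> prescribes the action of such multiples.\<close>
      have "lbr x h = fscale 0 h" unfolding central[OF x] by (rule ext) simp
      then have "lact S (lbr x h) v = lact S (fscale 0 h) v" by (simp only:)
      also have "\<dots> = zero S" unfolding Sxs[OF h vc] by (rule zero[OF Sc[OF h vc]])
      finally have z: "lact S x (lact S h v) \<ominus>\<^bsub>S\<^esub> lact S h (lact S x v) = zero S" using Sbr[OF x h vc] by simp
      have cl: "lact S x (lact S h v) \<in> carrier S" "lact S h (lact S x v) \<in> carrier S" using Sc x h vc by blast+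
      then have "lact S x (lact S h v) = (lact S x (lact S h v) \<ominus>\<^bsub>S\<^esub> lact S h (lact S x v)) \<oplus>\<^bsub>S\<^esub> lact S h (lact S x v)"
        by (simp add: a_minus_def S.M.a_assoc S.M.l_neg)
      then have "lact S x (lact S h v) = lact S h (lact S x v)" unfolding z using cl by simp
      then have "lact S h (lact S x v) = \<mu> \<odot>\<^bsub>S\<^esub> lact S x v" using vh Sscale[OF x vc] by simp
      then show ?thesis using Sc[OF x vc] by simp
    qed
  qed auto
  then have "?E = {zero S} \<or> ?E = carrier S" using simple unfolding simple_mod_def by blast
  then show ?thesis using s by blast
qed

context lmod_model
begin

text \<open>If \<open>h\<close> acts on \<open>S\<close> by \<open>\<chi>\<close>, take
  \<open>Z\<close> such that every vector is moved into \<open>Z\<close> by a product without the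
  factor \<open>h - \<chi>\<close>. Such a product keeps vectors of a factor isomorphic to
  \<open>S\<close> nonzero, so this factor is already visible in the chain intersected with
  \<open>Z\<close>, where \<open>chain_bounded\<close> applies.\<close>

lemma multiplicity_bounded:
  assumes L: "L \<subseteq> g" and h: "h \<in> L" and central: "\<And>x. x \<in> L \<Longrightarrow> lbr x h = 0"
    and finite: "\<And>v. v \<in> M \<Longrightarrow> \<exists>\<mu>s. shift_prod act h \<mu>s v = 0"
    and filt: "\<And>\<chi>. \<exists>Z c. stable_subspace L act Z \<and> chain_bounded L act Z c \<and>
       (\<forall>v\<in>M. \<exists>\<mu>s. \<chi> \<notin> set \<mu>s \<and> shift_prod act h \<mu>s v \<in> Z)"
    and S: "lie_module L S" "simple_mod L S"
  shows "\<exists>b::nat. \<forall>F. finite F \<and> F \<subseteq> carrier V \<longrightarrow> multiplicity L (restr V (gen L V F)) S \<le> enat b"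
proof -
  have sub: "subquotient g M act V \<iota> L (W (Suc i)) (W i)"
    if "F \<subseteq> carrier V" "\<And>i. i \<le> k \<Longrightarrow> submod L (restr V (gen L V F)) (W i)" "\<And>i. i < k \<Longrightarrow> W i \<subseteq> W (Suc i)" "i < k"
    for F k i and W :: "nat \<Rightarrow> 'v set"
    using that L submod_restr[OF submod_gen(1)[OF L that(1)] L]
    by unfold_locales (metis Suc_leI less_imp_le_nat)+
  show ?thesis
  proof (cases "\<exists>\<chi>. \<forall>s\<in>carrier S. lact S h s = \<chi> \<odot>\<^bsub>S\<^esub> s")
    case True
    then obtain \<chi> where \<chi>: "\<And>s. s \<in> carrier S \<Longrightarrow> lact S h s = \<chi> \<odot>\<^bsub>S\<^esub> s" by blast
    obtain Z c where Z: "stable_subspace L act Z" "chain_bounded L act Z c"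
      "\<And>v. v \<in> M \<Longrightarrow> \<exists>\<mu>s. \<chi> \<notin> set \<mu>s \<and> shift_prod act h \<mu>s v \<in> Z" using filt[of \<chi>] by blast
    show ?thesis
    proof (intro exI[of _ c] allI impI)
      fix F assume F: "finite F \<and> F \<subseteq> carrier V"
      show "multiplicity L (restr V (gen L V F)) S \<le> enat c"
        unfolding multiplicity_def
      proof (rule Sup_least, clarsimp)
        fix k and W :: "nat \<Rightarrow> 'v set"
        assume W: "\<forall>i\<le>k. submod L (restr V (gen L V F)) (W i)" "\<forall>i<k. W i \<subseteq> W (Suc i)"
        define Y where "Y i = \<iota> ` W i \<inter> Z" for i
        let ?J = "{i. i < k \<and> lmod_iso L (quot_mod (restr V (W (Suc i))) (W i)) S}"
        have WV: "submod L V (W i)" if "i \<le> k" for i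
          using W(1) that submod_restr[OF submod_gen(1)[OF L] L] F by blast
        have "card {i. i < k \<and> Y i \<noteq> Y (Suc i)} \<le> c"
        proof (rule Z(2)[unfolded chain_bounded_def, rule_format])
          fix i assume "i \<le> k"
          then have "stable_subspace L act (\<iota> ` W i)" using WV submod_model[OF L] by blast
          then show "stable_subspace L act (Y i) \<and> Y i \<subseteq> Z"
            using Z(1) cfun.subspace_inter unfolding stable_subspace_def Y_def by blast
        next
          fix i assume "i < k"
          then show "Y i \<subseteq> Y (Suc i)" using W(2) unfolding Y_def by blast
        qed
        moreover have "?J \<subseteq> {i. i < k \<and> Y i \<noteq> Y (Suc i)}"
        proof safe
          fix i assume i: "i < k" and iso: "lmod_iso L (quot_mod (restr V (W (Suc i))) (W i)) S" and eq: "Y i = Y (Suc i)"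
          interpret s: subquotient g M act V \<iota> L "W (Suc i)" "W i"
            by (rule sub[of F k W i]) (use F W i in auto)
          have "W (Suc i) \<noteq> W i" using s.iso_proper[OF S iso] .
          then obtain v where v: "v \<in> W (Suc i)" "v \<notin> W i" using s.BA by blast
          then have v': "\<iota> v \<in> \<iota> ` W (Suc i)" "\<iota> v \<notin> \<iota> ` W i" using s.iota_mem(1)[of v] s.A_carrier by blast+
          obtain \<mu>s where \<mu>s: "\<chi> \<notin> set \<mu>s" "shift_prod act h \<mu>s (\<iota> v) \<in> Z"
            using Z(3) \<iota>_in v(1) s.A_carrier by blast
          \<comment> \<open>The moved vector lies in \<open>Z\<close> and still witnesses that the
            inclusion is proper.\<close>
          have "shift_prod act h \<mu>s (\<iota> v) \<in> \<iota> ` W (Suc i) \<and> shift_prod act h \<mu>s (\<iota> v) \<notin> \<iota> ` W i"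
            using s.iso_scalar[OF h iso \<chi>] v' \<mu>s(1) by (intro s.shift_prod_mod[OF h]) auto
          then show False using \<mu>s(2) eq unfolding Y_def by blast
        qed
        then have "card ?J \<le> card {i. i < k \<and> Y i \<noteq> Y (Suc i)}" by (intro card_mono) auto
        ultimately show "card ?J \<le> c" by linarith
      qed
    qed
  next
    case False
    show ?thesis
    \<comment> \<open>Here no factor is isomorphic to \<open>S\<close>: local finiteness would give
      an eigenvector in the factor, and by \<open>central_scalar\<close> the element
      \<open>h\<close> would act on \<open>S\<close> by a scalar.\<close>
    proof (intro exI[of _ 0] allI impI)
      fix F assume F: "finite F \<and> F \<subseteq> carrier V"
      show "multiplicity L (restr V (gen L V F)) S \<le> enat 0"
        unfolding multiplicity_def
      proof (rule Sup_least, clarsimp)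
        fix k i and W :: "nat \<Rightarrow> 'v set"
        assume W: "\<forall>i\<le>k. submod L (restr V (gen L V F)) (W i)" "\<forall>i<k. W i \<subseteq> W (Suc i)"
          and i: "i < k" and iso: "lmod_iso L (quot_mod (restr V (W (Suc i))) (W i)) S"
        interpret s: subquotient g M act V \<iota> L "W (Suc i)" "W i"
          by (rule sub[of F k W i]) (use F W i in auto)
        have "W (Suc i) \<noteq> W i" using s.iso_proper[OF S iso] .
        then obtain v where v: "v \<in> W (Suc i)" "v \<notin> W i" using s.BA by blast
        then have v': "\<iota> v \<in> \<iota> ` W (Suc i)" "\<iota> v \<notin> \<iota> ` W i" using s.iota_mem(1)[of v] s.A_carrier by blast+
        obtain \<mu>s where "shift_prod act h \<mu>s (\<iota> v) = 0" using finite \<iota>_in v(1) s.A_carrier by blast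
        then have "shift_prod act h \<mu>s (\<iota> v) \<in> \<iota> ` W i" using cfun.subspace_0[OF s.B_sub] by simp
        from s.eigenvector_exists[OF h v' this] obtain w \<mu> where "w \<in> \<iota> ` W (Suc i)" "w \<notin> \<iota> ` W i"
          "act h w - fscale \<mu> w \<in> \<iota> ` W i" by blast
        from s.iso_eigenvector[OF h S(1) iso this] obtain t where "t \<in> carrier S" "t \<noteq> zero S" "lact S h t = \<mu> \<odot>\<^bsub>S\<^esub> t" by blast
        from central_scalar[OF S h central this] False show False by blast
      qed
    qed
  qed
qed

text \<open>The generated submodule is embedded in the span of \<open>B0\<close>, hence has a finite
  basis; this basis is pulled back along \<open>\<iota>\<close>, since \<open>fin_dim\<close> asks
  for generators in the module itself.\<close>

lemma fin_dim_gen: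
  assumes L: "L \<subseteq> g" and v: "v \<in> carrier V" and Z: "stable_subspace L act Z" "Z \<subseteq> M" "\<iota> v \<in> Z"
    and fin: "finite B0" "Z \<subseteq> cfun.span B0"
  shows "fin_dim V (gen L V {v})"
proof -
  let ?D = "gen L V {v}"
  have vc: "{v} \<subseteq> carrier V" using v by blast
  note D = submod_gen(1,3)[OF L vc]
  have "?D \<subseteq> {v \<in> carrier V. \<iota> v \<in> Z}" by (rule gen_least[OF submod_vimage(1)[OF L Z(1,2)]]) (use v Z(3) in simp)
  then have DZ: "\<iota> ` ?D \<subseteq> cfun.span B0" using fin by blast
  have Dsub: "cfun.subspace (\<iota> ` ?D)" using D(1) unfolding submod_model[OF L] stable_subspace_def by blast
  obtain B where B: "finite B" "B \<subseteq> \<iota> ` ?D" "cfun.span B = \<iota> ` ?D"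
    using finite_basis_in_span[OF Dsub DZ fin(1)] by metis
  obtain B' where B': "B' \<subseteq> ?D" "finite B'" "B = \<iota> ` B'" using finite_subset_image[OF B(1,2)] by blast
  have "?D = gen {} V B'"
  proof
    show "gen {} V B' \<subseteq> ?D"
      by (rule gen_least) (use D(1) B'(1) in \<open>auto simp: submod_def\<close>)
    show "?D \<subseteq> gen {} V B'"
    proof
      fix w assume w: "w \<in> ?D"
      have B'c: "B' \<subseteq> carrier V" using B' D by blast
      have s: "submod {} V (gen {} V B')" "gen {} V B' \<subseteq> carrier V" "B' \<subseteq> gen {} V B'"
        using submod_gen[of "{}" B'] B'c by auto
      then have "cfun.subspace (\<iota> ` gen {} V B')" by (simp add: submod_model stable_subspace_def)
      then have "cfun.span B \<subseteq> \<iota> ` gen {} V B'" unfolding B'(3) by (intro cfun.span_minimal image_mono s)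
      then have "\<iota> w \<in> \<iota> ` gen {} V B'" using w B(3) by blast
      then show "w \<in> gen {} V B'" using \<iota>_eqI w D(2) s(2) by blast
    qed
  qed
  then show ?thesis unfolding fin_dim_def using B' D(2) by blast
qed

end

section \<open>Matrices over an eigenbasis\<close>

lemma mmul_finite:
  assumes "finite S" "{j. A (i, j) \<noteq> 0} \<subseteq> S"
  shows "mmul A B (i, k) = (\<Sum>j\<in>S. A (i, j) * B (j, k))"
  unfolding mmul_def using assms by (auto intro!: sum.mono_neutral_left)

definition row_finite :: "cmat \<Rightarrow> bool" where
  "row_finite A \<longleftrightarrow> (\<forall>i. finite {j. A (i, j) \<noteq> 0})"

lemma mmul_add_left:
  assumes "row_finite A" "row_finite A'"
  shows "mmul (A + A') B = mmul A B + mmul A' B"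
proof
  fix z :: "nat \<times> nat" obtain i k where z: "z = (i, k)" by force
  let ?S = "{j. A (i, j) \<noteq> 0} \<union> {j. A' (i, j) \<noteq> 0}"
  have S: "finite ?S" "{j. A (i, j) \<noteq> 0} \<subseteq> ?S" "{j. A' (i, j) \<noteq> 0} \<subseteq> ?S" "{j. (A + A') (i, j) \<noteq> 0} \<subseteq> ?S"
    using assms by (auto simp: row_finite_def)
  show "mmul (A + A') B z = (mmul A B + mmul A' B) z"
    unfolding z plus_fun_apply mmul_finite[where A = A, OF S(1,2)] mmul_finite[where A = A', OF S(1,3)]
      mmul_finite[where A = "A + A'", OF S(1,4)] by (simp add: distrib_right sum.distrib)
qed

lemma mmul_scale_left: "mmul (fscale c A) B = fscale c (mmul A B)"
proof
  fix z :: "nat \<times> nat" obtain i k where z: "z = (i, k)" by force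
  show "mmul (fscale c A) B z = fscale c (mmul A B) z"
    unfolding z mmul_def by (cases "c = 0") (simp_all add: sum_distrib_left mult.assoc)
qed

lemma mmul_add_right: "mmul A (B + B') = mmul A B + mmul A B'"
  by (auto simp: mmul_def fun_eq_iff distrib_left sum.distrib)

lemma mmul_scale_right: "mmul A (fscale c B) = fscale c (mmul A B)"
  by (auto simp: mmul_def fun_eq_iff sum_distrib_left mult.left_commute intro!: sum.cong)

lemma dsum_apply: "dsum N A (i, j) = (if i div N = j div N then A (i mod N, j mod N) else 0)"
  by (simp add: dsum_def)

lemma dsum_row: 
  assumes "N > 0"
  shows "{j. dsum N A (i, j) \<noteq> 0} \<subseteq> (\<lambda>m. i div N * N + m) ` {..<N}"
proof
  fix j assume "j \<in> {j. dsum N A (i, j) \<noteq> 0}"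
  then have "i div N = j div N" by (auto simp: dsum_apply split: if_splits)
  then have "j = i div N * N + j mod N" by (metis div_mult_mod_eq)
  then show "j \<in> (\<lambda>m. i div N * N + m) ` {..<N}" using assms by auto
qed

lemma row_finite_dsum: "N > 0 \<Longrightarrow> row_finite (dsum N A)"
  unfolding row_finite_def by (intro allI finite_subset[OF dsum_row]) simp_all

definition bmul :: "nat \<Rightarrow> cmat \<Rightarrow> cmat \<Rightarrow> cmat" where
  "bmul N A B = (\<lambda>(i, k). \<Sum>m<N. A (i, m) * B (m, k))"

lemma mmul_dsum:
  assumes N: "N > 0"
  shows "mmul (dsum N A) (dsum N B) = dsum N (bmul N A B)"
proof
  fix z :: "nat \<times> nat" obtain i k where z: "z = (i, k)" by force
  have inj: "inj_on (\<lambda>m. i div N * N + m) {..<N}" by (simp add: inj_on_def)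
  have "mmul (dsum N A) (dsum N B) (i, k)
      = (\<Sum>j\<in>(\<lambda>m. i div N * N + m) ` {..<N}. dsum N A (i, j) * dsum N B (j, k))"
    by (rule mmul_finite[OF _ dsum_row[OF N]]) simp
  also have "\<dots> = (\<Sum>m<N. dsum N A (i, i div N * N + m) * dsum N B (i div N * N + m, k))"
    unfolding sum.reindex[OF inj] comp_def ..
  also have "\<dots> = (\<Sum>m<N. if i div N = k div N then A (i mod N, m) * B (m, k mod N) else 0)"
    by (rule sum.cong) (auto simp: dsum_apply N)
  also have "\<dots> = dsum N (bmul N A B) (i, k)" by (simp add: dsum_apply bmul_def)
  finally show "mmul (dsum N A) (dsum N B) z = dsum N (bmul N A B) z" unfolding z .
qed

lemma dsum_add: "dsum N (A + B) = dsum N A + dsum N B"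
  and dsum_scale: "dsum N (fscale c A) = fscale c (dsum N A)"
  by (auto simp: dsum_def fun_eq_iff)

lemma gl_blk_subspace: "cfun.subspace (gl_blk N)"
proof (rule cfun.subspaceI)
  have "dsum N 0 = 0" by (auto simp: dsum_def fun_eq_iff)
  then show "0 \<in> gl_blk N" unfolding gl_blk_def by (metis rangeI)
qed (auto simp: gl_blk_def dsum_add[symmetric] dsum_scale[symmetric])

lemma gl_blk_mmul: "N > 0 \<Longrightarrow> A \<in> gl_blk N \<Longrightarrow> B \<in> gl_blk N \<Longrightarrow> mmul A B \<in> gl_blk N"
  by (auto simp: gl_blk_def mmul_dsum)

lemma gl_blk_lbr: "N > 0 \<Longrightarrow> A \<in> gl_blk N \<Longrightarrow> B \<in> gl_blk N \<Longrightarrow> lbr A B \<in> gl_blk N"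
  unfolding lbr_def by (intro cfun.subspace_diff[OF gl_blk_subspace] gl_blk_mmul)

lemma gl_blk_row_finite: "N > 0 \<Longrightarrow> A \<in> gl_blk N \<Longrightarrow> row_finite A"
  by (auto simp: gl_blk_def row_finite_dsum)

lemma emat_gl: "emat N r s \<in> gl_blk N"
  by (simp add: emat_def gl_blk_def)

lemma gl_blk_expand:
  assumes "N > 0"
  shows "dsum N A = (\<Sum>(r, s)\<in>{..<N} \<times> {..<N}. fscale (A (r, s)) (emat N r s))"
proof
  fix z :: "nat \<times> nat" obtain i j where z: "z = (i, j)" by force
  have "(\<Sum>x\<in>{..<N} \<times> {..<N}. A x * emat N (fst x) (snd x) (i, j))
      = (\<Sum>x\<in>{..<N} \<times> {..<N}. if x = (i mod N, j mod N) then (if i div N = j div N then A (i mod N, j mod N) else 0) else 0)"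
    by (rule sum.cong) (auto simp: emat_apply)
  then show "dsum N A z = (\<Sum>(r, s)\<in>{..<N} \<times> {..<N}. fscale (A (r, s)) (emat N r s)) z"
    using assms by (simp add: z sum_fun_apply case_prod_beta dsum_apply)
qed

lemma emat_mmul:
  assumes "N > 0" "r < N" "s < N" "a < N" "c < N"
  shows "mmul (emat N r s) (emat N a c) = (if s = a then emat N r c else 0)"
proof -
  have "bmul N (delta (r, s)) (delta (a, c)) = (if s = a then delta (r, c) else 0)"
  proof
    fix z :: "nat \<times> nat" obtain i k where z: "z = (i, k)" by force
    have "(\<Sum>m<N. delta (r, s) (i, m) * delta (a, c) (m, k)) = (\<Sum>m<N. if m = s then of_bool (i = r \<and> s = a \<and> k = c) else 0)"
      by (rule sum.cong) (auto simp: delta_def)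
    then show "bmul N (delta (r, s)) (delta (a, c)) z = (if s = a then delta (r, c) else 0) z"
      using assms by (auto simp: z bmul_def delta_def)
  qed
  then show ?thesis
    unfolding emat_def mmul_dsum[OF assms(1)] by (auto simp: dsum_def fun_eq_iff)
qed

lemma Nsize_pos:
  assumes "\<And>i. i \<ge> 1 \<Longrightarrow> \<theta> i > (1::nat)"
  shows "Nsize \<theta> n > 0"
  unfolding Nsize_def using assms by (intro prod_pos) (auto intro: less_trans[OF zero_less_one])

lemma Nsize_Suc: "n \<ge> 1 \<Longrightarrow> Nsize \<theta> (Suc n) = Nsize \<theta> n * \<theta> n"
  by (simp add: Nsize_def)

lemma Nsize_dvd:
  assumes "\<And>i. i \<ge> 1 \<Longrightarrow> \<theta> i > (1::nat)" "1 \<le> m" "m \<le> n"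
  shows "\<exists>t>0. Nsize \<theta> n = Nsize \<theta> m * t"
  using assms(3)
proof (induction rule: dec_induct)
  case base
  then show ?case by auto
next
  case (step n)
  then obtain t where "t > 0" "Nsize \<theta> n = Nsize \<theta> m * t" by blast
  then show ?case using step assms(1)[of n] assms(2)
    by (intro exI[of _ "t * \<theta> n"]) (auto simp: Nsize_Suc)
qed

lemma gl_level_mono:
  assumes "\<And>i. i \<ge> 1 \<Longrightarrow> \<theta> i > (1::nat)" "q > 0" "1 \<le> m" "m \<le> n"
  shows "gl_level q \<theta> m \<subseteq> gl_level q \<theta> n"
proof -
  have "\<exists>t>0. Nsize \<theta> n = Nsize \<theta> m * t" by (rule Nsize_dvd) (fact assms)+
  then obtain t where t: "t > 0" "Nsize \<theta> n = Nsize \<theta> m * t" by auto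
  have "Nsize \<theta> m > 0" by (rule Nsize_pos) (fact assms)
  then show ?thesis
    unfolding gl_level_def using gl_blk_mono[of "q * Nsize \<theta> m" t] assms(2) t by (simp add: mult.assoc)
qed

text \<open>\<open>\<beta>\<close> is the dual basis of \<open>b\<close>. The two conditions say
  that the matrix with columns \<open>b j\<close> and the matrix with rows \<open>\<beta> i\<close>
  are inverse to each other on both sides.\<close>

locale split_basis =
  fixes p :: nat and b \<beta> :: "nat \<Rightarrow> nat \<Rightarrow> complex"
  assumes p: "p > 0"
    and dual: "\<And>i j. i < p \<Longrightarrow> j < p \<Longrightarrow> (\<Sum>l<p. \<beta> i l * b j l) = of_bool (i = j)"
    and dual': "\<And>k l. k < p \<Longrightarrow> l < p \<Longrightarrow> (\<Sum>j<p. b j k * \<beta> j l) = of_bool (k = l)"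
begin

text \<open>The matrix unit \<open>E\<^sub>i\<^sub>j\<close> in the basis \<open>b\<close>, with the matrix \<open>Y\<close> as its coefficient.\<close>

definition tmat :: "cmat \<Rightarrow> nat \<Rightarrow> nat \<Rightarrow> cmat" where
  "tmat Y i j = (\<lambda>(x, y). Y (x div p, y div p) * b i (x mod p) * \<beta> j (y mod p))"

definition comp :: "cmat \<Rightarrow> nat \<Rightarrow> nat \<Rightarrow> cmat" where
  "comp A i j = (\<lambda>(a, c). \<Sum>k<p. \<Sum>l<p. \<beta> i k * A (a * p + k, c * p + l) * b j l)"

lemma tmat_apply: "tmat Y i j (x, y) = Y (x div p, y div p) * b i (x mod p) * \<beta> j (y mod p)"
  by (simp add: tmat_def)

lemma comp_add: "comp (A + B) i j = comp A i j + comp B i j"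
  and comp_scale: "comp (fscale c A) i j = fscale c (comp A i j)"
  by (auto simp: comp_def fun_eq_iff sum.distrib sum_distrib_left algebra_simps)

lemma tmat_add: "tmat (Y + Z) i j = tmat Y i j + tmat Z i j"
  and tmat_scale: "tmat (fscale c Y) i j = fscale c (tmat Y i j)"
  and tmat_zero: "tmat 0 i j = 0"
  by (auto simp: tmat_def fun_eq_iff algebra_simps)

lemma comp_tmat:
  assumes "i < p" "j < p" "i' < p" "j' < p"
  shows "comp (tmat Y i' j') i j = (if i = i' \<and> j = j' then Y else 0)"
proof
  fix z :: "nat \<times> nat" obtain a c where z: "z = (a, c)" by force
  have "comp (tmat Y i' j') i j (a, c) = (\<Sum>k<p. \<Sum>l<p. Y (a, c) * (\<beta> i k * b i' k) * (\<beta> j' l * b j l))"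
    unfolding comp_def using p by (auto intro!: sum.cong simp: tmat_apply)
  also have "\<dots> = Y (a, c) * (\<Sum>k<p. \<beta> i k * b i' k) * (\<Sum>l<p. \<beta> j' l * b j l)"
    by (simp only: sum_distrib_left[symmetric] sum_distrib_right[symmetric])
  also have "\<dots> = (if i = i' \<and> j = j' then Y else 0) (a, c)" using assms dual by auto
  finally show "comp (tmat Y i' j') i j z = (if i = i' \<and> j = j' then Y else 0) z" unfolding z .
qed

text \<open>The identity of the space of dimension \<open>p\<close>, resolved by
  \<open>dual'\<close>, is inserted on both sides of every block of size \<open>p\<close>.\<close>

lemma expand: "A = (\<Sum>(i, j)\<in>{..<p} \<times> {..<p}. tmat (comp A i j) i j)"
proof
  fix z :: "nat \<times> nat" obtain x y where z: "z = (x, y)" by force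
  let ?A = "\<lambda>k l. A (x div p * p + k, y div p * p + l)"
  have xy: "x mod p < p" "y mod p < p" using p by simp_all
  have "(\<Sum>(i, j)\<in>{..<p} \<times> {..<p}. tmat (comp A i j) i j) (x, y)
      = (\<Sum>i<p. \<Sum>j<p. \<Sum>k<p. \<Sum>l<p. (b i (x mod p) * \<beta> i k) * (?A k l * (b j l * \<beta> j (y mod p))))"
  proof -
    have "(\<Sum>(i, j)\<in>{..<p} \<times> {..<p}. tmat (comp A i j) i j) (x, y) = (\<Sum>i<p. \<Sum>j<p. tmat (comp A i j) i j (x, y))"
      by (simp add: sum_fun_apply sum.cartesian_product case_prod_beta)
    then show ?thesis
      by (simp add: tmat_apply comp_def sum_distrib_left sum_distrib_right mult_ac)
  qed
  \<comment> \<open>The sums over \<open>i\<close> and \<open>j\<close> are moved inside, where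
    \<open>dual'\<close> evaluates them.\<close>
  also have "\<dots> = (\<Sum>k<p. \<Sum>l<p. (\<Sum>i<p. b i (x mod p) * \<beta> i k) * (?A k l * (\<Sum>j<p. b j l * \<beta> j (y mod p))))"
  proof -
    have gen: "(\<Sum>i<p. u i) * (c * (\<Sum>j<p. v j)) = (\<Sum>i<p. \<Sum>j<p. u i * (c * v j))" for u v :: "nat \<Rightarrow> complex" and c
      by (subst sum_distrib_left) (rule sum_product)
    have "(\<Sum>i<p. \<Sum>j<p. \<Sum>k<p. \<Sum>l<p. (b i (x mod p) * \<beta> i k) * (?A k l * (b j l * \<beta> j (y mod p))))
      = (\<Sum>i<p. \<Sum>k<p. \<Sum>j<p. \<Sum>l<p. (b i (x mod p) * \<beta> i k) * (?A k l * (b j l * \<beta> j (y mod p))))"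
      by (intro sum.cong refl sum.swap)
    also have "\<dots> = (\<Sum>k<p. \<Sum>i<p. \<Sum>j<p. \<Sum>l<p. (b i (x mod p) * \<beta> i k) * (?A k l * (b j l * \<beta> j (y mod p))))"
      by (rule sum.swap)
    also have "\<dots> = (\<Sum>k<p. \<Sum>i<p. \<Sum>l<p. \<Sum>j<p. (b i (x mod p) * \<beta> i k) * (?A k l * (b j l * \<beta> j (y mod p))))"
      by (intro sum.cong refl sum.swap)
    also have "\<dots> = (\<Sum>k<p. \<Sum>l<p. \<Sum>i<p. \<Sum>j<p. (b i (x mod p) * \<beta> i k) * (?A k l * (b j l * \<beta> j (y mod p))))"
      by (intro sum.cong refl sum.swap)
    also have "\<dots> = (\<Sum>k<p. \<Sum>l<p. (\<Sum>i<p. b i (x mod p) * \<beta> i k) * (?A k l * (\<Sum>j<p. b j l * \<beta> j (y mod p))))"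
      unfolding gen ..
    finally show ?thesis .
  qed
  also have "\<dots> = (\<Sum>k<p. if k = x mod p then ?A k (y mod p) else 0)"
  proof (rule sum.cong[OF refl])
    fix k assume "k \<in> {..<p}"
    then have "(\<Sum>l<p. (\<Sum>i<p. b i (x mod p) * \<beta> i k) * (?A k l * (\<Sum>j<p. b j l * \<beta> j (y mod p))))
      = (\<Sum>l<p. if l = y mod p then (if k = x mod p then ?A k l else 0) else 0)"
      using xy dual' by (intro sum.cong refl) auto
    then show "(\<Sum>l<p. (\<Sum>i<p. b i (x mod p) * \<beta> i k) * (?A k l * (\<Sum>j<p. b j l * \<beta> j (y mod p))))
      = (if k = x mod p then ?A k (y mod p) else 0)"
      using xy(2) by simp
  qed
  also have "\<dots> = A (x, y)" using xy by simp
  finally show "A z = (\<Sum>(i, j)\<in>{..<p} \<times> {..<p}. tmat (comp A i j) i j) z" unfolding z ..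
qed

lemma comp_ext: "(\<And>i j. i < p \<Longrightarrow> j < p \<Longrightarrow> comp A i j = comp B i j) \<Longrightarrow> A = B"
  by (subst (1 2) expand) (auto intro!: sum.cong)

lemma tmat_gl:
  assumes "N > 0" "Y \<in> gl_blk N"
  shows "tmat Y i j \<in> gl_blk (p * N)"
proof -
  obtain Y0 where Y: "Y = dsum N Y0" using assms by (auto simp: gl_blk_def)
  have "tmat Y i j = dsum (p * N) (tmat Y i j)"
  proof
    fix z :: "nat \<times> nat" obtain x y where z: "z = (x, y)" by force
    have m: "x mod (p * N) div p = x div p mod N" "x div (p * N) = x div p div N" "x mod (p * N) mod p = x mod p" for x
      using p assms(1) by (simp_all add: mod_mult2_eq div_mult2_eq)
    show "tmat Y i j z = dsum (p * N) (tmat Y i j) z"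
      unfolding z dsum_apply tmat_apply m Y using assms(1) by auto
  qed
  then show ?thesis unfolding gl_blk_def by (metis rangeI)
qed

lemma comp_gl:
  assumes "N > 0" "A \<in> gl_blk (p * N)"
  shows "comp A i j \<in> gl_blk N"
proof -
  obtain A0 where A: "A = dsum (p * N) A0" using assms by (auto simp: gl_blk_def)
  have "comp A i j = dsum N (comp A i j)"
  proof
    fix z :: "nat \<times> nat" obtain a c where z: "z = (a, c)" by force
    have m: "(a * p + k) div (p * N) = a div N" "(a * p + k) mod (p * N) = (a mod N) * p + k"
      "((a mod N) * p + k) div (p * N) = 0" "((a mod N) * p + k) mod (p * N) = (a mod N) * p + k" if "k < p" for a k
    proof -
      show 1: "(a * p + k) div (p * N) = a div N" using that p by (simp add: div_mult2_eq)
      show "(a * p + k) mod (p * N) = (a mod N) * p + k"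
        using mod_mult2_eq[of "a * p + k" p N] that by (simp add: mult.commute)
      have "a mod N < N" using assms(1) by simp
      then have "(a mod N + 1) * p \<le> N * p" by (intro mult_right_mono) auto
      then have "(a mod N) * p + k < p * N" using that by (simp add: algebra_simps)
      then show "((a mod N) * p + k) div (p * N) = 0" "((a mod N) * p + k) mod (p * N) = (a mod N) * p + k" by auto
    qed
    show "comp A i j z = dsum N (comp A i j) z"
      unfolding z dsum_apply comp_def A by (auto simp: m dsum_apply intro!: sum.cong sum.neutral)
  qed
  then show ?thesis unfolding gl_blk_def by (metis rangeI)
qed

text \<open>The middle index splits as \<open>m * p + l\<close>: the sum over \<open>m\<close>
  multiplies the coefficients, and the sum over \<open>l\<close> is a value of
  \<open>dual\<close>.\<close>

lemma mmul_tmat: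
  assumes "i < p" "j < p" "i' < p" "j' < p" "row_finite Y"
  shows "mmul (tmat Y i j) (tmat Z i' j') = (if j = i' then tmat (mmul Y Z) i j' else 0)"
proof
  fix z :: "nat \<times> nat" obtain x y where z: "z = (x, y)" by force
  let ?S = "{m. Y (x div p, m) \<noteq> 0}"
  let ?f = "\<lambda>(m, l). m * p + l"
  have fin: "finite ?S" using assms(5) by (auto simp: row_finite_def)
  have sub: "{m. tmat Y i j (x, m) \<noteq> 0} \<subseteq> ?f ` (?S \<times> {..<p})"
  proof
    fix m assume "m \<in> {m. tmat Y i j (x, m) \<noteq> 0}"
    then have "Y (x div p, m div p) \<noteq> 0" by (auto simp: tmat_apply)
    then show "m \<in> ?f ` (?S \<times> {..<p})"
      using p by (intro image_eqI[of _ _ "(m div p, m mod p)"]) auto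
  qed
  have inj: "inj_on ?f (?S \<times> {..<p})"
  proof (rule inj_onI, clarify)
    fix m l m' l' assume l: "l < p" "l' < p" and e: "m * p + l = m' * p + l'"
    have "(m * p + l) div p = m" "(m' * p + l') div p = m'" using l by simp_all
    then show "m = m' \<and> l = l'" using e by simp
  qed
  have "mmul (tmat Y i j) (tmat Z i' j') (x, y) = (\<Sum>m\<in>?f ` (?S \<times> {..<p}). tmat Y i j (x, m) * tmat Z i' j' (m, y))"
    using fin sub by (intro mmul_finite) auto
  also have "\<dots> = (\<Sum>(m, l)\<in>?S \<times> {..<p}. tmat Y i j (x, m * p + l) * tmat Z i' j' (m * p + l, y))"
    by (subst sum.reindex[OF inj]) (auto intro!: sum.cong)
  also have "\<dots> = (\<Sum>m\<in>?S. \<Sum>l<p. (Y (x div p, m) * Z (m, y div p)) * (b i (x mod p) * \<beta> j' (y mod p)) * (\<beta> j l * b i' l))"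
    unfolding sum.cartesian_product[symmetric] by (intro sum.cong refl) (simp add: tmat_apply)
  also have "\<dots> = mmul Y Z (x div p, y div p) * (b i (x mod p) * \<beta> j' (y mod p)) * (\<Sum>l<p. \<beta> j l * b i' l)"
    unfolding mmul_def prod.case by (simp only: sum_distrib_left[symmetric] sum_distrib_right[symmetric])
  also have "\<dots> = (if j = i' then tmat (mmul Y Z) i j' else 0) (x, y)"
    using assms dual by (auto simp: tmat_apply)
  finally show "mmul (tmat Y i j) (tmat Z i' j') z = (if j = i' then tmat (mmul Y Z) i j' else 0) z" unfolding z .
qed

end

text \<open>The coefficients of the standard basis vectors in the basis \<open>b\<close> form
  \<open>\<beta>\<close>, which is one of the two relations by construction; the other one follows
  from the independence of \<open>b\<close>.\<close>

lemma eigenbasis_dual: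
  assumes e: "eigenbasis p h b \<eta>" and p: "p > 0"
  shows "\<exists>\<beta>. split_basis p b \<beta>"
proof -
  have inj: "inj_on b {..<p}" and ind: "cfun.independent (b ` {..<p})"
    and span: "cfun.span (b ` {..<p}) = nat_vec p" using e by (simp_all add: eigenbasis_def)
  have "\<exists>u. delta l = (\<Sum>v\<in>b ` {..<p}. fscale (u v) v)" if "l < p" for l
  proof -
    have "delta l \<in> cfun.span (b ` {..<p})" unfolding span using that by (auto simp: nat_vec_def delta_def)
    then show ?thesis unfolding cfun.span_finite[OF finite_imageI[OF finite_lessThan]] by blast
  qed
  then obtain u where u: "\<And>l. l < p \<Longrightarrow> delta l = (\<Sum>v\<in>b ` {..<p}. fscale (u l v) v)" by metis
  define \<beta> where "\<beta> j l = u l (b j)" for j l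
  have d': "(\<Sum>j<p. b j k * \<beta> j l) = of_bool (k = l)" if "l < p" for k l
  proof -
    have "delta l k = (\<Sum>j<p. fscale (u l (b j)) (b j)) k"
      using u[OF that] by (simp only: sum.reindex[OF inj] comp_def)
    then show ?thesis by (simp add: sum_fun_apply \<beta>_def delta_def mult.commute)
  qed
  have "(\<Sum>l<p. \<beta> i l * b j l) = of_bool (i = j)" if ij: "i < p" "j < p" for i j
  proof -
    define c where "c i = (\<Sum>l<p. \<beta> i l * b j l) - of_bool (i = j)" for i
    have bj: "b j \<in> nat_vec p" unfolding span[symmetric] using ij by (intro cfun.span_base) auto
    have "(\<Sum>i<p. fscale (c i) (b i)) = 0"
    proof
      fix k
      have "(\<Sum>i<p. (\<Sum>l<p. \<beta> i l * b j l) * b i k) = (\<Sum>l<p. b j l * (\<Sum>i<p. b i k * \<beta> i l))"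
        unfolding sum_distrib_left sum_distrib_right by (subst sum.swap) (simp add: mult_ac)
      also have "\<dots> = (\<Sum>l<p. if l = k then b j k else 0)" by (intro sum.cong) (auto simp: d')
      also have "\<dots> = b j k" using bj by (auto simp: nat_vec_def)
      finally have 1: "(\<Sum>i<p. (\<Sum>l<p. \<beta> i l * b j l) * b i k) = b j k" .
      have "(\<Sum>i<p. of_bool (i = j) * b i k) = (\<Sum>i<p. if i = j then b j k else 0)"
        by (intro sum.cong) auto
      then have 2: "(\<Sum>i<p. of_bool (i = j) * b i k) = b j k" using ij by simp
      show "(\<Sum>i<p. fscale (c i) (b i)) k = 0 k"
        by (simp add: sum_fun_apply c_def left_diff_distrib sum_subtractf 1 2)
    qed
    then have "(\<Sum>v\<in>b ` {..<p}. fscale (c (inv_into {..<p} b v)) v) = 0"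
      by (simp add: sum.reindex[OF inj] inj)
    then have "c (inv_into {..<p} b (b i)) = 0"
      using ij by (intro cfun.independentD[OF ind, of "b ` {..<p}" "\<lambda>v. c (inv_into {..<p} b v)"]) auto
    then show ?thesis using ij inj by (simp add: c_def)
  qed
  then show ?thesis using d' p by (intro exI[of _ \<beta>]) (unfold_locales, auto)
qed

section \<open>Brackets with diagonal matrices\<close>

definition idm :: cmat where "idm = (\<lambda>(i, j). of_bool (i = j))"

lemma idm_dsum: "N > 0 \<Longrightarrow> idm = dsum N idm"
proof
  fix z :: "nat \<times> nat" assume "N > 0" obtain i j where z: "z = (i, j)" by force
  have "i = j \<longleftrightarrow> i div N = j div N \<and> i mod N = j mod N" by (metis div_mult_mod_eq)
  then show "idm z = dsum N idm z" unfolding z dsum_apply idm_def by auto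
qed

lemma idm_gl: "N > 0 \<Longrightarrow> idm \<in> gl_blk N"
  unfolding gl_blk_def using idm_dsum by (metis rangeI)

lemma mmul_idm_left: "mmul idm A = A"
proof
  fix z :: "nat \<times> nat" obtain i j where z: "z = (i, j)" by force
  show "mmul idm A z = A z" unfolding z using mmul_finite[of "{i}" idm i A j] by (auto simp: idm_def)
qed

lemma mmul_idm_right: "row_finite A \<Longrightarrow> mmul A idm = A"
proof
  fix z :: "nat \<times> nat" assume A: "row_finite A" obtain i j where z: "z = (i, j)" by force
  have "finite ({m. A (i, m) \<noteq> 0} \<union> {j})" using A by (simp add: row_finite_def)
  then have "mmul A idm (i, j) = (\<Sum>m\<in>{m. A (i, m) \<noteq> 0} \<union> {j}. A (i, m) * idm (m, j))"
    by (rule mmul_finite) auto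
  also have "\<dots> = (\<Sum>m\<in>{m. A (i, m) \<noteq> 0} \<union> {j}. if m = j then A (i, j) else 0)"
    by (rule sum.cong) (auto simp: idm_def)
  also have "\<dots> = A (i, j)" using \<open>finite ({m. A (i, m) \<noteq> 0} \<union> {j})\<close> by simp
  finally show "mmul A idm z = A z" unfolding z .
qed

lemma row_finite_subspace: "cfun.subspace {A. row_finite A}"
proof (rule cfun.subspaceI)
  fix A B assume "A \<in> {A. row_finite A}" "B \<in> {A. row_finite A}"
  then have f: "finite ({j. A (i, j) \<noteq> 0} \<union> {j. B (i, j) \<noteq> 0})" for i by (simp add: row_finite_def)
  have "finite {j. (A + B) (i, j) \<noteq> 0}" for i by (rule finite_subset[OF _ f[of i]]) auto
  then show "A + B \<in> {A. row_finite A}" by (simp add: row_finite_def)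
next
  fix c A assume "A \<in> {A. row_finite A}"
  then have f: "finite {j. A (i, j) \<noteq> 0}" for i by (simp add: row_finite_def)
  have "finite {j. fscale c A (i, j) \<noteq> 0}" for i by (rule finite_subset[OF _ f[of i]]) auto
  then show "fscale c A \<in> {A. row_finite A}" by (simp add: row_finite_def)
qed (simp add: row_finite_def)

lemma row_finite_sum: "(\<And>j. j \<in> J \<Longrightarrow> row_finite (F j)) \<Longrightarrow> row_finite (\<Sum>j\<in>J. F j)"
  using cfun.subspace_sum[OF row_finite_subspace] by auto

lemma mmul_sum_left:
  assumes "finite J" "\<And>j. j \<in> J \<Longrightarrow> row_finite (F j)"
  shows "mmul (\<Sum>j\<in>J. F j) B = (\<Sum>j\<in>J. mmul (F j) B)"
  using assms
proof (induction J)
  case empty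
  show ?case by (auto simp: mmul_def fun_eq_iff)
next
  case (insert a J)
  then have r: "row_finite (F a)" "row_finite (\<Sum>j\<in>J. F j)" by (auto intro: row_finite_sum)
  show ?case unfolding sum.insert[OF insert.hyps] mmul_add_left[OF r] using insert by (simp only: insert_iff simp_thms)
qed

lemma mmul_sum_right: "finite J \<Longrightarrow> mmul A (\<Sum>j\<in>J. F j) = (\<Sum>j\<in>J. mmul A (F j))"
proof (induction J rule: finite_induct)
  case empty
  show ?case by (auto simp: mmul_def fun_eq_iff)
next
  case (insert a J)
  show ?case unfolding sum.insert[OF insert.hyps] mmul_add_right insert.IH ..
qed

lemma lbr_add_right: "row_finite B \<Longrightarrow> row_finite C \<Longrightarrow> lbr A (B + C) = lbr A B + lbr A C"
  unfolding lbr_def mmul_add_right mmul_add_left by (simp only: add_diff_add)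

lemma lbr_scale_right: "lbr A (fscale c B) = fscale c (lbr A B)"
  unfolding lbr_def mmul_scale_right mmul_scale_left by (rule cfun.scale_right_diff_distrib[symmetric])

lemma lbr_sum_right:
  assumes "finite J" "\<And>j. j \<in> J \<Longrightarrow> row_finite (F j)"
  shows "lbr A (\<Sum>j\<in>J. F j) = (\<Sum>j\<in>J. lbr A (F j))"
proof -
  have "mmul (\<Sum>j\<in>J. F j) A = (\<Sum>j\<in>J. mmul (F j) A)" using assms by (rule mmul_sum_left)
  then show ?thesis by (simp only: lbr_def mmul_sum_right[OF assms(1)] sum_subtractf)
qed

lemma lbr_antisym: "lbr A B = - lbr B A"
  by (simp only: lbr_def minus_diff_eq)

context split_basis
begin

text \<open>The matrix \<open>Y \<otimes> D\<close> with \<open>D\<close> diagonal in the basis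
  \<open>b\<close>. It covers both \<open>h\<close>, with \<open>Y\<close> the identity, and the
  elements \<open>Y \<otimes> 1\<close>.\<close>

definition dmat :: "cmat \<Rightarrow> (nat \<Rightarrow> complex) \<Rightarrow> cmat" where
  "dmat Y c = (\<Sum>j<p. fscale (c j) (tmat Y j j))"

lemma tmat_row_finite:
  assumes "row_finite Y"
  shows "row_finite (tmat Y i j)"
  unfolding row_finite_def
proof
  fix x
  have "finite ({m. Y (x div p, m) \<noteq> 0} \<times> {..<p})" using assms by (auto simp: row_finite_def)
  moreover have "{m. tmat Y i j (x, m) \<noteq> 0} \<subseteq> (\<lambda>(m, l). m * p + l) ` ({m. Y (x div p, m) \<noteq> 0} \<times> {..<p})"
  proof
    fix m assume "m \<in> {m. tmat Y i j (x, m) \<noteq> 0}"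
    then have "Y (x div p, m div p) \<noteq> 0" by (auto simp: tmat_apply)
    then show "m \<in> (\<lambda>(m, l). m * p + l) ` ({m. Y (x div p, m) \<noteq> 0} \<times> {..<p})"
      using p by (intro image_eqI[of _ _ "(m div p, m mod p)"]) auto
  qed
  ultimately show "finite {m. tmat Y i j (x, m) \<noteq> 0}" using finite_surj by blast
qed

lemma row_finite_scale: "row_finite A \<Longrightarrow> row_finite (fscale c A)"
  using cfun.subspace_scale[OF row_finite_subspace] by auto

lemma comp_sum: "finite J \<Longrightarrow> comp (\<Sum>x\<in>J. F x) i j = (\<Sum>x\<in>J. comp (F x) i j)"
proof (induction J rule: finite_induct)
  case empty
  show ?case by (auto simp: comp_def fun_eq_iff)
next
  case (insert a J)
  show ?case unfolding sum.insert[OF insert.hyps] comp_add insert.IH ..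
qed

lemma comp_zero: "comp 0 i j = 0"
  by (auto simp: comp_def fun_eq_iff)

lemma comp_diff: "comp (A - B) i j = comp A i j - comp B i j"
  by (auto simp: comp_def fun_eq_iff sum_subtractf algebra_simps)

lemma comp_dmat:
  assumes "i < p" "j < p"
  shows "comp (dmat Y c) i j = (if i = j then fscale (c i) Y else 0)"
proof -
  have "comp (dmat Y c) i j = (\<Sum>k<p. if k = i then (if i = j then fscale (c i) Y else 0) else 0)"
    unfolding dmat_def comp_sum[OF finite_lessThan] comp_scale
    using assms by (intro sum.cong refl) (auto simp: comp_tmat fun_eq_iff)
  then show ?thesis using assms by simp
qed

lemma lbr_dmat_tmat:
  assumes "i < p" "j < p" "row_finite Y" "row_finite Z"
  shows "lbr (dmat Y c) (tmat Z i j) = fscale (c i) (tmat (mmul Y Z) i j) - fscale (c j) (tmat (mmul Z Y) i j)"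
proof -
  have "mmul (dmat Y c) (tmat Z i j) = (\<Sum>k<p. fscale (c k) (mmul (tmat Y k k) (tmat Z i j)))"
    unfolding dmat_def using assms by (subst mmul_sum_left) (simp_all add: row_finite_scale tmat_row_finite mmul_scale_left)
  also have "\<dots> = (\<Sum>k<p. if k = i then fscale (c i) (tmat (mmul Y Z) i j) else 0)"
    using assms by (intro sum.cong refl) (auto simp: mmul_tmat fun_eq_iff)
  also have "\<dots> = fscale (c i) (tmat (mmul Y Z) i j)" using assms by simp
  finally have 1: "mmul (dmat Y c) (tmat Z i j) = fscale (c i) (tmat (mmul Y Z) i j)" .
  have "mmul (tmat Z i j) (dmat Y c) = (\<Sum>k<p. fscale (c k) (mmul (tmat Z i j) (tmat Y k k)))"
    unfolding dmat_def mmul_sum_right[OF finite_lessThan] mmul_scale_right ..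
  also have "\<dots> = (\<Sum>k<p. if k = j then fscale (c j) (tmat (mmul Z Y) i j) else 0)"
    using assms by (intro sum.cong refl) (auto simp: mmul_tmat fun_eq_iff)
  also have "\<dots> = fscale (c j) (tmat (mmul Z Y) i j)" using assms by simp
  finally show ?thesis unfolding lbr_def 1 by simp
qed

lemma comp_row_finite: "row_finite A \<Longrightarrow> row_finite (comp A i j)"
  unfolding row_finite_def
proof
  fix a assume A: "\<forall>i. finite {j. A (i, j) \<noteq> 0}"
  have "{c. comp A i j (a, c) \<noteq> 0} \<subseteq> (\<Union>k<p. (\<lambda>x. x div p) ` {x. A (a * p + k, x) \<noteq> 0})"
  proof
    fix c assume "c \<in> {c. comp A i j (a, c) \<noteq> 0}"
    then have "\<exists>k<p. \<exists>l<p. A (a * p + k, c * p + l) \<noteq> 0"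
      unfolding comp_def by (auto elim!: sum.not_neutral_contains_not_neutral) blast
    then obtain k l where "k < p" "l < p" "A (a * p + k, c * p + l) \<noteq> 0" by blast
    then show "c \<in> (\<Union>k<p. (\<lambda>x. x div p) ` {x. A (a * p + k, x) \<noteq> 0})"
      by (intro UN_I[of k] image_eqI[of _ _ "c * p + l"]) auto
  qed
  moreover have "finite (\<Union>k<p. (\<lambda>x. x div p) ` {x. A (a * p + k, x) \<noteq> 0})" using A by simp
  ultimately show "finite {c. comp A i j (a, c) \<noteq> 0}" by (rule finite_subset)
qed

text \<open>The summands of \<open>expand\<close> are eigenvectors for the bracket with a diagonal
  matrix. The root decomposition, and with it the descriptions of \<open>m\<close>, \<open>n\<close>
  and the parabolic, rests on this.\<close>

lemma lbr_dmat_idm: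
  assumes "row_finite A" "i < p" "j < p"
  shows "comp (lbr (dmat idm c) A) i j = fscale (c i - c j) (comp A i j)"
proof -
  let ?I = "{..<p} \<times> {..<p}"
  have id: "row_finite idm" using gl_blk_row_finite[OF _ idm_gl] by (metis zero_less_one)
  have "lbr (dmat idm c) A = lbr (dmat idm c) (\<Sum>z\<in>?I. tmat (comp A (fst z) (snd z)) (fst z) (snd z))"
    by (subst expand[of A]) (simp add: case_prod_beta)
  also have "\<dots> = (\<Sum>z\<in>?I. lbr (dmat idm c) (tmat (comp A (fst z) (snd z)) (fst z) (snd z)))"
    by (rule lbr_sum_right) (auto intro: tmat_row_finite comp_row_finite assms)
  also have "\<dots> = (\<Sum>z\<in>?I. fscale (c (fst z) - c (snd z)) (tmat (comp A (fst z) (snd z)) (fst z) (snd z)))"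
  proof (rule sum.cong[OF refl])
    fix z assume "z \<in> ?I"
    then have z: "fst z < p" "snd z < p" by auto
    have "lbr (dmat idm c) (tmat (comp A (fst z) (snd z)) (fst z) (snd z)) = fscale (c (fst z)) (tmat (comp A (fst z) (snd z)) (fst z) (snd z)) - fscale (c (snd z)) (tmat (comp A (fst z) (snd z)) (fst z) (snd z))"
      unfolding lbr_dmat_tmat[OF z id comp_row_finite[OF assms(1)]] mmul_idm_left mmul_idm_right[OF comp_row_finite[OF assms(1)]] ..
    also have "\<dots> = fscale (c (fst z) - c (snd z)) (tmat (comp A (fst z) (snd z)) (fst z) (snd z))"
      by (rule cfun.scale_left_diff_distrib[symmetric])
    finally show "lbr (dmat idm c) (tmat (comp A (fst z) (snd z)) (fst z) (snd z))
      = fscale (c (fst z) - c (snd z)) (tmat (comp A (fst z) (snd z)) (fst z) (snd z))" .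
  qed
  finally have "lbr (dmat idm c) A = (\<Sum>z\<in>?I. fscale (c (fst z) - c (snd z)) (tmat (comp A (fst z) (snd z)) (fst z) (snd z)))" .
  then have "comp (lbr (dmat idm c) A) i j = (\<Sum>z\<in>?I. fscale (c (fst z) - c (snd z)) (comp (tmat (comp A (fst z) (snd z)) (fst z) (snd z)) i j))"
    by (simp add: comp_sum comp_scale)
  also have "\<dots> = (\<Sum>z\<in>?I. if z = (i, j) then fscale (c i - c j) (comp A i j) else 0)"
    using assms by (intro sum.cong refl) (auto simp: comp_tmat fun_eq_iff split: if_splits)
  also have "\<dots> = fscale (c i - c j) (comp A i j)" using assms by simp
  finally show ?thesis .
qed

lemma eigen_dmat:
  assumes h: "h \<in> gl_blk p" and eig: "\<And>j. j < p \<Longrightarrow> mvec h (b j) = fscale (\<eta> j) (b j)"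
  shows "h = dmat idm \<eta>"
proof (rule comp_ext)
  fix i j assume ij: "i < p" "j < p"
  obtain h0 where h0: "h = dsum p h0" using h by (auto simp: gl_blk_def)
  have hb: "(\<Sum>l<p. h0 (k, l) * b j l) = \<eta> j * b j k" if "k < p" for k
  proof -
    have "mvec h (b j) k = (\<Sum>l | h (k, l) \<noteq> 0. h (k, l) * b j l)" by (simp add: mvec_def)
    also have "\<dots> = (\<Sum>l<p. h (k, l) * b j l)"
      by (rule sum.mono_neutral_left) (use that p in \<open>auto simp: h0 dsum_apply div_eq_0_iff split: if_splits\<close>)
    also have "\<dots> = (\<Sum>l<p. h0 (k, l) * b j l)" using that by (intro sum.cong) (auto simp: h0 dsum_apply)
    finally show ?thesis using eig[OF ij(2)] by (simp add: fun_eq_iff)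
  qed
  have "comp h i j (a, c) = (if i = j then fscale (\<eta> i) idm else 0) (a, c)" for a c
  proof -
    have "comp h i j (a, c) = (\<Sum>k<p. \<beta> i k * (\<Sum>l<p. of_bool (a = c) * (h0 (k, l) * b j l)))"
      unfolding comp_def by (auto intro!: sum.cong simp: h0 dsum_apply sum_distrib_left mult.assoc)
    also have "\<dots> = (\<Sum>k<p. of_bool (a = c) * \<eta> j * (\<beta> i k * b j k))"
      by (intro sum.cong refl) (simp add: sum_distrib_left[symmetric] hb)
    also have "\<dots> = of_bool (a = c) * \<eta> j * of_bool (i = j)"
      unfolding sum_distrib_left[symmetric] dual[OF ij] ..
    finally show ?thesis by (auto simp: idm_def)
  qed
  then show "comp h i j = comp (dmat idm \<eta>) i j" unfolding comp_dmat[OF ij] by (auto simp: fun_eq_iff)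
qed

end

section \<open>The Levi subalgebra\<close>

locale levi_setup = split_basis p b \<beta>
  for p :: nat and b \<beta> +
  fixes \<theta> :: "nat \<Rightarrow> nat" and k0 t0 m n :: "cmat set" and h :: cmat and \<eta> :: "nat \<Rightarrow> complex"
  assumes theta: "\<And>i. i \<ge> 1 \<Longrightarrow> \<theta> i > 1"
    and k0: "k0 \<subseteq> gl_level p \<theta> 1" "0 \<in> k0"
    and hk0: "h \<in> k0" and regular: "regular_semisimple (gl_level p \<theta> 1) h"
    and t0: "t0 = centralizer k0 {h}" and m: "m = centralizer (gl_lim p \<theta>) t0"
    and ideal: "lie_ideal n (parabolic (gl_lim p \<theta>) h)"
    and decomp: "direct_sum_decomp (parabolic (gl_lim p \<theta>) h) m n"
    and eig: "\<And>j. j < p \<Longrightarrow> mvec h (b j) = fscale (\<eta> j) (b j)"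
begin

abbreviation "G l \<equiv> gl_level p \<theta> l"
abbreviation "g \<equiv> gl_lim p \<theta>"
abbreviation "P \<equiv> parabolic g h"
abbreviation "N l \<equiv> Nsize \<theta> l"

lemma N_pos [simp]: "N l > 0"
  by (rule Nsize_pos) (fact theta)

lemma G_blk: "G l = gl_blk (p * N l)"
  by (simp add: gl_level_def)

lemma G_mono: "1 \<le> l \<Longrightarrow> l \<le> l' \<Longrightarrow> G l \<subseteq> G l'"
  by (rule gl_level_mono) (use theta p in auto)

lemma gl1_level: "gl_level 1 \<theta> l = gl_blk (N l)"
  by (simp add: gl_level_def)

lemma gl1_mono: "1 \<le> l \<Longrightarrow> l \<le> l' \<Longrightarrow> gl_blk (N l) \<subseteq> gl_blk (N l')"
  unfolding gl1_level[symmetric] by (rule gl_level_mono) (use theta in auto)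

lemma g_level: "A \<in> g \<Longrightarrow> \<exists>l\<ge>1. A \<in> G l"
  by (auto simp: gl_lim_def)

lemma G_g: "l \<ge> 1 \<Longrightarrow> G l \<subseteq> g"
  by (auto simp: gl_lim_def)

lemma g_level2: "A \<in> g \<Longrightarrow> B \<in> g \<Longrightarrow> \<exists>l\<ge>1. A \<in> G l \<and> B \<in> G l"
proof -
  assume "A \<in> g" "B \<in> g"
  then obtain l l' where l: "l \<ge> 1" "l' \<ge> 1" "A \<in> G l" "B \<in> G l'" using g_level by blast
  then have "A \<in> G (max l l')" "B \<in> G (max l l')" using G_mono[of l "max l l'"] G_mono[of l' "max l l'"] by auto
  then show ?thesis using l by (intro exI[of _ "max l l'"]) auto
qed

lemma G_subspace: "cfun.subspace (G l)"
  unfolding G_blk by (rule gl_blk_subspace)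

lemma G_lbr: "A \<in> G l \<Longrightarrow> B \<in> G l \<Longrightarrow> lbr A B \<in> G l"
  unfolding G_blk using p by (intro gl_blk_lbr) auto

lemma g_subspace: "cfun.subspace g"
proof (rule cfun.subspaceI)
  show "0 \<in> g" using cfun.subspace_0[OF G_subspace[of 1]] G_g[of 1] by auto
  fix A B assume "A \<in> g" "B \<in> g"
  then obtain l where "l \<ge> 1" "A \<in> G l" "B \<in> G l" using g_level2 by blast
  then show "A + B \<in> g" using cfun.subspace_add[OF G_subspace[of l]] G_g[of l] by blast
next
  fix c A assume "A \<in> g"
  then obtain l where "l \<ge> 1" "A \<in> G l" using g_level by blast
  then show "fscale c A \<in> g" using cfun.subspace_scale[OF G_subspace[of l]] G_g[of l] by blast
qed

lemma g_lbr: "A \<in> g \<Longrightarrow> B \<in> g \<Longrightarrow> lbr A B \<in> g"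
proof -
  assume "A \<in> g" "B \<in> g"
  then obtain l where "l \<ge> 1" "A \<in> G l" "B \<in> G l" using g_level2 by blast
  then show "lbr A B \<in> g" using G_lbr[of A l B] G_g[of l] by blast
qed

lemma g_row_finite: "A \<in> g \<Longrightarrow> row_finite A"
  using g_level gl_blk_row_finite[of "p * N _" A] p unfolding G_blk by fastforce

lemma comp_G: "A \<in> G l \<Longrightarrow> comp A i j \<in> gl_blk (N l)"
  unfolding G_blk by (rule comp_gl) simp

lemma tmat_G: "Y \<in> gl_blk (N l) \<Longrightarrow> tmat Y i j \<in> G l"
  unfolding G_blk by (rule tmat_gl) simp

lemma G1: "G 1 = gl_blk p"
  by (simp add: G_blk Nsize_def)

lemma h_G1: "h \<in> gl_blk p"
  using hk0 k0(1) unfolding G1[symmetric] by blast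

lemma h_dmat: "h = dmat idm \<eta>"
  by (rule eigen_dmat[OF h_G1 eig])

lemma h_g: "h \<in> g"
  using h_G1 G_g[of 1] unfolding G1[symmetric] by auto

lemma comp_lbr_h: "A \<in> g \<Longrightarrow> i < p \<Longrightarrow> j < p \<Longrightarrow> comp (lbr h A) i j = fscale (\<eta> i - \<eta> j) (comp A i j)"
  unfolding h_dmat by (rule lbr_dmat_idm[OF g_row_finite])

lemma idm_N: "idm \<in> gl_blk (N l)"
  by (rule idm_gl) simp

lemma idm_rf: "row_finite idm"
  using gl_blk_row_finite[OF N_pos idm_N] .

lemma idm_nz: "idm \<noteq> 0"
  by (auto simp: idm_def fun_eq_iff)

lemma gl_row_finite: "Y \<in> gl_blk (N l) \<Longrightarrow> row_finite Y"
  by (rule gl_blk_row_finite) auto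

lemma lbr_h_zero: "A \<in> g \<Longrightarrow> (\<And>i j. i < p \<Longrightarrow> j < p \<Longrightarrow> \<eta> i \<noteq> \<eta> j \<Longrightarrow> comp A i j = 0) \<Longrightarrow> lbr h A = 0"
proof (rule comp_ext)
  fix i j assume A: "A \<in> g" "\<And>i j. i < p \<Longrightarrow> j < p \<Longrightarrow> \<eta> i \<noteq> \<eta> j \<Longrightarrow> comp A i j = 0" and ij: "i < p" "j < p"
  then show "comp (lbr h A) i j = comp 0 i j"
    unfolding comp_lbr_h[OF A(1) ij] by (cases "\<eta> i = \<eta> j") (auto simp: comp_zero fun_eq_iff)
qed

text \<open>If two eigenvalues agreed, the unit \<open>?e\<close> at \<open>(i, j)\<close> and the
  unit \<open>?d\<close> at \<open>(i, i)\<close> would centralise \<open>h\<close>. As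
  \<open>[?d, ?e] = ?e\<close>, the lower central series of the centralizer would never reach 0, but
  a Cartan subalgebra is nilpotent.\<close>

lemma \<eta>_inj:
  assumes ij: "i < p" "j < p" "i \<noteq> j"
  shows "\<eta> i \<noteq> \<eta> j"
proof
  assume eq: "\<eta> i = \<eta> j"
  let ?C = "centralizer (G 1) {h}"
  let ?e = "tmat idm i j" and ?d = "tmat idm i i"
  have G: "?e \<in> G 1" "?d \<in> G 1" by (rule tmat_G[OF idm_N])+
  then have g: "?e \<in> g" "?d \<in> g" using G_g[of 1] by auto
  have "lbr h ?e = 0" "lbr h ?d = 0"
    by (rule lbr_h_zero[OF g(1)], use ij eq in \<open>auto simp: comp_tmat\<close>) (rule lbr_h_zero[OF g(2)], use ij in \<open>auto simp: comp_tmat\<close>)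
  then have C: "?e \<in> ?C" "?d \<in> ?C" using G by (auto simp: centralizer_def lbr_antisym[of _ h])
  have de: "lbr ?d ?e = ?e"
    unfolding lbr_def using ij by (simp add: mmul_tmat idm_rf mmul_idm_left)
  have "?e \<in> lower_central ?C k" for k
  proof (induction k)
    case 0
    then show ?case using C by simp
  next
    case (Suc k)
    then have "lbr ?d ?e \<in> {lbr x y | x y. x \<in> ?C \<and> y \<in> lower_central ?C k}" using C by blast
    then show ?case unfolding de lower_central.simps by (rule cfun.span_base)
  qed
  moreover obtain k where "lower_central ?C k = {0}"
    using regular unfolding regular_semisimple_def cartan_subalgebra_def by blast
  ultimately have "?e = 0" by blast
  then have "comp ?e i j = 0" by (simp only: comp_zero)
  then show False using ij idm_nz by (simp add: comp_tmat)
qed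

lemma comp_zero_of_commuting:
  assumes A: "A \<in> g" "lbr h A = 0" and ij: "i < p" "j < p" "i \<noteq> j"
  shows "comp A i j = 0"
proof
  fix z
  have "0 = fscale (\<eta> i - \<eta> j) (comp A i j)"
    using comp_lbr_h[OF A(1) ij(1,2)] unfolding A(2) comp_zero .
  then have "0 = (\<eta> i - \<eta> j) * comp A i j z" by (metis zero_fun_apply)
  then show "comp A i j z = 0 z" using \<eta>_inj[OF ij] by simp
qed

lemma h_t0: "h \<in> t0"
  unfolding t0 centralizer_def using hk0 by (simp add: lbr_def)

text \<open>Commuting with the regular element \<open>h\<close> leaves the diagonal components;
  these are scalars because \<open>t0\<close> lies in the first level, where the coefficients come
  from \<open>gl(1)\<close>.\<close>

lemma t0_diag: "t \<in> t0 \<Longrightarrow> \<exists>c. t = dmat idm c"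
proof -
  assume t: "t \<in> t0"
  then have tG: "t \<in> G 1" and th: "lbr t h = 0" using k0 by (auto simp: t0 centralizer_def)
  then have tg: "t \<in> g" using G_g[of 1] by auto
  have "lbr h t = 0" using th lbr_antisym[of h t] by simp
  have off: "comp t i j = 0" if "i < p" "j < p" "i \<noteq> j" for i j
    using tg \<open>lbr h t = 0\<close> that by (rule comp_zero_of_commuting)
  have "\<exists>c. comp t i i = fscale c idm" for i
  proof -
    have "comp t i i \<in> gl_blk 1" using comp_G[OF tG, of i i] by (simp add: Nsize_def)
    then obtain A where "comp t i i = dsum 1 A" by (auto simp: gl_blk_def)
    then have "comp t i i = fscale (A (0, 0)) idm" by (auto simp: fun_eq_iff dsum_def idm_def)
    then show ?thesis by blast
  qed
  then obtain c where c: "\<And>i. comp t i i = fscale (c i) idm" by metis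
  have "t = dmat idm c"
    by (rule comp_ext) (auto simp: comp_dmat c off)
  then show ?thesis by blast
qed

text \<open>Since \<open>h\<close> is in \<open>t0\<close>, elements of \<open>m\<close> commute
  with \<open>h\<close> and have no off-diagonal components; conversely all of \<open>t0\<close> is
  diagonal with scalar components. This is the identification of \<open>m\<close> with
  \<open>p\<close> copies of \<open>gl(\<Theta>)\<close>.\<close>

lemma m_iff: "A \<in> m \<longleftrightarrow> A \<in> g \<and> (\<forall>i<p. \<forall>j<p. i \<noteq> j \<longrightarrow> comp A i j = 0)"
proof
  assume A: "A \<in> m"
  then have Ag: "A \<in> g" and "lbr A h = 0" using h_t0 by (auto simp: m centralizer_def)
  then have "lbr h A = 0" using lbr_antisym[of h A] by simp
  then show "A \<in> g \<and> (\<forall>i<p. \<forall>j<p. i \<noteq> j \<longrightarrow> comp A i j = 0)"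
    using comp_zero_of_commuting[OF Ag] Ag by blast
next
  assume A: "A \<in> g \<and> (\<forall>i<p. \<forall>j<p. i \<noteq> j \<longrightarrow> comp A i j = 0)"
  have "lbr A t = 0" if "t \<in> t0" for t
  proof -
    obtain c where t: "t = dmat idm c" using t0_diag[OF \<open>t \<in> t0\<close>] by blast
    have "lbr t A = 0"
    proof (rule comp_ext)
      fix i j assume ij: "i < p" "j < p"
      show "comp (lbr t A) i j = comp 0 i j"
        using A ij lbr_dmat_idm[OF g_row_finite ij, of A c] by (cases "i = j") (auto simp: t comp_zero fun_eq_iff)
    qed
    then show ?thesis using lbr_antisym[of A t] by simp
  qed
  then show "A \<in> m" using A by (auto simp: m centralizer_def)
qed

text \<open>The bracket with \<open>h\<close> multiplies the component \<open>(i, j)\<close> by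
  \<open>\<eta> i - \<eta> j\<close>, so an eigenvector with eigenvalue of nonnegative real part has
  no component where this difference has negative real part.\<close>

lemma P_iff: "A \<in> P \<longleftrightarrow> A \<in> g \<and> (\<forall>i<p. \<forall>j<p. Re (\<eta> i - \<eta> j) < 0 \<longrightarrow> comp A i j = 0)"
proof
  let ?R = "{A. A \<in> g \<and> (\<forall>i<p. \<forall>j<p. Re (\<eta> i - \<eta> j) < 0 \<longrightarrow> comp A i j = 0)}"
  have sub: "cfun.subspace ?R"
  proof (rule cfun.subspaceI)
    show "0 \<in> ?R" using cfun.subspace_0[OF g_subspace] by (simp add: comp_zero)
    fix A B assume "A \<in> ?R" "B \<in> ?R"
    then show "A + B \<in> ?R" using cfun.subspace_add[OF g_subspace] by (auto simp: comp_add)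
  next
    fix c A assume "A \<in> ?R"
    then show "fscale c A \<in> ?R" using cfun.subspace_scale[OF g_subspace, of A c] by (auto simp: comp_scale)
  qed
  have eigR: "ad_eigenspace g h \<sigma> \<subseteq> ?R" if "Re \<sigma> \<ge> 0" for \<sigma>
  proof
    fix A assume "A \<in> ad_eigenspace g h \<sigma>"
    then have A: "A \<in> g" "lbr h A = fscale \<sigma> A" by (auto simp: ad_eigenspace_def)
    have "comp A i j = 0" if "i < p" "j < p" "Re (\<eta> i - \<eta> j) < 0" for i j
    proof -
      have "fscale \<sigma> (comp A i j) = fscale (\<eta> i - \<eta> j) (comp A i j)"
        using comp_lbr_h[OF A(1) that(1,2)] unfolding A(2) comp_scale .
      moreover have "\<sigma> \<noteq> \<eta> i - \<eta> j" using that(3) \<open>Re \<sigma> \<ge> 0\<close> by auto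
      ultimately show ?thesis by (auto simp: fun_eq_iff)
    qed
    then show "A \<in> ?R" using A by blast
  qed
  show "A \<in> g \<and> (\<forall>i<p. \<forall>j<p. Re (\<eta> i - \<eta> j) < 0 \<longrightarrow> comp A i j = 0)" if "A \<in> P"
  proof -
    have "P \<subseteq> ?R" unfolding parabolic_def by (rule cfun.span_minimal[OF _ sub]) (use eigR in auto)
    then show ?thesis using that by blast
  qed
  assume A: "A \<in> g \<and> (\<forall>i<p. \<forall>j<p. Re (\<eta> i - \<eta> j) < 0 \<longrightarrow> comp A i j = 0)"
  obtain l where l: "l \<ge> 1" "A \<in> G l" using A g_level by blast
  have "tmat (comp A i j) i j \<in> P" if ij: "i < p" "j < p" for i j
  proof (cases "Re (\<eta> i - \<eta> j) < 0")
    case True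
    then have "tmat (comp A i j) i j = 0" using A ij by (simp add: tmat_zero)
    then show ?thesis unfolding parabolic_def by (simp add: cfun.span_zero)
  next
    case False
    have tg: "tmat (comp A i j) i j \<in> g" using tmat_G[OF comp_G[OF l(2)]] G_g[OF l(1)] by blast
    have "lbr h (tmat (comp A i j) i j) = fscale (\<eta> i - \<eta> j) (tmat (comp A i j) i j)"
    proof (rule comp_ext)
      fix i' j' assume "i' < p" "j' < p"
      then show "comp (lbr h (tmat (comp A i j) i j)) i' j' = comp (fscale (\<eta> i - \<eta> j) (tmat (comp A i j) i j)) i' j'"
        using ij by (auto simp: comp_lbr_h[OF tg] comp_scale comp_tmat)
    qed
    then have "tmat (comp A i j) i j \<in> ad_eigenspace g h (\<eta> i - \<eta> j)" using tg by (simp add: ad_eigenspace_def)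
    then show ?thesis
      unfolding parabolic_def using False by (intro cfun.span_base UN_I[of "\<eta> i - \<eta> j"]) auto
  qed
  then have "(\<Sum>(i, j)\<in>{..<p} \<times> {..<p}. tmat (comp A i j) i j) \<in> P"
    unfolding parabolic_def by (intro cfun.span_sum) auto
  then show "A \<in> P" by (subst expand)
qed

lemma P_subspace: "cfun.subspace P"
  by (simp add: parabolic_def)

lemma P_g: "P \<subseteq> g"
  using P_iff by blast

lemma m_P: "m \<subseteq> P"
  using m_iff P_iff by (metis complex_Re_of_nat diff_self less_irrefl of_nat_0 subsetI zero_complex.sel(1))

lemma n_P: "n \<subseteq> P" and n_subspace: "cfun.subspace n" and n_ideal: "x \<in> P \<Longrightarrow> y \<in> n \<Longrightarrow> lbr x y \<in> n"
  using ideal by (auto simp: lie_ideal_def)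

lemma h_P: "h \<in> P"
  unfolding P_iff using h_g by (simp add: h_dmat comp_dmat)

text \<open>Only the ideal property of \<open>n\<close> and its complement \<open>m\<close> are
  given. The bracket with \<open>h\<close> kills the part in \<open>m\<close>, so it maps the matrix
  into \<open>n\<close>; the matrix is an eigenvector with nonzero eigenvalue, hence lies in
  \<open>n\<close> itself.\<close>

lemma off_n:
  assumes ij: "i < p" "j < p" "i \<noteq> j" "\<not> Re (\<eta> i - \<eta> j) < 0" and Y: "Y \<in> gl_blk (N l)" "l \<ge> 1"
  shows "tmat Y i j \<in> n"
proof -
  let ?x = "tmat Y i j"
  have g: "?x \<in> g" using tmat_G[OF Y(1)] G_g[OF Y(2)] by blast
  have "?x \<in> P" unfolding P_iff using g ij by (auto simp: comp_tmat)
  then obtain a c where x: "?x = a + c" "a \<in> m" "c \<in> n" using decomp by (auto simp: direct_sum_decomp_def)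
  have cg: "c \<in> g" "a \<in> g" using x n_P P_g m_iff by auto
  have "lbr h ?x = lbr h a + lbr h c"
    unfolding x(1) by (rule lbr_add_right) (use cg g_row_finite in auto)
  also have "lbr h a = 0" using x(2) h_t0 lbr_antisym[of h a] by (auto simp: m centralizer_def)
  finally have "lbr h ?x \<in> n" using n_ideal[OF h_P x(3)] by simp
  moreover have "lbr h ?x = fscale (\<eta> i - \<eta> j) ?x"
    by (rule comp_ext) (use ij in \<open>auto simp: comp_lbr_h[OF g] comp_scale comp_tmat\<close>)
  ultimately have "fscale (inverse (\<eta> i - \<eta> j)) (fscale (\<eta> i - \<eta> j) ?x) \<in> n" by (metis cfun.subspace_scale[OF n_subspace])
  moreover have "fscale (inverse (\<eta> i - \<eta> j)) (fscale (\<eta> i - \<eta> j) ?x) = ?x"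
    using \<eta>_inj[OF ij(1-3)] by (auto simp: fun_eq_iff field_simps)
  ultimately show ?thesis by (simp only:)
qed

lemma m_n_zero: "x \<in> m \<Longrightarrow> x \<in> n \<Longrightarrow> x = 0"
  using decomp by (auto simp: direct_sum_decomp_def)

definition dpart :: "cmat \<Rightarrow> cmat" where
  "dpart A = (\<Sum>j<p. tmat (comp A j j) j j)"

lemma comp_dpart: "i < p \<Longrightarrow> j < p \<Longrightarrow> comp (dpart A) i j = (if i = j then comp A i j else 0)"
proof -
  assume ij: "i < p" "j < p"
  have "comp (dpart A) i j = (\<Sum>k<p. if k = i then (if i = j then comp A i j else 0) else 0)"
    unfolding dpart_def comp_sum[OF finite_lessThan]
    using ij by (intro sum.cong refl) (auto simp: comp_tmat)
  then show ?thesis using ij by simp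
qed

lemma dpart_g: "A \<in> g \<Longrightarrow> dpart A \<in> g"
proof -
  assume "A \<in> g"
  then obtain l where l: "l \<ge> 1" "A \<in> G l" using g_level by blast
  then have "dpart A \<in> G l" unfolding dpart_def by (intro cfun.subspace_sum[OF G_subspace] tmat_G comp_G)
  then show ?thesis using G_g[OF l(1)] by blast
qed

lemma dpart_m: "A \<in> g \<Longrightarrow> dpart A \<in> m"
  unfolding m_iff using dpart_g by (auto simp: comp_dpart)

lemma dpart_n: "A \<in> P \<Longrightarrow> A - dpart A \<in> n"
proof -
  assume A: "A \<in> P"
  then have Ag: "A \<in> g" using P_g by blast
  then obtain l where l: "l \<ge> 1" "A \<in> G l" using g_level by blast
  let ?F = "\<lambda>z. if fst z = snd z then 0 else tmat (comp A (fst z) (snd z)) (fst z) (snd z)"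
  have "?F z \<in> n" if z: "z \<in> {..<p} \<times> {..<p}" for z
  proof -
    have "tmat (comp A (fst z) (snd z)) (fst z) (snd z) \<in> n" if "fst z \<noteq> snd z"
    proof (cases "Re (\<eta> (fst z) - \<eta> (snd z)) < 0")
      case True
      then have "comp A (fst z) (snd z) = 0" using A z unfolding P_iff by auto
      then show ?thesis by (simp only: tmat_zero cfun.subspace_0[OF n_subspace])
    next
      case False
      show ?thesis by (rule off_n[OF _ _ that False comp_G[OF l(2)] l(1)]) (use z in auto)
    qed
    then show ?thesis using cfun.subspace_0[OF n_subspace] by auto
  qed
  then have "(\<Sum>z\<in>{..<p} \<times> {..<p}. ?F z) \<in> n" by (rule cfun.subspace_sum[OF n_subspace])
  moreover have "(\<Sum>z\<in>{..<p} \<times> {..<p}. ?F z) = A - dpart A"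
  proof (rule comp_ext)
    fix i j assume ij: "i < p" "j < p"
    have "comp (\<Sum>z\<in>{..<p} \<times> {..<p}. ?F z) i j = (\<Sum>z\<in>{..<p} \<times> {..<p}. comp (?F z) i j)"
      by (rule comp_sum) simp
    also have "\<dots> = (\<Sum>z\<in>{..<p} \<times> {..<p}. if z = (i, j) then (if i = j then 0 else comp A i j) else 0)"
      using ij by (intro sum.cong refl) (auto simp: comp_tmat comp_zero)
    also have "\<dots> = comp (A - dpart A) i j" using ij by (simp add: comp_diff comp_dpart)
    finally show "comp (\<Sum>z\<in>{..<p} \<times> {..<p}. ?F z) i j = comp (A - dpart A) i j" .
  qed
  ultimately show ?thesis by simp
qed

text \<open>Subtracting the off-diagonal part, which lies in \<open>n\<close>, leaves a block
  diagonal matrix in \<open>m\<close> and \<open>n\<close> at once.\<close>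

lemma n_diag_zero: "A \<in> n \<Longrightarrow> j < p \<Longrightarrow> comp A j j = 0"
proof -
  assume A: "A \<in> n" and j: "j < p"
  have AP: "A \<in> P" using A n_P by blast
  have "A - (A - dpart A) \<in> n" by (rule cfun.subspace_diff[OF n_subspace A dpart_n[OF AP]])
  then have "dpart A \<in> n" by simp
  then have "dpart A = 0" using m_n_zero[OF dpart_m] AP P_g by blast
  then have "comp (dpart A) j j = 0" by (simp only: comp_zero)
  then show ?thesis using j by (simp add: comp_dpart)
qed

lemma mcomp_eq: "A \<in> P \<Longrightarrow> mcomp m n A = dpart A"
  unfolding mcomp_def
proof (rule the_equality)
  assume A: "A \<in> P"
  then show "dpart A \<in> m \<and> A - dpart A \<in> n" using dpart_m dpart_n P_g by blast
  fix y assume y: "y \<in> m \<and> A - y \<in> n"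
  show "y = dpart A"
  proof (rule comp_ext)
    fix i j assume ij: "i < p" "j < p"
    have "comp (A - y) i i = 0" using n_diag_zero y ij by blast
    then show "comp y i j = comp (dpart A) i j"
      using y ij by (auto simp: m_iff comp_dpart comp_diff)
  qed
qed

lemma component_eq:
  assumes A: "A \<in> m" and j: "j < p"
  shows "component p b j A = comp A j j"
  unfolding component_def
proof (rule the_equality)
  have Ad: "A = dpart A" by (rule comp_ext) (use A in \<open>auto simp: comp_dpart m_iff\<close>)
  have Az: "A z = (\<Sum>i<p. tmat (comp A i i) i i z)" for z
    by (subst Ad) (simp only: dpart_def sum_fun_apply)
  show "\<forall>a c k. k < p \<longrightarrow> (\<Sum>l<p. A (a * p + k, c * p + l) * b j l) = comp A j j (a, c) * b j k"
  proof (intro allI impI)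
    fix a c k assume k: "k < p"
    have "(\<Sum>l<p. A (a * p + k, c * p + l) * b j l) = (\<Sum>l<p. \<Sum>i<p. comp A i i (a, c) * b i k * (\<beta> i l * b j l))"
      using k by (intro sum.cong refl) (simp add: Az[of "(_, _)"] tmat_apply sum_distrib_right mult.assoc)
    also have "\<dots> = (\<Sum>i<p. comp A i i (a, c) * b i k * (\<Sum>l<p. \<beta> i l * b j l))"
      unfolding sum_distrib_left by (rule sum.swap)
    also have "\<dots> = (\<Sum>i<p. if i = j then comp A j j (a, c) * b j k else 0)"
      using dual j by (intro sum.cong refl) auto
    finally show "(\<Sum>l<p. A (a * p + k, c * p + l) * b j l) = comp A j j (a, c) * b j k" using j by simp
  qed
  fix Y assume Y: "\<forall>a c k. k < p \<longrightarrow> (\<Sum>l<p. A (a * p + k, c * p + l) * b j l) = Y (a, c) * b j k"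
  show "Y = comp A j j"
  proof
    fix z :: "nat \<times> nat" obtain a c where z: "z = (a, c)" by force
    have "comp A j j (a, c) = (\<Sum>k<p. \<beta> j k * (\<Sum>l<p. A (a * p + k, c * p + l) * b j l))"
      by (simp add: comp_def sum_distrib_left mult.assoc)
    also have "\<dots> = (\<Sum>k<p. Y (a, c) * (\<beta> j k * b j k))" using Y by (intro sum.cong refl) auto
    also have "\<dots> = Y (a, c)" unfolding sum_distrib_left[symmetric] dual[OF j j] by simp
    finally show "Y z = comp A j j z" unfolding z by simp
  qed
qed

lemma component_mcomp: "A \<in> P \<Longrightarrow> j < p \<Longrightarrow> component p b j (mcomp m n A) = comp A j j"
  using component_eq[OF dpart_m] P_g by (auto simp: mcomp_eq comp_dpart)

text \<open>If \<open>\<eta> i - \<eta> j\<close> has negative real part, then so has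
  \<open>\<eta> i - \<eta> k\<close> or \<open>\<eta> k - \<eta> j\<close> for each
  \<open>k\<close>; thus one of the two components vanishes in every term of the product.\<close>

lemma P_mmul:
  assumes A: "A \<in> P" and B: "B \<in> P" and ij: "i < p" "j < p" "Re (\<eta> i - \<eta> j) < 0"
  shows "comp (mmul A B) i j = 0"
proof -
  let ?I = "{..<p} \<times> {..<p}"
  let ?T = "\<lambda>C z. tmat (comp C (fst z) (snd z)) (fst z) (snd z)"
  have rf: "row_finite A" "row_finite B" using A B P_g g_row_finite by blast+
  have exp: "C = (\<Sum>z\<in>?I. ?T C z)" for C
    by (subst expand[of C]) (simp add: case_prod_beta)
  have "mmul A B = mmul (\<Sum>z\<in>?I. ?T A z) (\<Sum>z\<in>?I. ?T B z)"
    by (rule arg_cong2[of _ _ _ _ mmul], rule exp, rule exp)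
  also have "\<dots> = (\<Sum>z\<in>?I. mmul (?T A z) (\<Sum>z\<in>?I. ?T B z))"
    by (rule mmul_sum_left) (auto intro: tmat_row_finite comp_row_finite rf)
  also have "\<dots> = (\<Sum>z\<in>?I. \<Sum>z'\<in>?I. mmul (?T A z) (?T B z'))"
    by (intro sum.cong refl mmul_sum_right) simp
  finally have "comp (mmul A B) i j = (\<Sum>z\<in>?I. \<Sum>z'\<in>?I. comp (mmul (?T A z) (?T B z')) i j)"
    by (simp only: comp_sum finite_cartesian_product finite_lessThan)
  also have "\<dots> = 0"
  proof (intro sum.neutral ballI)
    fix z z' assume z: "z \<in> ?I" and z': "z' \<in> ?I"
    then have zp: "fst z < p" "snd z < p" "fst z' < p" "snd z' < p" by auto
    show "comp (mmul (?T A z) (?T B z')) i j = 0"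
    proof (cases "snd z = fst z' \<and> fst z = i \<and> snd z' = j")
      case True
      define k where "k = snd z"
      have "Re (\<eta> i - \<eta> k) < 0 \<or> Re (\<eta> k - \<eta> j) < 0" using ij(3) by auto
      then have "comp A i k = 0 \<or> comp B k j = 0" using A B ij zp unfolding P_iff k_def by blast
      moreover have "mmul 0 C = 0" "mmul C 0 = 0" for C by (auto simp: mmul_def fun_eq_iff)
      ultimately have "mmul (comp A i k) (comp B k j) = 0" by metis
      then show ?thesis
        using True unfolding mmul_tmat[OF zp comp_row_finite[OF rf(1)]] k_def by (simp add: tmat_zero comp_zero)
    next
      case False
      then show ?thesis
        unfolding mmul_tmat[OF zp comp_row_finite[OF rf(1)]] using zp ij by (auto simp: comp_tmat comp_zero)
    qed
  qed
  finally show ?thesis .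
qed

lemma P_lbr: "A \<in> P \<Longrightarrow> B \<in> P \<Longrightarrow> lbr A B \<in> P"
  unfolding P_iff[of "lbr A B"] using g_lbr P_g by (auto simp: lbr_def comp_diff P_mmul)

lemma lie_closed_g: "lie_closed g"
  by unfold_locales (auto simp: g_subspace g_lbr)

lemma lie_closed_P: "lie_closed P"
  by unfold_locales (auto simp: P_subspace P_lbr)

section \<open>The matrices \<open>Y \<otimes> 1\<close>\<close>

definition one_tensor :: "cmat \<Rightarrow> cmat" where
  "one_tensor Y = dmat Y (\<lambda>_. 1)"

lemma one_tensor_G: "Y \<in> gl_blk (N l) \<Longrightarrow> one_tensor Y \<in> G l"
  unfolding one_tensor_def dmat_def
  by (intro cfun.subspace_sum[OF G_subspace] cfun.subspace_scale[OF G_subspace] tmat_G)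

lemma lbr_one_tensor:
  assumes "Y \<in> gl_blk (N l)" "Z \<in> gl_blk (N l)" "i < p" "j < p"
  shows "lbr (one_tensor Y) (tmat Z i j) = tmat (lbr Y Z) i j"
proof -
  have "lbr (one_tensor Y) (tmat Z i j) = tmat (mmul Y Z) i j - tmat (mmul Z Y) i j"
    unfolding one_tensor_def using assms gl_row_finite by (subst lbr_dmat_tmat) auto
  also have "\<dots> = tmat (lbr Y Z) i j" by (auto simp: lbr_def tmat_def fun_eq_iff algebra_simps)
  finally show ?thesis .
qed

text \<open>Elements of \<open>k0\<close> come from the first level, so their components are
  multiples of the identity and commute with \<open>Y\<close>; in the basis \<open>b\<close> they
  have the form \<open>1 \<otimes> X\<close>.\<close>

lemma one_tensor_in:
  assumes Y: "Y \<in> gl_blk (N l)" "l \<ge> 1"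
  shows "one_tensor Y \<in> m" "one_tensor Y \<in> centralizer g k0"
proof -
  have g: "one_tensor Y \<in> g" using one_tensor_G[OF Y(1)] G_g[OF Y(2)] by blast
  then show "one_tensor Y \<in> m" unfolding m_iff by (auto simp: one_tensor_def comp_dmat)
  have "lbr (one_tensor Y) t = 0" if "t \<in> k0" for t
  proof -
    have tG: "t \<in> G 1" using k0 that by blast
    then have tg: "t \<in> g" using G_g[of 1] by auto
    have sc: "\<exists>c. comp t i j = fscale c idm" for i j
    proof -
      have "comp t i j \<in> gl_blk 1" using comp_G[OF tG, of i j] by (simp add: Nsize_def)
      then obtain A where "comp t i j = dsum 1 A" by (auto simp: gl_blk_def)
      then have "comp t i j = fscale (A (0, 0)) idm" by (auto simp: fun_eq_iff dsum_def idm_def)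
      then show ?thesis by blast
    qed
    have z: "lbr (one_tensor Y) (tmat (comp t i j) i j) = 0" if ij: "i < p" "j < p" for i j
    proof -
      obtain c where c: "comp t i j = fscale c idm" using sc[of i j] by blast
      have "lbr Y idm = 0" unfolding lbr_def using gl_row_finite[OF Y(1)] by (simp add: mmul_idm_left mmul_idm_right)
      then have "lbr (one_tensor Y) (tmat idm i j) = 0"
        using lbr_one_tensor[OF Y(1) idm_N ij] by (simp add: tmat_zero)
      then show ?thesis unfolding c tmat_scale lbr_scale_right by (auto simp: fun_eq_iff)
    qed
    have "lbr (one_tensor Y) t = lbr (one_tensor Y) (\<Sum>z\<in>{..<p} \<times> {..<p}. tmat (comp t (fst z) (snd z)) (fst z) (snd z))"
      by (subst expand[of t]) (simp add: case_prod_beta)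
    also have "\<dots> = (\<Sum>z\<in>{..<p} \<times> {..<p}. lbr (one_tensor Y) (tmat (comp t (fst z) (snd z)) (fst z) (snd z)))"
      by (rule lbr_sum_right) (auto intro: tmat_row_finite comp_row_finite g_row_finite[OF tg])
    also have "\<dots> = 0" by (rule sum.neutral) (auto simp: z)
    finally show ?thesis .
  qed
  then show "one_tensor Y \<in> centralizer g k0" using g by (auto simp: centralizer_def)
qed

end

section \<open>The limit modules\<close>

lemma dsum_col:
  assumes "N > 0"
  shows "{j. dsum N A (j, i) \<noteq> 0} \<subseteq> (\<lambda>m. i div N * N + m) ` {..<N}"
proof
  fix j assume "j \<in> {j. dsum N A (j, i) \<noteq> 0}"
  then have "i div N = j div N" by (auto simp: dsum_apply split: if_splits)
  then have "j = i div N * N + j mod N" by (metis div_mult_mod_eq)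
  then show "j \<in> (\<lambda>m. i div N * N + m) ` {..<N}" using assms by auto
qed

lemma block_sum:
  assumes "(N::nat) > 0" "{j. (f j :: complex) \<noteq> 0} \<subseteq> (\<lambda>m. B * N + m) ` {..<N}"
  shows "(\<Sum>j | f j \<noteq> 0. f j * F j) = (\<Sum>m<N. f (B * N + m) * F (B * N + m))"
proof -
  have "(\<Sum>j | f j \<noteq> 0. f j * F j) = (\<Sum>j\<in>(\<lambda>m. B * N + m) ` {..<N}. f j * F j)"
    using assms by (intro sum.mono_neutral_left) auto
  also have "\<dots> = (\<Sum>m<N. f (B * N + m) * F (B * N + m))"
    by (subst sum.reindex) (auto simp: inj_on_def)
  finally show ?thesis .
qed

text \<open>Contribution of the letter at \<open>k\<close> to the action of \<open>dsum N A\<close>.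
  The replacing letters stay in the block of the old one, so the infinite matrix acts through a
  finite sum.\<close>

definition tact_at :: "nat \<Rightarrow> cmat \<Rightarrow> tensor \<Rightarrow> letter list \<Rightarrow> nat \<Rightarrow> complex" where
  "tact_at N A t w k = (if fst (w ! k)
     then - (\<Sum>m<N. A (m, snd (w ! k) mod N) * t (w[k := (True, snd (w ! k) div N * N + m)]))
     else (\<Sum>m<N. A (snd (w ! k) mod N, m) * t (w[k := (False, snd (w ! k) div N * N + m)])))"

lemma tact_dsum:
  assumes N: "N > 0"
  shows "tact (dsum N A) t w = (\<Sum>k<length w. tact_at N A t w k)"
  unfolding tact_def
proof (rule sum.cong[OF refl])
  fix k assume "k \<in> {..<length w}"
  obtain s i where l: "w ! k = (s, i)" by force
  have r: "(\<Sum>j | dsum N A (i, j) \<noteq> 0. dsum N A (i, j) * F j) = (\<Sum>m<N. A (i mod N, m) * F (i div N * N + m))" for F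
    unfolding block_sum[OF N dsum_row[OF N]] by (rule sum.cong) (auto simp: dsum_apply)
  have c: "(\<Sum>j | dsum N A (j, i) \<noteq> 0. dsum N A (j, i) * F j) = (\<Sum>m<N. A (m, i mod N) * F (i div N * N + m))" for F
    unfolding block_sum[OF N dsum_col[OF N]] by (rule sum.cong) (auto simp: dsum_apply)
  show "(case w ! k of
         (False, i) \<Rightarrow> \<Sum>j | dsum N A (i, j) \<noteq> 0. dsum N A (i, j) * t (w[k := (False, j)])
       | (True, i) \<Rightarrow> - (\<Sum>j | dsum N A (j, i) \<noteq> 0. dsum N A (j, i) * t (w[k := (True, j)]))) = tact_at N A t w k"
    unfolding l tact_at_def by (cases s; simp only: prod.case bool.case r c fst_conv snd_conv if_True if_False)
qed

lemma tact_add: "tact A (t + t') = tact A t + tact A t'"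
proof
  fix w
  show "tact A (t + t') w = (tact A t + tact A t') w"
    unfolding tact_def plus_fun_apply sum.distrib[symmetric]
    by (intro sum.cong refl) (auto simp: distrib_left sum.distrib split: prod.split bool.split)
qed

lemma tact_scale: "tact A (fscale c t) = fscale c (tact A t)"
proof
  fix w
  show "tact A (fscale c t) w = fscale c (tact A t) w"
    unfolding tact_def sum_distrib_left
    by (intro sum.cong refl) (auto simp: sum_distrib_left mult.left_commute split: prod.split bool.split intro!: sum.cong)
qed

text \<open>The action replaces natural letters by natural ones and dual letters by dual ones, so it
  does not mix patterns.\<close>

lemma tact_zero_pat:
  assumes "\<And>w'. map fst w' = map fst w \<Longrightarrow> t w' = 0"
  shows "tact A t w = 0"
  unfolding tact_def
proof (rule sum.neutral, rule ballI)
  fix k assume k: "k \<in> {..<length w}"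
  obtain s i where l: "w ! k = (s, i)" by force
  have "map fst (w[k := (s, j)]) = map fst w" for j
  proof -
    have s: "s = map fst w ! k" using k l by simp
    have "map fst (w[k := (s, j)]) = (map fst w)[k := s]" by (simp add: map_update)
    then show ?thesis unfolding s by simp
  qed
  then have "t (w[k := (s, j)]) = 0" for j by (rule assms)
  then show "(case w ! k of
         (False, i) \<Rightarrow> \<Sum>j | A (i, j) \<noteq> 0. A (i, j) * t (w[k := (False, j)])
       | (True, i) \<Rightarrow> - (\<Sum>j | A (j, i) \<noteq> 0. A (j, i) * t (w[k := (True, j)]))) = 0"
    unfolding l by (cases s) auto
qed

lemma tact_Nil: "tact A t [] = 0"
  by (simp add: tact_def)

definition wmod :: "nat \<Rightarrow> letter list \<Rightarrow> letter list" where
  "wmod N w = map (\<lambda>(s, a). (s, a mod N)) w"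

definition single_block :: "nat \<Rightarrow> letter list \<Rightarrow> bool" where
  "single_block N w \<longleftrightarrow> (\<exists>i. \<forall>l\<in>set w. snd l div N = i)"

lemma dext_alt: "dext N t w = (if single_block N w then t (wmod N w) else 0)"
  unfolding dext_def single_block_def wmod_def ..

lemma single_block_update:
  assumes "k < length w" "snd l div N = snd (w ! k) div N"
  shows "single_block N (w[k := l]) \<longleftrightarrow> single_block N w"
proof -
  have "map (\<lambda>l. snd l div N) (w[k := l]) = (map (\<lambda>l. snd l div N) w)[k := map (\<lambda>l. snd l div N) w ! k]"
    using assms by (simp add: map_update)
  then have "map (\<lambda>l. snd l div N) (w[k := l]) = map (\<lambda>l. snd l div N) w" by simp
  moreover have "single_block N w \<longleftrightarrow> (\<exists>i. \<forall>x\<in>set (map (\<lambda>l. snd l div N) w). x = i)" for w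
    by (simp add: single_block_def)
  ultimately show ?thesis by presburger
qed

text \<open>A replaced letter stays in its block, so the condition that a word lies in a single
  block is unaffected, and reduction modulo \<open>N\<close> commutes with the replacement.\<close>

lemma tact_dext:
  assumes N: "N > 0" and A: "A \<in> gl_blk N"
  shows "tact A (dext N t) = dext N (tact A t)"
proof
  fix w
  obtain A0 where A0: "A = dsum N A0" using A by (auto simp: gl_blk_def)
  have upd: "dext N t (w[k := (s, snd (w ! k) div N * N + m)])
      = (if single_block N w then t ((wmod N w)[k := (s, m)]) else 0)" if "k < length w" "m < N" for k m s
  proof -
    have "(snd (w ! k) div N * N + m) div N = snd (w ! k) div N" "(snd (w ! k) div N * N + m) mod N = m"
      using that N by simp_all
    then show ?thesis using that single_block_update[of k w "(s, snd (w ! k) div N * N + m)" N]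
      by (simp add: dext_alt wmod_def map_update)
  qed
  have "tact_at N A0 (dext N t) w k = (if single_block N w then tact_at N A0 t (wmod N w) k else 0)" if k: "k < length w" for k
  proof -
    obtain s i where l: "w ! k = (s, i)" by force
    then have l': "wmod N w ! k = (s, i mod N)" using k by (simp add: wmod_def)
    show ?thesis
      using upd[OF k] N unfolding tact_at_def l l' by (auto intro!: sum.cong)
  qed
  then show "tact A (dext N t) w = dext N (tact A t) w"
    unfolding A0 tact_dsum[OF N] dext_alt[of N "\<lambda>w. \<Sum>k<length w. tact_at N A0 t w k" w] by (auto simp: wmod_def)
qed

definition supp_pat :: "bool list set \<Rightarrow> tensor set" where
  "supp_pat Q = {t. \<forall>w. t w \<noteq> 0 \<longrightarrow> map fst w \<in> Q}"

lemma supp_pat_subspace: "cfun.subspace (supp_pat Q)"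
  by (rule cfun.subspaceI) (auto simp: supp_pat_def, metis add.right_neutral)

lemma tact_supp_pat: "t \<in> supp_pat Q \<Longrightarrow> tact A t \<in> supp_pat Q"
  unfolding supp_pat_def mem_Collect_eq
proof (intro allI impI, rule ccontr)
  fix w assume t: "\<forall>w. t w \<noteq> 0 \<longrightarrow> map fst w \<in> Q" and w: "tact A t w \<noteq> 0" "map fst w \<notin> Q"
  have "tact A t w = 0" by (rule tact_zero_pat) (use t w in metis)
  then show False using w by simp
qed

lemma tens_subspace: "cfun.subspace (tens N)"
proof (rule cfun.subspaceI)
  fix t t' assume t: "t \<in> tens N" "t' \<in> tens N"
  have "{w. (t + t') w \<noteq> 0} \<subseteq> {w. t w \<noteq> 0} \<union> {w. t' w \<noteq> 0}" by auto
  then show "t + t' \<in> tens N" using t finite_subset unfolding tens_def by blast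
qed (auto simp: tens_def)

lemma blk_inj_zero: "w \<noteq> [] \<Longrightarrow> \<forall>l\<in>set w. snd l < N \<Longrightarrow> blk_inj N 0 t w = t w \<and> blk_inj N 1 t w = 0"
proof -
  assume w: "w \<noteq> []" "\<forall>l\<in>set w. snd l < N"
  have "map (\<lambda>(s, a). (s, a mod N)) w = w" using w(2) by (intro map_idI) auto
  then show ?thesis using w by (cases w) (auto simp: blk_inj_def)
qed

lemma blk_inj_Nil: "blk_inj N i t [] = t []"
  by (simp add: blk_inj_def)

lemma blk_inj_supp: "t \<in> supp_pat Q \<Longrightarrow> blk_inj N i t \<in> supp_pat Q"
  unfolding supp_pat_def mem_Collect_eq
proof (intro allI impI)
  fix w assume t: "\<forall>w. t w \<noteq> 0 \<longrightarrow> map fst w \<in> Q" and "blk_inj N i t w \<noteq> 0"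
  then have "t (map (\<lambda>(s, a). (s, a mod N)) w) \<noteq> 0" by (auto simp: blk_inj_def split: if_splits)
  then have "map fst (map (\<lambda>(s, a). (s, a mod N)) w) \<in> Q" using t by blast
  moreover have "map fst (map (\<lambda>(s, a). (s, a mod N)) w) = map fst w" by auto
  ultimately show "map fst w \<in> Q" by (simp only:)
qed

locale natural_limit =
  fixes \<theta> :: "nat \<Rightarrow> nat" and n0 :: nat and lam :: "int list" and W :: "nat \<Rightarrow> tensor set"
  assumes theta: "\<And>i. i \<ge> 1 \<Longrightarrow> \<theta> i > 1" and n0: "n0 > 1" and W: "natural_realisation \<theta> n0 lam W"
begin

abbreviation "N l \<equiv> Nsize \<theta> l"

lemma N_pos: "N l > 0"
  by (rule Nsize_pos) (fact theta)

lemma level: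
  assumes "l \<ge> n0"
  shows "submod (gl_blk (N l)) (fmod (tens (N l)) tact) (W l)" "fin_dim (fmod (W l) tact) (W l)"
    "simple_mod (gl_blk (N l)) (fmod (W l) tact)" "i < \<theta> l \<Longrightarrow> t \<in> W l \<Longrightarrow> blk_inj (N l) i t \<in> W (Suc l)"
proof -
  have "l = n0 + (l - n0)" using assms by simp
  then show "submod (gl_blk (N l)) (fmod (tens (N l)) tact) (W l)" "fin_dim (fmod (W l) tact) (W l)"
    "simple_mod (gl_blk (N l)) (fmod (W l) tact)" "i < \<theta> l \<Longrightarrow> t \<in> W l \<Longrightarrow> blk_inj (N l) i t \<in> W (Suc l)"
    using W unfolding natural_realisation_def Let_def by (metis image_subset_iff)+
qed

lemma W_facts:
  assumes "l \<ge> n0"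
  shows "cfun.subspace (W l)" "W l \<subseteq> tens (N l)" "A \<in> gl_blk (N l) \<Longrightarrow> t \<in> W l \<Longrightarrow> tact A t \<in> W l"
  using level(1)[OF assms] unfolding submod_def submodule_fmod[OF tens_subspace] by auto

text \<open>A stable subspace of tensors meets the simple module in 0 or in everything, so a single
  nonzero vector decides. It is applied to conditions on the pattern and on the degree 0
  coefficient.\<close>

lemma W_simple:
  assumes l: "l \<ge> n0" and Z: "cfun.subspace Z" "\<And>A t. t \<in> Z \<Longrightarrow> tact A t \<in> Z" and t: "t \<in> W l" "t \<in> Z" "t \<noteq> 0"
  shows "W l \<subseteq> Z"
proof -
  have "cfun.subspace (W l \<inter> Z)" using W_facts(1)[OF l] Z(1) by (rule cfun.subspace_inter)
  then have "submod (gl_blk (N l)) (fmod (W l) tact) (W l \<inter> Z)"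
    unfolding submod_def submodule_fmod[OF W_facts(1)[OF l]] using W_facts(3)[OF l] Z(2) by auto
  then have "W l \<inter> Z = {0} \<or> W l \<inter> Z = W l" using level(3)[OF l] unfolding simple_mod_def fmod_simps by blast
  then show ?thesis using t by blast
qed

lemma W_nonzero: "l \<ge> n0 \<Longrightarrow> \<exists>t\<in>W l. t \<noteq> 0"
  using level(3)[of l] cfun.subspace_0[OF W_facts(1)[of l]] unfolding simple_mod_def fmod_simps by blast

text \<open>The patterns at level \<open>n0\<close> are finite in number and persist:
  \<open>blk_inj\<close> sends a nonzero tensor to a nonzero tensor of the next module with the same
  patterns, and by simplicity the whole next module is confined to them.\<close>

lemma bounded_patterns: "\<exists>Q. finite Q \<and> (\<forall>l\<ge>n0. W l \<subseteq> supp_pat Q)"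
proof -
  obtain B where B: "finite B" "B \<subseteq> W n0" "W n0 = cfun.span B"
    using level(2)[of n0] gen_fmod_span[OF W_facts(1)[of n0]] unfolding fin_dim_def fmod_simps by auto
  define Q where "Q = (\<Union>t\<in>B. map fst ` {w. t w \<noteq> 0})"
  have "finite Q"
    unfolding Q_def using B W_facts(2)[of n0] by (intro finite_UN_I finite_imageI) (auto simp: tens_def)
  moreover have "W l \<subseteq> supp_pat Q" if "l \<ge> n0" for l
    using that
  proof (induction rule: dec_induct)
    case base
    show ?case unfolding B(3) by (rule cfun.span_minimal[OF _ supp_pat_subspace]) (auto simp: supp_pat_def Q_def)
  next
    case (step l)
    obtain t where t: "t \<in> W l" "t \<noteq> 0" using W_nonzero step(1) by blast
    then obtain w where w: "t w \<noteq> 0" by (auto simp: fun_eq_iff)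
    have th: "\<theta> l > 1" using theta[of l] n0 step(1) by simp
    have "\<forall>x\<in>set w. snd x < N l" using W_facts(2)[OF step(1)] t(1) w by (auto simp: tens_def)
    \<comment> \<open>Block 0 leaves words with letters below \<open>N l\<close> as they are, so the
      image of a nonzero tensor is nonzero.\<close>
    then have "blk_inj (N l) 0 t w = t w" using blk_inj_zero[of w "N l" t] blk_inj_Nil by (cases "w = []") auto
    then have nz: "blk_inj (N l) 0 t \<noteq> 0" using w by (metis zero_fun_apply)
    have "blk_inj (N l) 0 t \<in> W (Suc l)" using level(4)[OF step(1) _ t(1), of 0] th by simp
    moreover have "blk_inj (N l) 0 t \<in> supp_pat Q" using step.IH t(1) blk_inj_supp by blast
    ultimately show ?case
      using W_simple[of "Suc l" "supp_pat Q"] step(1) supp_pat_subspace tact_supp_pat nz by auto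
  qed
  ultimately show ?thesis by blast
qed

text \<open>Tensors without degree 0 coefficient form a stable subspace; as it does not contain
  \<open>y\<close>, it meets \<open>W l\<close> in 0.\<close>

lemma Nil_zero: "l \<ge> n0 \<Longrightarrow> y \<in> W l \<Longrightarrow> y [] \<noteq> 0 \<Longrightarrow> t \<in> W l \<Longrightarrow> t [] = 0 \<Longrightarrow> t = 0"
proof (rule ccontr)
  assume l: "l \<ge> n0" and y: "y \<in> W l" "y [] \<noteq> 0" and t: "t \<in> W l" "t [] = 0" "t \<noteq> 0"
  have "cfun.subspace {t :: tensor. t [] = 0}" by (rule cfun.subspaceI) auto
  then have "W l \<subseteq> {t. t [] = 0}" using t by (intro W_simple[OF l]) (auto simp: tact_Nil)
  then show False using y by blast
qed

text \<open>If a degree 0 component occurs, then \<open>W l\<close> is the trivial module in tensor degree 0: the copies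
  in two different blocks agree in degree 0, hence everywhere.\<close>

lemma dext_mono_Suc:
  assumes l: "l \<ge> n0"
  shows "dext (N l) ` W l \<subseteq> dext (N (Suc l)) ` W (Suc l)"
proof
  fix e assume "e \<in> dext (N l) ` W l"
  then obtain x where x: "x \<in> W l" "e = dext (N l) x" by blast
  have th: "\<theta> l > 1" using theta[of l] n0 l by simp
  have NS: "N (Suc l) = N l * \<theta> l" using Nsize_Suc[of l \<theta>] n0 l by simp
  have l': "Suc l \<ge> n0" using l by simp
  show "e \<in> dext (N (Suc l)) ` W (Suc l)"
  proof (cases "\<exists>y\<in>W l. y [] \<noteq> 0")
    case False
    have "diag_inj (N l) (\<theta> l) x \<in> W (Suc l)"
      unfolding diag_inj_def using W_facts(1)[OF l'] level(4)[OF l _ x(1)] by (intro cfun.subspace_sum) auto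
    \<comment> \<open>On nonempty words this is \<open>dext_diag_inj\<close>. On the empty word,
      where the diagonal map multiplies by \<open>\<theta> l\<close>, both sides are 0.\<close>
    moreover have "e = dext (N (Suc l)) (diag_inj (N l) (\<theta> l) x)"
    proof
      fix w
      show "e w = dext (N (Suc l)) (diag_inj (N l) (\<theta> l) x) w"
      proof (cases "w = []")
        case True
        have "x [] = 0" using False x(1) by blast
        then show ?thesis unfolding True x(2) dext_def diag_inj_def by (simp add: sum_fun_apply blk_inj_Nil)
      next
        case False
        show ?thesis unfolding x(2) NS using dext_diag_inj[of "N l" "\<theta> l" w x] N_pos[of l] th False by simp
      qed
    qed
    ultimately show ?thesis by blast
  next
    case True
    then obtain y where y: "y \<in> W l" "y [] \<noteq> 0" by blast
    have b: "blk_inj (N l) i y \<in> W (Suc l)" if "i < \<theta> l" for i using level(4)[OF l that y(1)] .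
    \<comment> \<open>Both copies have the coefficient \<open>y []\<close> in degree 0. A second
      block exists because \<open>\<theta> l > 1\<close>.\<close>
    have "blk_inj (N l) 0 y - blk_inj (N l) 1 y = 0"
    proof (rule Nil_zero[OF l' b[of 0]])
      show "blk_inj (N l) 0 y - blk_inj (N l) 1 y \<in> W (Suc l)"
        using W_facts(1)[OF l'] b th by (intro cfun.subspace_diff) auto
    qed (use y th in \<open>auto simp: blk_inj_Nil\<close>)
    then have bb: "blk_inj (N l) 0 y w = blk_inj (N l) 1 y w" for w by simp
    have small: "\<forall>a\<in>set w. snd a < N l" if "t w \<noteq> 0" "t \<in> W l" for t w
      using W_facts(2)[OF l] that by (auto simp: tens_def)
    have y0: "y w = 0" if "w \<noteq> []" for w
    proof (rule ccontr)
      assume "y w \<noteq> 0"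
      then show False using blk_inj_zero[OF that small[OF \<open>y w \<noteq> 0\<close> y(1)], of y] bb[of w] by auto
    qed
    have x0: "x w = 0" if "w \<noteq> []" for w
    proof -
      have "x - fscale (x [] / y []) y = 0"
      proof (rule Nil_zero[OF l y])
        show "x - fscale (x [] / y []) y \<in> W l"
          by (intro cfun.subspace_diff cfun.subspace_scale W_facts(1)[OF l] x(1) y(1))
      qed (use y in simp)
      then have "x w = (x [] / y []) * y w" by (metis eq_iff_diff_eq_0 minus_apply zero_fun_apply)
      then show ?thesis using y0[OF that] by simp
    qed
    have d: "dext M x = x" for M
    proof
      fix w show "dext M x w = x w" by (cases "w = []") (simp_all add: dext_def x0)
    qed
    have "blk_inj (N l) 0 x = x"
    proof
      fix w show "blk_inj (N l) 0 x w = x w" by (cases "w = []") (simp_all add: blk_inj_def x0)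
    qed
    then have "x \<in> W (Suc l)" using level(4)[OF l _ x(1), of 0] th by simp
    then show ?thesis unfolding x(2) d using d by (metis imageI)
  qed
qed

lemma dext_mono:
  assumes "n0 \<le> l" "l \<le> l'"
  shows "dext (N l) ` W l \<subseteq> dext (N l') ` W l'"
  using assms(2)
proof (induction rule: dec_induct)
  case (step k)
  then show ?case using dext_mono_Suc[of k] assms(1) by auto
qed simp

end

section \<open>The inducing module\<close>

lemma pure_box_upd:
  assumes "j < p" "length ws = p"
  shows "pure_box p f (ws[j := w]) = (\<Prod>i\<in>{..<p} - {j}. f i (ws ! i)) * f j w"
proof -
  have "pure_box p f (ws[j := w]) = (\<Prod>i<p. f i (ws[j := w] ! i))" using assms by (simp add: pure_box_def)
  also have "\<dots> = f j (ws[j := w] ! j) * (\<Prod>i\<in>{..<p} - {j}. f i (ws[j := w] ! i))"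
    using assms by (intro prod.remove) auto
  also have "(\<Prod>i\<in>{..<p} - {j}. f i (ws[j := w] ! i)) = (\<Prod>i\<in>{..<p} - {j}. f i (ws ! i))"
    by (intro prod.cong) auto
  finally show ?thesis using assms by (simp add: mult.commute)
qed

lemma box_act_pure:
  "box_act p \<phi> A (pure_box p f) = (\<Sum>j<p. pure_box p (f(j := tact (\<phi> j A) (f j))))"
proof
  fix ws
  show "box_act p \<phi> A (pure_box p f) ws = (\<Sum>j<p. pure_box p (f(j := tact (\<phi> j A) (f j)))) ws"
  proof (cases "length ws = p")
    case True
    have "tact (\<phi> j A) (\<lambda>w. pure_box p f (ws[j := w])) (ws ! j) = pure_box p (f(j := tact (\<phi> j A) (f j))) ws"
      if j: "j < p" for j
    proof -
      let ?c = "\<Prod>i\<in>{..<p} - {j}. f i (ws ! i)"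
      have "(\<lambda>w. pure_box p f (ws[j := w])) = fscale ?c (f j)" using pure_box_upd[OF j True, of f] by auto
      then have "tact (\<phi> j A) (\<lambda>w. pure_box p f (ws[j := w])) (ws ! j) = ?c * tact (\<phi> j A) (f j) (ws ! j)"
        by (simp add: tact_scale)
      also have "\<dots> = pure_box p (f(j := tact (\<phi> j A) (f j))) (ws[j := ws ! j])"
      proof -
        have "(\<Prod>i\<in>{..<p} - {j}. (f(j := tact (\<phi> j A) (f j))) i (ws ! i)) = ?c" by (rule prod.cong) auto
        then show ?thesis unfolding pure_box_upd[OF j True] by simp
      qed
      finally show ?thesis by simp
    qed
    then show ?thesis using True by (simp add: box_act_def sum_fun_apply)
  qed (simp add: box_act_def sum_fun_apply pure_box_def)
qed

lemma box_act_add: "box_act p \<phi> A (F + G) = box_act p \<phi> A F + box_act p \<phi> A G"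
proof
  fix ws
  have "(\<lambda>w. (F + G) (ws[j := w])) = (\<lambda>w. F (ws[j := w])) + (\<lambda>w. G (ws[j := w]))" for j
    by (simp add: plus_fun_def)
  then show "box_act p \<phi> A (F + G) ws = (box_act p \<phi> A F + box_act p \<phi> A G) ws"
    unfolding box_act_def by (simp only: tact_add plus_fun_apply sum.distrib) simp
qed

lemma box_act_scale: "box_act p \<phi> A (fscale c F) = fscale c (box_act p \<phi> A F)"
proof
  fix ws
  have "tact B (\<lambda>w. c * F (ws[j := w])) (ws ! j) = c * tact B (\<lambda>w. F (ws[j := w])) (ws ! j)" for B j
    using fun_cong[OF tact_scale[of B c "\<lambda>w. F (ws[j := w])"]] .
  then show "box_act p \<phi> A (fscale c F) ws = fscale c (box_act p \<phi> A F) ws"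
    unfolding box_act_def by (simp add: sum_distrib_left)
qed

section \<open>The finite stages of the inducing module\<close>

locale box_setup = levi_setup +
  fixes n0 :: "nat \<Rightarrow> nat" and lam :: "nat \<Rightarrow> int list" and W :: "nat \<Rightarrow> nat \<Rightarrow> tensor set"
  assumes n0: "\<And>j. j < p \<Longrightarrow> n0 j > 1" and W: "\<And>j. j < p \<Longrightarrow> natural_realisation \<theta> (n0 j) (lam j) (W j)"
begin

lemma limit: "j < p \<Longrightarrow> natural_limit \<theta> (n0 j) (lam j) (W j)"
  using theta n0 W by unfold_locales auto

abbreviation "box \<equiv> box_space p (\<lambda>j. Vtilde \<theta> (n0 j) (W j))"
abbreviation "\<rho> A \<equiv> box_act p (component p b) (mcomp m n A)"
text \<open>From level \<open>l0\<close> on all \<open>p\<close> factors are defined. The inducing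
  module is the increasing union of the spaces \<open>El l\<close> for
  \<open>l \<ge> l0\<close>.\<close>

definition "l0 = Max (insert 1 (n0 ` {..<p}))"
definition "gens l = {pure_box p f | f. \<forall>j<p. f j \<in> dext (N l) ` W j l}"
definition "El l = cfun.span (gens l)"

lemma l0: "l0 \<ge> 1" "j < p \<Longrightarrow> n0 j \<le> l0"
  unfolding l0_def by (auto intro!: Max_ge)

lemma El_subspace: "cfun.subspace (El l)"
  by (simp add: El_def)

lemma gens_mono: "l0 \<le> l \<Longrightarrow> l \<le> l' \<Longrightarrow> gens l \<subseteq> gens l'"
proof -
  assume l: "l0 \<le> l" "l \<le> l'"
  have "dext (N l) ` W j l \<subseteq> dext (N l') ` W j l'" if "j < p" for j
    using natural_limit.dext_mono[OF limit[OF that] _ l(2)] l0(2)[OF that] l by simp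
  then show ?thesis unfolding gens_def by blast
qed

lemma El_mono: "l0 \<le> l \<Longrightarrow> l \<le> l' \<Longrightarrow> El l \<subseteq> El l'"
  unfolding El_def by (intro cfun.span_mono gens_mono)

lemma El_box: "l0 \<le> l \<Longrightarrow> El l \<subseteq> box"
proof -
  assume l: "l0 \<le> l"
  have "dext (N l) ` W j l \<subseteq> Vtilde \<theta> (n0 j) (W j)" if "j < p" for j
    using l0(2)[OF that] l unfolding Vtilde_def by fastforce
  then show ?thesis unfolding El_def gens_def box_space_def by (intro cfun.span_mono) blast
qed

lemma box_El: "e \<in> box \<Longrightarrow> \<exists>l\<ge>l0. e \<in> El l"
proof -
  let ?Z = "{e. \<exists>l\<ge>l0. e \<in> El l}"
  have "cfun.subspace ?Z"
  proof (rule cfun.subspaceI)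
    show "0 \<in> ?Z" using cfun.subspace_0[OF El_subspace[of l0]] by auto
    fix e e' assume "e \<in> ?Z" "e' \<in> ?Z"
    then obtain l l' where l: "l \<ge> l0" "e \<in> El l" "l' \<ge> l0" "e' \<in> El l'" by blast
    then have "e \<in> El (max l l')" "e' \<in> El (max l l')"
      using El_mono[of l "max l l'"] El_mono[of l' "max l l'"] by auto
    then show "e + e' \<in> ?Z" using cfun.subspace_add[OF El_subspace] l(1) by (metis (mono_tags, lifting) max.coboundedI1 mem_Collect_eq)
  next
    fix c e assume "e \<in> ?Z"
    then show "fscale c e \<in> ?Z" using cfun.subspace_scale[OF El_subspace] by blast
  qed
  moreover have "{pure_box p f | f. \<forall>j<p. f j \<in> Vtilde \<theta> (n0 j) (W j)} \<subseteq> ?Z"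
  proof safe
    fix f assume f: "\<forall>j<p. f j \<in> Vtilde \<theta> (n0 j) (W j)"
    have "\<exists>l\<ge>n0 j. f j \<in> dext (N l) ` W j l" if "j < p" for j
    proof -
      have "f j \<in> Vtilde \<theta> (n0 j) (W j)" using f that by blast
      then show ?thesis unfolding Vtilde_def UN_iff by (auto simp: Bex_def)
    qed
    then obtain lf where lf: "\<And>j. j < p \<Longrightarrow> n0 j \<le> lf j \<and> f j \<in> dext (N (lf j)) ` W j (lf j)" by metis
    define l where "l = Max (insert l0 (lf ` {..<p}))"
    have ll: "l0 \<le> l" "j < p \<Longrightarrow> lf j \<le> l" for j unfolding l_def by (auto intro!: Max_ge)
    have "f j \<in> dext (N l) ` W j l" if "j < p" for j
      using natural_limit.dext_mono[OF limit[OF that], of "lf j" l] lf[OF that] ll(2)[OF that] by blast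
    then have "pure_box p f \<in> gens l" unfolding gens_def by blast
    then have "pure_box p f \<in> El l" unfolding El_def by (rule cfun.span_base)
    then show "\<exists>l\<ge>l0. pure_box p f \<in> El l" using ll(1) by blast
  qed
  ultimately have "box \<subseteq> ?Z" unfolding box_space_def by (intro cfun.span_minimal)
  then show "e \<in> box \<Longrightarrow> \<exists>l\<ge>l0. e \<in> El l" by blast
qed

lemma box_subspace: "cfun.subspace box"
  by (simp add: box_space_def)

lemma \<rho>_cong: "A \<in> P \<Longrightarrow> \<rho> A e = box_act p (\<lambda>j A. comp A j j) A e"
  unfolding box_act_def by (auto simp: component_mcomp fun_eq_iff intro!: sum.cong)

lemma El_act:
  assumes l: "l \<ge> l0" and A: "A \<in> P" "A \<in> G l" and e: "e \<in> El l"
  shows "\<rho> A e \<in> El l"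
proof -
  let ?Z = "{e. box_act p (\<lambda>j A. comp A j j) A e \<in> El l}"
  have "cfun.subspace ?Z"
  proof (rule cfun.subspaceI)
    have "box_act p (\<lambda>j A. comp A j j) A 0 = 0" using box_act_add[of p "\<lambda>j A. comp A j j" A 0 0] by simp
    then show "0 \<in> ?Z" using cfun.subspace_0[OF El_subspace] by simp
  qed (auto simp: box_act_add box_act_scale intro: cfun.subspace_add[OF El_subspace] cfun.subspace_scale[OF El_subspace])
  moreover have "gens l \<subseteq> ?Z"
  proof
    fix e assume "e \<in> gens l"
    then obtain f where f: "e = pure_box p f" "\<And>j. j < p \<Longrightarrow> f j \<in> dext (N l) ` W j l" by (auto simp: gens_def)
    have "tact (comp A j j) (f j) \<in> dext (N l) ` W j l" if j: "j < p" for j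
    proof -
      obtain t where t: "t \<in> W j l" "f j = dext (N l) t" using f(2)[OF j] by blast
      have c: "comp A j j \<in> gl_blk (N l)" by (rule comp_G[OF A(2)])
      have "n0 j \<le> l" using l0(2)[OF j] l by simp
      then have "tact (comp A j j) t \<in> W j l" using natural_limit.W_facts(3)[OF limit[OF j] _ c t(1)] by simp
      then show ?thesis unfolding t(2) tact_dext[OF N_pos c] by blast
    qed
    then have "pure_box p (f(j := tact (comp A j j) (f j))) \<in> El l" if "j < p" for j
      unfolding El_def gens_def using f(2) that by (intro cfun.span_base) auto
    then have "box_act p (\<lambda>j A. comp A j j) A e \<in> El l"
      unfolding f(1) box_act_pure by (intro cfun.subspace_sum[OF El_subspace]) auto
    then show "e \<in> ?Z" by simp
  qed
  ultimately have "El l \<subseteq> ?Z" unfolding El_def by (intro cfun.span_minimal)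
  then show ?thesis using e \<rho>_cong[OF A(1)] by auto
qed

lemma box_closed: "A \<in> P \<Longrightarrow> e \<in> box \<Longrightarrow> \<rho> A e \<in> box"
proof -
  assume A: "A \<in> P" and e: "e \<in> box"
  obtain l where l: "l \<ge> l0" "e \<in> El l" using box_El[OF e] by blast
  obtain l' where l': "l' \<ge> 1" "A \<in> G l'" using A P_g g_level by blast
  have "e \<in> El (max l l')" using El_mono[of l "max l l'"] l by auto
  moreover have "A \<in> G (max l l')" using G_mono[of l' "max l l'"] l' by auto
  moreover have m: "l0 \<le> max l l'" using l by (simp add: le_max_iff_disj)
  ultimately have "\<rho> A e \<in> El (max l l')" by (intro El_act A)
  then show "\<rho> A e \<in> box" using El_box[OF m] by blast
qed

definition "Qp = (SOME Q. \<forall>j<p. finite (Q j) \<and> (\<forall>l\<ge>n0 j. W j l \<subseteq> supp_pat (Q j)))"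

lemma Qp: "j < p \<Longrightarrow> finite (Qp j)" "j < p \<Longrightarrow> l \<ge> n0 j \<Longrightarrow> W j l \<subseteq> supp_pat (Qp j)"
proof -
  have "\<exists>Q. \<forall>j<p. finite (Q j) \<and> (\<forall>l\<ge>n0 j. W j l \<subseteq> supp_pat (Q j))"
    using natural_limit.bounded_patterns[OF limit] by metis
  from someI_ex[OF this] show "j < p \<Longrightarrow> finite (Qp j)" "j < p \<Longrightarrow> l \<ge> n0 j \<Longrightarrow> W j l \<subseteq> supp_pat (Qp j)"
    unfolding Qp_def by blast+
qed

definition "pats = {pts. length pts = p \<and> (\<forall>j<p. pts ! j \<in> Qp j)}"

lemma finite_pats: "finite pats"
proof -
  have "pats \<subseteq> {pts. set pts \<subseteq> (\<Union>j<p. Qp j) \<and> length pts = p}"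
  proof
    fix pts assume pts: "pts \<in> pats"
    have "x \<in> (\<Union>j<p. Qp j)" if x: "x \<in> set pts" for x
    proof -
      obtain i where "i < length pts" "x = pts ! i" using x by (auto simp: in_set_conv_nth)
      then have "i < p" "x \<in> Qp i" using pts by (auto simp: pats_def)
      then show ?thesis by blast
    qed
    then show "pts \<in> {pts. set pts \<subseteq> (\<Union>j<p. Qp j) \<and> length pts = p}" using pts by (auto simp: pats_def)
  qed
  moreover have "finite {pts. set pts \<subseteq> (\<Union>j<p. Qp j) \<and> length pts = p}"
    by (rule finite_lists_length_eq) (use Qp(1) in auto)
  ultimately show ?thesis by (rule finite_subset)
qed

text \<open>Inherited from the generators: each factor is an extension by \<open>dext\<close>, so a
  word matters only if it lies in a single block, and then only through its residues. Hence an
  element is known from its values at letters below \<open>N l\<close>, on patterns that do not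
  depend on \<open>l\<close>.\<close>

lemma El_props:
  assumes l: "l \<ge> l0" and e: "e \<in> El l"
  shows "e ws \<noteq> 0 \<Longrightarrow> pat ws \<in> pats"
    and "e ws = (if length ws = p \<and> (\<forall>w\<in>set ws. single_block (N l) w) then e (map (wmod (N l)) ws) else 0)"
proof -
  let ?Z = "{e :: letter list list \<Rightarrow> complex. \<forall>ws. (e ws \<noteq> 0 \<longrightarrow> pat ws \<in> pats) \<and>
    e ws = (if length ws = p \<and> (\<forall>w\<in>set ws. single_block (N l) w) then e (map (wmod (N l)) ws) else 0)}"
  have "cfun.subspace ?Z"
  proof (rule cfun.subspaceI)
    show "0 \<in> ?Z" by simp
    fix e e' assume e: "e \<in> ?Z" "e' \<in> ?Z"
    show "e + e' \<in> ?Z"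
    proof (intro CollectI allI conjI impI)
      fix ws
      assume "(e + e') ws \<noteq> 0"
      then have "e ws \<noteq> 0 \<or> e' ws \<noteq> 0" by auto
      then show "pat ws \<in> pats" using e by blast
    next
      fix ws
      show "(e + e') ws = (if length ws = p \<and> (\<forall>w\<in>set ws. single_block (N l) w) then (e + e') (map (wmod (N l)) ws) else 0)"
        using e unfolding mem_Collect_eq plus_fun_apply by (metis (no_types, lifting) add.right_neutral)
    qed
  next
    fix c e assume e: "e \<in> ?Z"
    then show "fscale c e \<in> ?Z"
      unfolding mem_Collect_eq by (metis (no_types, lifting) mult_zero_right)
  qed
  moreover have "gens l \<subseteq> ?Z"
  proof
    fix e assume "e \<in> gens l"
    then obtain f where f: "e = pure_box p f" "\<And>j. j < p \<Longrightarrow> f j \<in> dext (N l) ` W j l" by (auto simp: gens_def)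
    have "\<exists>t\<in>W j l. f j = dext (N l) t" if "j < p" for j using f(2)[OF that] by blast
    then obtain t where t: "\<And>j. j < p \<Longrightarrow> t j \<in> W j l \<and> f j = dext (N l) (t j)" by metis
    have idem: "wmod (N l) (wmod (N l) w) = wmod (N l) w" "single_block (N l) (wmod (N l) w)" for w
      by (auto simp: wmod_def single_block_def)
    show "e \<in> ?Z"
    proof (intro CollectI allI conjI impI)
      fix ws assume nz: "e ws \<noteq> 0"
      then have len: "length ws = p" and fz: "\<And>j. j < p \<Longrightarrow> f j (ws ! j) \<noteq> 0"
        by (auto simp: f(1) pure_box_def split: if_splits)
      have "map fst (ws ! j) \<in> Qp j" if j: "j < p" for j
      proof -
        have "t j (wmod (N l) (ws ! j)) \<noteq> 0" using fz[OF j] t[OF j] by (auto simp: dext_alt split: if_splits)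
        moreover have "t j \<in> supp_pat (Qp j)" using subsetD[OF Qp(2)[OF j order_trans[OF l0(2)[OF j] l]]] t[OF j] by blast
        ultimately have "map fst (wmod (N l) (ws ! j)) \<in> Qp j" by (auto simp: supp_pat_def)
        moreover have "map fst (wmod (N l) (ws ! j)) = map fst (ws ! j)" by (auto simp: wmod_def)
        ultimately show ?thesis by (simp only:)
      qed
      then show "pat ws \<in> pats" using len by (auto simp: pats_def pat_def)
    next
      fix ws
      show "e ws = (if length ws = p \<and> (\<forall>w\<in>set ws. single_block (N l) w) then e (map (wmod (N l)) ws) else 0)"
      proof (cases "length ws = p \<and> (\<forall>w\<in>set ws. single_block (N l) w)")
        case True
        then have "f j (ws ! j) = f j (map (wmod (N l)) ws ! j)" if "j < p" for j
          using that t[OF that] by (auto simp: dext_alt idem)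
        then show ?thesis using True by (simp add: f(1) pure_box_def)
      next
        case False
        have "e ws = 0"
        proof (cases "length ws = p")
          case True
          then obtain j where "j < p" "\<not> single_block (N l) (ws ! j)" using False by (auto simp: in_set_conv_nth)
          then have "f j (ws ! j) = 0" using t by (simp add: dext_alt)
          then show ?thesis using \<open>j < p\<close> by (auto simp: f(1) pure_box_def)
        qed (simp add: f(1) pure_box_def)
        then show ?thesis unfolding if_not_P[OF False] .
      qed
    qed
  qed
  ultimately have "El l \<subseteq> ?Z" unfolding El_def by (intro cfun.span_minimal)
  then show "e ws \<noteq> 0 \<Longrightarrow> pat ws \<in> pats"
    "e ws = (if length ws = p \<and> (\<forall>w\<in>set ws. single_block (N l) w) then e (map (wmod (N l)) ws) else 0)"
    using e by blast+
qed

text \<open>The label of an index lists the roots of the factors applied to the inducing module; for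
  the module itself it is empty.\<close>

definition QE :: "((nat \<times> nat) list \<times> bool list list) set" where "QE = {[]} \<times> pats"

lemma finite_QE: "finite QE"
  by (simp add: QE_def finite_pats)

text \<open>Restriction to the first block identifies \<open>El l\<close> with a subspace of a mixed
  tensor space for \<open>gl(N l)\<close>.\<close>

definition res :: "nat \<Rightarrow> (letter list list \<Rightarrow> complex) \<Rightarrow> (nat \<times> nat) list \<times> letter list list \<Rightarrow> complex" where
  "res l e = (\<lambda>(c, ws). if c = [] \<and> small (N l) ws then e ws else 0)"

lemma res_lin: "res l (e + e') = res l e + res l e'" "res l (fscale c e) = fscale c (res l e)"
  by (auto simp: res_def fun_eq_iff)

lemma res_wfun: "l \<ge> l0 \<Longrightarrow> e \<in> El l \<Longrightarrow> res l e \<in> wfun (N l) QE"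
  using El_props(1)[of l e] by (auto simp: wfun_def fun_on_def res_def widx_def QE_def)

lemma res_inj:
  assumes l: "l \<ge> l0" and e: "e \<in> El l" "e' \<in> El l" and eq: "res l e = res l e'"
  shows "e = e'"
proof
  fix ws
  have "small (N l) (map (wmod (N l)) ws)" by (auto simp: small_def wmod_def)
  then have "e (map (wmod (N l)) ws) = e' (map (wmod (N l)) ws)"
    using fun_cong[OF eq, of "([], map (wmod (N l)) ws)"] by (simp add: res_def)
  then show "e ws = e' ws" using El_props(2)[OF l e(1), of ws] El_props(2)[OF l e(2), of ws] by simp
qed

lemma one_tensor_P: "Y \<in> gl_blk (N l) \<Longrightarrow> l \<ge> 1 \<Longrightarrow> one_tensor Y \<in> P"
  using one_tensor_in(1) m_P by blast

lemma res_act: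
  assumes l: "l \<ge> l0" and rs: "r < N l" "s < N l" and e: "e \<in> El l"
  shows "res l (\<rho> (one_tensor (emat (N l) r s)) e) = eact (N l) QE r s (res l e)"
proof
  fix x :: "(nat \<times> nat) list \<times> letter list list"
  obtain c ws where x: "x = (c, ws)" by force
  let ?A = "one_tensor (emat (N l) r s)"
  have AP: "?A \<in> P" using one_tensor_P[OF emat_gl] l l0 by simp
  have AG: "?A \<in> G l" by (rule one_tensor_G[OF emat_gl])
  have eE: "\<rho> ?A e \<in> El l" by (rule El_act[OF l AP AG e])
  show "res l (\<rho> ?A e) x = eact (N l) QE r s (res l e) x"
  proof (cases "x \<in> widx (N l) QE")
    case True
    then have c: "c = []" "pat ws \<in> pats" "small (N l) ws" by (auto simp: x widx_def QE_def)
    have len: "length ws = p" using c(2) by (auto simp: pats_def pat_def)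
    have "res l (\<rho> ?A e) x = \<rho> ?A e ws" using c by (simp add: res_def x)
    also have "\<dots> = (\<Sum>j<p. tact (emat (N l) r s) (\<lambda>w. e (ws[j := w])) (ws ! j))"
      unfolding \<rho>_cong[OF AP] using len by (simp add: box_act_def one_tensor_def comp_dmat)
    also have "\<dots> = wact (emat (N l) r s) e ws" by (simp add: wact_def len)
    also have "\<dots> = wact (emat (N l) r s) (\<lambda>ws. res l e ([], ws)) ws"
      unfolding wact_emat[OF rs c(3)]
    proof (rule sum.cong[OF refl])
      fix y assume y: "y \<in> positions ws"
      have "small (N l) (upd ws y (swp r s (letter_at ws y)))"
        using c(3) y rs by (intro small_upd snd_swp) (auto simp: small_iff)
      then show "sg r s (letter_at ws y) * e (upd ws y (swp r s (letter_at ws y)))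
        = sg r s (letter_at ws y) * res l e ([], upd ws y (swp r s (letter_at ws y)))" by (simp add: res_def)
    qed
    also have "\<dots> = eact (N l) QE r s (res l e) x" using True c(1) by (simp add: eact_def ract_def x)
    finally show ?thesis .
  next
    case False
    then have "res l (\<rho> ?A e) x = 0" using res_wfun[OF l eE] unfolding wfun_def fun_on_def by blast
    then show ?thesis using False by (simp add: eact_def)
  qed
qed

lemma einvariant_res: "l \<ge> l0 \<Longrightarrow> einvariant (N l) QE (res l ` El l)"
proof -
  assume l: "l \<ge> l0"
  have "cfun.subspace (res l ` El l)"
  proof (rule cfun.subspaceI)
    have "res l 0 = 0" by (rule ext) (auto simp: res_def)
    then show "0 \<in> res l ` El l" using cfun.subspace_0[OF El_subspace[of l]] by (metis imageI)
    fix v w assume "v \<in> res l ` El l" "w \<in> res l ` El l"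
    then obtain e e' where "v = res l e" "w = res l e'" "e \<in> El l" "e' \<in> El l" by blast
    then show "v + w \<in> res l ` El l" using cfun.subspace_add[OF El_subspace] by (intro image_eqI[of _ _ "e + e'"]) (simp_all only: res_lin)
  next
    fix c v assume "v \<in> res l ` El l"
    then obtain e where "v = res l e" "e \<in> El l" by blast
    then show "fscale c v \<in> res l ` El l" using cfun.subspace_scale[OF El_subspace, of e l c] by (intro image_eqI[of _ _ "fscale c e"]) (simp_all only: res_lin)
  qed
  moreover have "eact (N l) QE r s (res l e) \<in> res l ` El l" if "r < N l" "s < N l" "e \<in> El l" for r s e
    unfolding res_act[OF l that, symmetric]
    using El_act[OF l one_tensor_P[OF emat_gl] one_tensor_G[OF emat_gl] that(3)] l l0 by (intro imageI) simp
  ultimately show ?thesis unfolding einvariant_def using res_wfun[OF l] by blast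
qed

text \<open>The orthogonal projection onto \<open>El l\<close> presents it as a quotient of the
  mixed tensor space, and \<open>\<epsilon> l x\<close> is the image of the basis tensor
  \<open>x\<close>. A quotient is wanted because generators, unlike submodules, can be pushed
  through the induction.\<close>

definition \<epsilon> :: "nat \<Rightarrow> (nat \<times> nat) list \<times> letter list list \<Rightarrow> letter list list \<Rightarrow> complex" where
  "\<epsilon> l x = (THE e. e \<in> El l \<and> res l e = proj (widx (N l) QE) (res l ` El l) (delta x))"

lemma \<epsilon>:
  assumes l: "l \<ge> l0" and x: "x \<in> widx (N l) QE"
  shows "\<epsilon> l x \<in> El l" "res l (\<epsilon> l x) = proj (widx (N l) QE) (res l ` El l) (delta x)"
proof -
  have "proj (widx (N l) QE) (res l ` El l) (delta x) \<in> res l ` El l"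
    using proj(1)[OF finite_widx[OF finite_QE]] einvariant_res[OF l] x
    by (auto simp: einvariant_def wfun_def delta_in_fun_on)
  then obtain e where "e \<in> El l" "res l e = proj (widx (N l) QE) (res l ` El l) (delta x)" by auto
  then have "\<exists>!e. e \<in> El l \<and> res l e = proj (widx (N l) QE) (res l ` El l) (delta x)"
    using res_inj[OF l] by (intro ex1I[of _ e]) simp_all
  from theI'[OF this] show "\<epsilon> l x \<in> El l" "res l (\<epsilon> l x) = proj (widx (N l) QE) (res l ` El l) (delta x)"
    unfolding \<epsilon>_def by blast+
qed

lemma res_sum: "res l (\<Sum>x\<in>J. fscale (c x) (e x)) = (\<Sum>x\<in>J. fscale (c x) (res l (e x)))"
  by (auto simp: res_def fun_eq_iff sum_fun_apply)

lemma \<epsilon>_expand: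
  assumes l: "l \<ge> l0" and F: "F \<in> wfun (N l) QE" and e: "e \<in> El l"
    and eq: "res l e = proj (widx (N l) QE) (res l ` El l) F"
  shows "e = (\<Sum>x\<in>widx (N l) QE. fscale (F x) (\<epsilon> l x))"
proof (rule res_inj[OF l e])
  show "(\<Sum>x\<in>widx (N l) QE. fscale (F x) (\<epsilon> l x)) \<in> El l"
    by (intro cfun.subspace_sum[OF El_subspace] cfun.subspace_scale[OF El_subspace] \<epsilon>(1)[OF l])
  show "res l e = res l (\<Sum>x\<in>widx (N l) QE. fscale (F x) (\<epsilon> l x))"
    unfolding eq res_sum proj_expand[OF finite_QE einvariant_res[OF l] F] using \<epsilon>(2)[OF l] by (intro sum.cong refl) simp
qed

lemma El_span: "l \<ge> l0 \<Longrightarrow> e \<in> El l \<Longrightarrow> e \<in> cfun.span (\<epsilon> l ` widx (N l) QE)"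
proof -
  assume l: "l \<ge> l0" and e: "e \<in> El l"
  have "res l e = proj (widx (N l) QE) (res l ` El l) (res l e)"
    using proj_ident[OF finite_widx[OF finite_QE], of "res l ` El l" "N l" "res l e"] einvariant_res[OF l] e
    by (simp add: einvariant_def wfun_def)
  from \<epsilon>_expand[OF l res_wfun[OF l e] e this]
  have "e = (\<Sum>x\<in>widx (N l) QE. fscale (res l e x) (\<epsilon> l x))" .
  moreover have "(\<Sum>x\<in>widx (N l) QE. fscale (res l e x) (\<epsilon> l x)) \<in> cfun.span (\<epsilon> l ` widx (N l) QE)"
    by (intro cfun.span_sum cfun.span_scale cfun.span_base imageI)
  ultimately show ?thesis by (simp only:)
qed

text \<open>The quotient map is equivariant because the orthogonal projection commutes with the
  matrix units.\<close>

lemma \<epsilon>_act: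
  assumes l: "l \<ge> l0" and rs: "r < N l" "s < N l" and x: "x \<in> widx (N l) QE"
  shows "\<rho> (one_tensor (emat (N l) r s)) (\<epsilon> l x)
    = (\<Sum>y\<in>widx (N l) QE. fscale (eact (N l) QE r s (delta x) y) (\<epsilon> l y))"
proof (rule \<epsilon>_expand[OF l eact_in_wfun])
  have d: "delta x \<in> wfun (N l) QE" using x by (simp add: wfun_def delta_in_fun_on)
  show "\<rho> (one_tensor (emat (N l) r s)) (\<epsilon> l x) \<in> El l"
    using El_act[OF l one_tensor_P[OF emat_gl] one_tensor_G[OF emat_gl] \<epsilon>(1)[OF l x]] l l0 by simp
  show "res l (\<rho> (one_tensor (emat (N l) r s)) (\<epsilon> l x)) = proj (widx (N l) QE) (res l ` El l) (eact (N l) QE r s (delta x))"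
    unfolding res_act[OF l rs \<epsilon>(1)[OF l x]] \<epsilon>(2)[OF l x] proj_eact[OF finite_QE einvariant_res[OF l] rs d] ..
qed

end

section \<open>The filtration of the induced module\<close>

context lie_rep
begin

lemma act_diff_right: "x \<in> g \<Longrightarrow> v \<in> M \<Longrightarrow> w \<in> M \<Longrightarrow> act x (v - w) = act x v - act x w"
proof -
  assume x: "x \<in> g" "v \<in> M" "w \<in> M"
  have "act x ((v - w) + w) = act x (v - w) + act x w"
    by (rule act_add[OF x(1) cfun.subspace_diff[OF subspace_rep x(2,3)] x(3)])
  then show ?thesis by (simp only: diff_add_cancel eq_diff_eq)
qed

lemma act_zero: "x \<in> g \<Longrightarrow> act x 0 = 0"
  using act_add[OF _ cfun.subspace_0[OF subspace_rep] cfun.subspace_0[OF subspace_rep], of x] by simp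

lemma act_sum:
  assumes "finite J" "x \<in> g" "\<And>j. j \<in> J \<Longrightarrow> v j \<in> M"
  shows "act x (\<Sum>j\<in>J. fscale (c j) (v j)) = (\<Sum>j\<in>J. fscale (c j) (act x (v j)))"
  using assms(1,3)
proof (induction J rule: finite_induct)
  case empty
  show ?case by (simp only: sum.empty act_zero[OF assms(2)])
next
  case (insert a J)
  have m: "fscale (c a) (v a) \<in> M" "(\<Sum>j\<in>J. fscale (c j) (v j)) \<in> M"
    using insert.prems by (auto intro!: cfun.subspace_scale[OF subspace_rep] cfun.subspace_sum[OF subspace_rep])
  have "act x (fscale (c a) (v a)) = fscale (c a) (act x (v a))" using insert.prems by (intro act_scale[OF assms(2)]) auto
  moreover have "act x (\<Sum>j\<in>J. fscale (c j) (v j)) = (\<Sum>j\<in>J. fscale (c j) (act x (v j)))"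
    using insert.IH insert.prems by blast
  ultimately show ?case unfolding sum.insert[OF insert.hyps] act_add[OF assms(2) m] by (simp only:)
qed

lemma act_sum_left:
  assumes g: "cfun.subspace g" and "finite J" "v \<in> M" "\<And>j. j \<in> J \<Longrightarrow> x j \<in> g"
  shows "act (\<Sum>j\<in>J. x j) v = (\<Sum>j\<in>J. act (x j) v)"
  using assms(2,4)
proof (induction J rule: finite_induct)
  case empty
  have z: "0 \<in> g" using g by (rule cfun.subspace_0)
  have "act (0 + 0) v = act 0 v + act 0 v" by (rule act_plus[OF z z assms(3)])
  then have "act 0 v = 0" by simp
  then show ?case by (simp only: sum.empty)
next
  case (insert a J)
  have m: "x a \<in> g" "(\<Sum>j\<in>J. x j) \<in> g" using insert.prems by (auto intro!: cfun.subspace_sum[OF g])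
  have "act (\<Sum>j\<in>J. x j) v = (\<Sum>j\<in>J. act (x j) v)" using insert.IH insert.prems by blast
  then show ?case unfolding sum.insert[OF insert.hyps] act_plus[OF m assms(3)] by (simp only:)
qed

lemma vimage_subspace:
  assumes "x \<in> g" "cfun.subspace S"
  shows "cfun.subspace {v \<in> M. act x v \<in> S}"
proof (rule cfun.subspaceI)
  show "0 \<in> {v \<in> M. act x v \<in> S}"
    using cfun.subspace_0[OF subspace_rep] cfun.subspace_0[OF assms(2)] act_zero[OF assms(1)] by simp
  fix v w assume vw: "v \<in> {v \<in> M. act x v \<in> S}" "w \<in> {v \<in> M. act x v \<in> S}"
  then show "v + w \<in> {v \<in> M. act x v \<in> S}"
    using act_add[OF assms(1), of v w] cfun.subspace_add[OF subspace_rep] cfun.subspace_add[OF assms(2)] by simp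
next
  fix c v assume v: "v \<in> {v \<in> M. act x v \<in> S}"
  then show "fscale c v \<in> {v \<in> M. act x v \<in> S}"
    using act_scale[OF assms(1), of v c] cfun.subspace_scale[OF subspace_rep, of v c] cfun.subspace_scale[OF assms(2), of "act x v" c] by simp
qed

lemma act_comm: "x \<in> g \<Longrightarrow> y \<in> g \<Longrightarrow> v \<in> M \<Longrightarrow> act x (act y v) = act (lbr x y) v + act y (act x v)"
  by (simp only: act_lbr diff_add_cancel)

context
  fixes h assumes h: "h \<in> g"
begin

lemma shift_prod_M: "v \<in> M \<Longrightarrow> shift_prod act h \<mu>s v \<in> M"
  using shift_prod_closed[OF subspace_rep, of act h v \<mu>s] act_closed[OF h] by blast

lemma shift_prod_add: "v \<in> M \<Longrightarrow> w \<in> M \<Longrightarrow> shift_prod act h \<mu>s (v + w) = shift_prod act h \<mu>s v + shift_prod act h \<mu>s w"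
proof (induction \<mu>s)
  case (Cons \<mu> \<mu>s)
  have IH: "shift_prod act h \<mu>s (v + w) = shift_prod act h \<mu>s v + shift_prod act h \<mu>s w" by (rule Cons.IH[OF Cons.prems])
  show ?case
    unfolding shift_prod_simps IH act_add[OF h shift_prod_M[OF Cons.prems(1)] shift_prod_M[OF Cons.prems(2)]]
    by (rule ext) (simp add: algebra_simps)
qed (simp add: shift_prod_simps)

lemma shift_prod_scale: "v \<in> M \<Longrightarrow> shift_prod act h \<mu>s (fscale c v) = fscale c (shift_prod act h \<mu>s v)"
proof (induction \<mu>s)
  case (Cons \<mu> \<mu>s)
  have IH: "shift_prod act h \<mu>s (fscale c v) = fscale c (shift_prod act h \<mu>s v)" by (rule Cons.IH[OF Cons.prems])
  let ?u = "shift_prod act h \<mu>s v"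
  have s: "act h (fscale c ?u) = fscale c (act h ?u)" by (rule act_scale[OF h shift_prod_M[OF Cons.prems]])
  have "shift_prod act h (\<mu> # \<mu>s) (fscale c v) = fscale c (act h ?u) - fscale \<mu> (fscale c ?u)"
    unfolding shift_prod_simps IH s ..
  also have "fscale \<mu> (fscale c ?u) = fscale c (fscale \<mu> ?u)" by (rule cfun.scale_left_commute)
  also have "fscale c (act h ?u) - fscale c (fscale \<mu> ?u) = fscale c (act h ?u - fscale \<mu> ?u)"
    by (rule cfun.scale_right_diff_distrib[symmetric])
  finally show ?case unfolding shift_prod_simps .
qed (simp add: shift_prod_simps)

lemma shift_prod_step:
  "v \<in> M \<Longrightarrow> shift_prod act h \<mu>s (act h v - fscale \<mu> v) = act h (shift_prod act h \<mu>s v) - fscale \<mu> (shift_prod act h \<mu>s v)"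
proof (induction \<mu>s)
  case (Cons \<nu> \<mu>s)
  let ?u = "shift_prod act h \<mu>s v"
  have u: "?u \<in> M" by (rule shift_prod_M[OF Cons.prems])
  have IH: "shift_prod act h \<mu>s (act h v - fscale \<mu> v) = act h ?u - fscale \<mu> ?u" by (rule Cons.IH[OF Cons.prems])
  have s: "fscale c ?u \<in> M" for c by (rule cfun.subspace_scale[OF subspace_rep u])
  show ?case
    unfolding shift_prod_simps IH act_diff_right[OF h act_closed[OF h u] s] act_scale[OF h u]
    by (rule ext) (simp add: algebra_simps)
qed (simp add: shift_prod_simps)

text \<open>Both products are polynomials in the single operator \<open>act h\<close>, and such
  polynomials commute.\<close>

lemma shift_prod_swap: "v \<in> M \<Longrightarrow> shift_prod act h \<mu>s (shift_prod act h \<nu>s v) = shift_prod act h \<nu>s (shift_prod act h \<mu>s v)"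
proof (induction \<nu>s)
  case (Cons \<nu> \<nu>s)
  show ?case
    unfolding shift_prod_simps shift_prod_step[OF shift_prod_M[OF Cons.prems]] Cons.IH[OF Cons.prems] ..
qed (simp add: shift_prod_simps)

text \<open>For a sum of two vectors the concatenation of their lists works: the products commute,
  and \<open>Z\<close> is stable under the additional factors.\<close>

lemma shift_into_subspace:
  assumes Z: "cfun.subspace Z" "\<And>v. v \<in> Z \<Longrightarrow> act h v \<in> Z"
  shows "cfun.subspace {v \<in> M. \<exists>\<mu>s. (\<forall>\<mu>\<in>set \<mu>s. R \<mu>) \<and> shift_prod act h \<mu>s v \<in> Z}" (is "cfun.subspace ?S")
proof (rule cfun.subspaceI)
  have "(0 :: 'i \<Rightarrow> complex) \<in> M" by (rule cfun.subspace_0[OF subspace_rep])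
  moreover have "shift_prod act h [] 0 \<in> Z" unfolding shift_prod_simps by (rule cfun.subspace_0[OF Z(1)])
  ultimately show "0 \<in> ?S" by (auto intro!: exI[of _ "[]"])
next
  fix v w assume "v \<in> ?S" "w \<in> ?S"
  then obtain \<mu>s \<nu>s where vw: "v \<in> M" "w \<in> M" and \<mu>: "\<forall>\<mu>\<in>set \<mu>s. R \<mu>" "shift_prod act h \<mu>s v \<in> Z"
    and \<nu>: "\<forall>\<mu>\<in>set \<nu>s. R \<mu>" "shift_prod act h \<nu>s w \<in> Z" by blast
  have "shift_prod act h (\<nu>s @ \<mu>s) (v + w) = shift_prod act h \<nu>s (shift_prod act h \<mu>s v) + shift_prod act h \<mu>s (shift_prod act h \<nu>s w)"
    unfolding shift_prod_append shift_prod_add[OF vw] shift_prod_add[OF shift_prod_M[OF vw(1)] shift_prod_M[OF vw(2)]]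
    by (simp only: shift_prod_swap[OF vw(2), of \<nu>s \<mu>s])
  also have "\<dots> \<in> Z"
    by (intro cfun.subspace_add[OF Z(1)] shift_prod_closed[where act = act and h = h and Z = Z] Z \<mu> \<nu>)
  finally have "shift_prod act h (\<nu>s @ \<mu>s) (v + w) \<in> Z" .
  moreover have "v + w \<in> M" by (rule cfun.subspace_add[OF subspace_rep vw])
  moreover have "\<forall>\<mu>\<in>set (\<nu>s @ \<mu>s). R \<mu>" using \<mu> \<nu> by auto
  ultimately show "v + w \<in> ?S" by blast
next
  fix c v assume "v \<in> ?S"
  then obtain \<mu>s where v: "v \<in> M" and \<mu>: "\<forall>\<mu>\<in>set \<mu>s. R \<mu>" "shift_prod act h \<mu>s v \<in> Z" by blast
  have "shift_prod act h \<mu>s (fscale c v) \<in> Z" unfolding shift_prod_scale[OF v] by (rule cfun.subspace_scale[OF Z(1) \<mu>(2)])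
  moreover have "fscale c v \<in> M" by (rule cfun.subspace_scale[OF subspace_rep v])
  ultimately show "fscale c v \<in> ?S" using \<mu>(1) by blast
qed

end

end

locale filtration = box_setup p b \<beta> \<theta> k0 t0 m n h \<eta> n0 lam W + lie_rep "gl_lim p \<theta>" M act
  for p b \<beta> \<theta> k0 t0 m n h \<eta> n0 lam W and M :: "('q \<Rightarrow> complex) set" and act +
  fixes \<tau> :: "(letter list list \<Rightarrow> complex) \<Rightarrow> 'q \<Rightarrow> complex"
  assumes \<tau>_closed: "e \<in> box \<Longrightarrow> \<tau> e \<in> M"
    and \<tau>_add: "e \<in> box \<Longrightarrow> e' \<in> box \<Longrightarrow> \<tau> (e + e') = \<tau> e + \<tau> e'"
    and \<tau>_scale: "e \<in> box \<Longrightarrow> \<tau> (fscale c e) = fscale c (\<tau> e)"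
    and \<tau>_act: "A \<in> P \<Longrightarrow> e \<in> box \<Longrightarrow> act A (\<tau> e) = \<tau> (\<rho> A e)"
    and generated: "cfun.subspace Z \<Longrightarrow> \<tau> ` box \<subseteq> Z \<Longrightarrow> (\<forall>A\<in>g. \<forall>v\<in>Z \<inter> M. act A v \<in> Z) \<Longrightarrow> M \<subseteq> Z"
begin

text \<open>The roots of the opposite nilradical: these are the components that elements of the
  parabolic lack.\<close>

definition "negpairs = {(i, j). i < p \<and> j < p \<and> Re (\<eta> i - \<eta> j) < 0}"
definition "nmE l = {tmat Y i j | Y i j. Y \<in> gl_blk (N l) \<and> (i, j) \<in> negpairs}"

text \<open>Exactly \<open>k\<close> factors from the opposite nilradical, applied to the stage
  \<open>El l\<close>. The level \<open>l\<close> bounds everything involved, so each of these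
  spaces is finite-dimensional; \<open>F l D\<close> allows up to \<open>D\<close> factors.\<close>

primrec Fk :: "nat \<Rightarrow> nat \<Rightarrow> ('q \<Rightarrow> complex) set" where
  "Fk l 0 = \<tau> ` El l"
| "Fk l (Suc k) = cfun.span {act y v | y v. y \<in> nmE l \<and> v \<in> Fk l k}"

definition "F l D = cfun.span (\<Union>k\<le>D. Fk l k)"

lemma finite_negpairs: "finite negpairs"
  by (rule finite_subset[of _ "{..<p} \<times> {..<p}"]) (auto simp: negpairs_def)

lemma l1: "l \<ge> l0 \<Longrightarrow> l \<ge> 1"
  using l0(1) by simp

lemma nmE_G: "y \<in> nmE l \<Longrightarrow> y \<in> G l"
  by (auto simp: nmE_def tmat_G)

lemma nmE_g: "l \<ge> l0 \<Longrightarrow> y \<in> nmE l \<Longrightarrow> y \<in> g"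
  using nmE_G G_g[OF l1] by blast

lemma El_in_box: "l \<ge> l0 \<Longrightarrow> e \<in> El l \<Longrightarrow> e \<in> box"
  using El_box by blast

lemma Fk_subspace: "l \<ge> l0 \<Longrightarrow> cfun.subspace (Fk l k)"
proof (cases k)
  case 0
  assume l: "l \<ge> l0"
  have "cfun.subspace (\<tau> ` El l)"
  proof (rule cfun.subspaceI)
    have "0 \<in> El l" by (rule cfun.subspace_0[OF El_subspace])
    then have "\<tau> 0 \<in> \<tau> ` El l" by blast
    moreover have "\<tau> (0 + 0) = \<tau> 0 + \<tau> 0" by (rule \<tau>_add) (rule El_in_box[OF l \<open>0 \<in> El l\<close>])+
    then have "\<tau> 0 = 0" by simp
    ultimately show "0 \<in> \<tau> ` El l" by simp
    fix v w assume "v \<in> \<tau> ` El l" "w \<in> \<tau> ` El l"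
    then obtain e e' where e: "v = \<tau> e" "w = \<tau> e'" "e \<in> El l" "e' \<in> El l" by blast
    have "v + w = \<tau> (e + e')" unfolding e using \<tau>_add El_in_box[OF l] e by simp
    then show "v + w \<in> \<tau> ` El l" using cfun.subspace_add[OF El_subspace e(3,4)] by blast
  next
    fix c v assume "v \<in> \<tau> ` El l"
    then obtain e where e: "v = \<tau> e" "e \<in> El l" by blast
    have "fscale c v = \<tau> (fscale c e)" unfolding e by (rule \<tau>_scale[symmetric]) (rule El_in_box[OF l e(2)])
    then show "fscale c v \<in> \<tau> ` El l" using cfun.subspace_scale[OF El_subspace e(2)] by blast
  qed
  then show ?thesis using 0 by simp
qed simp

lemma Fk_M: "l \<ge> l0 \<Longrightarrow> Fk l k \<subseteq> M"
proof (induction k)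
  case 0
  then show ?case using \<tau>_closed El_in_box by auto
next
  case (Suc k)
  then show ?case unfolding Fk.simps
    by (intro cfun.span_minimal subspace_rep) (auto intro!: act_closed nmE_g)
qed

lemma Fk_act: "y \<in> nmE l \<Longrightarrow> v \<in> Fk l k \<Longrightarrow> act y v \<in> Fk l (Suc k)"
  unfolding Fk.simps by (rule cfun.span_base) blast

lemma F_subspace: "cfun.subspace (F l D)"
  by (simp add: F_def)

lemma Fk_F: "k \<le> D \<Longrightarrow> Fk l k \<subseteq> F l D"
  unfolding F_def by (auto intro: cfun.span_base)

lemma F_M: "l \<ge> l0 \<Longrightarrow> F l D \<subseteq> M"
  unfolding F_def using Fk_M by (intro cfun.span_minimal subspace_rep) auto

lemma F_induct: "cfun.subspace Z \<Longrightarrow> (\<And>k. k \<le> D \<Longrightarrow> Fk l k \<subseteq> Z) \<Longrightarrow> F l D \<subseteq> Z"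
  unfolding F_def by (intro cfun.span_minimal) auto

lemma F_mono_D: "D \<le> D' \<Longrightarrow> F l D \<subseteq> F l D'"
  unfolding F_def by (intro cfun.span_mono UN_mono) auto

lemma Fk_mono: "l0 \<le> l \<Longrightarrow> l \<le> l' \<Longrightarrow> Fk l k \<subseteq> Fk l' k"
proof (induction k)
  case 0
  then show ?case using El_mono by auto
next
  case (Suc k)
  have "nmE l \<subseteq> nmE l'" unfolding nmE_def using gl1_mono[OF l1[OF Suc.prems(1)] Suc.prems(2)] by blast
  then show ?case unfolding Fk.simps using Suc by (intro cfun.span_mono) blast
qed

lemma F_mono_l: "l0 \<le> l \<Longrightarrow> l \<le> l' \<Longrightarrow> F l D \<subseteq> F l' D"
  unfolding F_def using Fk_mono by (intro cfun.span_mono) blast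

lemma act_nm_F:
  assumes l: "l \<ge> l0" and y: "y \<in> nmE l" and v: "v \<in> F l D"
  shows "act y v \<in> F l (Suc D)"
proof -
  have "F l D \<subseteq> {v \<in> M. act y v \<in> F l (Suc D)}"
  proof (rule F_induct[OF vimage_subspace[OF nmE_g[OF l y] F_subspace]])
    fix k assume "k \<le> D"
    then show "Fk l k \<subseteq> {v \<in> M. act y v \<in> F l (Suc D)}"
      using Fk_M[OF l] Fk_act[OF y] Fk_F[of "Suc k" "Suc D" l] by blast
  qed
  then show ?thesis using v by blast
qed

text \<open>With \<open>A\<close> block diagonal, the new coefficient is
  \<open>A_i Y - Y A_j\<close> for the diagonal components of \<open>A\<close>. So \<open>m\<close>
  preserves the root of a factor, and thereby the number of factors.\<close>

lemma lbr_m_tmat: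
  assumes A: "A \<in> m" "A \<in> G l" and Y: "Y \<in> gl_blk (N l)" and ij: "i < p" "j < p"
  shows "\<exists>Z\<in>gl_blk (N l). lbr A (tmat Y i j) = tmat Z i j"
proof -
  have Ad: "A = dpart A" by (rule comp_ext) (use A in \<open>auto simp: comp_dpart m_iff\<close>)
  have rf: "row_finite (comp A k k)" "row_finite Y" for k
    using comp_G[OF A(2)] gl_row_finite Y by blast+
  have "mmul (dpart A) (tmat Y i j) = (\<Sum>k<p. mmul (tmat (comp A k k) k k) (tmat Y i j))"
    unfolding dpart_def by (rule mmul_sum_left) (auto intro: tmat_row_finite rf)
  also have "\<dots> = (\<Sum>k<p. if k = i then tmat (mmul (comp A i i) Y) i j else 0)"
    using ij by (intro sum.cong refl) (auto simp: mmul_tmat rf)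
  also have "\<dots> = tmat (mmul (comp A i i) Y) i j" using ij by simp
  finally have 1: "mmul A (tmat Y i j) = tmat (mmul (comp A i i) Y) i j" using Ad by simp
  have "mmul (tmat Y i j) (dpart A) = (\<Sum>k<p. mmul (tmat Y i j) (tmat (comp A k k) k k))"
    unfolding dpart_def by (rule mmul_sum_right) simp
  also have "\<dots> = (\<Sum>k<p. if k = j then tmat (mmul Y (comp A j j)) i j else 0)"
    using ij by (intro sum.cong refl) (auto simp: mmul_tmat rf)
  also have "\<dots> = tmat (mmul Y (comp A j j)) i j" using ij by simp
  finally have 2: "mmul (tmat Y i j) A = tmat (mmul Y (comp A j j)) i j" using Ad by simp
  have "lbr A (tmat Y i j) = tmat (mmul (comp A i i) Y - mmul Y (comp A j j)) i j"
    unfolding lbr_def 1 2 by (rule ext) (auto simp: tmat_def algebra_simps)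
  moreover have "mmul (comp A i i) Y - mmul Y (comp A j j) \<in> gl_blk (N l)"
    by (intro cfun.subspace_diff[OF gl_blk_subspace] gl_blk_mmul N_pos comp_G[OF A(2)] Y)
  ultimately show ?thesis by blast
qed

lemma Fk_m:
  assumes l: "l \<ge> l0" and A: "A \<in> m" "A \<in> G l"
  shows "v \<in> Fk l k \<Longrightarrow> act A v \<in> Fk l k"
proof (induction k arbitrary: v)
  case 0
  then obtain e where e: "e \<in> El l" "v = \<tau> e" by auto
  have AP: "A \<in> P" using A m_P by blast
  have "act A v = \<tau> (\<rho> A e)" unfolding e(2) by (rule \<tau>_act[OF AP El_in_box[OF l e(1)]])
  then show ?case using El_act[OF l AP A(2) e(1)] by simp
next
  case (Suc k)
  have Ag: "A \<in> g" using A m_iff by blast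
  have "Fk l (Suc k) \<subseteq> {v \<in> M. act A v \<in> Fk l (Suc k)}"
    (is "_ \<subseteq> ?Z")
  proof (subst Fk.simps(2), rule cfun.span_minimal[where T = ?Z, OF _ vimage_subspace[OF Ag Fk_subspace[OF l]]], rule subsetI, elim CollectE exE conjE, hypsubst, intro CollectI conjI)
    fix y v assume y: "y \<in> nmE l" and v: "v \<in> Fk l k"
    have yg: "y \<in> g" and vM: "v \<in> M" using nmE_g[OF l y] v Fk_M[OF l] by blast+
    show "act y v \<in> M" by (rule act_closed[OF yg vM])
    obtain Y i j where Y: "y = tmat Y i j" "Y \<in> gl_blk (N l)" "(i, j) \<in> negpairs" using y by (auto simp: nmE_def)
    have "i < p" "j < p" using Y(3) by (auto simp: negpairs_def)
    then have "lbr A y \<in> nmE l" using lbr_m_tmat[OF A Y(2)] Y unfolding nmE_def by blast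
    then have "act (lbr A y) v + act y (act A v) \<in> Fk l (Suc k)"
      using Fk_act v y Suc.IH by (intro cfun.subspace_add[OF Fk_subspace[OF l]]) blast+
    then show "act A (act y v) \<in> Fk l (Suc k)" by (simp only: act_comm[OF Ag yg vM])
  qed
  then show ?case using Suc.prems by blast
qed

lemma F_m:
  assumes l: "l \<ge> l0" and A: "A \<in> m" "A \<in> G l" and v: "v \<in> F l D"
  shows "act A v \<in> F l D"
proof -
  have Ag: "A \<in> g" using A m_iff by blast
  have "F l D \<subseteq> {v \<in> M. act A v \<in> F l D}"
  proof (rule F_induct[OF vimage_subspace[OF Ag F_subspace]])
    fix k assume "k \<le> D"
    then show "Fk l k \<subseteq> {v \<in> M. act A v \<in> F l D}" using Fk_M[OF l] Fk_m[OF l A] Fk_F[of k D l] by blast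
  qed
  then show ?thesis using v by blast
qed

text \<open>Components of \<open>x\<close> in the opposite nilradical add one factor; the others lie
  in the parabolic and add none. The latter is an assumption, so that the lemma serves both inside
  the induction for the parabolic and after it.\<close>

lemma split_act:
  assumes l: "l \<ge> l0" and x: "x \<in> G l" and v: "v \<in> F l k"
    and IH: "\<And>x. x \<in> P \<Longrightarrow> x \<in> G l \<Longrightarrow> act x v \<in> F l k"
  shows "act x v \<in> F l (Suc k)"
proof -
  let ?T = "\<lambda>z. tmat (comp x (fst z) (snd z)) (fst z) (snd z)"
  let ?I = "{..<p} \<times> {..<p}"
  have TG: "?T z \<in> G l" for z by (rule tmat_G[OF comp_G[OF x]])
  have vM: "v \<in> M" using v F_M[OF l] by blast
  have "x = (\<Sum>z\<in>?I. ?T z)" by (subst expand[of x]) (simp add: case_prod_beta)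
  then have "act x v = act (\<Sum>z\<in>?I. ?T z) v" by simp
  also have "\<dots> = (\<Sum>z\<in>?I. act (?T z) v)"
    by (rule act_sum_left[OF g_subspace _ vM]) (use TG G_g[OF l1[OF l]] in auto)
  also have "\<dots> \<in> F l (Suc k)"
  proof (rule cfun.subspace_sum[OF F_subspace])
    fix z assume z: "z \<in> ?I"
    show "act (?T z) v \<in> F l (Suc k)"
    proof (cases "Re (\<eta> (fst z) - \<eta> (snd z)) < 0")
      case True
      then have "(fst z, snd z) \<in> negpairs" using z by (auto simp: negpairs_def)
      then have "?T z \<in> nmE l" unfolding nmE_def using comp_G[OF x] by blast
      then show ?thesis by (rule act_nm_F[OF l _ v])
    next
      case False
      have "?T z \<in> P" unfolding P_iff using TG G_g[OF l1[OF l]] z False by (auto simp: comp_tmat)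
      then show ?thesis using IH TG F_mono_D[of k "Suc k" l] by auto
    qed
  qed
  finally show ?thesis .
qed

text \<open>The bracket of \<open>x\<close> with a factor may fall into the parabolic, so the number
  of factors can drop; hence the target is \<open>F l k\<close> and not \<open>Fk l k\<close>.
  Components of the bracket in the opposite nilradical take the place of the factor.\<close>

lemma Fk_P:
  assumes l: "l \<ge> l0"
  shows "x \<in> P \<Longrightarrow> x \<in> G l \<Longrightarrow> v \<in> Fk l k \<Longrightarrow> act x v \<in> F l k"
proof (induction k arbitrary: x v)
  case 0
  then obtain e where e: "e \<in> El l" "v = \<tau> e" by auto
  have "act x v = \<tau> (\<rho> x e)" unfolding e(2) by (rule \<tau>_act[OF 0(1) El_in_box[OF l e(1)]])
  then have "act x v \<in> Fk l 0" using El_act[OF l 0(1,2) e(1)] by simp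
  then show ?case using Fk_F by blast
next
  case (Suc k)
  have xg: "x \<in> g" using Suc.prems P_g by blast
  have "Fk l (Suc k) \<subseteq> {v \<in> M. act x v \<in> F l (Suc k)}"
  proof (subst Fk.simps(2), rule cfun.span_minimal[OF _ vimage_subspace[OF xg F_subspace]], safe)
    fix y v assume y: "y \<in> nmE l" and v: "v \<in> Fk l k"
    have yg: "y \<in> g" and vM: "v \<in> M" using nmE_g[OF l y] v Fk_M[OF l] by blast+
    show "act y v \<in> M" by (rule act_closed[OF yg vM])
    have "lbr x y \<in> G l" by (rule G_lbr[OF Suc.prems(2) nmE_G[OF y]])
    then have "act (lbr x y) v \<in> F l (Suc k)"
      by (rule split_act[OF l]) (use v Fk_F Suc.IH in blast)+
    moreover have "act y (act x v) \<in> F l (Suc k)"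
      by (rule act_nm_F[OF l y Suc.IH[OF Suc.prems(1,2) v]])
    ultimately show "act x (act y v) \<in> F l (Suc k)"
      unfolding act_comm[OF xg yg vM] by (rule cfun.subspace_add[OF F_subspace])
  qed
  then show ?case using Suc.prems by blast
qed

lemma F_P:
  assumes l: "l \<ge> l0" and x: "x \<in> P" "x \<in> G l" and v: "v \<in> F l D"
  shows "act x v \<in> F l D"
proof -
  have xg: "x \<in> g" using x P_g by blast
  have "F l D \<subseteq> {v \<in> M. act x v \<in> F l D}"
  proof (rule F_induct[OF vimage_subspace[OF xg F_subspace]])
    fix k assume "k \<le> D"
    then show "Fk l k \<subseteq> {v \<in> M. act x v \<in> F l D}" using Fk_M[OF l] Fk_P[OF l x] F_mono_D[of k D l] by blast
  qed
  then show ?thesis using v by blast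
qed

lemma F_g: "l \<ge> l0 \<Longrightarrow> x \<in> G l \<Longrightarrow> v \<in> F l D \<Longrightarrow> act x v \<in> F l (Suc D)"
  by (rule split_act) (auto intro: F_P)

text \<open>The finite layers: at most \<open>D\<close> factors, of any level. The union over the
  levels is what is stable under all of \<open>m\<close>.\<close>

definition "Fd D = (\<Union>l\<in>{l0..}. F l D)"

lemma Fd_subspace: "cfun.subspace (Fd D)"
proof (rule cfun.subspaceI)
  show "0 \<in> Fd D" using cfun.subspace_0[OF F_subspace[of l0 D]] by (auto simp: Fd_def)
  fix v w assume "v \<in> Fd D" "w \<in> Fd D"
  then obtain l l' where l: "l \<ge> l0" "v \<in> F l D" "l' \<ge> l0" "w \<in> F l' D" by (auto simp: Fd_def)
  then have "v \<in> F (max l l') D" "w \<in> F (max l l') D"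
    using F_mono_l[of l "max l l'" D] F_mono_l[of l' "max l l'" D] by auto
  then have "v + w \<in> F (max l l') D" by (rule cfun.subspace_add[OF F_subspace])
  moreover have "max l l' \<in> {l0..}" using l(1) by (simp add: le_max_iff_disj)
  ultimately show "v + w \<in> Fd D" unfolding Fd_def by blast
next
  fix c v assume "v \<in> Fd D"
  then show "fscale c v \<in> Fd D" using cfun.subspace_scale[OF F_subspace, of v _ D c] unfolding Fd_def by blast
qed

lemma Fd_m:
  assumes A: "A \<in> m" and v: "v \<in> Fd D"
  shows "act A v \<in> Fd D"
proof -
  obtain l where l: "l \<ge> l0" "v \<in> F l D" using v by (auto simp: Fd_def)
  obtain l' where l': "l' \<ge> 1" "A \<in> G l'" using A m_iff g_level by blast
  have mx: "max l l' \<ge> l0" using l(1) by (simp add: le_max_iff_disj)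
  have "v \<in> F (max l l') D" using F_mono_l[OF l(1), of "max l l'" D] l(2) by auto
  moreover have "A \<in> G (max l l')" using G_mono[of l' "max l l'"] l' by auto
  ultimately have "act A v \<in> F (max l l') D" by (intro F_m[OF mx A])
  then show ?thesis unfolding Fd_def using mx by auto
qed

lemma Fd_M: "Fd D \<subseteq> M"
  using F_M by (auto simp: Fd_def)

text \<open>By \<open>F_g\<close> one more element of the Lie algebra costs at most one more factor,
  so the vectors that are reached form a stable subspace containing the generators.\<close>

lemma M_Fd: "v \<in> M \<Longrightarrow> \<exists>l\<ge>l0. \<exists>D. v \<in> F l D"
proof -
  let ?Z = "{v. \<exists>l\<ge>l0. \<exists>D. v \<in> F l D}"
  have join: "\<exists>l\<ge>l0. \<exists>D. v \<in> F l D \<and> w \<in> F l D" if "v \<in> ?Z" "w \<in> ?Z" for v w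
  proof -
    from that obtain l D l' D' where l: "l \<ge> l0" "v \<in> F l D" "l' \<ge> l0" "w \<in> F l' D'" by blast
    have "v \<in> F (max l l') (max D D')" using F_mono_l[OF l(1), of "max l l'" D] F_mono_D[of D "max D D'"] l by auto
    moreover have "w \<in> F (max l l') (max D D')" using F_mono_l[OF l(3), of "max l l'" D'] F_mono_D[of D' "max D D'"] l by auto
    moreover have "max l l' \<ge> l0" using l(1) by (simp add: le_max_iff_disj)
    ultimately show ?thesis by blast
  qed
  have "M \<subseteq> ?Z"
  proof (rule generated)
    show "cfun.subspace ?Z"
    proof (rule cfun.subspaceI)
      show "0 \<in> ?Z" using cfun.subspace_0[OF F_subspace] by blast
      show "v + w \<in> ?Z" if "v \<in> ?Z" "w \<in> ?Z" for v w
        using join[OF that] cfun.subspace_add[OF F_subspace] by blast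
      show "fscale c v \<in> ?Z" if "v \<in> ?Z" for c v
        using that cfun.subspace_scale[OF F_subspace] by blast
    qed
    show "\<tau> ` box \<subseteq> ?Z"
    proof
      fix v assume "v \<in> \<tau> ` box"
      then obtain e where e: "e \<in> box" "v = \<tau> e" by blast
      obtain l where l: "l \<ge> l0" "e \<in> El l" using box_El[OF e(1)] by blast
      then have "v \<in> Fk l 0" by (simp add: e(2))
      then show "v \<in> ?Z" using Fk_F[of 0 0 l] l by blast
    qed
    show "\<forall>A\<in>g. \<forall>v\<in>?Z \<inter> M. act A v \<in> ?Z"
    proof (intro ballI)
      fix A v assume A: "A \<in> g" and "v \<in> ?Z \<inter> M"
      then obtain l D where l: "l \<ge> l0" "v \<in> F l D" by blast
      obtain l' where l': "l' \<ge> 1" "A \<in> G l'" using A g_level by blast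
      have mx: "max l l' \<ge> l0" using l(1) by (simp add: le_max_iff_disj)
      have "v \<in> F (max l l') D" using F_mono_l[OF l(1), of "max l l'" D] l(2) by auto
      moreover have "A \<in> G (max l l')" using G_mono[of l' "max l l'"] l' by auto
      ultimately have "act A v \<in> F (max l l') (Suc D)" by (intro F_g[OF mx])
      then show "act A v \<in> ?Z" using mx by blast
    qed
  qed
  then show "v \<in> M \<Longrightarrow> \<exists>l\<ge>l0. \<exists>D. v \<in> F l D" by blast
qed

end

section \<open>Weights\<close>

text \<open>The eigenvalue of the identity matrix on tensors with this pattern: the number of
  natural letters minus the number of dual ones.\<close>

definition letter_sum :: "bool list \<Rightarrow> complex" where
  "letter_sum bs = (\<Sum>k<length bs. if bs ! k then -1 else 1)"

lemma tact_scalar: "tact (fscale c idm) t w = c * letter_sum (map fst w) * t w"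
proof -
  have "tact (fscale c idm) t w = (\<Sum>k<length w. c * (if fst (w ! k) then -1 else 1) * t w)"
    unfolding tact_def
  proof (rule sum.cong[OF refl])
    fix k assume "k \<in> {..<length w}"
    obtain b i where l: "w ! k = (b, i)" by force
    have w: "w[k := (b, i)] = w" using list_update_id[of w k] l by simp
    have "{j. fscale c idm (i, j) \<noteq> 0} = (if c = 0 then {} else {i})"
      "{j. fscale c idm (j, i) \<noteq> 0} = (if c = 0 then {} else {i})" by (auto simp: idm_def)
    then show "(case w ! k of
         (False, i) \<Rightarrow> \<Sum>j | fscale c idm (i, j) \<noteq> 0. fscale c idm (i, j) * t (w[k := (False, j)])
       | (True, i) \<Rightarrow> - (\<Sum>j | fscale c idm (j, i) \<noteq> 0. fscale c idm (j, i) * t (w[k := (True, j)])))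
     = c * (if fst (w ! k) then -1 else 1) * t w"
      using w unfolding l by (cases b; simp only: prod.case bool.case) (auto simp: idm_def)
  qed
  also have "\<dots> = c * letter_sum (map fst w) * t w"
    by (simp add: letter_sum_def sum_distrib_left sum_distrib_right)
  finally show ?thesis .
qed

context filtration
begin

lemma \<tau>_diff: "e \<in> box \<Longrightarrow> e' \<in> box \<Longrightarrow> \<tau> (e - e') = \<tau> e - \<tau> e'"
proof -
  assume e: "e \<in> box" "e' \<in> box"
  have "\<tau> ((e - e') + e') = \<tau> (e - e') + \<tau> e'" by (rule \<tau>_add[OF cfun.subspace_diff[OF box_subspace e] e(2)])
  then show ?thesis by (simp only: diff_add_cancel eq_diff_eq)
qed

text \<open>The eigenvalue of \<open>h\<close> on tensors of the given patterns, as \<open>h\<close>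
  acts on the \<open>j\<close>-th factor as the scalar matrix \<open>\<eta> j\<close>.\<close>

definition \<kappa> :: "bool list list \<Rightarrow> complex" where
  "\<kappa> pts = (\<Sum>j<p. \<eta> j * letter_sum (pts ! j))"

lemma \<rho>_h:
  assumes l: "l \<ge> l0" and e: "e \<in> El l"
  shows "\<rho> h e = (\<lambda>ws. \<kappa> (pat ws) * e ws)"
proof
  fix ws
  show "\<rho> h e ws = \<kappa> (pat ws) * e ws"
  proof (cases "length ws = p")
    case True
    have "\<rho> h e ws = (\<Sum>j<p. tact (fscale (\<eta> j) idm) (\<lambda>w. e (ws[j := w])) (ws ! j))"
      unfolding \<rho>_cong[OF h_P] using True by (simp add: box_act_def h_dmat comp_dmat)
    also have "\<dots> = (\<Sum>j<p. \<eta> j * letter_sum (pat ws ! j) * e ws)"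
      unfolding tact_scalar using True by (intro sum.cong refl) (simp add: pat_def)
    finally show ?thesis by (simp add: \<kappa>_def sum_distrib_right)
  next
    case False
    then show ?thesis using El_props(2)[OF l e, of ws] by (simp add: \<rho>_cong[OF h_P] box_act_def)
  qed
qed

text \<open>On \<open>El l\<close> the element \<open>h\<close> multiplies each coefficient by a
  number depending on the pattern only. Membership is proved along with the formula because
  \<open>\<tau>\<close> is controlled only on the inducing module.\<close>

lemma shift_\<tau>:
  assumes l: "l \<ge> l0" and e: "e \<in> El l"
  shows "(\<lambda>ws. prod_list (map (\<lambda>\<mu>. \<kappa> (pat ws) - \<mu>) \<mu>s) * e ws) \<in> El l
    \<and> shift_prod act h \<mu>s (\<tau> e) = \<tau> (\<lambda>ws. prod_list (map (\<lambda>\<mu>. \<kappa> (pat ws) - \<mu>) \<mu>s) * e ws)"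
proof (induction \<mu>s)
  case Nil
  then show ?case using e by (simp add: shift_prod_simps)
next
  case (Cons \<mu> \<mu>s)
  let ?d = "\<lambda>ws. prod_list (map (\<lambda>\<mu>. \<kappa> (pat ws) - \<mu>) \<mu>s) * e ws"
  have d: "?d \<in> El l" using Cons by blast
  have hd: "\<rho> h ?d \<in> El l" by (rule El_act[OF l h_P _ d]) (use h_G1 G1 G_mono[of 1 l] l1[OF l] in auto)
  have sd: "fscale \<mu> ?d \<in> El l" by (rule cfun.subspace_scale[OF El_subspace d])
  have eq: "(\<lambda>ws. prod_list (map (\<lambda>\<mu>. \<kappa> (pat ws) - \<mu>) (\<mu> # \<mu>s)) * e ws) = \<rho> h ?d - fscale \<mu> ?d"
    unfolding \<rho>_h[OF l d] by (rule ext) (simp add: algebra_simps)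
  have "shift_prod act h (\<mu> # \<mu>s) (\<tau> e) = act h (\<tau> ?d) - fscale \<mu> (\<tau> ?d)"
    using Cons unfolding shift_prod_simps by (simp only:)
  also have "\<dots> = \<tau> (\<rho> h ?d) - \<tau> (fscale \<mu> ?d)"
    using \<tau>_act[OF h_P El_in_box[OF l d]] \<tau>_scale[OF El_in_box[OF l d], of \<mu>] by (simp only:)
  also have "\<dots> = \<tau> (\<rho> h ?d - fscale \<mu> ?d)"
    by (rule \<tau>_diff[symmetric]) (rule El_in_box[OF l hd], rule El_in_box[OF l sd])
  finally show ?case unfolding eq using cfun.subspace_diff[OF El_subspace hd sd] by blast
qed

lemma \<tau>_zero: "\<tau> 0 = 0"
  using \<tau>_diff[OF cfun.subspace_0[OF box_subspace] cfun.subspace_0[OF box_subspace]] by simp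

text \<open>Every coefficient meets a vanishing factor, since the list runs through the eigenvalues
  of all occurring patterns.\<close>

lemma shift_\<tau>_zero:
  assumes l: "l \<ge> l0" and e: "e \<in> El l" and \<mu>s: "set \<mu>s = \<kappa> ` pats"
  shows "shift_prod act h \<mu>s (\<tau> e) = 0"
proof -
  have "(\<lambda>ws. prod_list (map (\<lambda>\<mu>. \<kappa> (pat ws) - \<mu>) \<mu>s) * e ws) = 0"
  proof
    fix ws
    show "prod_list (map (\<lambda>\<mu>. \<kappa> (pat ws) - \<mu>) \<mu>s) * e ws = 0 ws"
    proof (cases "e ws = 0")
      case False
      then have "\<kappa> (pat ws) \<in> set \<mu>s" using El_props(1)[OF l e] unfolding \<mu>s by blast
      then show ?thesis by (auto simp: prod_list_zero_iff)
    qed simp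
  qed
  then show ?thesis using shift_\<tau>[OF l e, of \<mu>s] \<tau>_zero by (simp only:)
qed

lemma lbr_h_nm:
  assumes y: "y \<in> nmE l" and l: "l \<ge> l0"
  shows "\<exists>(i, j)\<in>negpairs. lbr h y = fscale (\<eta> i - \<eta> j) y"
proof -
  obtain Y i j where Y: "y = tmat Y i j" "Y \<in> gl_blk (N l)" "(i, j) \<in> negpairs" using y by (auto simp: nmE_def)
  have ij: "i < p" "j < p" using Y(3) by (auto simp: negpairs_def)
  have "lbr h y = fscale (\<eta> i - \<eta> j) y"
    by (rule comp_ext) (use ij in \<open>auto simp: comp_lbr_h[OF nmE_g[OF l y, unfolded Y(1)]] comp_scale comp_tmat Y(1)\<close>)
  then show ?thesis using Y(3) by blast
qed

text \<open>A factor of weight \<open>\<nu>\<close> raises all eigenvalues by \<open>\<nu>\<close>: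
  \<open>h - \<mu> - \<nu>\<close> passes \<open>y\<close> and becomes
  \<open>h - \<mu>\<close>.\<close>

lemma shift_nm:
  assumes y: "y \<in> g" "lbr h y = fscale \<nu> y" and v: "v \<in> M"
  shows "shift_prod act h (map (\<lambda>\<mu>. \<mu> + \<nu>) \<mu>s) (act y v) = act y (shift_prod act h \<mu>s v)"
proof (induction \<mu>s)
  case Nil
  then show ?case by (simp add: shift_prod_simps)
next
  case (Cons \<mu> \<mu>s)
  let ?u = "shift_prod act h \<mu>s v"
  have u: "?u \<in> M" by (rule shift_prod_M[OF h_g v])
  have c: "act h (act y ?u) = fscale \<nu> (act y ?u) + act y (act h ?u)"
    using act_comm[OF h_g y(1) u] unfolding y(2) act_smult[OF y(1) u] .
  have "shift_prod act h (map (\<lambda>\<mu>. \<mu> + \<nu>) (\<mu> # \<mu>s)) (act y v) = act h (act y ?u) - fscale (\<mu> + \<nu>) (act y ?u)"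
    unfolding list.map shift_prod_simps Cons ..
  also have "\<dots> = act y (act h ?u) - fscale \<mu> (act y ?u)"
    unfolding c by (rule ext) (simp add: algebra_simps)
  also have "\<dots> = act y (act h ?u - fscale \<mu> ?u)"
    unfolding act_diff_right[OF y(1) act_closed[OF h_g u] cfun.subspace_scale[OF subspace_rep u]] act_scale[OF y(1) u] ..
  finally show ?case unfolding shift_prod_simps .
qed

text \<open>An upper bound for the real parts of the eigenvalues of \<open>h\<close> on
  \<open>E\<close>, and the least drop caused by a factor. The inserted 0 and 1 cover empty sets,
  such as \<open>negpairs\<close> for \<open>p = 1\<close>, and keep the gap positive; the gap
  exists because there are finitely many roots.\<close>

definition "wt_bound = Max (insert 0 (Re ` \<kappa> ` pats))"
definition "wt_gap = Min (insert 1 ((\<lambda>(i, j). - Re (\<eta> i - \<eta> j)) ` negpairs))"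

lemma wt_gap: "wt_gap > 0" "(i, j) \<in> negpairs \<Longrightarrow> Re (\<eta> i - \<eta> j) \<le> - wt_gap"
proof -
  show "wt_gap > 0"
    unfolding wt_gap_def using finite_negpairs by (subst Min_gr_iff) (auto simp: negpairs_def)
  assume "(i, j) \<in> negpairs"
  then have "- Re (\<eta> i - \<eta> j) \<in> insert 1 ((\<lambda>(i, j). - Re (\<eta> i - \<eta> j)) ` negpairs)" by force
  then have "wt_gap \<le> - Re (\<eta> i - \<eta> j)" unfolding wt_gap_def using finite_negpairs by (intro Min_le) auto
  then show "Re (\<eta> i - \<eta> j) \<le> - wt_gap" by simp
qed

lemma zero_subspace: "cfun.subspace {0}" "v \<in> {0} \<Longrightarrow> act h v \<in> {0}"
  using act_zero[OF h_g] by auto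

text \<open>Starting from the bound for \<open>E\<close>, each of the \<open>k\<close> factors
  lowers the real parts by at least the gap.\<close>

lemma Fk_shift:
  assumes l: "l \<ge> l0"
  shows "Fk l k \<subseteq> {v \<in> M. \<exists>\<mu>s. (\<forall>\<mu>\<in>set \<mu>s. Re \<mu> \<le> wt_bound - of_nat k * wt_gap) \<and> shift_prod act h \<mu>s v \<in> {0}}"
proof (induction k)
  case 0
  have fin: "finite (\<kappa> ` pats)" using finite_pats by simp
  then obtain \<mu>s where \<mu>s: "set \<mu>s = \<kappa> ` pats" using finite_list by blast
  have "Re \<mu> \<le> wt_bound" if "\<mu> \<in> set \<mu>s" for \<mu>
    unfolding wt_bound_def using fin that \<mu>s by (intro Max_ge) auto
  then have r: "\<forall>\<mu>\<in>set \<mu>s. Re \<mu> \<le> wt_bound - of_nat 0 * wt_gap" by simp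
  show ?case
  proof
    fix v assume v: "v \<in> Fk l 0"
    then obtain e where e: "e \<in> El l" "v = \<tau> e" by auto
    have "shift_prod act h \<mu>s v \<in> {0}" unfolding e(2) using shift_\<tau>_zero[OF l e(1) \<mu>s] by simp
    then show "v \<in> {v \<in> M. \<exists>\<mu>s. (\<forall>\<mu>\<in>set \<mu>s. Re \<mu> \<le> wt_bound - of_nat 0 * wt_gap) \<and> shift_prod act h \<mu>s v \<in> {0}}"
      using r v Fk_M[OF l] by blast
  qed
next
  case (Suc k)
  let ?S = "\<lambda>k. {v \<in> M. \<exists>\<mu>s. (\<forall>\<mu>\<in>set \<mu>s. Re \<mu> \<le> wt_bound - of_nat k * wt_gap) \<and> shift_prod act h \<mu>s v \<in> {0}}"
  have "{act y v | y v. y \<in> nmE l \<and> v \<in> Fk l k} \<subseteq> ?S (Suc k)"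
  proof
    fix w assume "w \<in> {act y v | y v. y \<in> nmE l \<and> v \<in> Fk l k}"
    then obtain y v where w: "w = act y v" "y \<in> nmE l" "v \<in> Fk l k" by blast
    have yg: "y \<in> g" by (rule nmE_g[OF l w(2)])
    obtain \<mu>s where \<mu>s: "v \<in> M" "\<forall>\<mu>\<in>set \<mu>s. Re \<mu> \<le> wt_bound - of_nat k * wt_gap" "shift_prod act h \<mu>s v = 0"
      using Suc w(3) by blast
    obtain i j where ij: "(i, j) \<in> negpairs" "lbr h y = fscale (\<eta> i - \<eta> j) y" using lbr_h_nm[OF w(2) l] by blast
    let ?\<nu> = "\<eta> i - \<eta> j"
    have z: "shift_prod act h (map (\<lambda>\<mu>. \<mu> + ?\<nu>) \<mu>s) w \<in> {0}"
      unfolding w(1) shift_nm[OF yg ij(2) \<mu>s(1)] \<mu>s(3) using act_zero[OF yg] by blast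
    have "Re \<mu> \<le> wt_bound - of_nat (Suc k) * wt_gap" if "\<mu> \<in> set (map (\<lambda>\<mu>. \<mu> + ?\<nu>) \<mu>s)" for \<mu>
    proof -
      from that obtain \<mu>' where \<mu>': "\<mu> = \<mu>' + ?\<nu>" "\<mu>' \<in> set \<mu>s" by auto
      have "Re \<mu>' \<le> wt_bound - of_nat k * wt_gap" using \<mu>s(2) \<mu>'(2) by blast
      then show ?thesis using wt_gap(2)[OF ij(1)] unfolding \<mu>'(1) by (simp add: algebra_simps)
    qed
    moreover have "w \<in> M" unfolding w(1) by (rule act_closed[OF yg \<mu>s(1)])
    ultimately show "w \<in> ?S (Suc k)" using z by blast
  qed
  then show ?case unfolding Fk.simps
    by (rule cfun.span_minimal) (rule shift_into_subspace[OF h_g zero_subspace])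
qed

lemma locally_finite: "v \<in> M \<Longrightarrow> \<exists>\<mu>s. shift_prod act h \<mu>s v = 0"
proof -
  assume v: "v \<in> M"
  obtain l D where l: "l \<ge> l0" "v \<in> F l D" using M_Fd[OF v] by blast
  have "F l D \<subseteq> {v \<in> M. \<exists>\<mu>s. (\<forall>\<mu>\<in>set \<mu>s. True) \<and> shift_prod act h \<mu>s v \<in> {0}}"
  proof (rule F_induct[OF shift_into_subspace[OF h_g zero_subspace]])
    fix k
    show "Fk l k \<subseteq> {v \<in> M. \<exists>\<mu>s. (\<forall>\<mu>\<in>set \<mu>s. True) \<and> shift_prod act h \<mu>s v \<in> {0}}"
      by (rule order_trans[OF Fk_shift[OF l(1)]]) auto
  qed
  then show ?thesis using l(2) by blast
qed

text \<open>Vectors with at most \<open>d\<close> factors are in the layer already, with the empty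
  product. Those with more factors are killed by a product whose eigenvalues have real parts below
  that of \<open>\<chi>\<close>.\<close>

lemma weight_in_layer: "\<exists>d. \<forall>v\<in>M. \<exists>\<mu>s. \<chi> \<notin> set \<mu>s \<and> shift_prod act h \<mu>s v \<in> Fd d"
proof -
  \<comment> \<open>After \<open>d\<close> factors every real part is smaller than that of
    \<open>\<chi>\<close>.\<close>
  obtain d :: nat where "(wt_bound - Re \<chi>) / wt_gap < of_nat d" using reals_Archimedean2 by blast
  then have d: "wt_bound - of_nat d * wt_gap < Re \<chi>" using wt_gap(1) by (simp add: field_simps)
  have h_m: "h \<in> m" unfolding m_iff using h_g by (auto simp: h_dmat comp_dmat)
  let ?S = "{v \<in> M. \<exists>\<mu>s. (\<forall>\<mu>\<in>set \<mu>s. \<mu> \<noteq> \<chi>) \<and> shift_prod act h \<mu>s v \<in> Fd d}"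
  have S: "cfun.subspace ?S" by (rule shift_into_subspace[OF h_g Fd_subspace Fd_m[OF h_m]])
  have Fk: "Fk l k \<subseteq> ?S" if l: "l \<ge> l0" for l k
  proof (cases "k \<le> d")
    case True
    have "Fk l k \<subseteq> Fd d" using Fk_F[OF True, of l] l unfolding Fd_def by blast
    then show ?thesis using Fd_M by (auto intro!: exI[of _ "[]"] simp: shift_prod_simps)
  next
    case False
    have "wt_bound - of_nat k * wt_gap \<le> wt_bound - of_nat d * wt_gap"
      using False wt_gap(1) by (simp add: mult_right_mono)
    then have ne: "Re \<mu> \<le> wt_bound - of_nat k * wt_gap \<Longrightarrow> \<mu> \<noteq> \<chi>" for \<mu> using d by auto
    show ?thesis
    proof
      fix v assume "v \<in> Fk l k"
      then obtain \<mu>s where "v \<in> M" "\<forall>\<mu>\<in>set \<mu>s. Re \<mu> \<le> wt_bound - of_nat k * wt_gap" "shift_prod act h \<mu>s v = 0"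
        using Fk_shift[OF l] by blast
      moreover have "0 \<in> Fd d" by (rule cfun.subspace_0[OF Fd_subspace])
      ultimately have "v \<in> M" "\<forall>\<mu>\<in>set \<mu>s. \<mu> \<noteq> \<chi>" "shift_prod act h \<mu>s v \<in> Fd d"
        using ne by auto
      then show "v \<in> ?S" by blast
    qed
  qed
  have "v \<in> ?S" if vM: "v \<in> M" for v
  proof -
    obtain l D where l: "l \<ge> l0" "v \<in> F l D" using M_Fd[OF vM] by blast
    have "F l D \<subseteq> ?S" by (rule F_induct[OF S Fk[OF l(1)]])
    then show ?thesis using l(2) by blast
  qed
  then show ?thesis by (intro exI[of _ d]) auto
qed

end

section \<open>Generators of the layers\<close>

context filtration
begin

text \<open>A factor \<open>tmat (emat (N l) a d) i j\<close> is recorded by the label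
  \<open>(i, j)\<close> and the additional word \<open>[(False, a), (True, d)]\<close>, because
  under brackets a matrix unit transforms as a vector tensor a covector. Thus products of factors
  applied to the inducing module are indexed like basis tensors.\<close>

primrec uu :: "nat \<Rightarrow> (nat \<times> nat) list \<Rightarrow> letter list list \<Rightarrow> 'q \<Rightarrow> complex" where
  "uu l [] ws = \<tau> (\<epsilon> l ([], ws))"
| "uu l (c # cs) ws = act (tmat (emat (N l) (snd (ws ! 0 ! 0)) (snd (ws ! 0 ! 1))) (fst c) (snd c)) (uu l cs (tl ws))"

definition "u l x = uu l (fst x) (snd x)"

text \<open>The pattern of the additional word is natural followed by dual. The set is finite and
  independent of the level.\<close>

primrec Qk :: "nat \<Rightarrow> ((nat \<times> nat) list \<times> bool list list) set" where
  "Qk 0 = QE"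
| "Qk (Suc k) = (\<lambda>(c, x). (c # fst x, [False, True] # snd x)) ` (negpairs \<times> Qk k)"

definition "Qd D = (\<Union>k\<le>D. Qk k)"

lemma finite_Qk: "finite (Qk k)"
  by (induction k) (auto simp: finite_QE finite_negpairs)

lemma finite_Qd: "finite (Qd D)"
  by (simp add: Qd_def finite_Qk)

lemma widx_Nil: "([], ws) \<in> widx K (Qk k) \<Longrightarrow> k = 0"
  by (cases k) (auto simp: widx_def)

lemma widx_Cons:
  assumes "(c # cs, ws) \<in> widx K (Qk k)"
  shows "\<exists>k' a d ws'. k = Suc k' \<and> c \<in> negpairs \<and> ws = [(False, a), (True, d)] # ws' \<and> a < K \<and> d < K
    \<and> (cs, ws') \<in> widx K (Qk k')"
proof -
  obtain k' where k: "k = Suc k'" using assms by (cases k) (auto simp: widx_def QE_def)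
  have "c \<in> negpairs" "\<exists>pt. pat ws = [False, True] # pt \<and> (cs, pt) \<in> Qk k'" "small K ws"
    using assms by (auto simp: widx_def k)
  then obtain pt where pt: "pat ws = [False, True] # pt" "(cs, pt) \<in> Qk k'" by blast
  obtain w ws' where ws: "ws = w # ws'" "map fst w = [False, True]" "pat ws' = pt"
    using pt(1) by (cases ws) (auto simp: pat_def)
  then obtain a d where w: "w = [(False, a), (True, d)]" by (auto simp: map_eq_Cons_conv)
  show ?thesis
    using \<open>c \<in> negpairs\<close> \<open>small K ws\<close> k ws w pt by (auto simp: small_def widx_def)
qed

lemma widx_Cons_I:
  "c \<in> negpairs \<Longrightarrow> a < K \<Longrightarrow> d < K \<Longrightarrow> (cs, ws) \<in> widx K (Qk k)
    \<Longrightarrow> (c # cs, [(False, a), (True, d)] # ws) \<in> widx K (Qk (Suc k))"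
  by (force simp: widx_def small_def pat_def)

lemma word_nm: "c \<in> negpairs \<Longrightarrow> tmat (emat (N l) a d) (fst c) (snd c) \<in> nmE l"
  unfolding nmE_def using emat_gl[of "N l" a d] by (cases c) fastforce

lemma uu_Fk: "l \<ge> l0 \<Longrightarrow> (cs, ws) \<in> widx (N l) (Qk k) \<Longrightarrow> uu l cs ws \<in> Fk l k"
proof (induction cs arbitrary: k ws)
  case Nil
  then show ?case using widx_Nil[OF Nil(2)] \<epsilon>(1)[OF Nil(1)] by auto
next
  case (Cons c cs)
  obtain k' a d ws' where k: "k = Suc k'" "c \<in> negpairs" "ws = [(False, a), (True, d)] # ws'" "a < N l" "d < N l"
    "(cs, ws') \<in> widx (N l) (Qk k')" using widx_Cons[OF Cons.prems(2)] by blast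
  have "act (tmat (emat (N l) a d) (fst c) (snd c)) (uu l cs ws') \<in> Fk l (Suc k')"
    by (rule Fk_act[OF word_nm[OF k(2)] Cons.IH[OF Cons.prems(1) k(6)]])
  then show ?case unfolding k(1,3) uu.simps by simp
qed

text \<open>Matrix units span the coefficients of a factor, and the vectors
  \<open>\<epsilon> l x\<close> span \<open>El l\<close>.\<close>

lemma Fk_span: "l \<ge> l0 \<Longrightarrow> Fk l k \<subseteq> cfun.span (u l ` widx (N l) (Qk k))"
proof (induction k)
  case 0
  have "El l \<subseteq> {e \<in> box. \<tau> e \<in> cfun.span (u l ` widx (N l) QE)}" (is "_ \<subseteq> ?Z")
  proof -
    have sub: "cfun.subspace ?Z"
    proof (rule cfun.subspaceI)
      show "0 \<in> ?Z" using cfun.subspace_0[OF box_subspace] \<tau>_zero by (simp add: cfun.span_zero)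
      fix e e' assume e: "e \<in> ?Z" "e' \<in> ?Z"
      then have "\<tau> (e + e') = \<tau> e + \<tau> e'" using \<tau>_add by blast
      then show "e + e' \<in> ?Z" using e cfun.subspace_add[OF box_subspace] cfun.span_add by auto
    next
      fix c e assume e: "e \<in> ?Z"
      then have eb: "e \<in> box" by blast
      have "\<tau> (fscale c e) \<in> cfun.span (u l ` widx (N l) QE)"
        unfolding \<tau>_scale[OF eb] using e by (intro cfun.span_scale) blast
      then show "fscale c e \<in> ?Z" using cfun.subspace_scale[OF box_subspace eb] by blast
    qed
    have "\<epsilon> l ` widx (N l) QE \<subseteq> ?Z"
    proof
      fix e assume "e \<in> \<epsilon> l ` widx (N l) QE"
      then obtain x where x: "x \<in> widx (N l) QE" "e = \<epsilon> l x" by blast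
      have "x = ([], snd x)" using x(1) by (cases x) (auto simp: widx_def QE_def)
      then have "u l x = \<tau> e" unfolding u_def x(2) by (metis uu.simps(1) fst_conv)
      then have "\<tau> e \<in> cfun.span (u l ` widx (N l) QE)" using x(1) by (intro cfun.span_base) force
      then show "e \<in> ?Z" using El_in_box[OF 0 \<epsilon>(1)[OF 0 x(1)]] x(2) by blast
    qed
    then have "cfun.span (\<epsilon> l ` widx (N l) QE) \<subseteq> ?Z" by (rule cfun.span_minimal[OF _ sub])
    then show ?thesis using El_span[OF 0] by blast
  qed
  then show ?case by auto
next
  case (Suc k)
  let ?S = "cfun.span (u l ` widx (N l) (Qk (Suc k)))"
  have "{act y v | y v. y \<in> nmE l \<and> v \<in> Fk l k} \<subseteq> ?S"
  proof
    fix w assume "w \<in> {act y v | y v. y \<in> nmE l \<and> v \<in> Fk l k}"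
    then obtain y v where w: "w = act y v" "y \<in> nmE l" "v \<in> Fk l k" by blast
    obtain Y i j where Y: "y = tmat Y i j" "Y \<in> gl_blk (N l)" "(i, j) \<in> negpairs" using w(2) by (auto simp: nmE_def)
    have yg: "y \<in> g" by (rule nmE_g[OF Suc.prems w(2)])
    have "Fk l k \<subseteq> {v \<in> M. act y v \<in> ?S}"
    proof (rule order_trans[OF Suc.IH[OF Suc.prems]], rule cfun.span_minimal[OF _ vimage_subspace[OF yg cfun.subspace_span]], rule subsetI)
      fix v assume "v \<in> u l ` widx (N l) (Qk k)"
      then obtain x where x: "v = u l x" "x \<in> widx (N l) (Qk k)" by blast
      have vM: "v \<in> M" using uu_Fk[OF Suc.prems, of "fst x" "snd x" k] x Fk_M[OF Suc.prems] unfolding u_def by auto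
      obtain B where B: "Y = dsum (N l) B" using Y(2) by (auto simp: gl_blk_def)
      let ?I = "{..<N l} \<times> {..<N l}"
      let ?T = "\<lambda>z. tmat (fscale (B z) (emat (N l) (fst z) (snd z))) i j"
      have "tmat (\<Sum>z\<in>J. F z) i j = (\<Sum>z\<in>J. tmat (F z) i j)" if "finite J" for J :: "(nat \<times> nat) set" and F
        using that
      proof (induction J rule: finite_induct)
        case empty
        show ?case by (simp only: sum.empty tmat_zero)
      next
        case (insert a J)
        show ?case unfolding sum.insert[OF insert.hyps] tmat_add insert.IH ..
      qed
      then have "y = (\<Sum>z\<in>?I. ?T z)"
        unfolding Y(1) B gl_blk_expand[OF N_pos] by (simp add: case_prod_beta)
      then have "act y v = act (\<Sum>z\<in>?I. ?T z) v" by (simp only:)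
      also have "\<dots> = (\<Sum>z\<in>?I. act (?T z) v)"
      proof (rule act_sum_left[OF g_subspace _ vM])
        fix z
        have "fscale (B z) (emat (N l) (fst z) (snd z)) \<in> gl_blk (N l)" by (rule cfun.subspace_scale[OF gl_blk_subspace emat_gl])
        from tmat_G[OF this] show "?T z \<in> g" using G_g[OF l1[OF Suc.prems]] by blast
      qed simp
      also have "\<dots> \<in> ?S"
      proof (rule cfun.span_sum)
        fix z assume z: "z \<in> ?I"
        obtain cs ws where xx: "x = (cs, ws)" by force
        let ?x = "((i, j) # cs, [(False, fst z), (True, snd z)] # ws)"
        have tg: "tmat (emat (N l) (fst z) (snd z)) i j \<in> g"
          using tmat_G[OF emat_gl] G_g[OF l1[OF Suc.prems]] by blast
        have "?x \<in> widx (N l) (Qk (Suc k))" using z x(2) Y(3) unfolding xx by (intro widx_Cons_I) auto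
        then have "u l ?x \<in> ?S" by (intro cfun.span_base imageI)
        moreover have "u l ?x = act (tmat (emat (N l) (fst z) (snd z)) i j) v" by (simp add: u_def x(1) xx)
        ultimately show "act (?T z) v \<in> ?S"
          unfolding tmat_scale act_smult[OF tg vM] by (intro cfun.span_scale) simp
      qed
      finally show "v \<in> {v \<in> M. act y v \<in> ?S}" using vM by blast
    qed
    then show "w \<in> ?S" using w by blast
  qed
  then show ?case unfolding Fk.simps by (rule cfun.span_minimal) simp
qed

text \<open>Matrix units move through the generators \<open>tmat (emat a d) i j\<close> as through the word \<open>e\<^sub>a e\<^sub>d\<^sup>*\<close>.\<close>

lemma uu_act:
  assumes l: "l \<ge> l0" and rs: "r < N l" "s < N l"
  shows "(cs, ws) \<in> widx (N l) (Qk k) \<Longrightarrow>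
    act (one_tensor (emat (N l) r s)) (uu l cs ws) z = wact (emat (N l) s r) (\<lambda>ws. uu l cs ws z) ws"
proof (induction cs arbitrary: k ws z)
  case Nil
  let ?A = "one_tensor (emat (N l) r s)"
  let ?I = "widx (N l) QE"
  have x: "([], ws) \<in> ?I" using Nil widx_Nil[OF Nil] by simp
  have AP: "?A \<in> P" by (rule one_tensor_P[OF emat_gl l1[OF l]])
  have Eb: "\<epsilon> l y \<in> box" if "y \<in> ?I" for y by (rule El_in_box[OF l \<epsilon>(1)[OF l that]])
  have \<tau>s: "\<tau> (\<Sum>y\<in>J. fscale (c y) (\<epsilon> l y)) = (\<Sum>y\<in>J. fscale (c y) (\<tau> (\<epsilon> l y)))" if "finite J" "J \<subseteq> ?I" for J c
    using that
  proof (induction J rule: finite_induct)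
    case empty
    show ?case by (simp only: sum.empty \<tau>_zero)
  next
    case (insert a J)
    have Ej: "\<epsilon> l y \<in> box" if "y \<in> insert a J" for y by (rule Eb) (use that insert.prems in blast)
    have b: "fscale (c a) (\<epsilon> l a) \<in> box" "(\<Sum>y\<in>J. fscale (c y) (\<epsilon> l y)) \<in> box"
      by (rule cfun.subspace_scale[OF box_subspace Ej], simp)
        (rule cfun.subspace_sum[OF box_subspace], rule cfun.subspace_scale[OF box_subspace Ej], simp)
    have "\<tau> (fscale (c a) (\<epsilon> l a)) = fscale (c a) (\<tau> (\<epsilon> l a))" using insert.prems Eb[of a] by (intro \<tau>_scale) blast
    then show ?case unfolding sum.insert[OF insert.hyps] \<tau>_add[OF b] using insert by simp
  qed
  have fin: "finite ?I" by (rule finite_widx[OF finite_QE])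
  have "act ?A (uu l [] ws) = \<tau> (\<rho> ?A (\<epsilon> l ([], ws)))" unfolding uu.simps by (rule \<tau>_act[OF AP Eb[OF x]])
  also have "\<dots> = (\<Sum>y\<in>?I. fscale (eact (N l) QE r s (delta ([], ws)) y) (\<tau> (\<epsilon> l y)))"
    unfolding \<epsilon>_act[OF l rs x] by (rule \<tau>s[OF fin order_refl])
  finally have "act ?A (uu l [] ws) z = (\<Sum>y\<in>?I. eact (N l) QE r s (delta ([], ws)) y * \<tau> (\<epsilon> l y) z)"
    by (simp only: sum_fun_apply)
  also have "\<dots> = (\<Sum>y\<in>?I. ract (emat (N l) r s) (delta ([], ws)) y * \<tau> (\<epsilon> l y) z)"
    by (intro sum.cong refl) (simp add: eact_def)
  \<comment> \<open>The adjunction passes from coefficients to basis vectors; it transposes the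
    unit, which is why \<open>r\<close> and \<open>s\<close> are exchanged on the right.\<close>
  also have "\<dots> = (\<Sum>y\<in>?I. delta ([], ws) y * ract (emat (N l) s r) (\<lambda>y. \<tau> (\<epsilon> l y) z) y)"
    by (rule ract_adjoint[OF finite_QE rs])
  also have "\<dots> = (\<Sum>y\<in>?I. if y = ([], ws) then ract (emat (N l) s r) (\<lambda>y. \<tau> (\<epsilon> l y) z) ([], ws) else 0)"
    by (intro sum.cong refl) (auto simp: delta_def)
  also have "\<dots> = ract (emat (N l) s r) (\<lambda>y. \<tau> (\<epsilon> l y) z) ([], ws)" using x fin by simp
  finally show ?case by (simp add: ract_def)
next
  case (Cons c cs)
  let ?E = "emat (N l)" and ?A = "one_tensor (emat (N l) r s)"
  obtain k' a d ws' where k: "k = Suc k'" "c \<in> negpairs" "ws = [(False, a), (True, d)] # ws'" "a < N l" "d < N l"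
    "(cs, ws') \<in> widx (N l) (Qk k')" using widx_Cons[OF Cons.prems] by blast
  let ?T = "\<lambda>a d. tmat (?E a d) (fst c) (snd c)"
  have Tg: "?T a d \<in> g" for a d by (rule nmE_g[OF l word_nm[OF k(2)]])
  have Ag: "?A \<in> g" using one_tensor_P[OF emat_gl l1[OF l]] P_g by blast
  have c: "fst c < p" "snd c < p" using k(2) by (auto simp: negpairs_def)
  let ?v = "uu l cs ws'"
  have vM: "?v \<in> M" using uu_Fk[OF l k(6)] Fk_M[OF l] by blast
  have small: "small (N l) ws'" "small (N l) ws" using k(6) Cons.prems by (auto simp: widx_def)
  \<comment> \<open>The bracket of two matrix units: \<open>a = s\<close> is replaced by
    \<open>r\<close>, and \<open>d = r\<close> is replaced by \<open>s\<close> with a minus sign,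
    exactly as \<open>swp s r\<close> and \<open>sg s r\<close> treat the letters of the additional
    word.\<close>
  have lbr: "lbr ?A (?T a d) = (if s = a then ?T r d else 0) - (if d = r then ?T a s else 0)"
  proof -
    have td: "tmat (Y - Z) i j = tmat Y i j - tmat Z i j" for Y Z i j
      by (auto simp: tmat_def fun_eq_iff algebra_simps)
    show ?thesis
      unfolding lbr_one_tensor[OF emat_gl emat_gl c] unfolding lbr_def td emat_mmul[OF N_pos rs k(4,5)] emat_mmul[OF N_pos k(4,5) rs]
      by (simp add: tmat_zero)
  qed
  have act0: "act 0 ?v = 0"
    using act_plus[OF cfun.subspace_0[OF g_subspace] cfun.subspace_0[OF g_subspace] vM] by simp
  have act_diff_left: "act (x - y) ?v = act x ?v - act y ?v" if "x \<in> g" "y \<in> g" for x y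
    using act_plus[OF cfun.subspace_diff[OF g_subspace that] that(2) vM] by (simp only: diff_add_cancel eq_diff_eq)
  have L: "act (lbr ?A (?T a d)) ?v = (if s = a then act (?T r d) ?v else 0) - (if d = r then act (?T a s) ?v else 0)"
    unfolding lbr by (subst act_diff_left) (auto simp: Tg act0 cfun.subspace_0[OF g_subspace])
  have R: "act (?T a d) (act ?A ?v) = (\<Sum>y\<in>positions ws'. fscale (sg s r (letter_at ws' y)) (act (?T a d) (uu l cs (upd ws' y (swp s r (letter_at ws' y))))))"
  proof -
    have "act ?A ?v = (\<Sum>y\<in>positions ws'. fscale (sg s r (letter_at ws' y)) (uu l cs (upd ws' y (swp s r (letter_at ws' y)))))"
      by (rule ext) (simp only: Cons.IH[OF k(6)] wact_emat[OF rs(2,1) small(1)] sum_fun_apply)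
    moreover have "uu l cs (upd ws' y (swp s r (letter_at ws' y))) \<in> M" if "y \<in> positions ws'" for y
      using uu_Fk[OF l widx_upd[OF k(6) that rs(2,1)]] Fk_M[OF l] by blast
    ultimately show ?thesis by (simp only: act_sum[OF finite_positions Tg])
  qed
  have "act ?A (uu l (c # cs) ws) = act ?A (act (?T a d) ?v)" by (simp add: k(3))
  also have "\<dots> = act (lbr ?A (?T a d)) ?v + act (?T a d) (act ?A ?v)" by (rule act_comm[OF Ag Tg vM])
  finally have "act ?A (uu l (c # cs) ws) z = act (lbr ?A (?T a d)) ?v z + act (?T a d) (act ?A ?v) z" by (simp only: plus_fun_apply)
  \<comment> \<open>In the Leibniz rule the bracket accounts for the additional word, and the
    remaining term for the words after it.\<close>
  also have "act (lbr ?A (?T a d)) ?v z = wact (?E s r) (\<lambda>us. uu l (c # cs) (us @ ws') z) [[(False, a), (True, d)]]"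
  proof -
    have p: "positions [[(False, a), (True, d)]] = {(0, 0), (0, 1)}" by (auto simp: positions_def less_Suc_eq)
    have "small (N l) [[(False, a), (True, d)]]" using k(4,5) by (simp add: small_def)
    from wact_emat[OF rs(2,1) this] show ?thesis unfolding L p
      by (auto simp: letter_at_def upd_def sg_def swp_def)
  qed
  also have "act (?T a d) (act ?A ?v) z = wact (?E s r) (\<lambda>us. uu l (c # cs) ([[(False, a), (True, d)]] @ us) z) ws'"
    unfolding R wact_emat[OF rs(2,1) small(1)] by (simp add: sum_fun_apply)
  also have "wact (?E s r) (\<lambda>us. uu l (c # cs) (us @ ws') z) [[(False, a), (True, d)]] + wact (?E s r) (\<lambda>us. uu l (c # cs) ([[(False, a), (True, d)]] @ us) z) ws'
    = wact (?E s r) (\<lambda>ws. uu l (c # cs) ws z) ([[(False, a), (True, d)]] @ ws')"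
    by (rule wact_append[symmetric])
  finally show ?case unfolding k(3) by simp
qed

end

section \<open>Layers as quotients of mixed tensor spaces\<close>

context filtration
begin

text \<open>The quotient map from a mixed tensor space for \<open>gl(N l)\<close> onto
  \<open>F l D\<close>. It sends the basis tensor \<open>x\<close> to \<open>u l x\<close>.\<close>

definition comb :: "nat \<Rightarrow> nat \<Rightarrow> ((nat \<times> nat) list \<times> letter list list \<Rightarrow> complex) \<Rightarrow> 'q \<Rightarrow> complex" where
  "comb l D H = (\<Sum>x\<in>widx (N l) (Qd D). fscale (H x) (u l x))"

lemma widx_Qd: "x \<in> widx K (Qd D) \<longleftrightarrow> (\<exists>k\<le>D. x \<in> widx K (Qk k))"
  by (auto simp: widx_def Qd_def)

lemma u_F: "l \<ge> l0 \<Longrightarrow> x \<in> widx (N l) (Qd D) \<Longrightarrow> u l x \<in> F l D"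
proof -
  assume l: "l \<ge> l0" and "x \<in> widx (N l) (Qd D)"
  then obtain k where k: "k \<le> D" "(fst x, snd x) \<in> widx (N l) (Qk k)" by (auto simp: widx_Qd)
  show "u l x \<in> F l D" unfolding u_def using uu_Fk[OF l k(2)] Fk_F[OF k(1), of l] by blast
qed

lemma u_act:
  assumes l: "l \<ge> l0" and rs: "r < N l" "s < N l" and x: "x \<in> widx (N l) (Qd D)"
  shows "act (one_tensor (emat (N l) r s)) (u l x) z = ract (emat (N l) s r) (\<lambda>y. u l y z) x"
proof -
  obtain k where "(fst x, snd x) \<in> widx (N l) (Qk k)" using x by (auto simp: widx_Qd)
  from uu_act[OF l rs this] show ?thesis by (simp add: u_def ract_def)
qed

lemma comb_apply: "comb l D H z = (\<Sum>x\<in>widx (N l) (Qd D). H x * u l x z)"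
  by (simp only: comb_def sum_fun_apply)

lemma comb_add: "comb l D (H + H') = comb l D H + comb l D H'"
  by (rule ext) (simp only: comb_apply plus_fun_apply distrib_right sum.distrib)

lemma comb_scale: "comb l D (fscale c H) = fscale c (comb l D H)"
  by (rule ext) (simp only: comb_apply sum_distrib_left mult.assoc)

lemma comb_zero: "comb l D 0 = 0"
  by (rule ext) (simp only: comb_apply zero_fun_apply mult_zero_left sum.neutral_const)

lemma finite_widx_Qd: "finite (widx K (Qd D))"
  by (rule finite_widx[OF finite_Qd])

lemma comb_delta: "x \<in> widx (N l) (Qd D) \<Longrightarrow> comb l D (delta x) = u l x"
proof
  fix z assume x: "x \<in> widx (N l) (Qd D)"
  have "comb l D (delta x) z = (\<Sum>y\<in>widx (N l) (Qd D). if y = x then u l x z else 0)"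
    unfolding comb_def sum_fun_apply by (intro sum.cong refl) (auto simp: delta_def)
  then show "comb l D (delta x) z = u l x z" using x finite_widx_Qd by simp
qed

lemma F_u: "l \<ge> l0 \<Longrightarrow> F l D \<subseteq> cfun.span (u l ` widx (N l) (Qd D))"
proof (rule F_induct)
  fix k assume "l \<ge> l0" "k \<le> D"
  then show "Fk l k \<subseteq> cfun.span (u l ` widx (N l) (Qd D))"
    by (intro order_trans[OF Fk_span] cfun.span_mono image_mono) (auto simp: widx_Qd)
qed simp

lemma F_comb: "l \<ge> l0 \<Longrightarrow> F l D \<subseteq> comb l D ` wfun (N l) (Qd D)"
proof -
  assume l: "l \<ge> l0"
  let ?Z = "comb l D ` wfun (N l) (Qd D)"
  have w: "cfun.subspace (wfun (N l) (Qd D))"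
    by (rule cfun.subspaceI) (auto simp: wfun_def fun_on_def)
  have "cfun.subspace ?Z"
  proof (rule cfun.subspaceI)
    have "comb l D 0 \<in> ?Z" by (rule imageI) (rule cfun.subspace_0[OF w])
    then show "0 \<in> ?Z" by (simp only: comb_zero)
    fix v v' assume "v \<in> ?Z" "v' \<in> ?Z"
    then obtain H H' where H: "v = comb l D H" "v' = comb l D H'" "H \<in> wfun (N l) (Qd D)" "H' \<in> wfun (N l) (Qd D)"
      by (elim imageE)
    show "v + v' \<in> ?Z"
      unfolding H(1,2) comb_add[symmetric] by (rule imageI) (rule cfun.subspace_add[OF w H(3,4)])
  next
    fix c v assume "v \<in> ?Z"
    then obtain H where H: "v = comb l D H" "H \<in> wfun (N l) (Qd D)" by (elim imageE)
    show "fscale c v \<in> ?Z"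
      unfolding H(1) comb_scale[symmetric] by (rule imageI) (rule cfun.subspace_scale[OF w H(2)])
  qed
  moreover have "u l ` widx (N l) (Qd D) \<subseteq> ?Z"
  proof
    fix v assume "v \<in> u l ` widx (N l) (Qd D)"
    then obtain x where x: "x \<in> widx (N l) (Qd D)" "v = u l x" by blast
    have "delta x \<in> wfun (N l) (Qd D)" using x(1) by (simp add: wfun_def delta_in_fun_on)
    then show "v \<in> ?Z" unfolding x(2) comb_delta[OF x(1), symmetric] by (rule imageI)
  qed
  ultimately have "cfun.span (u l ` widx (N l) (Qd D)) \<subseteq> ?Z" by (intro cfun.span_minimal)
  then show ?thesis using F_u[OF l] by blast
qed

text \<open>The vectors \<open>u l x\<close> transform by the transposed unit on the index, and
  \<open>ract_adjoint\<close> turns this into the original unit on the coefficients.\<close>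

lemma comb_act:
  assumes l: "l \<ge> l0" and rs: "r < N l" "s < N l"
  shows "comb l D (eact (N l) (Qd D) r s H) = act (one_tensor (emat (N l) r s)) (comb l D H)"
proof
  fix z
  let ?A = "one_tensor (emat (N l) r s)" and ?I = "widx (N l) (Qd D)"
  have Ag: "?A \<in> g" using one_tensor_P[OF emat_gl l1[OF l]] P_g by blast
  have uM: "u l x \<in> M" if "x \<in> ?I" for x using u_F[OF l that] F_M[OF l] by blast
  have "act ?A (comb l D H) z = (\<Sum>x\<in>?I. H x * ract (emat (N l) s r) (\<lambda>y. u l y z) x)"
  proof -
    have "act ?A (comb l D H) = (\<Sum>x\<in>?I. fscale (H x) (act ?A (u l x)))"
      unfolding comb_def by (rule act_sum[OF finite_widx_Qd Ag uM])
    then have "act ?A (comb l D H) z = (\<Sum>x\<in>?I. H x * act ?A (u l x) z)" by (simp only: sum_fun_apply)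
    also have "\<dots> = (\<Sum>x\<in>?I. H x * ract (emat (N l) s r) (\<lambda>y. u l y z) x)"
      by (rule sum.cong[OF refl]) (simp only: u_act[OF l rs])
    finally show ?thesis .
  qed
  also have "\<dots> = (\<Sum>x\<in>?I. ract (emat (N l) r s) H x * u l x z)"
    by (rule ract_adjoint[OF finite_Qd rs, symmetric])
  also have "\<dots> = comb l D (eact (N l) (Qd D) r s H) z"
    unfolding comb_apply
  proof (rule sum.cong[OF refl])
    fix x assume "x \<in> ?I"
    then show "ract (emat (N l) r s) H x * u l x z = eact (N l) (Qd D) r s H x * u l x z"
      unfolding eact_def by (simp only: if_True)
  qed
  finally show "comb l D (eact (N l) (Qd D) r s H) z = act ?A (comb l D H) z" by simp
qed

text \<open>The witnesses of the proper inclusions are finitely many and lie at one level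
  \<open>l\<close>. Preimages along \<open>comb l D\<close> give a chain of invariant subspaces over
  \<open>gl(N l)\<close> with at least the same proper inclusions, and its bound depends on
  \<open>Qd D\<close> only, hence not on \<open>l\<close>.\<close>

lemma layer_chain_bounded:
  assumes L: "\<And>l r s. l \<ge> l0 \<Longrightarrow> r < N l \<Longrightarrow> s < N l \<Longrightarrow> one_tensor (emat (N l) r s) \<in> L"
  shows "\<exists>c. chain_bounded L act (Fd D) c"
proof -
  let ?Q = "Qd D"
  obtain c where c: "\<forall>K k Y. (\<forall>i\<le>k. einvariant K ?Q (Y i)) \<longrightarrow> (\<forall>i<k. Y i \<subseteq> Y (Suc i)) \<longrightarrow>
    card {i. i < k \<and> Y i \<noteq> Y (Suc i)} \<le> c" using einvariant_chain_bound[OF finite_Qd] by (rule exE)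
  have "chain_bounded L act (Fd D) c"
    unfolding chain_bounded_def
  proof (intro allI impI)
    fix k and Y :: "nat \<Rightarrow> ('q \<Rightarrow> complex) set"
    assume Y: "\<forall>i\<le>k. stable_subspace L act (Y i) \<and> Y i \<subseteq> Fd D" and mono: "\<forall>i<k. Y i \<subseteq> Y (Suc i)"
    let ?J = "{i. i < k \<and> Y i \<noteq> Y (Suc i)}"
    have "\<forall>i\<in>?J. \<exists>v. v \<in> Y (Suc i) \<and> v \<notin> Y i"
    proof
      fix i assume "i \<in> ?J"
      then have "Y i \<subseteq> Y (Suc i)" "Y i \<noteq> Y (Suc i)" using mono by auto
      then show "\<exists>v. v \<in> Y (Suc i) \<and> v \<notin> Y i" by blast
    qed
    then obtain v where vJ: "\<forall>i\<in>?J. v i \<in> Y (Suc i) \<and> v i \<notin> Y i" by (rule bchoice[THEN exE])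
    have v: "v i \<in> Y (Suc i)" "v i \<notin> Y i" if "i \<in> ?J" for i
      by (rule bspec[OF vJ that, THEN conjunct1]) (rule bspec[OF vJ that, THEN conjunct2])
    have "\<forall>i\<in>?J. \<exists>l. l0 \<le> l \<and> v i \<in> F l D"
    proof
      fix i assume i: "i \<in> ?J"
      then have "Y (Suc i) \<subseteq> Fd D" using Y by auto
      then have "v i \<in> Fd D" using v(1)[OF i] by blast
      then show "\<exists>l. l0 \<le> l \<and> v i \<in> F l D" unfolding Fd_def by blast
    qed
    then obtain lv where "\<forall>i\<in>?J. l0 \<le> lv i \<and> v i \<in> F (lv i) D" by (rule bchoice[THEN exE])
    then have lv: "l0 \<le> lv i \<and> v i \<in> F (lv i) D" if "i \<in> ?J" for i using that by (rule bspec)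
    \<comment> \<open>A level containing all witnesses; it depends on the chain, so the bound
      \<open>c\<close> had to be fixed for all levels beforehand.\<close>
    define l where "l = Max (insert l0 (lv ` ?J))"
    have fin: "finite (insert l0 (lv ` ?J))" by simp
    have l: "l \<ge> l0" unfolding l_def by (rule Max_ge[OF fin]) simp
    have vl: "v i \<in> F l D" if i: "i \<in> ?J" for i
    proof -
      have "lv i \<le> l" unfolding l_def by (rule Max_ge[OF fin]) (use i in blast)
      then show ?thesis using F_mono_l[of "lv i" l D] lv[OF i] by blast
    qed
    \<comment> \<open>Preimages keep the witnesses apart because every witness is in the image of
      \<open>comb l D\<close>.\<close>
    define Y' where "Y' i = {H \<in> wfun (N l) ?Q. comb l D H \<in> Y i}" for i
    have inv: "einvariant (N l) ?Q (Y' i)" if i: "i \<le> k" for i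
    proof -
      have sub: "cfun.subspace (Y i)" and st: "\<And>x v. x \<in> L \<Longrightarrow> v \<in> Y i \<Longrightarrow> act x v \<in> Y i"
        using Y i by (auto simp: stable_subspace_def)
      have "cfun.subspace (Y' i)"
      proof (rule cfun.subspaceI)
        have "0 \<in> wfun (N l) ?Q" by (simp add: wfun_def fun_on_def)
        then show "0 \<in> Y' i" unfolding Y'_def using cfun.subspace_0[OF sub] comb_zero[of l D] by simp
        fix H H' assume H: "H \<in> Y' i" "H' \<in> Y' i"
        then have "H + H' \<in> wfun (N l) ?Q" by (auto simp: Y'_def wfun_def fun_on_def)
        moreover have "comb l D (H + H') \<in> Y i"
          unfolding comb_add using H by (intro cfun.subspace_add[OF sub]) (auto simp: Y'_def)
        ultimately show "H + H' \<in> Y' i" unfolding Y'_def by blast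
      next
        fix c H assume H: "H \<in> Y' i"
        then have "fscale c H \<in> wfun (N l) ?Q" by (auto simp: Y'_def wfun_def fun_on_def)
        moreover have "comb l D (fscale c H) \<in> Y i"
          unfolding comb_scale using H by (intro cfun.subspace_scale[OF sub]) (auto simp: Y'_def)
        ultimately show "fscale c H \<in> Y' i" unfolding Y'_def by blast
      qed
      moreover have "eact (N l) ?Q r s H \<in> Y' i" if "r < N l" "s < N l" "H \<in> Y' i" for r s H
      proof -
        have "comb l D (eact (N l) ?Q r s H) \<in> Y i"
          unfolding comb_act[OF l that(1,2)] using that(3) L[OF l that(1,2)] by (intro st) (auto simp: Y'_def)
        then show ?thesis by (simp add: Y'_def)
      qed
      ultimately show ?thesis unfolding einvariant_def by (auto simp: Y'_def)
    qed
    have "?J \<subseteq> {i. i < k \<and> Y' i \<noteq> Y' (Suc i)}"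
    proof
      fix i assume i: "i \<in> ?J"
      obtain H where H: "H \<in> wfun (N l) ?Q" "v i = comb l D H" using vl[OF i] F_comb[OF l] by (metis (no_types, lifting) imageE subsetD)
      have "H \<in> Y' (Suc i)" "H \<notin> Y' i" using H v[OF i] by (auto simp: Y'_def)
      then show "i \<in> {i. i < k \<and> Y' i \<noteq> Y' (Suc i)}" using i by auto
    qed
    then have "card ?J \<le> card {i. i < k \<and> Y' i \<noteq> Y' (Suc i)}" by (intro card_mono) auto
    also have "\<dots> \<le> c" by (rule c[rule_format]) (use inv mono in \<open>auto simp: Y'_def\<close>)
    finally show "card ?J \<le> c" .
  qed
  then show ?thesis by blast
qed

end

section \<open>The finiteness conditions over \<open>k \<inter> m\<close>\<close>

locale finite_type_setup = filtration p b \<beta> \<theta> k0 t0 m n h \<eta> n0 lam W M act \<tau> + lmod_model "gl_lim p \<theta>" M act V \<iota>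
  for p b \<beta> \<theta> k0 t0 m n h \<eta> n0 lam W and M :: "('q \<Rightarrow> complex) set" and act \<tau> and V :: "(cmat, 'v) lmod" and \<iota> +
  fixes k :: "cmat set"
  assumes k: "k = {x + y | x y. x \<in> k0 \<and> y \<in> centralizer (gl_lim p \<theta>) k0}"
begin

abbreviation "K \<equiv> k \<inter> m"

lemma m_g: "m \<subseteq> g"
  using m_iff by blast

lemma K_g: "K \<subseteq> g"
  using m_g by blast

lemma h_K: "h \<in> K"
proof -
  have "0 \<in> centralizer g k0"
    using cfun.subspace_0[OF g_subspace] by (auto simp: centralizer_def lbr_def mmul_def fun_eq_iff)
  then have "h + 0 \<in> k" unfolding k using hk0 by blast
  moreover have "h \<in> m" unfolding m_iff using h_g by (auto simp: h_dmat comp_dmat)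
  ultimately show ?thesis by simp
qed

lemma one_tensor_K: "l \<ge> l0 \<Longrightarrow> one_tensor (emat (N l) r s) \<in> K"
proof -
  assume l: "l \<ge> l0"
  have "0 + one_tensor (emat (N l) r s) \<in> k"
    unfolding k using k0(2) one_tensor_in(2)[OF emat_gl l1[OF l]] by blast
  then show ?thesis using one_tensor_in(1)[OF emat_gl l1[OF l]] by simp
qed

lemma K_layer: "\<exists>c. stable_subspace K act (Fd D) \<and> chain_bounded K act (Fd D) c"
  using layer_chain_bounded[of K D] one_tensor_K Fd_m Fd_subspace by (auto simp: stable_subspace_def)

lemma integrable: "integrable_mod (\<lambda>n. K \<inter> G n) V"
  unfolding integrable_mod_def
proof (intro allI impI ballI)
  fix q :: nat and v assume q: "q \<ge> 1" and v: "v \<in> carrier V"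
  obtain l D where l: "l \<ge> l0" "\<iota> v \<in> F l D" using M_Fd[OF \<iota>_in[OF v]] by blast
  \<comment> \<open>At this level both the vector and the algebra \<open>K \<inter> G q\<close> are
    present, and \<open>F (max l q) D\<close> is finite-dimensional and stable.\<close>
  have mx: "max l q \<ge> l0" using l(1) by (simp add: le_max_iff_disj)
  have vF: "\<iota> v \<in> F (max l q) D" using F_mono_l[OF l(1), of "max l q" D] l(2) by auto
  have "stable_subspace (K \<inter> G q) act (F (max l q) D)"
    unfolding stable_subspace_def
  proof (intro conjI ballI F_subspace)
    fix x w assume x: "x \<in> K \<inter> G q" and w: "w \<in> F (max l q) D"
    have "x \<in> G (max l q)" using G_mono[OF q, of "max l q"] x by auto
    then show "act x w \<in> F (max l q) D" using x by (intro F_m[OF mx _ _ w]) auto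
  qed
  note stable = this
  have "K \<inter> G q \<subseteq> g" using K_g by blast
  then show "fin_dim V (gen (K \<inter> G q) V {v})"
    by (rule fin_dim_gen[OF _ v stable F_M[OF mx] vF finite_imageI[OF finite_widx_Qd] F_u[OF mx]])
qed

text \<open>Each generator lies in some layer; the layers increase with \<open>D\<close> and are
  submodules, so the largest one contains everything generated.\<close>

lemma finitely_generated_in_layer: "finite B \<Longrightarrow> B \<subseteq> carrier V \<Longrightarrow> \<exists>D. \<iota> ` gen K V B \<subseteq> Fd D"
proof -
  assume B: "finite B" "B \<subseteq> carrier V"
  have "\<exists>D. \<iota> v \<in> Fd D" if v: "v \<in> B" for v
  proof -
    have "\<iota> v \<in> M" using v B(2) \<iota>_in by blast
    then show ?thesis using M_Fd unfolding Fd_def by blast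
  qed
  then obtain Dv where Dv: "\<And>v. v \<in> B \<Longrightarrow> \<iota> v \<in> Fd (Dv v)" by metis
  define D where "D = Max (insert 0 (Dv ` B))"
  have "\<iota> v \<in> Fd D" if v: "v \<in> B" for v
  proof -
    have "Dv v \<le> D" unfolding D_def using B(1) v by (intro Max_ge) auto
    then show ?thesis using Dv[OF v] F_mono_D[of "Dv v" D] unfolding Fd_def by blast
  qed
  moreover obtain c where "stable_subspace K act (Fd D)" using K_layer by blast
  note Z = submod_vimage[OF K_g this Fd_M]
  ultimately have "gen K V B \<subseteq> {v \<in> carrier V. \<iota> v \<in> Fd D}" using B(2) by (intro gen_least[OF Z(1)]) blast
  then show ?thesis by blast
qed

lemma finite_length: "finite B \<Longrightarrow> B \<subseteq> carrier V \<Longrightarrow> has_finite_length K (restr V (gen K V B))"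
proof -
  assume B: "finite B" "B \<subseteq> carrier V"
  obtain D where D: "\<iota> ` gen K V B \<subseteq> Fd D" using finitely_generated_in_layer[OF B] by blast
  obtain c where "chain_bounded K act (Fd D) c" using K_layer by blast
  then have "chain_bounded K act (\<iota> ` gen K V B) c" using D unfolding chain_bounded_def by (meson order_trans)
  then show ?thesis by (rule has_finite_length_of_bound[OF K_g submod_gen(1)[OF K_g B(2)]])
qed

text \<open>\<open>m\<close> centralises \<open>t0\<close>, which contains \<open>h\<close>.\<close>

lemma h_central: "x \<in> K \<Longrightarrow> lbr x h = 0"
  using h_t0 by (auto simp: m centralizer_def)

lemma multiplicities:
  assumes "lie_module K S" "simple_mod K S"
  shows "\<exists>b::nat. \<forall>B. finite B \<and> B \<subseteq> carrier V \<longrightarrow> multiplicity K (restr V (gen K V B)) S \<le> enat b"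
proof (rule multiplicity_bounded[OF K_g h_K h_central locally_finite _ assms])
  fix \<chi>
  obtain d where "\<forall>v\<in>M. \<exists>\<mu>s. \<chi> \<notin> set \<mu>s \<and> shift_prod act h \<mu>s v \<in> Fd d" using weight_in_layer by blast
  then show "\<exists>Z c. stable_subspace K act Z \<and> chain_bounded K act Z c \<and> (\<forall>v\<in>M. \<exists>\<mu>s. \<chi> \<notin> set \<mu>s \<and> shift_prod act h \<mu>s v \<in> Z)"
    using K_layer[of d] by blast
qed

lemma pair_module: "pair_module_of_finite_type TYPE('w) G m K V"
  unfolding pair_module_of_finite_type_def finite_type_mod_def
  using lie_module[OF lie_closed_g m_g] integrable finite_length multiplicities by blast

end

theorem proposition4p5:
  fixes \<theta> :: "nat \<Rightarrow> nat" and p :: nat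
    and G :: "nat \<Rightarrow> cmat set" and g k0 k t0 P m n :: "cmat set" and mf :: "nat \<Rightarrow> cmat set"
    and h :: cmat and b :: "nat \<Rightarrow> nat \<Rightarrow> complex" and \<eta> :: "nat \<Rightarrow> complex"
    and n0 :: "nat \<Rightarrow> nat" and lam :: "nat \<Rightarrow> int list" and W :: "nat \<Rightarrow> nat \<Rightarrow> tensor set"
    and E :: "(cmat, letter list list \<Rightarrow> complex) lmod"
  assumes theta: "\<And>i. i \<ge> 1 \<Longrightarrow> \<theta> i > 1"
    and p: "p \<ge> 1"
    and G: "G = gl_level p \<theta>"
    and g: "g = gl_lim p \<theta>"
    and k0: "reductive_in k0 (G 1)"
    and k0_simple: "simple_mod k0 (fmod (nat_vec p) mvec)"
    and h: "h \<in> k0" "regular_semisimple (G 1) h"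
    and t0: "t0 = centralizer k0 {h}"
    and P: "P = parabolic g h"
    and levi: "levi_decomposition G P mf m n"
    and m: "m = centralizer g t0"
    and k: "k = {x + y | x y. x \<in> k0 \<and> y \<in> centralizer g k0}"
    and basis: "eigenbasis p h b \<eta>"
    and ordering: "\<And>i j. i < j \<Longrightarrow> j < p \<Longrightarrow> Re (\<eta> i - \<eta> j) \<ge> 0"
    and n0: "\<And>j. j < p \<Longrightarrow> n0 j > 1"
    and lam: "\<And>j. j < p \<Longrightarrow> dominant_integral (Nsize \<theta> (n0 j)) (lam j)"
    and W: "\<And>j. j < p \<Longrightarrow> natural_realisation \<theta> (n0 j) (lam j) (W j)"
    and E: "E = inducing_module \<theta> p b m n n0 W"
  shows "pair_module_of_finite_type TYPE('w) G m (k \<inter> m) (induced g P E)"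
proof -
  have "p > 0" using p by simp
  then obtain \<beta> where \<beta>: "split_basis p b \<beta>" using eigenbasis_dual[OF basis] by blast
  interpret split_basis p b \<beta> by (rule \<beta>)
  have sub: "lie_subalgebra k0 (gl_level p \<theta> 1)" using k0 unfolding G reductive_in_def by blast
  interpret box_setup p b \<beta> \<theta> k0 t0 m n h \<eta> n0 lam W
  proof unfold_locales
    show "k0 \<subseteq> gl_level p \<theta> 1" using sub by (simp add: lie_subalgebra_def)
    show "0 \<in> k0" using sub cfun.subspace_0 by (auto simp: lie_subalgebra_def)
    show "regular_semisimple (gl_level p \<theta> 1) h" using h(2) by (simp only: G)
    show "m = centralizer (gl_lim p \<theta>) t0" using m by (simp only: g)
    show "lie_ideal n (parabolic (gl_lim p \<theta>) h)" "direct_sum_decomp (parabolic (gl_lim p \<theta>) h) m n"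
      using levi unfolding levi_decomposition_def P g by blast+
    show "mvec h (b j) = fscale (\<eta> j) (b j)" if "j < p" for j
      using basis that by (simp add: eigenbasis_def)
  qed (use theta h(1) t0 n0 W in auto)
  interpret gc: lie_closed "gl_lim p \<theta>" by (rule lie_closed_g)
  interpret Pc: lie_closed "parabolic (gl_lim p \<theta>) h" by (rule lie_closed_P)
  interpret ind: induction_data "gl_lim p \<theta>" "parabolic (gl_lim p \<theta>) h" box \<rho>
    by unfold_locales (use P_g box_subspace box_closed in auto)
  obtain M act \<tau> \<iota> where mod: "lmod_model (gl_lim p \<theta>) (M :: (free_elem set \<times> (letter list list \<Rightarrow> complex) \<Rightarrow> complex) set) act
      (induced (gl_lim p \<theta>) (parabolic (gl_lim p \<theta>) h) (fmod box \<rho>)) \<iota>"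
    and \<tau>: "\<forall>e\<in>box. \<tau> e \<in> M" "\<forall>e\<in>box. \<forall>e'\<in>box. \<tau> (e + e') = \<tau> e + \<tau> e'"
      "\<forall>c. \<forall>e\<in>box. \<tau> (fscale c e) = fscale c (\<tau> e)" "\<forall>x\<in>parabolic (gl_lim p \<theta>) h. \<forall>e\<in>box. act x (\<tau> e) = \<tau> (\<rho> x e)"
      "\<forall>Z. cfun.subspace Z \<longrightarrow> \<tau> ` box \<subseteq> Z \<longrightarrow> (\<forall>x\<in>gl_lim p \<theta>. \<forall>v\<in>Z \<inter> M. act x v \<in> Z) \<longrightarrow> M \<subseteq> Z"
    using ind.induced_model by (elim exE conjE) (rule that; assumption)
  interpret mm: lmod_model "gl_lim p \<theta>" M act "induced (gl_lim p \<theta>) (parabolic (gl_lim p \<theta>) h) (fmod box \<rho>)" \<iota>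
    by (rule mod)
  interpret ft: finite_type_setup p b \<beta> \<theta> k0 t0 m n h \<eta> n0 lam W M act \<tau> "induced (gl_lim p \<theta>) (parabolic (gl_lim p \<theta>) h) (fmod box \<rho>)" \<iota> k
  proof unfold_locales
    show "k = {x + y | x y. x \<in> k0 \<and> y \<in> centralizer (gl_lim p \<theta>) k0}" using k by (simp only: g)
    show "\<tau> e \<in> M" if "e \<in> box" for e using \<tau>(1) that by (rule bspec)
    show "\<tau> (e + e') = \<tau> e + \<tau> e'" if "e \<in> box" "e' \<in> box" for e e'
      by (rule bspec[OF bspec[OF \<tau>(2) that(1)] that(2)])
    show "\<tau> (fscale c e) = fscale c (\<tau> e)" if "e \<in> box" for c e by (rule bspec[OF spec[OF \<tau>(3)] that])
    show "act A (\<tau> e) = \<tau> (\<rho> A e)" if "A \<in> parabolic (gl_lim p \<theta>) h" "e \<in> box" for A e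
      by (rule bspec[OF bspec[OF \<tau>(4) that(1)] that(2)])
    show "M \<subseteq> Z" if "cfun.subspace Z" "\<tau> ` box \<subseteq> Z" "\<forall>A\<in>gl_lim p \<theta>. \<forall>v\<in>Z \<inter> M. act A v \<in> Z" for Z
      by (rule mp[OF mp[OF mp[OF spec[OF \<tau>(5)]]]]) (fact that)+
  qed
  show ?thesis unfolding E P g G inducing_module_def by (rule ft.pair_module)
qed

end
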